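(* Let $\Omega\subseteq\mathbb{R}^N$ be a region, $m\ge1$ an integer, and $H_m$ the polyharmonic operator of order $2m$ in $L^2(\Omega)$ with Dirichlet boundary conditions. Suppose the kernel $K_\Omega(t,x,y)$ of $e^{-H_m t}$ exists, is jointly continuous and satisfies $|K_\Omega(t,x,y)|\le c\,t^{-N/2m}$ for some constant $c$ and all $t>0$, $x,y\in\Omega$. Then for $t>0$, \[ \operatorname{tr}[e^{-H_m t}]\le b'_{m,N}t^{-N/2m}\int_\Omega\exp[-c'_{m,N}a_m(x)^{-2m}t]\,dx, \] where $b'_{m,N}=2^{N/2m}c$ and $c'_{m,N}=2^{-2m-1}(N+2m-2)(N+2m-4)\cdots N\,(2m-1)(2m-3)\cdots1$.
   Context: $H_m$ is the non-negative self-adjoint operator associated with the closure (domain $W_0^{m,2}(\Omega)$) of the form $Q_m(f)=\langle(-\Delta)^m f,f\rangle$ on $C_c^\infty(\Omega)$. For $\omega\in S^{N-1}$, $d_\omega(x)=\min\{|s|:x+s\omega\notin\Omega\}\in(0,\infty]$, and $a_m(x)=\left[\int_{S^{N-1}}d_\omega(x)^{-2m}\,d^{N-1}\omega\right]^{-1/(2m)}$ with $d^{N-1}\omega$ normalized surface measure on $S^{N-1}$. The products denote $\prod_{k=0}^{m-1}(N+2k)$ and $\prod_{k=0}^{m-1}(2k+1)$. *)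

theory Defs
  imports "HOL-Analysis.Analysis"
begin

text \<open>Functions on R^N are modelled as real-valued functions on the Euclidean space real^'n,
  with N = CARD('n). Elements of L^2(Omega) are represented by measurable functions
  (identified up to a.e. equality only through the norm).\<close>

definition L2 :: "(real^'n) set \<Rightarrow> (real^'n \<Rightarrow> real) \<Rightarrow> bool" where
  "L2 \<Omega> f \<longleftrightarrow> set_borel_measurable lborel \<Omega> f \<and> set_integrable lborel \<Omega> (\<lambda>x. (f x)\<^sup>2)"

definition l2_inner :: "(real^'n) set \<Rightarrow> (real^'n \<Rightarrow> real) \<Rightarrow> (real^'n \<Rightarrow> real) \<Rightarrow> real" where
  "l2_inner \<Omega> f g = (LINT x:\<Omega>|lborel. f x * g x)"

definition l2_norm :: "(real^'n) set \<Rightarrow> (real^'n \<Rightarrow> real) \<Rightarrow> real" where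
  "l2_norm \<Omega> f = sqrt (l2_inner \<Omega> f f)"

definition partial :: "'n \<Rightarrow> (real^'n \<Rightarrow> real) \<Rightarrow> (real^'n \<Rightarrow> real)" where
  "partial i f = (\<lambda>x. deriv (\<lambda>s. f (x + s *\<^sub>R axis i 1)) 0)"

fun Ck :: "nat \<Rightarrow> (real^'n \<Rightarrow> real) \<Rightarrow> bool" where
  "Ck 0 f \<longleftrightarrow> continuous_on UNIV f"
| "Ck (Suc k) f \<longleftrightarrow> continuous_on UNIV f \<and>
     (\<forall>i x. (\<lambda>s. f (x + s *\<^sub>R axis i 1)) differentiable (at 0)) \<and>
     (\<forall>i. Ck k (partial i f))"

definition test_fun :: "(real^'n) set \<Rightarrow> (real^'n \<Rightarrow> real) \<Rightarrow> bool" where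
  "test_fun \<Omega> f \<longleftrightarrow> (\<forall>k. Ck k f) \<and> compact (closure {x. f x \<noteq> 0})
     \<and> closure {x. f x \<noteq> 0} \<subseteq> \<Omega>"

definition laplacian :: "(real^'n \<Rightarrow> real) \<Rightarrow> (real^'n \<Rightarrow> real)" where
  "laplacian f = (\<lambda>x. \<Sum>i\<in>UNIV. partial i (partial i f) x)"

definition Qm :: "(real^'n) set \<Rightarrow> nat \<Rightarrow> (real^'n \<Rightarrow> real) \<Rightarrow> real" where
  "Qm \<Omega> m f = l2_inner \<Omega> (\<lambda>x. (-1)^m * (laplacian ^^ m) f x) f"

definition form_approx :: "(real^'n) set \<Rightarrow> nat \<Rightarrow> (real^'n \<Rightarrow> real) \<Rightarrow> (nat \<Rightarrow> real^'n \<Rightarrow> real) \<Rightarrow> bool" where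
  "form_approx \<Omega> m f \<phi> \<longleftrightarrow> (\<forall>k. test_fun \<Omega> (\<phi> k)) \<and>
     (\<lambda>k. l2_norm \<Omega> (\<lambda>x. \<phi> k x - f x)) \<longlonglongrightarrow> 0 \<and>
     (\<forall>e>0. \<exists>M. \<forall>j\<ge>M. \<forall>k\<ge>M. Qm \<Omega> m (\<lambda>x. \<phi> j x - \<phi> k x) < e)"

definition form_dom :: "(real^'n) set \<Rightarrow> nat \<Rightarrow> (real^'n \<Rightarrow> real) set" where
  "form_dom \<Omega> m = {f. L2 \<Omega> f \<and> (\<exists>\<phi>. form_approx \<Omega> m f \<phi>)}"

definition form_val :: "(real^'n) set \<Rightarrow> nat \<Rightarrow> (real^'n \<Rightarrow> real) \<Rightarrow> real" where
  "form_val \<Omega> m f = lim (\<lambda>k. Qm \<Omega> m ((SOME \<phi>. form_approx \<Omega> m f \<phi>) k))"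

definition form_bil :: "(real^'n) set \<Rightarrow> nat \<Rightarrow> (real^'n \<Rightarrow> real) \<Rightarrow> (real^'n \<Rightarrow> real) \<Rightarrow> real" where
  "form_bil \<Omega> m f g = (form_val \<Omega> m (\<lambda>x. f x + g x) - form_val \<Omega> m (\<lambda>x. f x - g x)) / 4"

definition Hm_graph :: "(real^'n) set \<Rightarrow> nat \<Rightarrow> (real^'n \<Rightarrow> real) \<Rightarrow> (real^'n \<Rightarrow> real) \<Rightarrow> bool" where
  "Hm_graph \<Omega> m f h \<longleftrightarrow> f \<in> form_dom \<Omega> m \<and> L2 \<Omega> h \<and>
     (\<forall>g\<in>form_dom \<Omega> m. form_bil \<Omega> m f g = l2_inner \<Omega> h g)"

text \<open>u solves u' = -H_m u, u(0) = f in L^2 (strong solution of the abstract Cauchy problem);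
  for the non-negative self-adjoint H_m this solution is unique and equals e^{-H_m t} f.\<close>
definition heat_sol :: "(real^'n) set \<Rightarrow> nat \<Rightarrow> (real^'n \<Rightarrow> real) \<Rightarrow> (real \<Rightarrow> real^'n \<Rightarrow> real) \<Rightarrow> bool" where
  "heat_sol \<Omega> m f u \<longleftrightarrow>
     (\<forall>t>0. \<exists>h. Hm_graph \<Omega> m (u t) h \<and>
        ((\<lambda>s. l2_norm \<Omega> (\<lambda>x. (u s x - u t x) / (s - t) + h x)) \<longlongrightarrow> 0) (at t)) \<and>
     ((\<lambda>s. l2_norm \<Omega> (\<lambda>x. u s x - f x)) \<longlongrightarrow> 0) (at_right 0)"

definition heat_sg :: "(real^'n) set \<Rightarrow> nat \<Rightarrow> real \<Rightarrow> (real^'n \<Rightarrow> real) \<Rightarrow> (real^'n \<Rightarrow> real)" where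
  "heat_sg \<Omega> m t f = (SOME u. heat_sol \<Omega> m f u) t"

definition onb :: "(real^'n) set \<Rightarrow> (real^'n \<Rightarrow> real) set \<Rightarrow> bool" where
  "onb \<Omega> B \<longleftrightarrow> (\<forall>e\<in>B. L2 \<Omega> e) \<and>
     (\<forall>e\<in>B. \<forall>e'\<in>B. l2_inner \<Omega> e e' = (if e = e' then 1 else 0)) \<and>
     (\<forall>f. L2 \<Omega> f \<and> (\<forall>e\<in>B. l2_inner \<Omega> f e = 0) \<longrightarrow> l2_norm \<Omega> f = 0)"

definition op_trace :: "(real^'n) set \<Rightarrow> ((real^'n \<Rightarrow> real) \<Rightarrow> (real^'n \<Rightarrow> real)) \<Rightarrow> ennreal" where
  "op_trace \<Omega> T = (\<Sum>\<^sub>\<infinity>e\<in>(SOME B. onb \<Omega> B). ennreal (l2_inner \<Omega> (T e) e))"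

text \<open>d_omega(x)^(-2m), with the convention infinity^(-2m) = 0.\<close>
definition dist_inv_pow :: "(real^'n) set \<Rightarrow> nat \<Rightarrow> real^'n \<Rightarrow> real^'n \<Rightarrow> real" where
  "dist_inv_pow \<Omega> m \<omega> x =
     (if {s::real. x + s *\<^sub>R \<omega> \<notin> \<Omega>} = {} then 0
      else inverse ((Inf {\<bar>s\<bar> | s::real. x + s *\<^sub>R \<omega> \<notin> \<Omega>}) ^ (2*m)))"

text \<open>Integral against normalized surface measure on S^{N-1}, realised as the image of
  normalised Lebesgue measure on the unit ball under y |-> y/|y|.\<close>
definition sphere_avg :: "(real^'n \<Rightarrow> real) \<Rightarrow> real" where
  "sphere_avg g = (LINT y:ball 0 1|lborel. g (y /\<^sub>R norm y)) / measure lborel (ball (0::real^'n) 1)"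

definition am_inv_pow :: "(real^'n) set \<Rightarrow> nat \<Rightarrow> real^'n \<Rightarrow> real" where
  "am_inv_pow \<Omega> m x = sphere_avg (\<lambda>\<omega>. dist_inv_pow \<Omega> m \<omega> x)"

definition c'_const :: "nat \<Rightarrow> nat \<Rightarrow> real" where
  "c'_const m N = 2 powr (- real (2*m) - 1) * (\<Prod>k<m. real (N + 2*k)) * (\<Prod>k<m. real (2*k + 1))"

end

theory Submission
  imports Defs "HOL-Computational_Algebra.Polynomial" "HOL-Real_Asymp.Real_Asymp"
begin

text \<open>Let \<open>H = H_m\<close> and \<open>G = (1 + H)\<^sup>-\<^sup>1\<close>. The resolvent \<open>G\<close> comes from the closed form by the Riesz argument
  and is a symmetric contraction, so the semigroup consists of continuous functions of \<open>G\<close>, which are limits of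
  polynomials in \<open>G\<close>; no spectral theorem is needed. Monotonicity of \<open>H\<close> makes solutions of the Cauchy
  problem unique, which identifies this semigroup with \<open>heat_sg\<close>.

  The one-dimensional Hardy inequality of order \<open>m\<close>, applied on all lines of direction \<open>\<omega>\<close> and averaged over \<open>\<omega>\<close>,
  gives \<open>2 c' am_inv_pow \<le> H\<close> in the sense of forms: the spherical average of \<open>(\<omega> \<cdot> \<nabla>)\<close> to the power \<open>2m\<close> is a multiple of the
  \<open>m\<close>-th power of the Laplacian. Hence \<open>W = c' am_inv_pow t\<close> satisfies \<open>W \<le> (t/2) H\<close>.

  Jensen's inequality, used on thin layers of the spectrum of \<open>(t/2) H\<close>, then gives
  \<open>tr exp (- t H) \<le> tr (exp (- t H / 4) exp (- W) exp (- t H / 4))\<close>. The right-hand side is the squared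
  Hilbert-Schmidt norm of \<open>exp (- W / 2) exp (- t H / 4)\<close>. The kernel bound at time \<open>t/2\<close> makes \<open>exp (- t H / 4)\<close> bounded from
  \<open>L\<^sup>2\<close> to \<open>L\<^sup>\<infinity>\<close> with squared norm \<open>C = c (t/2) powr (- N / 2m)\<close>, and the Hilbert-Schmidt norm is at most
  \<open>C\<close> times the integral of \<open>exp (- W)\<close>.\<close>

subsection \<open>Polynomials in a symmetric contraction\<close>

text \<open>The form inequality \<open>W \<le> (t/2) H\<close> gives no inequality between
  exponentials, because the exponential is not operator monotone; only traces can be compared. The
  tangent bound exp (- w) \<ge> exp (- l) (1 + l - w) helps because, taken in expectation, its right
  side asks only for an upper bound on the form of \<open>W\<close>. That bound is the form of (t/2)
  H, nearly l on a thin spectral layer around l, so almost nothing is lost. The time t is shared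
  out: one half dominates the weight, which is why Hardy is needed with 2 c', and the other half is
  split evenly around the weight, which leads to the kernel at time t/2 and to the factor 2^(N/2m).
  The constant 2 c' is the one-dimensional Hardy constant divided by the 2m-th moment of a
  coordinate on the sphere. Trace estimates are made for finite orthonormal families, with a bound
  independent of the family. All operators act on L2 of the whole space, with functions on \<Omega>
  extended by zero. \<open>G\<close> annihilates what lives off \<Omega>, so the functions of
  \<open>G\<close> that form the semigroup have the value 0 at 0.\<close>

locale sym_contraction =
  fixes G :: "'a::{real_inner,complete_space} \<Rightarrow> 'a"
  assumes lin: "linear G"
    and sym: "inner (G x) y = inner x (G y)"
    and pos: "0 \<le> inner (G x) x"
    and le1: "inner (G x) x \<le> inner x x"
begin

lemma G_add: "G (x + y) = G x + G y"
  and G_diff: "G (x - y) = G x - G y"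
  and G_scaleR: "G (a *\<^sub>R x) = a *\<^sub>R G x"
  and G_zero [simp]: "G 0 = 0"
  using lin by (simp_all add: linear_add linear_diff linear_scale linear_0)

lemma G_minus: "G (- x) = - G x"
  using lin by (rule linear_neg)

lemma one_minus_pos: "0 \<le> inner (x - G x) x"
  using le1[of x] by (simp add: inner_diff_left)

text \<open>\<open>G - G^2 = G (1 - G) G + (1 - G) G (1 - G)\<close>, and both summands are positive
  operators conjugated by symmetric ones. With \<open>pos\<close> and \<open>one_minus_pos\<close>
  this settles the products left over in \<open>opoly_bernstein_pos\<close>.\<close>

lemma G_one_minus_pos: "0 \<le> inner (G x - G (G x)) x"
proof -
  have "inner (G x - G (G x)) x = inner (G x - G (G x)) (G x) + inner (G (x - G x)) (x - G x)"
    using sym[of x "G x"] sym[of "G x" x] sym[of "G x" "G x"]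
    by (simp add: G_diff inner_diff_left inner_diff_right inner_commute)
  moreover have "0 \<le> inner (G x - G (G x)) (G x)"
    using one_minus_pos[of "G x"] .
  ultimately show ?thesis using pos[of "x - G x"] by simp
qed

text \<open>The operator p(G) by Horner's scheme, so that \<open>opoly_pCons\<close> is the
  recursion on which the inductions run.\<close>

definition opoly :: "real poly \<Rightarrow> 'a \<Rightarrow> 'a"
  where "opoly p = fold_coeffs (\<lambda>a T x. a *\<^sub>R x + G (T x)) p (\<lambda>x. 0)"

lemma opoly_0 [simp]: "opoly 0 x = 0"
  by (simp add: opoly_def)

lemma opoly_pCons [simp]: "opoly (pCons a p) x = a *\<^sub>R x + G (opoly p x)"
  by (cases "p = 0 \<and> a = 0") (auto simp: opoly_def)

lemma opoly_1 [simp]: "opoly 1 x = x"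
  by (simp add: one_pCons)

lemma opoly_add: "opoly (p + q) x = opoly p x + opoly q x"
  by (induction p q rule: poly_induct2) (simp_all add: G_add algebra_simps)

lemma opoly_smult: "opoly (smult a p) x = a *\<^sub>R opoly p x"
  by (induction p) (simp_all add: G_scaleR algebra_simps)

lemma opoly_diff: "opoly (p - q) x = opoly p x - opoly q x"
  using opoly_add[of "p - q" q x] by simp

lemma opoly_sum: "opoly (sum h S) x = (\<Sum>i\<in>S. opoly (h i) x)"
  by (induction S rule: infinite_finite_induct) (auto simp: opoly_add)

lemma linear_opoly: "linear (opoly p)"
  by (induction p) (auto intro!: linearI simp: G_add G_scaleR algebra_simps linear_add linear_scale)

lemma opoly_G: "opoly p (G x) = G (opoly p x)"
  by (induction p) (auto simp: G_add G_scaleR)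

lemma opoly_mult: "opoly (p * q) x = opoly p (opoly q x)"
  by (induction p arbitrary: x) (simp_all add: opoly_add opoly_smult)

lemma opoly_sym: "inner (opoly p x) y = inner x (opoly p y)"
proof (induction p arbitrary: x y)
  case (pCons a p)
  then show ?case
    by (simp add: inner_add_left inner_add_right sym opoly_G[symmetric])
qed simp

text \<open>Polynomials in \<open>G\<close> commute, so p^2 q acts as p q p, and symmetry moves the
  outer p to the other argument.\<close>

lemma opoly_square_pos: "0 \<le> inner (opoly (p * p * q) x) x"
  if "\<And>y. 0 \<le> inner (opoly q y) y"
proof -
  have "opoly (p * p * q) x = opoly p (opoly q (opoly p x))"
    by (metis (no_types) mult.commute mult.assoc opoly_mult)
  then show ?thesis using that[of "opoly p x"] by (simp add: opoly_sym)
qed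

text \<open>Splitting off the largest squares from x^j and (1 - x)^l leaves one of 1, x, 1 - x and x
  (1 - x), each known to be positive at \<open>G\<close>.\<close>

lemma opoly_bernstein_pos: "0 \<le> inner (opoly ([:0,1:] ^ j * [:1,-1:] ^ l) x) x"
proof -
  have ev: "\<exists>r q. p ^ k = r * r * q \<and> (q = 1 \<or> q = p)" for p :: "real poly" and k
  proof (cases "even k")
    case True
    then obtain i where "k = i + i" by (metis evenE mult_2)
    then show ?thesis by (intro exI[of _ "p ^ i"] exI[of _ 1]) (simp add: power_add)
  next
    case False
    then obtain i where "k = i + i + 1" by (metis oddE mult_2)
    then show ?thesis by (intro exI[of _ "p ^ i"] exI[of _ p]) (simp add: power_add)
  qed
  obtain r q where rq: "[:0,1::real:] ^ j = r * r * q" "q = 1 \<or> q = [:0,1:]" using ev by blast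
  obtain r' q' where rq': "[:1,-1::real:] ^ l = r' * r' * q'" "q' = 1 \<or> q' = [:1,-1:]" using ev by blast
  have q: "0 \<le> inner (opoly (q * q') y) y" for y
    using rq(2) rq'(2) pos[of y] one_minus_pos[of y] G_one_minus_pos[of y]
    by (auto simp: inner_diff_left G_diff inner_add_left G_add G_minus)
  have "[:0,1::real:] ^ j * [:1,-1:] ^ l = (r * r') * (r * r') * (q * q')"
    by (simp add: rq rq' algebra_simps)
  then show ?thesis using opoly_square_pos[OF q] by metis
qed

end

text \<open>Degree elevation: multiply x^k by (x + (1 - x))^(n - k) = 1 and expand. All monomials of
  a polynomial are thus written in the Bernstein basis of one common degree n.\<close>

lemma bernstein_monom:
  assumes "k \<le> n"
  shows "monom 1 k = (\<Sum>j\<le>n. smult (if k \<le> j then real ((n - k) choose (j - k)) else 0)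
            ([:0,1:] ^ j * [:1,-1:] ^ (n - j)))"
proof -
  have "[:0,1:] + [:1,-1:] = (1 :: real poly)" by (simp add: one_pCons)
  then have "monom (1::real) k = [:0,1:] ^ k * ([:0,1:] + [:1,-1:]) ^ (n - k)"
    by (simp only: power_one mult_1_right monom_altdef smult_1_left)
  also have "\<dots> = (\<Sum>i\<le>n-k. [:0,1:] ^ k * (of_nat ((n-k) choose i) * [:0,1:] ^ i * [:1,-1:] ^ (n - k - i)))"
    by (simp only: binomial_ring sum_distrib_left)
  also have "\<dots> = (\<Sum>i\<le>n-k. smult (real ((n-k) choose i)) ([:0,1:] ^ (k + i) * [:1,-1:] ^ (n - (k + i))))"
    by (intro sum.cong refl) (simp add: power_add of_nat_poly ac_simps)
  also have "\<dots> = (\<Sum>j=k..n. smult (real ((n-k) choose (j-k))) ([:0,1:] ^ j * [:1,-1:] ^ (n - j)))"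
    using assms by (intro sum.reindex_bij_witness[of _ "\<lambda>j. j - k" "\<lambda>i. k + i"]) auto
  also have "\<dots> = (\<Sum>j\<le>n. smult (if k \<le> j then real ((n - k) choose (j - k)) else 0)
            ([:0,1:] ^ j * [:1,-1:] ^ (n - j)))"
    by (rule sum.mono_neutral_cong_left) auto
  finally show ?thesis .
qed

text \<open>Writes the Bernstein coefficient of x^k as a quotient of falling factorials of j and n,
  visibly close to (j/n)^k for large n. For k > j the product contains the factor 0.\<close>

lemma binomial_ratio_prod:
  assumes "k \<le> n" "j \<le> n"
  shows "(if k \<le> j then real ((n - k) choose (j - k)) else 0)
     = real (n choose j) * (\<Prod>i<k. (real j - real i) / (real n - real i))"
  using assms
proof (induction k)
  case (Suc k)
  show ?case
  proof (cases "Suc k \<le> j")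
    case True
    have "Suc (n - Suc k) * (n - Suc k choose (j - Suc k)) = (Suc (n - Suc k) choose Suc (j - Suc k)) * Suc (j - Suc k)"
      by (rule Suc_times_binomial_eq)
    moreover have "Suc (n - Suc k) = n - k" "Suc (j - Suc k) = j - k" using Suc.prems True by auto
    ultimately have "real (n - k) * real (n - Suc k choose (j - Suc k)) = real (n - k choose (j - k)) * real (j - k)"
      by (metis of_nat_mult)
    then have "(real n - real k) * real (n - Suc k choose (j - Suc k)) = real (n - k choose (j - k)) * (real j - real k)"
      using Suc.prems True by (simp add: of_nat_diff)
    then have "real (n - Suc k choose (j - Suc k)) = real (n - k choose (j - k)) * (real j - real k) / (real n - real k)"
      using Suc.prems by (simp add: field_simps)
    then show ?thesis using Suc True by simp
  next
    case False
    then have "(\<Prod>i<Suc k. (real j - real i) / (real n - real i)) = 0"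
      by (intro prod_zero) auto
    then show ?thesis using False by simp
  qed
qed simp

text \<open>The factors differ by i (n - j) / (n (n - i)), which is at most d / (n - d) uniformly in
  j. The comparison of products needs factors of modulus at most 1, and \<open>2 * d \<le> n\<close>
  secures this when j < i.\<close>

lemma bernstein_prod_close:
  assumes "d < n" "2 * d \<le> n" "j \<le> n" "k \<le> d"
  shows "\<bar>(\<Prod>i<k. (real j - real i) / (real n - real i)) - (real j / real n) ^ k\<bar> \<le> real d * (real d / (real n - real d))"
proof -
  have b: "\<bar>(real j - real i) / (real n - real i)\<bar> \<le> 1" if "i < k" for i
  proof -
    have "\<bar>real j - real i\<bar> \<le> real n - real i" using that assms by (auto simp: abs_le_iff)
    then show ?thesis using that assms by (simp add: abs_divide)
  qed
  have "\<bar>(\<Prod>i<k. (real j - real i) / (real n - real i)) - (\<Prod>i<k. real j / real n)\<bar>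
     \<le> (\<Sum>i<k. \<bar>(real j - real i) / (real n - real i) - real j / real n\<bar>)"
    using norm_prod_diff[of "{..<k}" "\<lambda>i. (real j - real i) / (real n - real i)" "\<lambda>i. real j / real n"] b assms
    by (auto simp: divide_le_eq)
  also have "\<dots> \<le> (\<Sum>i<k. real d / (real n - real d))"
  proof (rule sum_mono)
    fix i assume "i \<in> {..<k}"
    then have i: "i < d" using assms by auto
    have "(real j - real i) / (real n - real i) - real j / real n = - (real i * (real n - real j) / (real n * (real n - real i)))"
      using i assms by (simp add: field_simps)
    also have "\<bar>\<dots>\<bar> = real i * ((real n - real j) / real n) / (real n - real i)"
      using i assms by (simp add: abs_mult abs_divide)
    also have "\<dots> \<le> real i * 1 / (real n - real i)"
      using i assms by (intro divide_right_mono mult_left_mono) auto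
    also have "\<dots> \<le> real d / (real n - real d)"
      using i assms by (intro frac_le) auto
    finally show "\<bar>(real j - real i) / (real n - real i) - real j / real n\<bar> \<le> real d / (real n - real d)" .
  qed
  also have "\<dots> \<le> real d * (real d / (real n - real d))"
    using assms by (simp add: mult_right_mono divide_right_mono)
  finally show ?thesis by simp
qed

context sym_contraction
begin

text \<open>Bernstein's argument: divided by the binomial coefficients, the degree n Bernstein
  coefficients of p approach p(j/n) uniformly in j. The lower bound e absorbs the error for large n,
  so all coefficients are nonnegative, and the basis polynomials are positive at
  \<open>G\<close>.\<close>

lemma opoly_pos_strict:
  assumes p: "\<And>t. 0 \<le> t \<Longrightarrow> t \<le> 1 \<Longrightarrow> e \<le> poly p t" and e: "0 < e"
  shows "0 \<le> inner (opoly p x) x"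
proof -
  define d where "d = degree p"
  define A where "A = (\<Sum>k\<le>d. \<bar>coeff p k\<bar>)"
  have "(\<lambda>n. A * (real d * (real d / (real n - real d)))) \<longlonglongrightarrow> 0"
    by real_asymp
  then have "\<forall>\<^sub>F n in sequentially. A * (real d * (real d / (real n - real d))) < e"
    using e by (rule order_tendstoD)
  then have "\<forall>\<^sub>F n in sequentially. A * (real d * (real d / (real n - real d))) < e \<and> 2 * d + 1 \<le> n"
    using eventually_ge_at_top[of "2 * d + 1"] by eventually_elim auto
  then obtain n where n: "A * (real d * (real d / (real n - real d))) < e" "2 * d + 1 \<le> n"
    by (auto simp: eventually_sequentially)
  define B where "B k j = (if k \<le> j then real ((n - k) choose (j - k)) else 0)" for k j
  define b where "b j = [:0,1::real:] ^ j * [:1,-1:] ^ (n - j)" for j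
  have "p = (\<Sum>k\<le>d. smult (coeff p k) (monom 1 k))"
    unfolding d_def by (subst poly_as_sum_of_monoms[symmetric]) (simp add: smult_monom)
  also have "\<dots> = (\<Sum>k\<le>d. smult (coeff p k) (\<Sum>j\<le>n. smult (B k j) (b j)))"
    using n unfolding B_def b_def by (intro sum.cong refl arg_cong[of _ _ "smult _"] bernstein_monom) auto
  also have "\<dots> = (\<Sum>j\<le>n. smult (\<Sum>k\<le>d. coeff p k * B k j) (b j))"
proof -
    have r: "smult a (sum h S) = (\<Sum>i\<in>S. smult a (h i))" for a :: real and h and S :: "nat set"
      by (induction S rule: infinite_finite_induct) (auto simp: smult_add_right)
    show ?thesis by (simp only: r smult_smult smult_sum sum.swap[of _ "{..d}"])
  qed
  finally have p_eq: "p = (\<Sum>j\<le>n. smult (\<Sum>k\<le>d. coeff p k * B k j) (b j))" .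
  have c: "0 \<le> (\<Sum>k\<le>d. coeff p k * B k j)" if j: "j \<le> n" for j
  proof -
    define Q where "Q k = (\<Prod>i<k. (real j - real i) / (real n - real i))" for k
    have B: "B k j = real (n choose j) * Q k" if "k \<le> d" for k
      unfolding B_def Q_def using n j that by (intro binomial_ratio_prod) auto
    have "(\<Sum>k\<le>d. coeff p k * B k j) = real (n choose j) * (\<Sum>k\<le>d. coeff p k * Q k)"
      by (simp add: B sum_distrib_left algebra_simps)
    moreover have "0 \<le> (\<Sum>k\<le>d. coeff p k * Q k)"
    proof -
      have "\<bar>(\<Sum>k\<le>d. coeff p k * Q k) - poly p (j / n)\<bar> = \<bar>\<Sum>k\<le>d. coeff p k * (Q k - (real j / real n) ^ k)\<bar>"
        by (simp add: poly_altdef d_def sum_subtractf[symmetric] algebra_simps)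
      also have "\<dots> \<le> (\<Sum>k\<le>d. \<bar>coeff p k\<bar> * \<bar>Q k - (real j / real n) ^ k\<bar>)"
        by (rule order_trans[OF sum_abs]) (simp add: abs_mult)
      also have "\<dots> \<le> (\<Sum>k\<le>d. \<bar>coeff p k\<bar> * (real d * (real d / (real n - real d))))"
        unfolding Q_def using n j by (intro sum_mono mult_left_mono bernstein_prod_close) auto
      also have "\<dots> = A * (real d * (real d / (real n - real d)))"
        unfolding A_def by (simp only: sum_distrib_right)
      finally show ?thesis using n p[of "j / n"] j by (auto simp: divide_le_eq)
    qed
    ultimately show ?thesis by simp
  qed
  have "inner (opoly p x) x = (\<Sum>j\<le>n. (\<Sum>k\<le>d. coeff p k * B k j) * inner (opoly (b j) x) x)"
    by (subst p_eq) (simp add: opoly_sum opoly_smult inner_sum_left)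
  also have "\<dots> \<ge> 0"
    by (rule sum_nonneg, rule mult_nonneg_nonneg[OF c]) (simp_all add: b_def opoly_bernstein_pos)
  finally show ?thesis .
qed

lemma opoly_pos:
  assumes p: "\<And>t. 0 \<le> t \<Longrightarrow> t \<le> 1 \<Longrightarrow> 0 \<le> poly p t"
  shows "0 \<le> inner (opoly p x) x"
proof -
  have "- (e * inner x x) \<le> inner (opoly p x) x" if "0 < e" for e
  proof -
    have "0 \<le> inner (opoly (p + [:e:]) x) x"
      using p that by (intro opoly_pos_strict[of e]) auto
    then show ?thesis by (simp add: opoly_add inner_add_left)
  qed
  have "((\<lambda>e. - (e * inner x x)) \<longlongrightarrow> - (0 * inner x x)) (at_right 0)"
    by (intro tendsto_minus tendsto_mult tendsto_ident_at tendsto_const)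
  moreover have "\<forall>\<^sub>F e in at_right 0. - (e * inner x x) \<le> inner (opoly p x) x"
    using \<open>\<And>e. 0 < e \<Longrightarrow> _\<close> by (auto simp: eventually_at_filter)
  ultimately have "- (0 * inner x x) \<le> inner (opoly p x) x"
    by (rule tendsto_upperbound) simp
  then show ?thesis by simp
qed

text \<open>Positivity of C^2 - p^2 at \<open>G\<close>. Bounding the operator by the supremum of p
  over [0,1] is what takes the place of the spectral theorem.\<close>

lemma opoly_norm:
  assumes p: "\<And>t. 0 \<le> t \<Longrightarrow> t \<le> 1 \<Longrightarrow> \<bar>poly p t\<bar> \<le> C"
  shows "norm (opoly p x) \<le> C * norm x"
proof -
  have C: "0 \<le> C" using p[of 0] by simp
  have "0 \<le> inner (opoly ([:C\<^sup>2:] - p * p) x) x"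
  proof (rule opoly_pos)
    fix t :: real assume "0 \<le> t" "t \<le> 1"
    from p[OF this] have "\<bar>poly p t\<bar> ^ 2 \<le> C ^ 2" by (intro power_mono) auto
    then show "0 \<le> poly ([:C\<^sup>2:] - p * p) t" by (simp add: power2_eq_square)
  qed
  then have "(norm (opoly p x))\<^sup>2 \<le> (C * norm x)\<^sup>2"
    by (simp add: opoly_diff opoly_mult opoly_sym inner_diff_left power_mult_distrib
        flip: power2_norm_eq_inner)
  then show ?thesis by (rule power2_le_imp_le) (use C in simp)
qed

subsection \<open>Continuous functional calculus\<close>

definition papprox :: "(real \<Rightarrow> real) \<Rightarrow> nat \<Rightarrow> real poly"
  where "papprox f n = (SOME p. \<forall>t\<in>{0..1}. \<bar>poly p t - f t\<bar> < 1 / Suc n)"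

lemma papprox:
  assumes "continuous_on {0..1} f" "t \<in> {0..1}"
  shows "\<bar>poly (papprox f n) t - f t\<bar> < 1 / Suc n"
proof -
  obtain g where g: "real_polynomial_function g" "\<And>x. x \<in> {0..1::real} \<Longrightarrow> \<bar>f x - g x\<bar> < 1 / Suc n"
    using Stone_Weierstrass_real_polynomial_function[of "{0..1::real}" f "1 / Suc n"] assms by auto
  then obtain a N where a: "g = (\<lambda>x. \<Sum>i\<le>N. a i * x ^ i)"
    by (auto simp: real_polynomial_function_iff_sum)
  have "poly (\<Sum>i\<le>N. monom (a i) i) x = g x" for x
    by (simp add: a poly_sum poly_monom)
  then have "\<forall>t\<in>{0..1}. \<bar>poly (\<Sum>i\<le>N. monom (a i) i) t - f t\<bar> < 1 / Suc n"
    using g(2) by (simp add: abs_minus_commute)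
  then have "\<exists>p. \<forall>t\<in>{0..1}. \<bar>poly p t - f t\<bar> < 1 / Suc n" by (rule exI)
  then have "\<forall>t\<in>{0..1}. \<bar>poly (papprox f n) t - f t\<bar> < 1 / Suc n"
    unfolding papprox_def by (rule someI_ex)
  with assms show ?thesis by blast
qed

definition calc :: "(real \<Rightarrow> real) \<Rightarrow> 'a \<Rightarrow> 'a"
  where "calc f x = lim (\<lambda>n. opoly (papprox f n) x)"

lemma opoly_papprox_tendsto:
  assumes f: "continuous_on {0..1} f"
  shows "(\<lambda>n. opoly (papprox f n) x) \<longlonglongrightarrow> calc f x"
proof -
  have "Cauchy (\<lambda>n. opoly (papprox f n) x)"
  proof (rule metric_CauchyI)
    fix e :: real assume e: "0 < e"
    obtain M where M: "2 / real (Suc M) * norm x < e"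
    proof -
      have "(\<lambda>n. 2 / real (Suc n) * norm x) \<longlonglongrightarrow> 0" by real_asymp
      then have "\<forall>\<^sub>F n in sequentially. 2 / real (Suc n) * norm x < e"
        using e by (rule order_tendstoD)
      then show ?thesis using that by (auto simp: eventually_sequentially)
    qed
    show "\<exists>M. \<forall>m\<ge>M. \<forall>n\<ge>M. dist (opoly (papprox f m) x) (opoly (papprox f n) x) < e"
    proof (intro exI[of _ M] allI impI)
      fix m n assume mn: "M \<le> m" "M \<le> n"
      have "norm (opoly (papprox f m - papprox f n) x) \<le> (2 / real (Suc M)) * norm x"
      proof (rule opoly_norm)
        fix t :: real assume t: "0 \<le> t" "t \<le> 1"
        have "\<bar>poly (papprox f m) t - f t\<bar> < 1 / Suc m" "\<bar>poly (papprox f n) t - f t\<bar> < 1 / Suc n"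
          using papprox[OF f] t by auto
        moreover have "1 / real (Suc m) \<le> 1 / real (Suc M)" "1 / real (Suc n) \<le> 1 / real (Suc M)"
          using mn by (auto intro!: divide_left_mono)
        ultimately show "\<bar>poly (papprox f m - papprox f n) t\<bar> \<le> 2 / real (Suc M)"
          by (simp add: abs_le_iff abs_less_iff)
      qed
      also note M
      finally show "dist (opoly (papprox f m) x) (opoly (papprox f n) x) < e"
        by (simp add: dist_norm opoly_diff)
    qed
  qed
  then have "convergent (\<lambda>n. opoly (papprox f n) x)" by (rule Cauchy_convergent)
  then show ?thesis unfolding calc_def by (simp add: convergent_LIMSEQ_iff)
qed

lemma papprox_uniform:
  assumes "continuous_on {0..1} f"
  shows "uniform_limit {0..1} (\<lambda>n. poly (papprox f n)) f sequentially"
proof (rule uniform_limitI)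
  fix e :: real assume "0 < e"
  have "(\<lambda>n. 1 / real (Suc n)) \<longlonglongrightarrow> 0" by real_asymp
  then have "\<forall>\<^sub>F n in sequentially. 1 / real (Suc n) < e" using \<open>0 < e\<close> by (rule order_tendstoD)
  then show "\<forall>\<^sub>F n in sequentially. \<forall>x\<in>{0..1}. dist (poly (papprox f n) x) (f x) < e"
    by eventually_elim (metis papprox[OF assms] dist_real_def order.strict_trans)
qed

text \<open>The limit does not depend on the approximating polynomials. Laws such as
  \<open>calc_add\<close> and \<open>calc_mult\<close> can therefore be proved with approximants
  that satisfy them exactly.\<close>

lemma opoly_tendsto_calc:
  assumes f: "continuous_on {0..1} f" and q: "uniform_limit {0..1} (\<lambda>n. poly (q n)) f sequentially"
  shows "(\<lambda>n. opoly (q n) x) \<longlonglongrightarrow> calc f x"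
proof -
  have u: "uniform_limit {0..1} (\<lambda>n t. poly (q n - papprox f n) t) (\<lambda>t. f t - f t) sequentially"
    unfolding poly_diff by (intro uniform_limit_intros q papprox_uniform f)
  have "(\<lambda>n. opoly (q n - papprox f n) x) \<longlonglongrightarrow> 0"
  proof (rule tendstoI)
    fix e :: real assume e: "0 < e"
    define d where "d = e / (norm x + 1)"
    have d: "0 < d" unfolding d_def using e by (simp add: add_nonneg_pos)
    from uniform_limitD[OF u d] 
    show "\<forall>\<^sub>F n in sequentially. dist (opoly (q n - papprox f n) x) 0 < e"
    proof eventually_elim
      case (elim n)
      have "norm (opoly (q n - papprox f n) x) \<le> d * norm x"
        using elim by (intro opoly_norm) (auto simp: dist_real_def intro: less_imp_le)
      also have "\<dots> < d * (norm x + 1)" using d by simp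
      also have "\<dots> = e"
      proof -
        have "norm x + 1 \<noteq> 0" using norm_ge_zero[of x] by linarith
        then show ?thesis unfolding d_def by simp
      qed
      finally show ?case by simp
    qed
  qed
  from tendsto_add[OF this opoly_papprox_tendsto[OF f, of x]] show ?thesis
    by (simp add: opoly_diff)
qed

lemma calc_poly: "calc (poly p) x = opoly p x"
proof -
  have "(\<lambda>n::nat. opoly p x) \<longlonglongrightarrow> calc (poly p) x"
    by (intro opoly_tendsto_calc) (auto intro!: continuous_intros uniform_limit_const)
  then show ?thesis by (simp add: LIMSEQ_const_iff)
qed

lemma calc_one: "calc (\<lambda>t. 1) x = x"
proof -
  have "poly 1 = (\<lambda>t. 1 :: real)" by (rule ext) simp
  then show ?thesis using calc_poly[of 1 x] by simp
qed

lemma calc_id: "calc (\<lambda>t. t) x = G x"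
proof -
  have "poly [:0,1:] = (\<lambda>t. t :: real)" by (rule ext) simp
  then show ?thesis using calc_poly[of "[:0,1:]" x] by simp
qed

lemma calc_zero: "calc (\<lambda>t. 0) x = 0"
proof -
  have "poly 0 = (\<lambda>t. 0 :: real)" by (rule ext) simp
  then show ?thesis using calc_poly[of 0 x] by simp
qed

lemma calc_cong:
  assumes "continuous_on {0..1} f" "\<And>t. 0 \<le> t \<Longrightarrow> t \<le> 1 \<Longrightarrow> f t = g t"
  shows "calc f x = calc g x"
proof -
  have g: "continuous_on {0..1} g" using assms by (metis (no_types, lifting) atLeastAtMost_iff continuous_on_cong)
  have "uniform_limit {0..1} (\<lambda>n. poly (papprox f n)) g sequentially"
    using papprox_uniform[OF assms(1)] assms(2) by (simp add: uniform_limit_iff)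
  from LIMSEQ_unique[OF opoly_tendsto_calc[OF g this] opoly_papprox_tendsto[OF assms(1)]]
  show ?thesis by metis
qed

lemma calc_add:
  assumes "continuous_on {0..1} f" "continuous_on {0..1} g"
  shows "calc (\<lambda>t. f t + g t) x = calc f x + calc g x"
proof -
  have "uniform_limit {0..1} (\<lambda>n t. poly (papprox f n + papprox g n) t) (\<lambda>t. f t + g t) sequentially"
    unfolding poly_add by (rule uniform_limit_add[OF papprox_uniform[OF assms(1)] papprox_uniform[OF assms(2)]])
  then have "(\<lambda>n. opoly (papprox f n + papprox g n) x) \<longlonglongrightarrow> calc (\<lambda>t. f t + g t) x"
    by (rule opoly_tendsto_calc[OF continuous_on_add[OF assms]])
  moreover have "(\<lambda>n. opoly (papprox f n + papprox g n) x) \<longlonglongrightarrow> calc f x + calc g x"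
    unfolding opoly_add by (rule tendsto_add[OF opoly_papprox_tendsto[OF assms(1)] opoly_papprox_tendsto[OF assms(2)]])
  ultimately show ?thesis by (rule LIMSEQ_unique)
qed

lemma calc_cmult:
  assumes "continuous_on {0..1} f"
  shows "calc (\<lambda>t. a * f t) x = a *\<^sub>R calc f x"
proof -
  have "uniform_limit {0..1} (\<lambda>n t. a * poly (papprox f n) t) (\<lambda>t. a * f t) sequentially"
    by (rule bounded_linear.uniform_limit[OF bounded_linear_mult_right papprox_uniform[OF assms]])
  then have "(\<lambda>n. opoly (smult a (papprox f n)) x) \<longlonglongrightarrow> calc (\<lambda>t. a * f t) x"
    by (intro opoly_tendsto_calc[OF continuous_on_mult_left[OF assms]]) (simp add: uniform_limit_iff)
  moreover have "(\<lambda>n. opoly (smult a (papprox f n)) x) \<longlonglongrightarrow> a *\<^sub>R calc f x"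
    unfolding opoly_smult by (rule tendsto_scaleR[OF tendsto_const opoly_papprox_tendsto[OF assms]])
  ultimately show ?thesis by (rule LIMSEQ_unique)
qed

lemma calc_norm:
  assumes f: "continuous_on {0..1} f" and C: "\<And>t. 0 \<le> t \<Longrightarrow> t \<le> 1 \<Longrightarrow> \<bar>f t\<bar> \<le> C"
  shows "norm (calc f x) \<le> C * norm x"
proof -
  have "norm (opoly (papprox f n) x) \<le> (C + 1 / Suc n) * norm x" for n
  proof (rule opoly_norm)
    fix t :: real assume t: "0 \<le> t" "t \<le> 1"
    show "\<bar>poly (papprox f n) t\<bar> \<le> C + 1 / Suc n"
      using papprox[OF f, of t n] t C[OF t] unfolding abs_le_iff abs_less_iff atLeastAtMost_iff by linarith
  qed
  moreover have "(\<lambda>n. (C + 1 / real (Suc n)) * norm x) \<longlonglongrightarrow> (C + 0) * norm x"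
    by (intro tendsto_mult tendsto_add tendsto_const LIMSEQ_Suc[OF lim_1_over_n])
  moreover have "(\<lambda>n. norm (opoly (papprox f n) x)) \<longlonglongrightarrow> norm (calc f x)"
    by (intro tendsto_norm opoly_papprox_tendsto f)
  ultimately have "norm (calc f x) \<le> (C + 0) * norm x"
    using LIMSEQ_le by blast
  then show ?thesis by simp
qed

lemma calc_sym:
  assumes f: "continuous_on {0..1} f"
  shows "inner (calc f x) y = inner x (calc f y)"
proof -
  have "(\<lambda>n. inner (opoly (papprox f n) x) y) \<longlonglongrightarrow> inner (calc f x) y"
    by (rule tendsto_inner[OF opoly_papprox_tendsto[OF f] tendsto_const])
  moreover have "(\<lambda>n. inner (opoly (papprox f n) x) y) \<longlonglongrightarrow> inner x (calc f y)"
    unfolding opoly_sym by (rule tendsto_inner[OF tendsto_const opoly_papprox_tendsto[OF f]])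
  ultimately show ?thesis by (rule LIMSEQ_unique)
qed

lemma linear_calc:
  assumes f: "continuous_on {0..1} f"
  shows "linear (calc f)"
proof (rule linearI)
  show "calc f (x + y) = calc f x + calc f y" for x y
    using LIMSEQ_unique[OF opoly_papprox_tendsto[OF f, of "x + y"]
       tendsto_add[OF opoly_papprox_tendsto[OF f, of x] opoly_papprox_tendsto[OF f, of y], folded linear_add[OF linear_opoly]]] .
  show "calc f (c *\<^sub>R x) = c *\<^sub>R calc f x" for c x
    using LIMSEQ_unique[OF opoly_papprox_tendsto[OF f, of "c *\<^sub>R x"]
       tendsto_scaleR[OF tendsto_const opoly_papprox_tendsto[OF f, of x], of c, folded linear_scale[OF linear_opoly]]] .
qed

lemma calc_mult:
  assumes f: "continuous_on {0..1} f" and g: "continuous_on {0..1} g"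
  shows "calc (\<lambda>t. f t * g t) x = calc f (calc g x)"
proof -
  have bnd: "bounded (h ` {0..1})" if "continuous_on {0..1} h" for h :: "real \<Rightarrow> real"
    using that compact_continuous_image compact_imp_bounded compact_Icc by blast
  have "uniform_limit {0..1} (\<lambda>n t. poly (papprox f n * papprox g n) t) (\<lambda>t. f t * g t) sequentially"
    unfolding poly_mult
    by (rule bounded_bilinear.bounded_uniform_limit[OF bounded_bilinear_mult papprox_uniform[OF f] papprox_uniform[OF g] bnd[OF g] bnd[OF f]])
  then have "(\<lambda>n. opoly (papprox f n * papprox g n) x) \<longlonglongrightarrow> calc (\<lambda>t. f t * g t) x"
    by (rule opoly_tendsto_calc[OF continuous_on_mult[OF f g]])
  moreover have "(\<lambda>n. opoly (papprox f n * papprox g n) x) \<longlonglongrightarrow> calc f (calc g x)"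
  proof -
    obtain B where B: "\<And>t. t \<in> {0..1} \<Longrightarrow> \<bar>f t\<bar> \<le> B"
      using bnd[OF f] unfolding bounded_iff by (metis imageI real_norm_def)
    \<comment> \<open>With p_n and q_n for the approximants of f and g, the vector p_n(G) q_n(G) x
      is split at p_n(G) g(G) x. The operators p_n(G) are bounded uniformly in n, so this difference
      tends to 0.\<close>
    have "(\<lambda>n. opoly (papprox f n) (opoly (papprox g n) x - calc g x)) \<longlonglongrightarrow> 0"
    proof (rule Lim_null_comparison)
      show "\<forall>\<^sub>F n in sequentially. norm (opoly (papprox f n) (opoly (papprox g n) x - calc g x)) \<le> (B + 1) * norm (opoly (papprox g n) x - calc g x)"
      proof (intro always_eventually allI opoly_norm)
        fix n and t :: real assume t: "0 \<le> t" "t \<le> 1"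
        have "1 / real (Suc n) \<le> 1" by simp
        then show "\<bar>poly (papprox f n) t\<bar> \<le> B + 1"
          using papprox[OF f, of t n] t B[of t] unfolding abs_le_iff abs_less_iff atLeastAtMost_iff by linarith
      qed
      have "(\<lambda>n. opoly (papprox g n) x - calc g x) \<longlonglongrightarrow> 0"
        using opoly_papprox_tendsto[OF g, of x] by (simp add: LIM_zero)
      then show "(\<lambda>n. (B + 1) * norm (opoly (papprox g n) x - calc g x)) \<longlonglongrightarrow> 0"
        by (intro tendsto_mult_right_zero tendsto_norm_zero)
    qed
    from tendsto_add[OF this opoly_papprox_tendsto[OF f, of "calc g x"]]
    show ?thesis by (simp add: opoly_mult linear_diff[OF linear_opoly])
  qed
  ultimately show ?thesis by (rule LIMSEQ_unique)
qed

lemma calc_diff: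
  assumes "continuous_on {0..1} f" "continuous_on {0..1} g"
  shows "calc (\<lambda>t. f t - g t) x = calc f x - calc g x"
  using calc_add[of f "\<lambda>t. -1 * g t" x] calc_cmult[of g "-1" x] assms
  by (simp add: continuous_on_minus)

lemma calc_sum:
  assumes "\<And>i. i \<in> S \<Longrightarrow> continuous_on {0..1} (f i)"
  shows "calc (\<lambda>t. \<Sum>i\<in>S. f i t) x = (\<Sum>i\<in>S. calc (f i) x)"
  using assms
proof (induction S rule: infinite_finite_induct)
  case (insert i S)
  then show ?case by (simp add: calc_add continuous_on_sum)
qed (simp_all add: calc_zero)

text \<open>The continuous square root of \<open>g - f\<close> on [0,1] exhibits the difference of
  the two sides as a squared norm.\<close>

lemma calc_mono:
  assumes f: "continuous_on {0..1} f" and g: "continuous_on {0..1} g" and le: "\<And>t. 0 \<le> t \<Longrightarrow> t \<le> 1 \<Longrightarrow> f t \<le> g t"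
  shows "inner (calc f x) x \<le> inner (calc g x) x"
proof -
  define h where "h t = sqrt (g t - f t)" for t
  have h: "continuous_on {0..1} h" unfolding h_def by (intro continuous_intros f g)
  have "calc g x - calc f x = calc (\<lambda>t. g t - f t) x" using f g by (simp add: calc_diff)
  also have "\<dots> = calc (\<lambda>t. h t * h t) x"
    using f g le by (intro calc_cong) (auto simp: h_def intro!: continuous_intros)
  finally have "inner (calc g x - calc f x) x = inner (calc h x) (calc h x)"
    using h by (simp add: calc_mult calc_sym)
  then show ?thesis by (metis inner_diff_left inner_ge_zero diff_ge_0_iff_ge)
qed

lemma calc_inner_mult:
  assumes "continuous_on {0..1} f" "continuous_on {0..1} g"
  shows "inner (calc f x) (calc g y) = inner (calc (\<lambda>t. f t * g t) x) y"
  using assms by (simp add: calc_sym[of g, symmetric] calc_mult[symmetric] mult.commute)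

end

section \<open>The closed quadratic form generated by a symmetric operator on a core\<close>

text \<open>Serves twice: as Cauchy-Schwarz for the semidefinite form \<open>q\<close>, and in
  \<open>resolvent_exists\<close> as a first-order optimality condition with an error term, where
  \<open>a\<close> is the excess of the energy over its infimum.\<close>

lemma discriminant_nonpos:
  fixes a b c :: real
  assumes "\<And>s. 0 \<le> a + 2 * s * b + s\<^sup>2 * c"
  shows "b\<^sup>2 \<le> a * c"
proof (cases "c = 0")
  case True
  have "b = 0"
  proof (rule ccontr)
    assume "b \<noteq> 0"
    then have "2 * (- (a + 1) / (2 * b)) * b = - (a + 1)" by (simp add: field_simps)
    then show False using assms[of "- (a + 1) / (2 * b)"] True by simp
  qed
  then show ?thesis using True by simp
next
  case False
  have c: "0 \<le> c"
  proof (rule ccontr)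
    assume "\<not> 0 \<le> c"
    then have "filterlim (\<lambda>s. a + 2 * s * b + s\<^sup>2 * c) at_bot at_top" by real_asymp
    then have "\<forall>\<^sub>F s in at_top. a + 2 * s * b + s\<^sup>2 * c < 0" by (simp add: filterlim_at_bot_dense)
    then obtain s where "a + 2 * s * b + s\<^sup>2 * c < 0" by (auto simp: eventually_at_top_linorder)
    then show False using assms[of s] by simp
  qed
  have "0 \<le> a - b\<^sup>2 / c" using assms[of "- b / c"] False by (simp add: power2_eq_square field_simps)
  then show ?thesis using c False by (simp add: field_simps)
qed

text \<open>\<open>T\<close> is a core, dense only in its own closure: the ambient space will
  consist of functions on all of R^N and \<open>T\<close> of test functions of a domain. The
  resolvent \<open>G\<close> built below vanishes on the orthogonal complement of
  \<open>T\<close>.\<close>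

locale form_op =
  fixes T :: "'a::{real_inner,complete_space} set" and L :: "'a \<Rightarrow> 'a"
  assumes T: "subspace T"
    and L_add: "x \<in> T \<Longrightarrow> y \<in> T \<Longrightarrow> L (x + y) = L x + L y"
    and L_scaleR: "x \<in> T \<Longrightarrow> L (a *\<^sub>R x) = a *\<^sub>R L x"
    and L_sym: "x \<in> T \<Longrightarrow> y \<in> T \<Longrightarrow> inner (L x) y = inner x (L y)"
    and L_pos: "x \<in> T \<Longrightarrow> 0 \<le> inner (L x) x"
begin

definition q :: "'a \<Rightarrow> 'a \<Rightarrow> real" where "q x y = inner (L x) y"

definition p :: "'a \<Rightarrow> real" where "p x = sqrt (q x x)"

lemma T_add [simp]: "x \<in> T \<Longrightarrow> y \<in> T \<Longrightarrow> x + y \<in> T"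
  and T_diff [simp]: "x \<in> T \<Longrightarrow> y \<in> T \<Longrightarrow> x - y \<in> T"
  and T_scaleR [simp]: "x \<in> T \<Longrightarrow> a *\<^sub>R x \<in> T"
  and T_zero [simp]: "0 \<in> T"
  using T by (auto intro: subspace_add subspace_diff subspace_scale subspace_0)

lemma L_diff: "x \<in> T \<Longrightarrow> y \<in> T \<Longrightarrow> L (x - y) = L x - L y"
  using L_add[of x "(-1) *\<^sub>R y"] L_scaleR[of y "-1"] T_scaleR[of y "-1"] by simp

lemma q_simps:
  "x \<in> T \<Longrightarrow> y \<in> T \<Longrightarrow> q (x + y) z = q x z + q y z"
  "x \<in> T \<Longrightarrow> y \<in> T \<Longrightarrow> q (x - y) z = q x z - q y z"
  "x \<in> T \<Longrightarrow> q (a *\<^sub>R x) z = a * q x z"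
  "q z (x + y) = q z x + q z y"
  "q z (x - y) = q z x - q z y"
  "q z (a *\<^sub>R x) = a * q z x"
  by (simp_all add: q_def L_add L_diff L_scaleR inner_add_left inner_diff_left inner_add_right inner_diff_right)

lemma q_sym: "x \<in> T \<Longrightarrow> y \<in> T \<Longrightarrow> q x y = q y x"
  unfolding q_def using L_sym[of x y] by (simp add: inner_commute)

lemma q_pos: "x \<in> T \<Longrightarrow> 0 \<le> q x x"
  by (simp add: q_def L_pos)

lemma p_pos: "x \<in> T \<Longrightarrow> 0 \<le> p x"
  by (simp add: p_def q_pos)

lemma p_sq: "x \<in> T \<Longrightarrow> (p x)\<^sup>2 = q x x"
  by (simp add: p_def q_pos)

lemma q_CS: "\<bar>q x y\<bar> \<le> p x * p y" if "x \<in> T" "y \<in> T"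
proof -
  have "(q x y)\<^sup>2 \<le> q x x * q y y"
  proof (rule discriminant_nonpos)
    fix s
    have "0 \<le> q (x + s *\<^sub>R y) (x + s *\<^sub>R y)" using that by (intro q_pos) simp
    also have "\<dots> = q x x + 2 * s * q x y + s\<^sup>2 * q y y"
      using that q_sym[of y x] by (simp add: q_simps power2_eq_square algebra_simps)
    finally show "0 \<le> q x x + 2 * s * q x y + s\<^sup>2 * q y y" .
  qed
  then have "\<bar>q x y\<bar>\<^sup>2 \<le> (p x * p y)\<^sup>2" using that by (simp add: power_mult_distrib p_sq)
  then show ?thesis using that by (simp add: p_pos power2_le_iff_abs_le)
qed

lemma p_triangle: "\<bar>p x - p y\<bar> \<le> p (x - y)" if "x \<in> T" "y \<in> T"
proof -
  have *: "p (x + y) \<le> p x + p y" if "x \<in> T" "y \<in> T" for x y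
  proof (rule power2_le_imp_le)
    have "(p (x + y))\<^sup>2 = (p x)\<^sup>2 + 2 * q x y + (p y)\<^sup>2"
      using that q_sym[of y x] by (simp add: p_sq q_simps)
    also have "\<dots> \<le> (p x + p y)\<^sup>2"
      using q_CS[OF that] by (simp add: power2_eq_square algebra_simps)
    finally show "(p (x + y))\<^sup>2 \<le> (p x + p y)\<^sup>2" .
  qed (use that in \<open>simp add: p_pos\<close>)
  have "p (y - x) = p (x - y)"
    using that q_sym[of x y] by (simp add: p_def q_simps)
  then show ?thesis using *[of "x - y" y] *[of "y - x" x] that by simp
qed

text \<open>The clauses copy those of \<open>form_approx\<close>, so that the two notions can be
  matched one by one in \<open>form_approx_iff\<close>.\<close>

definition approx :: "'a \<Rightarrow> (nat \<Rightarrow> 'a) \<Rightarrow> bool" where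
  "approx x \<phi> \<longleftrightarrow> (\<forall>k. \<phi> k \<in> T) \<and> \<phi> \<longlonglongrightarrow> x \<and>
     (\<forall>e>0. \<exists>M. \<forall>j\<ge>M. \<forall>k\<ge>M. q (\<phi> j - \<phi> k) (\<phi> j - \<phi> k) < e)"

definition D :: "'a set" where "D = {x. \<exists>\<phi>. approx x \<phi>}"

lemma approx_T: "approx x \<phi> \<Longrightarrow> \<phi> k \<in> T"
  and approx_lim: "approx x \<phi> \<Longrightarrow> \<phi> \<longlonglongrightarrow> x"
  by (auto simp: approx_def)

lemma approx_p:
  assumes "approx x \<phi>" "0 < e"
  shows "\<exists>M. \<forall>j\<ge>M. \<forall>k\<ge>M. p (\<phi> j - \<phi> k) < e"
proof -
  obtain M where M: "\<And>j k. M \<le> j \<Longrightarrow> M \<le> k \<Longrightarrow> q (\<phi> j - \<phi> k) (\<phi> j - \<phi> k) < e\<^sup>2"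
    using assms unfolding approx_def by (meson zero_less_power)
  have "p (\<phi> j - \<phi> k) < e" if "M \<le> j" "M \<le> k" for j k
    using M[OF that] assms(2) unfolding p_def by (simp add: real_sqrt_less_iff sqrt_le_D real_less_lsqrt)
  then show ?thesis by blast
qed

lemma approxI:
  assumes "\<And>k. \<phi> k \<in> T" "\<phi> \<longlonglongrightarrow> x" "\<And>e. 0 < e \<Longrightarrow> \<exists>M. \<forall>j\<ge>M. \<forall>k\<ge>M. p (\<phi> j - \<phi> k) < e"
  shows "approx x \<phi>"
  unfolding approx_def
proof (intro conjI allI impI)
  fix e :: real assume "0 < e"
  then obtain M where M: "\<And>j k. M \<le> j \<Longrightarrow> M \<le> k \<Longrightarrow> p (\<phi> j - \<phi> k) < sqrt e"
    using assms(3)[of "sqrt e"] by auto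
  have "q (\<phi> j - \<phi> k) (\<phi> j - \<phi> k) < e" if "M \<le> j" "M \<le> k" for j k
    using M[OF that] unfolding p_def by simp
  then show "\<exists>M. \<forall>j\<ge>M. \<forall>k\<ge>M. q (\<phi> j - \<phi> k) (\<phi> j - \<phi> k) < e" by blast
qed (use assms in auto)

lemma approx_const: "x \<in> T \<Longrightarrow> approx x (\<lambda>_. x)"
  by (auto simp: approx_def q_simps q_def L_diff)

lemma approx_comb:
  assumes "approx x \<phi>" "approx y \<psi>"
  shows "approx (x + a *\<^sub>R y) (\<lambda>k. \<phi> k + a *\<^sub>R \<psi> k)"
proof (rule approxI)
  have T: "\<phi> k \<in> T" "\<psi> k \<in> T" for k using assms approx_T by auto
  show "\<phi> k + a *\<^sub>R \<psi> k \<in> T" for k using T by simp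
  show "(\<lambda>k. \<phi> k + a *\<^sub>R \<psi> k) \<longlonglongrightarrow> x + a *\<^sub>R y"
    by (rule tendsto_add[OF approx_lim[OF assms(1)] tendsto_scaleR[OF tendsto_const approx_lim[OF assms(2)]]])
  fix e :: real assume e: "0 < e"
  define e' where "e' = e / (2 * (\<bar>a\<bar> + 1))"
  have e': "0 < e'" unfolding e'_def using e by (simp add: add_nonneg_pos)
  obtain M1 where M1: "\<And>j k. M1 \<le> j \<Longrightarrow> M1 \<le> k \<Longrightarrow> p (\<phi> j - \<phi> k) < e / 2"
    using approx_p[OF assms(1), of "e/2"] e by auto
  obtain M2 where M2: "\<And>j k. M2 \<le> j \<Longrightarrow> M2 \<le> k \<Longrightarrow> p (\<psi> j - \<psi> k) < e'"
    using approx_p[OF assms(2) e'] by auto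
  have "p ((\<phi> j + a *\<^sub>R \<psi> j) - (\<phi> k + a *\<^sub>R \<psi> k)) < e" if "max M1 M2 \<le> j" "max M1 M2 \<le> k" for j k
  proof -
    let ?u = "\<phi> j - \<phi> k" and ?v = "(- a) *\<^sub>R (\<psi> j - \<psi> k)"
    have pv: "p ?v = \<bar>a\<bar> * p (\<psi> j - \<psi> k)"
      using T unfolding p_def by (simp only: q_simps(3,6) T_diff real_sqrt_mult mult.assoc[symmetric]) simp
    have "p (?u - ?v) \<le> p ?u + p ?v"
      using p_triangle[of "?u - ?v" ?u] T pv p_triangle[of "?u - ?v" "?u"] p_triangle[of ?u "?u - ?v"] by auto
    also have "\<dots> < e / 2 + e / 2"
    proof -
      have "\<bar>a\<bar> * p (\<psi> j - \<psi> k) \<le> (\<bar>a\<bar> + 1) * e'"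
        using M2[of j k] that e' T by (intro mult_mono) (auto simp: p_pos)
      also have "\<dots> = e / 2" unfolding e'_def by (simp add: field_simps)
      finally show ?thesis using M1[of j k] that pv by auto
    qed
    finally show ?thesis by (simp add: algebra_simps)
  qed
  then show "\<exists>M. \<forall>j\<ge>M. \<forall>k\<ge>M. p ((\<phi> j + a *\<^sub>R \<psi> j) - (\<phi> k + a *\<^sub>R \<psi> k)) < e" by blast
qed

lemma approx_diff: "approx x \<phi> \<Longrightarrow> approx y \<psi> \<Longrightarrow> approx (x - y) (\<lambda>k. \<phi> k - \<psi> k)"
  using approx_comb[of x \<phi> y \<psi> "-1"] by simp

lemma approx_bounded: "\<exists>B>0. \<forall>k. p (\<phi> k) \<le> B" if "approx x \<phi>"
proof -
  have "Cauchy (\<lambda>k. p (\<phi> k))"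
  proof (rule metric_CauchyI)
    fix e :: real assume "0 < e"
    from approx_p[OF that this] obtain M where M: "\<And>j k. M \<le> j \<Longrightarrow> M \<le> k \<Longrightarrow> p (\<phi> j - \<phi> k) < e" by auto
    then show "\<exists>M. \<forall>j\<ge>M. \<forall>k\<ge>M. dist (p (\<phi> j)) (p (\<phi> k)) < e"
      using p_triangle approx_T[OF that] unfolding dist_real_def by (meson le_less_trans)
  qed
  then obtain B where "0 < B" "\<And>k. norm (p (\<phi> k)) \<le> B" using Cauchy_Bseq BseqE by metis
  then show ?thesis by (intro exI[of _ B]) (auto simp: abs_le_iff)
qed

text \<open>Closability of the form. In \<open>q (\<phi> k) (\<phi> k - \<phi> n) + inner (L (\<phi>
  k)) (\<phi> n)\<close>, which equals the square of \<open>p (\<phi> k)\<close>, the first term is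
  small by the Cauchy property; the second tends to 0 in n because \<open>L (\<phi> k)\<close> is a
  fixed vector.\<close>

lemma approx_zero:
  assumes \<phi>: "approx 0 \<phi>"
  shows "(\<lambda>k. p (\<phi> k)) \<longlonglongrightarrow> 0"
proof -
  obtain B where B: "0 < B" "\<And>k. p (\<phi> k) \<le> B" using approx_bounded[OF \<phi>] by auto
  note T = approx_T[OF \<phi>]
  have "(\<lambda>k. (p (\<phi> k))\<^sup>2) \<longlonglongrightarrow> 0"
  proof (rule LIMSEQ_I)
    fix e :: real assume e: "0 < e"
    then have "0 < e / (2 * B)" using B by simp
    from approx_p[OF \<phi> this] obtain M where M: "\<And>j k. M \<le> j \<Longrightarrow> M \<le> k \<Longrightarrow> p (\<phi> j - \<phi> k) < e / (2 * B)" by auto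
    have "(p (\<phi> k))\<^sup>2 \<le> e / 2" if k: "M \<le> k" for k
    proof (rule LIMSEQ_le)
      have "(\<lambda>j. e / 2 + inner (L (\<phi> k)) (\<phi> j)) \<longlonglongrightarrow> e / 2 + inner (L (\<phi> k)) 0"
        by (rule tendsto_add[OF tendsto_const tendsto_inner[OF tendsto_const approx_lim[OF \<phi>]]])
      then show "(\<lambda>j. e / 2 + inner (L (\<phi> k)) (\<phi> j)) \<longlonglongrightarrow> e / 2" by simp
      show "\<exists>N. \<forall>n\<ge>N. (p (\<phi> k))\<^sup>2 \<le> e / 2 + inner (L (\<phi> k)) (\<phi> n)"
      proof (intro exI[of _ M] allI impI)
        fix n assume n: "M \<le> n"
        have "(p (\<phi> k))\<^sup>2 = q (\<phi> k) (\<phi> k - \<phi> n) + inner (L (\<phi> k)) (\<phi> n)"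
          using T by (simp add: p_sq q_def inner_diff_right)
        moreover have "q (\<phi> k) (\<phi> k - \<phi> n) \<le> p (\<phi> k) * p (\<phi> k - \<phi> n)"
          using q_CS[of "\<phi> k" "\<phi> k - \<phi> n"] T by simp
        moreover have "p (\<phi> k) * p (\<phi> k - \<phi> n) \<le> B * (e / (2 * B))"
          using B M[of k n] k n T by (intro mult_mono) (auto simp: p_pos less_imp_le)
        moreover have "B * (e / (2 * B)) = e / 2" using B by simp
        ultimately show "(p (\<phi> k))\<^sup>2 \<le> e / 2 + inner (L (\<phi> k)) (\<phi> n)" by linarith
      qed
    qed simp
    then show "\<exists>no. \<forall>n\<ge>no. norm ((p (\<phi> n))\<^sup>2 - 0) < e"
      using e by (intro exI[of _ M]) force
  qed
  from tendsto_real_sqrt[OF this] show ?thesis using T by (simp add: p_pos)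
qed

definition bf :: "'a \<Rightarrow> 'a \<Rightarrow> real" where
  "bf x y = lim (\<lambda>k. q ((SOME \<phi>. approx x \<phi>) k) ((SOME \<psi>. approx y \<psi>) k))"

lemma q_convergent:
  assumes "approx x \<phi>" "approx y \<psi>"
  shows "convergent (\<lambda>k. q (\<phi> k) (\<psi> k))"
proof -
  have T: "\<phi> k \<in> T" "\<psi> k \<in> T" for k using assms approx_T by auto
  obtain B1 where B1: "0 < B1" "\<And>k. p (\<phi> k) \<le> B1" using approx_bounded[OF assms(1)] by auto
  obtain B2 where B2: "0 < B2" "\<And>k. p (\<psi> k) \<le> B2" using approx_bounded[OF assms(2)] by auto
  have "Cauchy (\<lambda>k. q (\<phi> k) (\<psi> k))"
  proof (rule metric_CauchyI)
    fix e :: real assume e: "0 < e"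
    obtain M1 where M1: "\<And>j k. M1 \<le> j \<Longrightarrow> M1 \<le> k \<Longrightarrow> p (\<phi> j - \<phi> k) < e / (2 * B2)"
      using approx_p[OF assms(1), of "e / (2 * B2)"] e B2 by auto
    obtain M2 where M2: "\<And>j k. M2 \<le> j \<Longrightarrow> M2 \<le> k \<Longrightarrow> p (\<psi> j - \<psi> k) < e / (2 * B1)"
      using approx_p[OF assms(2), of "e / (2 * B1)"] e B1 by auto
    show "\<exists>M. \<forall>j\<ge>M. \<forall>k\<ge>M. dist (q (\<phi> j) (\<psi> j)) (q (\<phi> k) (\<psi> k)) < e"
    proof (intro exI[of _ "max M1 M2"] allI impI)
      fix j k assume jk: "max M1 M2 \<le> j" "max M1 M2 \<le> k"
      have "q (\<phi> j) (\<psi> j) - q (\<phi> k) (\<psi> k) = q (\<phi> j - \<phi> k) (\<psi> j) + q (\<phi> k) (\<psi> j - \<psi> k)"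
        using T by (simp add: q_simps)
      moreover have "\<bar>q (\<phi> j - \<phi> k) (\<psi> j)\<bar> < e / 2"
      proof -
        have "\<bar>q (\<phi> j - \<phi> k) (\<psi> j)\<bar> \<le> p (\<phi> j - \<phi> k) * p (\<psi> j)" using T by (intro q_CS) auto
        also have "\<dots> \<le> p (\<phi> j - \<phi> k) * B2" using T B2 by (intro mult_left_mono) (auto simp: p_pos)
        also have "\<dots> < e / (2 * B2) * B2" using M1[of j k] jk B2 by (intro mult_strict_right_mono) auto
        also have "\<dots> = e / 2" using B2 by simp
        finally show ?thesis .
      qed
      moreover have "\<bar>q (\<phi> k) (\<psi> j - \<psi> k)\<bar> < e / 2"
      proof -
        have "\<bar>q (\<phi> k) (\<psi> j - \<psi> k)\<bar> \<le> p (\<phi> k) * p (\<psi> j - \<psi> k)" using T by (intro q_CS) auto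
        also have "\<dots> \<le> B1 * p (\<psi> j - \<psi> k)" using T B1 by (intro mult_right_mono) (auto simp: p_pos)
        also have "\<dots> < B1 * (e / (2 * B1))" using M2[of j k] jk B1 by (intro mult_strict_left_mono) auto
        also have "\<dots> = e / 2" using B1 by simp
        finally show ?thesis .
      qed
      ultimately show "dist (q (\<phi> j) (\<psi> j)) (q (\<phi> k) (\<psi> k)) < e"
        unfolding dist_real_def by linarith
    qed
  qed
  then show ?thesis by (rule Cauchy_convergent)
qed

text \<open>Two approximating sequences of one vector differ by an approximation of 0, so
  \<open>approx_zero\<close> removes the dependence on the sequences chosen in
  \<open>bf\<close>.\<close>

lemma bf_lim:
  assumes "approx x \<phi>" "approx y \<psi>"
  shows "(\<lambda>k. q (\<phi> k) (\<psi> k)) \<longlonglongrightarrow> bf x y"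
proof -
  define \<phi>' \<psi>' where "\<phi>' = (SOME \<phi>. approx x \<phi>)" and "\<psi>' = (SOME \<psi>. approx y \<psi>)"
  have a: "approx x \<phi>'" "approx y \<psi>'"
    unfolding \<phi>'_def \<psi>'_def by (rule someI[of _ \<phi>], fact, rule someI[of _ \<psi>], fact)
  have T: "\<phi> k \<in> T" "\<psi> k \<in> T" "\<phi>' k \<in> T" "\<psi>' k \<in> T" for k using assms a approx_T by auto
  have lim: "(\<lambda>k. q (\<phi>' k) (\<psi>' k)) \<longlonglongrightarrow> bf x y"
    using q_convergent[OF a] unfolding bf_def \<phi>'_def \<psi>'_def by (simp add: convergent_LIMSEQ_iff)
  obtain B1 where B1: "0 < B1" "\<And>k. p (\<phi>' k) \<le> B1" using approx_bounded[OF a(1)] by auto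
  obtain B2 where B2: "0 < B2" "\<And>k. p (\<psi> k) \<le> B2" using approx_bounded[OF assms(2)] by auto
  have z: "(\<lambda>k. p (\<phi> k - \<phi>' k)) \<longlonglongrightarrow> 0" "(\<lambda>k. p (\<psi> k - \<psi>' k)) \<longlonglongrightarrow> 0"
    using approx_zero approx_diff[OF assms(1) a(1)] approx_diff[OF assms(2) a(2)] by auto
  have "(\<lambda>k. q (\<phi> k) (\<psi> k) - q (\<phi>' k) (\<psi>' k)) \<longlonglongrightarrow> 0"
  proof (rule Lim_null_comparison)
    show "(\<lambda>k. B2 * p (\<phi> k - \<phi>' k) + B1 * p (\<psi> k - \<psi>' k)) \<longlonglongrightarrow> 0"
      using tendsto_add[OF tendsto_mult_right_zero[OF z(1)] tendsto_mult_right_zero[OF z(2)]] by simp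
    show "\<forall>\<^sub>F k in sequentially. norm (q (\<phi> k) (\<psi> k) - q (\<phi>' k) (\<psi>' k)) \<le> B2 * p (\<phi> k - \<phi>' k) + B1 * p (\<psi> k - \<psi>' k)"
    proof (intro always_eventually allI)
      fix k
      have "q (\<phi> k) (\<psi> k) - q (\<phi>' k) (\<psi>' k) = q (\<phi> k - \<phi>' k) (\<psi> k) + q (\<phi>' k) (\<psi> k - \<psi>' k)"
        using T by (simp add: q_simps)
      moreover have "\<bar>q (\<phi> k - \<phi>' k) (\<psi> k)\<bar> \<le> p (\<phi> k - \<phi>' k) * p (\<psi> k)" using T by (intro q_CS) auto
      moreover have "p (\<phi> k - \<phi>' k) * p (\<psi> k) \<le> B2 * p (\<phi> k - \<phi>' k)"
        using T B2 by (subst mult.commute) (intro mult_right_mono, auto simp: p_pos)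
      moreover have "\<bar>q (\<phi>' k) (\<psi> k - \<psi>' k)\<bar> \<le> p (\<phi>' k) * p (\<psi> k - \<psi>' k)" using T by (intro q_CS) auto
      moreover have "p (\<phi>' k) * p (\<psi> k - \<psi>' k) \<le> B1 * p (\<psi> k - \<psi>' k)"
        using T B1 by (intro mult_right_mono) (auto simp: p_pos)
      ultimately show "norm (q (\<phi> k) (\<psi> k) - q (\<phi>' k) (\<psi>' k)) \<le> B2 * p (\<phi> k - \<phi>' k) + B1 * p (\<psi> k - \<psi>' k)"
        unfolding real_norm_def by linarith
    qed
  qed
  from tendsto_add[OF this lim] show ?thesis by simp
qed

lemma D_comb: "x \<in> D \<Longrightarrow> y \<in> D \<Longrightarrow> x + a *\<^sub>R y \<in> D"
  unfolding D_def using approx_comb by blast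

lemma T_sub_D: "x \<in> T \<Longrightarrow> x \<in> D"
  unfolding D_def using approx_const by blast

lemma bf_comb_left:
  assumes "x \<in> D" "y \<in> D" "z \<in> D"
  shows "bf (x + a *\<^sub>R y) z = bf x z + a * bf y z"
proof -
  obtain \<phi> \<psi> \<eta> where a: "approx x \<phi>" "approx y \<psi>" "approx z \<eta>" using assms by (auto simp: D_def)
  have T: "\<phi> k \<in> T" "\<psi> k \<in> T" "\<eta> k \<in> T" for k using a approx_T by auto
  have "(\<lambda>k. q (\<phi> k + a *\<^sub>R \<psi> k) (\<eta> k)) \<longlonglongrightarrow> bf (x + a *\<^sub>R y) z"
    by (rule bf_lim[OF approx_comb[OF a(1,2)] a(3)])
  moreover have "(\<lambda>k. q (\<phi> k) (\<eta> k) + a * q (\<psi> k) (\<eta> k)) \<longlonglongrightarrow> bf x z + a * bf y z"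
    by (rule tendsto_add[OF bf_lim[OF a(1,3)] tendsto_mult[OF tendsto_const bf_lim[OF a(2,3)]]])
  ultimately show ?thesis using LIMSEQ_unique T by (simp add: q_simps)
qed

lemma bf_sym:
  assumes "x \<in> D" "y \<in> D"
  shows "bf x y = bf y x"
proof -
  obtain \<phi> \<psi> where a: "approx x \<phi>" "approx y \<psi>" using assms by (auto simp: D_def)
  have "q (\<phi> k) (\<psi> k) = q (\<psi> k) (\<phi> k)" for k using a approx_T by (intro q_sym) auto
  then show ?thesis using bf_lim[OF a(1,2)] bf_lim[OF a(2,1)] LIMSEQ_unique by simp
qed

lemma bf_pos:
  assumes "x \<in> D"
  shows "0 \<le> bf x x"
proof -
  obtain \<phi> where a: "approx x \<phi>" using assms by (auto simp: D_def)
  have "0 \<le> q (\<phi> k) (\<phi> k)" for k using a approx_T by (intro q_pos) auto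
  then show ?thesis using bf_lim[OF a a] LIMSEQ_le_const by blast
qed

subsection \<open>The resolvent\<close>

text \<open>Direct method: the energy \<open>E\<close> is minimised over the core \<open>T\<close>
  itself. A minimising sequence is Cauchy both in norm and for \<open>q\<close>, so its limit lies
  in \<open>D\<close>, and the Euler-Lagrange equation of \<open>E\<close> is the resolvent
  equation.\<close>

lemma resolvent_exists: "\<exists>x\<in>D. \<forall>y\<in>D. bf x y + inner x y = inner h y"
proof -
  define E where "E \<phi> = q \<phi> \<phi> + inner \<phi> \<phi> - 2 * inner h \<phi>" for \<phi>
  define q1 where "q1 x y = q x y + inner x y" for x y
  define m where "m = Inf (E ` T)"
  have E_lower: "- inner h h \<le> E \<phi>" if "\<phi> \<in> T" for \<phi>
  proof -
    have "0 \<le> inner (\<phi> - h) (\<phi> - h)" by simp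
    then have "- inner h h \<le> inner \<phi> \<phi> - 2 * inner h \<phi>"
      by (simp add: inner_diff_left inner_diff_right inner_commute)
    then show ?thesis unfolding E_def using q_pos[OF that] by simp
  qed
  have bdd: "bdd_below (E ` T)" using E_lower by (auto simp: bdd_below_def)
  have m_le: "m \<le> E \<phi>" if "\<phi> \<in> T" for \<phi>
    unfolding m_def using that bdd by (intro cInf_lower) auto
  have "\<exists>\<phi>\<in>T. E \<phi> < m + 1 / real (Suc k)" for k
  proof -
    have "E ` T \<noteq> {}" using T_zero by blast
    then have "\<exists>y\<in>E ` T. y < m + 1 / real (Suc k)"
      unfolding m_def by (intro cInf_lessD) simp_all
    then show ?thesis by blast
  qed
  then obtain \<phi> where \<phi>T: "\<And>k. \<phi> k \<in> T" and \<phi>E: "\<And>k. E (\<phi> k) < m + 1 / real (Suc k)"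
    by metis
  \<comment> \<open>Parallelogram identity: the midpoint has energy at least \<open>m\<close>, so
    two near-minimisers are close in the form norm.\<close>
  have par: "q1 (u - v) (u - v) = 2 * E u + 2 * E v - 4 * E ((1/2) *\<^sub>R (u + v))" if "u \<in> T" "v \<in> T" for u v
    using that unfolding E_def q1_def
    by (simp add: q_simps q_sym[of v u] inner_diff_left inner_diff_right inner_add_left inner_add_right inner_commute[of v u] field_simps)
  have q1_small: "q1 (\<phi> j - \<phi> k) (\<phi> j - \<phi> k) \<le> 2 / real (Suc j) + 2 / real (Suc k)" for j k
    using par[OF \<phi>T \<phi>T, of j k] \<phi>E[of j] \<phi>E[of k] m_le[of "(1/2) *\<^sub>R (\<phi> j + \<phi> k)"] \<phi>T by simp
  have small: "\<exists>M. \<forall>j\<ge>M. \<forall>k\<ge>M. q1 (\<phi> j - \<phi> k) (\<phi> j - \<phi> k) < e" if e: "0 < e" for e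
  proof -
    have "(\<lambda>n. 4 / real (Suc n)) \<longlonglongrightarrow> 0" by real_asymp
    then have "\<forall>\<^sub>F n in sequentially. 4 / real (Suc n) < e" using e by (rule order_tendstoD)
    then obtain M where M: "4 / real (Suc M) < e" by (auto simp: eventually_sequentially)
    have "q1 (\<phi> j - \<phi> k) (\<phi> j - \<phi> k) < e" if "M \<le> j" "M \<le> k" for j k
    proof -
      have "2 / real (Suc j) \<le> 2 / real (Suc M)" "2 / real (Suc k) \<le> 2 / real (Suc M)"
        using that by (auto intro!: divide_left_mono)
      then show ?thesis using q1_small[of j k] M by simp
    qed
    then show ?thesis by blast
  qed
  have "Cauchy \<phi>"
  proof (rule metric_CauchyI)
    fix e :: real assume "0 < e"
    then obtain M where M: "\<And>j k. M \<le> j \<Longrightarrow> M \<le> k \<Longrightarrow> q1 (\<phi> j - \<phi> k) (\<phi> j - \<phi> k) < e\<^sup>2"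
      using small[of "e\<^sup>2"] by auto
    have "dist (\<phi> j) (\<phi> k) < e" if "M \<le> j" "M \<le> k" for j k
    proof -
      have "(dist (\<phi> j) (\<phi> k))\<^sup>2 < e\<^sup>2"
        using M[OF that] q_pos[of "\<phi> j - \<phi> k"] \<phi>T by (simp add: q1_def dist_norm power2_norm_eq_inner)
      then show ?thesis using \<open>0 < e\<close> by (simp add: power2_less_imp_less)
    qed
    then show "\<exists>M. \<forall>j\<ge>M. \<forall>k\<ge>M. dist (\<phi> j) (\<phi> k) < e" by blast
  qed
  then obtain x where x: "\<phi> \<longlonglongrightarrow> x" using Cauchy_convergent convergent_def by blast
  have appr: "approx x \<phi>"
    unfolding approx_def
  proof (intro conjI allI impI)
    fix e :: real assume "0 < e"
    then obtain M where "\<And>j k. M \<le> j \<Longrightarrow> M \<le> k \<Longrightarrow> q1 (\<phi> j - \<phi> k) (\<phi> j - \<phi> k) < e"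
      using small[of e] by auto
    then show "\<exists>M. \<forall>j\<ge>M. \<forall>k\<ge>M. q (\<phi> j - \<phi> k) (\<phi> j - \<phi> k) < e"
      unfolding q1_def by (smt (verit) inner_ge_zero)
  qed (use \<phi>T x in auto)
  have "bf x y + inner x y = inner h y" if "y \<in> D" for y
  proof -
    obtain \<psi> where \<psi>: "approx y \<psi>" using \<open>y \<in> D\<close> by (auto simp: D_def)
    have \<psi>T: "\<psi> k \<in> T" for k using approx_T[OF \<psi>] .
    obtain B1 where B1: "0 < B1" "\<And>k. p (\<psi> k) \<le> B1" using approx_bounded[OF \<psi>] by auto
    define l where "l k = q1 (\<phi> k) (\<psi> k) - inner h (\<psi> k)" for k
    have l_lim: "l \<longlonglongrightarrow> bf x y + inner x y - inner h y"
      unfolding l_def q1_def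
      by (rule tendsto_diff[OF tendsto_add[OF bf_lim[OF appr \<psi>] tendsto_inner[OF x approx_lim[OF \<psi>]]]
            tendsto_inner[OF tendsto_const approx_lim[OF \<psi>]]])
    \<comment> \<open>\<open>\<phi> k\<close> minimises up to 1/(k+1), which makes a quadratic in s
      nonnegative; its discriminant bounds the defect \<open>l k\<close> in the Euler-Lagrange
      equation.\<close>
    have l_sq: "(l k)\<^sup>2 \<le> 1 / real (Suc k) * q1 (\<psi> k) (\<psi> k)" for k
    proof -
      have "(l k)\<^sup>2 \<le> (E (\<phi> k) - m) * q1 (\<psi> k) (\<psi> k)"
      proof (rule discriminant_nonpos)
        fix s
        have "m \<le> E (\<phi> k + s *\<^sub>R \<psi> k)" using \<phi>T \<psi>T by (intro m_le) simp
        also have "\<dots> = E (\<phi> k) + 2 * s * l k + s\<^sup>2 * q1 (\<psi> k) (\<psi> k)"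
          unfolding E_def l_def q1_def using \<phi>T \<psi>T q_sym[of "\<psi> k" "\<phi> k"]
          by (simp add: q_simps inner_add_left inner_add_right inner_commute[of "\<psi> k" "\<phi> k"] power2_eq_square algebra_simps)
        finally show "0 \<le> E (\<phi> k) - m + 2 * s * l k + s\<^sup>2 * q1 (\<psi> k) (\<psi> k)" by simp
      qed
      also have "\<dots> \<le> 1 / real (Suc k) * q1 (\<psi> k) (\<psi> k)"
        using \<phi>E[of k] \<psi>T by (intro mult_right_mono) (auto simp: q1_def q_pos)
      finally show ?thesis .
    qed
    have "(\<lambda>k. 1 / real (Suc k) * q1 (\<psi> k) (\<psi> k)) \<longlonglongrightarrow> 0 * (bf y y + inner y y)"
      unfolding q1_def
      by (intro tendsto_mult tendsto_add bf_lim[OF \<psi> \<psi>] tendsto_inner approx_lim[OF \<psi>] LIMSEQ_Suc[OF lim_1_over_n])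
    moreover have "(\<lambda>k. (l k)\<^sup>2) \<longlonglongrightarrow> (bf x y + inner x y - inner h y)\<^sup>2"
      by (intro tendsto_power l_lim)
    ultimately have "(bf x y + inner x y - inner h y)\<^sup>2 \<le> 0 * (bf y y + inner y y)"
      using l_sq by (intro LIMSEQ_le) auto
    then show ?thesis by simp
  qed
  moreover have "x \<in> D" using appr by (auto simp: D_def)
  ultimately show ?thesis by blast
qed

definition G :: "'a \<Rightarrow> 'a" where
  "G h = (SOME x. x \<in> D \<and> (\<forall>y\<in>D. bf x y + inner x y = inner h y))"

lemma G_D: "G h \<in> D" and G_eq: "y \<in> D \<Longrightarrow> bf (G h) y + inner (G h) y = inner h y"
proof -
  have "G h \<in> D \<and> (\<forall>y\<in>D. bf (G h) y + inner (G h) y = inner h y)"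
    unfolding G_def by (rule someI_ex) (use resolvent_exists in blast)
  then show "G h \<in> D" "y \<in> D \<Longrightarrow> bf (G h) y + inner (G h) y = inner h y" by auto
qed

lemma G_unique:
  assumes "x \<in> D" "\<And>y. y \<in> D \<Longrightarrow> bf x y + inner x y = inner h y"
  shows "x = G h"
proof -
  define d where "d = x + (-1) *\<^sub>R G h"
  have d: "d \<in> D" unfolding d_def using assms G_D by (intro D_comb)
  have "bf d d = bf x d - bf (G h) d"
    using bf_comb_left[OF assms(1) G_D d, of "-1" h] by (simp add: d_def)
  moreover have "inner d d = inner x d - inner (G h) d" by (simp add: d_def inner_diff_left)
  ultimately have "bf d d + inner d d = 0" using assms(2)[OF d] G_eq[OF d, of h] by simp
  then have "inner d d = 0" using bf_pos[OF d] inner_ge_zero[of d] by linarith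
  then show ?thesis by (simp add: d_def)
qed

sublocale sym_contraction G
proof (rule sym_contraction.intro)
  have comb: "G (x + a *\<^sub>R y) = G x + a *\<^sub>R G y" for x y a
  proof (rule G_unique[symmetric])
    show "G x + a *\<^sub>R G y \<in> D" by (intro D_comb G_D)
    fix z assume z: "z \<in> D"
    have "bf (G x) z + a * bf (G y) z + (inner (G x) z + a * inner (G y) z) = inner x z + a * inner y z"
      using G_eq[OF z, of x] G_eq[OF z, of y] by (metis add.assoc add.left_commute distrib_left)
    with z show "bf (G x + a *\<^sub>R G y) z + inner (G x + a *\<^sub>R G y) z = inner (x + a *\<^sub>R y) z"
      by (simp add: bf_comb_left G_D inner_add_left)
  qed
  show "linear G"
  proof (rule linearI)
    show "G (x + y) = G x + G y" for x y using comb[of x 1 y] by simp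
    then have "G 0 = 0" by (metis add.right_neutral add_left_cancel)
    then show "G (a *\<^sub>R x) = a *\<^sub>R G x" for a x using comb[of 0 a x] by simp
  qed
  show "inner (G x) y = inner x (G y)" for x y
    using G_eq[OF G_D[of y], of x] G_eq[OF G_D[of x], of y] bf_sym[OF G_D[of x] G_D[of y]]
    by (simp add: inner_commute)
  \<comment> \<open>The resolvent equation tested with \<open>G x\<close> itself; dropping the form
    term leaves G^2 \<le> G, from which both bounds on \<open>G\<close> follow.\<close>
  have 1: "inner (G x) (G x) \<le> inner (G x) x" for x
    using G_eq[OF G_D[of x], of x] bf_pos[OF G_D[of x]] by (simp add: inner_commute)
  show "0 \<le> inner (G x) x" for x using 1[of x] inner_ge_zero[of "G x"] by linarith
  show "inner (G x) x \<le> inner x x" for x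
  proof -
    have "0 \<le> inner (x - G x) (x - G x)" by simp
    then show ?thesis using 1[of x] by (simp add: inner_diff_left inner_diff_right inner_commute)
  qed
qed

definition hgraph :: "'a \<Rightarrow> 'a \<Rightarrow> bool" where
  "hgraph x h \<longleftrightarrow> x \<in> D \<and> (\<forall>y\<in>D. bf x y = inner h y)"

lemma hgraph_G: "hgraph (G k) (k - G k)"
  unfolding hgraph_def using G_eq[of _ k] by (auto simp: G_D inner_diff_left algebra_simps)

lemma hgraph_imp_G: "hgraph x h \<Longrightarrow> x = G (h + x)"
  unfolding hgraph_def by (rule G_unique) (auto simp: inner_add_left)

lemma hgraph_diff_nonneg:
  assumes "hgraph x h" "hgraph y k"
  shows "0 \<le> inner (h - k) (x - y)"
proof -
  have d: "x + (-1) *\<^sub>R y \<in> D" using assms by (intro D_comb) (auto simp: hgraph_def)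
  have "bf (x + (-1) *\<^sub>R y) (x + (-1) *\<^sub>R y) = inner (h - k) (x - y)"
    using assms d bf_comb_left[of x y "x + (-1) *\<^sub>R y" "-1"]
    by (simp add: hgraph_def inner_diff_left)
  then show ?thesis using bf_pos[OF d] by simp
qed

text \<open>The operator of the form extends \<open>L\<close>. Hence the core lies in the range of
  \<open>G\<close>, where the semigroup is controlled near time 0 by
  \<open>U_G_close\<close>.\<close>

lemma T_range_G: "x \<in> T \<Longrightarrow> x = G (L x + x)"
proof (rule hgraph_imp_G)
  assume x: "x \<in> T"
  have "bf x y = inner (L x) y" if "y \<in> D" for y
  proof -
    obtain \<psi> where \<psi>: "approx y \<psi>" using \<open>y \<in> D\<close> by (auto simp: D_def)
    show ?thesis
      using LIMSEQ_unique[OF bf_lim[OF approx_const[OF x] \<psi>]] 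
        tendsto_inner[OF tendsto_const approx_lim[OF \<psi>], of "L x"] by (simp add: q_def)
  qed
  then show "hgraph x (L x)" using x by (simp add: hgraph_def T_sub_D)
qed

lemma D_closure: "x \<in> D \<Longrightarrow> x \<in> closure T"
  unfolding D_def using approx_T approx_lim by (force simp: closure_sequential)

subsection \<open>The semigroup\<close>

text \<open>Under \<open>x = 1 / (1 + \<lambda>)\<close> the functions \<open>ft t\<close>, \<open>gt t\<close> and \<open>ht t\<close> below are \<open>exp (- t \<lambda>)\<close>, \<open>(1 + \<lambda>) exp (- t \<lambda>)\<close>
  and \<open>\<lambda> exp (- t \<lambda>)\<close>.\<close>
definition ft :: "real \<Rightarrow> real \<Rightarrow> real" where
  "ft t x = (if x \<le> 0 then 0 else exp (- t * (1 / x - 1)))"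

end

lemma continuous_on_if_nonpos:
  fixes g :: "real \<Rightarrow> real"
  assumes g: "continuous_on {0<..} g" and lim: "(g \<longlongrightarrow> 0) (at_right 0)"
  shows "continuous_on A (\<lambda>x. if x \<le> 0 then 0 else g x)"
proof -
  have "isCont (\<lambda>x. if x \<le> 0 then 0 else g x) x" for x
  proof (cases x "0::real" rule: linorder_cases)
    case less
    have "\<forall>\<^sub>F y in nhds x. (if y \<le> 0 then 0 else g y) = 0"
      using less by (intro eventually_nhds_in_open[THEN eventually_mono, of "{..<0}"]) auto
    then show ?thesis by (subst isCont_cong) auto
  next
    case greater
    have "\<forall>\<^sub>F y in nhds x. (if y \<le> 0 then 0 else g y) = g y"
      using greater by (intro eventually_nhds_in_open[THEN eventually_mono, of "{0<..}"]) auto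
    moreover have "isCont g x" using g greater continuous_on_eq_continuous_at[of "{0<..}" g] by auto
    ultimately show ?thesis by (subst isCont_cong) auto
  next
    case equal
    have "((\<lambda>x. if x \<le> 0 then 0 else g x) \<longlongrightarrow> 0) (at_right 0)"
      using lim by (rule Lim_transform_eventually) (auto simp: eventually_at_filter)
    moreover have "((\<lambda>x. if x \<le> 0 then 0 else g x) \<longlongrightarrow> 0) (at_left 0)"
      by (rule tendsto_eventually) (auto simp: eventually_at_filter)
    ultimately show ?thesis unfolding equal isCont_def by (simp add: filterlim_split_at)
  qed
  then show ?thesis by (simp add: continuous_at_imp_continuous_on)
qed

text \<open>Second-order Taylor remainder for both signs of y. The factor
  \<open>max 1 (exp y)\<close> is absorbed by the decaying exponential in
  \<open>ft_diff_quotient\<close>, where y is nonnegative when s < t.\<close>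

lemma exp_quadratic_bound: "\<bar>exp y - 1 - y\<bar> \<le> y\<^sup>2 * max 1 (exp y)" for y :: real
proof -
  have lower: "0 \<le> exp y - 1 - y" using exp_ge_add_one_self[of y] by linarith
  have *: "exp y - 1 \<le> y * exp y"
  proof -
    have "(1 - y) * exp y \<le> exp (- y) * exp y"
      using exp_ge_add_one_self[of "- y"] by (intro mult_right_mono) auto
    then show ?thesis by (simp add: algebra_simps flip: exp_add)
  qed
  have "exp y - 1 - y \<le> y * (exp y - 1)" using * by (simp add: algebra_simps)
  also have "\<dots> \<le> y\<^sup>2 * max 1 (exp y)"
  proof (cases "0 \<le> y")
    case True
    then have "y * (exp y - 1) \<le> y * (y * exp y)" using * by (intro mult_left_mono)
    then show ?thesis using True by (simp add: power2_eq_square max_def algebra_simps)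
  next
    case False
    then have "(- y) * (1 - exp y) \<le> (- y) * (- y)" using exp_ge_add_one_self[of y]
      by (intro mult_left_mono) (linarith, linarith)
    then show ?thesis using False by (simp add: power2_eq_square max_def algebra_simps)
  qed
  finally show ?thesis using lower by simp
qed

context form_op
begin

lemma cont_ft: "0 < t \<Longrightarrow> continuous_on A (ft t)"
  unfolding ft_def[abs_def]
  by (rule continuous_on_if_nonpos) (auto intro!: continuous_intros, real_asymp)

lemma ft_bounds: "0 < t \<Longrightarrow> x \<le> 1 \<Longrightarrow> 0 \<le> ft t x" "0 \<le> t \<Longrightarrow> x \<le> 1 \<Longrightarrow> ft t x \<le> 1"
  by (auto simp: ft_def)

lemma ft_add: "ft s x * ft t x = ft (s + t) x"
  by (simp add: ft_def algebra_simps flip: exp_add)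

definition gt :: "real \<Rightarrow> real \<Rightarrow> real" where
  "gt t x = (if x \<le> 0 then 0 else (1 / x) * exp (- t * (1 / x - 1)))"

definition ht :: "real \<Rightarrow> real \<Rightarrow> real" where
  "ht t x = gt t x - ft t x"

lemma cont_gt: "0 < t \<Longrightarrow> continuous_on A (gt t)"
  unfolding gt_def[abs_def]
  by (rule continuous_on_if_nonpos) (auto intro!: continuous_intros, real_asymp)

lemma cont_ht: "0 < t \<Longrightarrow> continuous_on A (ht t)"
  unfolding ht_def[abs_def] by (intro continuous_on_diff cont_gt cont_ft)

definition U :: "real \<Rightarrow> 'a \<Rightarrow> 'a" where "U t = calc (ft t)"

text \<open>exp (- t \<lambda>) decays faster than x = 1 / (1 + \<lambda>), so the symbol stays
  continuous after division by x. This is the smoothing effect: \<open>U t\<close> maps everything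
  into the range of \<open>G\<close>, that is, into the operator domain.\<close>

lemma U_eq_G: "U t f = G (calc (gt t) f)" if "0 < t"
proof -
  have "U t f = calc (\<lambda>x. x * gt t x) f"
    unfolding U_def using that by (intro calc_cong cont_ft) (auto simp: ft_def gt_def)
  also have "\<dots> = calc (\<lambda>x. x) (calc (gt t) f)"
    using that by (intro calc_mult cont_gt continuous_intros)
  finally show ?thesis by (simp add: calc_id)
qed

lemma hgraph_U: "hgraph (U t f) (calc (ht t) f)" if "0 < t"
proof -
  have "calc (ht t) f = calc (gt t) f - U t f"
    unfolding ht_def[abs_def] U_def using that by (intro calc_diff cont_gt cont_ft)
  then show ?thesis using hgraph_G[of "calc (gt t) f"] U_eq_G[OF that] by simp
qed

lemma U_add: "0 < s \<Longrightarrow> 0 < t \<Longrightarrow> U (s + t) f = U s (U t f)"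
  unfolding U_def by (simp add: calc_mult[symmetric] cont_ft ft_add)

lemma U_sym: "0 < t \<Longrightarrow> inner (U t f) g = inner f (U t g)"
  unfolding U_def by (simp add: calc_sym cont_ft)

lemma norm_U_le: "0 < t \<Longrightarrow> norm (U t f) \<le> norm f"
  unfolding U_def using calc_norm[OF cont_ft, of t 1 f] ft_bounds[of t] by simp

text \<open>With \<lambda> = 1/x - 1 the Taylor remainder gives at most |s - t| \<lambda>^2 exp (-
  (t/2) \<lambda>), because s > t/2. The inequality z^2 / 2 \<le> exp z at z = (t/2) \<lambda>
  yields the constant 8 / t^2, uniformly in \<lambda>; \<open>calc_norm\<close> turns uniformity
  into a bound for operators.\<close>

lemma ft_diff_quotient:
  assumes "0 < t" "t / 2 < s" "s \<noteq> t" "0 \<le> x" "x \<le> 1"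
  shows "\<bar>(ft s x - ft t x) / (s - t) + ht t x\<bar> \<le> (8 / t\<^sup>2) * \<bar>s - t\<bar>"
proof (cases "x = 0")
  case False
  define l where "l = 1 / x - 1"
  have l: "0 \<le> l" using assms False by (simp add: l_def field_simps)
  define y where "y = - (s - t) * l"
  have ft: "ft t x = exp (- t * l)" "ft s x = exp (- t * l) * exp y" "ht t x = l * exp (- t * l)"
  proof -
    have "- t * l + y = - s * l" by (simp add: y_def algebra_simps)
    moreover have "ft s x = exp (- s * l)" using assms False by (simp add: ft_def l_def)
    ultimately show "ft s x = exp (- t * l) * exp y" by (simp only: exp_add[symmetric])
    show "ft t x = exp (- t * l)" using assms False by (simp add: ft_def l_def)
    have "1 / x = l + 1" by (simp add: l_def)
    then show "ht t x = l * exp (- t * l)" using assms False by (simp add: ht_def gt_def ft_def algebra_simps)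
  qed
  have "(ft s x - ft t x) / (s - t) + ht t x = exp (- t * l) * (exp y - 1 - y) / (s - t)"
  proof -
    have "y / (s - t) = - l" unfolding y_def using assms(3) by (simp only: mult_minus_left minus_divide_left[symmetric] nonzero_mult_div_cancel_left right_minus_eq simp_thms)
    then have "l * exp (- t * l) = - (exp (- t * l) * y) / (s - t)" by (simp flip: times_divide_eq_right)
    then show ?thesis unfolding ft by (simp add: add_divide_distrib diff_divide_distrib algebra_simps)
  qed
  also have "\<bar>\<dots>\<bar> = exp (- t * l) * \<bar>exp y - 1 - y\<bar> / \<bar>s - t\<bar>"
    by (simp add: abs_mult abs_divide)
  also have "\<dots> \<le> exp (- t * l) * (y\<^sup>2 * max 1 (exp y)) / \<bar>s - t\<bar>"
    by (intro divide_right_mono mult_left_mono exp_quadratic_bound) auto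
  also have "\<dots> = (max (exp (- t * l)) (exp (- t * l) * exp y) * l\<^sup>2) * \<bar>s - t\<bar>"
  proof -
    have "y\<^sup>2 = \<bar>s - t\<bar> * \<bar>s - t\<bar> * l\<^sup>2" unfolding y_def by (simp add: power2_eq_square algebra_simps)
    moreover have "exp (- t * l) * max 1 (exp y) = max (exp (- t * l)) (exp (- t * l) * exp y)"
      by (simp add: max_mult_distrib_left)
    ultimately have "exp (- t * l) * (y\<^sup>2 * max 1 (exp y)) = (max (exp (- t * l)) (exp (- t * l) * exp y) * l\<^sup>2) * \<bar>s - t\<bar> * \<bar>s - t\<bar>"
    proof -
      assume a: "y\<^sup>2 = \<bar>s - t\<bar> * \<bar>s - t\<bar> * l\<^sup>2"
        and b: "exp (- t * l) * max 1 (exp y) = max (exp (- t * l)) (exp (- t * l) * exp y)"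
      have "exp (- t * l) * (y\<^sup>2 * max 1 (exp y)) = (exp (- t * l) * max 1 (exp y)) * y\<^sup>2"
        by (simp only: ac_simps)
      also have "\<dots> = max (exp (- t * l)) (exp (- t * l) * exp y) * (\<bar>s - t\<bar> * \<bar>s - t\<bar> * l\<^sup>2)"
        by (simp only: a b)
      also have "\<dots> = (max (exp (- t * l)) (exp (- t * l) * exp y) * l\<^sup>2) * \<bar>s - t\<bar> * \<bar>s - t\<bar>"
        by (simp only: ac_simps)
      finally show ?thesis .
    qed
    then show ?thesis using assms(3) by simp
  qed
  also have "\<dots> \<le> (exp (- (t / 2) * l) * l\<^sup>2) * \<bar>s - t\<bar>"
  proof (intro mult_right_mono)
    have "- t * l + y = - s * l" by (simp add: y_def algebra_simps)
    then have "exp (- t * l) * exp y = exp (- s * l)" by (simp only: exp_add[symmetric])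
    moreover have "exp (- s * l) \<le> exp (- (t / 2) * l)" using assms l mult_right_mono[of "t / 2" s l] by simp
    moreover have "exp (- t * l) \<le> exp (- (t / 2) * l)" using assms l by simp
    ultimately show "max (exp (- t * l)) (exp (- t * l) * exp y) \<le> exp (- (t / 2) * l)" by simp
  qed auto
  also have "\<dots> \<le> (8 / t\<^sup>2) * \<bar>s - t\<bar>"
  proof (intro mult_right_mono)
    have z: "z\<^sup>2 / 2 \<le> exp z" if "0 \<le> z" for z :: real
      using exp_lower_Taylor_quadratic[OF that] that by linarith
    have "((t/2) * l)\<^sup>2 / 2 \<le> exp ((t/2) * l)" using assms l by (intro z) auto
    then have "exp (- (t / 2) * l) * (((t/2) * l)\<^sup>2 / 2) \<le> exp (- (t / 2) * l) * exp ((t/2) * l)"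
      by (intro mult_left_mono) auto
    then have "exp (- (t / 2) * l) * (((t/2) * l)\<^sup>2 / 2) \<le> 1" by (simp flip: exp_add)
    then have "(exp (- (t / 2) * l) * l\<^sup>2) * (t\<^sup>2 / 8) \<le> 1" by (simp add: power_mult_distrib power_divide ac_simps)
    then show "exp (- (t / 2) * l) * l\<^sup>2 \<le> 8 / t\<^sup>2" using assms by (simp add: pos_le_divide_eq)
  qed auto
  finally show ?thesis .
qed (simp add: ft_def ht_def gt_def)

lemma U_diff_quotient:
  assumes "0 < t"
  shows "((\<lambda>s. norm ((1 / (s - t)) *\<^sub>R (U s f - U t f) + calc (ht t) f)) \<longlongrightarrow> 0) (at t)"
proof (rule Lim_null_comparison)
  show "\<forall>\<^sub>F s in at t. norm (norm ((1 / (s - t)) *\<^sub>R (U s f - U t f) + calc (ht t) f)) \<le> (8 / t\<^sup>2) * \<bar>s - t\<bar> * norm f"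
  proof -
    have "\<forall>\<^sub>F s in at t. s \<in> {t/2<..}" using assms by (intro eventually_at_in_open') auto
    moreover have "\<forall>\<^sub>F s in at t. s \<noteq> t" by (simp add: eventually_at_filter)
    ultimately show ?thesis
    proof eventually_elim
      case (elim s)
      then have s: "0 < s" "t / 2 < s" "s \<noteq> t" using assms by auto
      have "(1 / (s - t)) *\<^sub>R (U s f - U t f) + calc (ht t) f
          = calc (\<lambda>x. (1 / (s - t)) * (ft s x - ft t x) + ht t x) f"
        unfolding U_def using s assms
        by (simp add: calc_add calc_cmult calc_diff cont_ft cont_ht continuous_on_diff continuous_on_mult_left del: times_divide_eq_left)
      also have "norm \<dots> \<le> ((8 / t\<^sup>2) * \<bar>s - t\<bar>) * norm f"
        using s assms ft_diff_quotient[OF assms s(2,3)]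
        by (intro calc_norm continuous_on_add continuous_on_mult_left continuous_on_diff cont_ft cont_ht) auto
      finally show ?case by simp
    qed
  qed
  have "((\<lambda>s. (8 / t\<^sup>2) * \<bar>s - t\<bar> * norm f) \<longlongrightarrow> (8 / t\<^sup>2) * \<bar>t - t\<bar> * norm f) (at t)"
    by (intro tendsto_intros)
  then show "((\<lambda>s. (8 / t\<^sup>2) * \<bar>s - t\<bar> * norm f) \<longlongrightarrow> 0) (at t)" by simp
qed

text \<open>1 - exp (- s \<lambda>) \<le> s \<lambda>, and the factor 1 / (1 + \<lambda>)
  contributed by \<open>G\<close> brings this below s.\<close>

lemma U_G_close: "norm (U s (G k) - G k) \<le> s * norm k" if "0 < s"
proof -
  have "U s (G k) - G k = calc (\<lambda>x. ft s x * x - x) k"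
    unfolding U_def using that
    by (simp add: calc_diff calc_mult calc_id cont_ft continuous_on_mult continuous_on_id)
  also have "norm \<dots> \<le> s * norm k"
  proof (rule calc_norm)
    fix x :: real assume x: "0 \<le> x" "x \<le> 1"
    show "\<bar>ft s x * x - x\<bar> \<le> s"
    proof (cases "x = 0")
      case False
      then have x0: "0 < x" using x by simp
      have "1 - s * (1 / x - 1) \<le> ft s x" using x0 exp_ge_add_one_self[of "- s * (1 / x - 1)"] by (simp add: ft_def)
      then have "(1 - s * (1 / x - 1)) * x \<le> ft s x * x" using x0 by (intro mult_right_mono) auto
      moreover have "(1 - s * (1 / x - 1)) * x = x - s * (1 - x)" using x0 by (simp add: field_simps)
      moreover have "s * (1 - x) \<le> s * 1" using x that by (intro mult_left_mono) auto
      moreover have "ft s x * x \<le> 1 * x" using ft_bounds(2)[of s x] x that by (intro mult_right_mono) auto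
      ultimately show ?thesis using that unfolding abs_le_iff by linarith
    qed (use that in simp)
  qed (use that in \<open>intro continuous_intros cont_ft\<close>)
  finally show ?thesis .
qed

text \<open>Restricted to the closure of \<open>T\<close>, since \<open>U s\<close> vanishes on the
  orthogonal complement. There it suffices to approximate by elements of \<open>T\<close>, which lie
  in the range of \<open>G\<close>, and to use that \<open>U s\<close> is a contraction.\<close>

lemma U_strongly_continuous:
  assumes f: "f \<in> closure T"
  shows "((\<lambda>s. norm (U s f - f)) \<longlongrightarrow> 0) (at_right 0)"
proof (rule tendstoI)
  fix e :: real assume e: "0 < e"
  obtain y where y: "y \<in> T" "dist y f < e / 3" 
    using f e unfolding closure_approachable by (meson divide_pos_pos zero_less_numeral)
  define k where "k = L y + y"
  have yk: "y = G k" unfolding k_def by (rule T_range_G[OF y(1)])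
  have "((\<lambda>s. s * norm k) \<longlongrightarrow> 0 * norm k) (at_right 0)" by (intro tendsto_intros)
  then have "\<forall>\<^sub>F s in at_right 0. s * norm k < e / 3" using e by (intro order_tendstoD(2)[where a = "e/3"]) auto
  moreover have "\<forall>\<^sub>F s in at_right (0::real). 0 < s" by (simp add: eventually_at_filter)
  ultimately show "\<forall>\<^sub>F s in at_right 0. dist (norm (U s f - f)) 0 < e"
  proof eventually_elim
    case (elim s)
    have "U s f - U s y = U s (f - y)" unfolding U_def using elim by (simp add: linear_diff linear_calc cont_ft)
    then have "norm (U s f - U s y) \<le> norm (f - y)" using norm_U_le elim by simp
    moreover have "norm (U s y - y) \<le> s * norm k" unfolding yk using U_G_close elim by blast
    moreover have "norm (U s f - f) \<le> norm (U s f - U s y) + norm (U s y - y) + norm (y - f)"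
      using norm_triangle_ineq[of "U s f - U s y + (U s y - y)" "y - f"] norm_triangle_ineq[of "U s f - U s y" "U s y - y"] by simp
    ultimately show ?case using y(2) elim by (simp add: dist_norm norm_minus_commute)
  qed
qed

text \<open>The squared norm of \<open>v\<close> has derivative
  \<open>- 2 * inner (k t) (v t)\<close>, so it cannot grow from its limit 0 at time 0.\<close>

lemma cauchy_problem_unique:
  fixes v k :: "real \<Rightarrow> 'a"
  assumes g: "\<And>t. 0 < t \<Longrightarrow> 0 \<le> inner (k t) (v t)"
    and d: "\<And>t. 0 < t \<Longrightarrow> (v has_vector_derivative - k t) (at t)"
    and 0: "((\<lambda>s. norm (v s)) \<longlongrightarrow> 0) (at_right 0)"
    and t: "0 < t"
  shows "v t = 0"
proof -
  have der: "((\<lambda>s. inner (v s) (v s)) has_real_derivative - 2 * inner (k s) (v s)) (at s)" if "0 < s" for s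
  proof -
    have "((\<lambda>s. inner (v s) (v s)) has_derivative (\<lambda>h. inner (v s) (h *\<^sub>R (- k s)) + inner (h *\<^sub>R (- k s)) (v s))) (at s)"
      using d[OF that] unfolding has_vector_derivative_def by (intro has_derivative_inner)
    then show ?thesis
      by (rule has_derivative_imp_has_field_derivative) (simp add: inner_commute)
  qed
  have mono: "inner (v t) (v t) \<le> inner (v s) (v s)" if "0 < s" "s \<le> t" for s
  proof (rule DERIV_nonpos_imp_nonincreasing[OF that(2)])
    fix x assume "s \<le> x" "x \<le> t"
    then have "0 < x" using that by simp
    then show "\<exists>y. ((\<lambda>s. inner (v s) (v s)) has_real_derivative y) (at x) \<and> y \<le> 0"
      using der[of x] g[of x] by (intro exI[of _ "- 2 * inner (k x) (v x)"]) auto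
  qed
  have "((\<lambda>s. (norm (v s))\<^sup>2) \<longlongrightarrow> 0\<^sup>2) (at_right 0)" by (intro tendsto_power 0)
  then have lim: "((\<lambda>s. inner (v s) (v s)) \<longlongrightarrow> 0) (at_right 0)" by (simp add: power2_norm_eq_inner)
  have "\<forall>\<^sub>F s in at_right 0. s \<in> {0<..<t}" using t by (intro eventually_at_right_real)
  then have "\<forall>\<^sub>F s in at_right 0. inner (v t) (v t) \<le> inner (v s) (v s)"
    by eventually_elim (use mono in auto)
  from tendsto_lowerbound[OF lim this] have "inner (v t) (v t) \<le> 0" by simp
  then have "inner (v t) (v t) = 0" using inner_ge_zero[of "v t"] by linarith
  then show ?thesis by simp
qed

end

subsection \<open>A trace inequality\<close>

definition orthonormal :: "'a::real_inner set \<Rightarrow> bool" where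
  "orthonormal B \<longleftrightarrow> (\<forall>b\<in>B. \<forall>b'\<in>B. inner b b' = (if b = b' then 1 else 0))"

lemma orthonormal_expansion:
  assumes B: "finite B" "orthonormal B"
  defines "P \<equiv> \<lambda>x. \<Sum>b\<in>B. inner x b *\<^sub>R b"
  shows "b \<in> B \<Longrightarrow> inner (x - P x) b = 0"
    and "inner (x - P x) (x - P x) = inner x x - (\<Sum>b\<in>B. (inner x b)\<^sup>2)"
proof -
  have Pb: "inner (P x) b = inner x b" if "b \<in> B" for b
  proof -
    have "inner (P x) b = (\<Sum>b'\<in>B. inner x b' * (if b' = b then 1 else 0))"
      unfolding P_def inner_sum_left using B that by (intro sum.cong) (auto simp: orthonormal_def)
    then show ?thesis using B that by (simp add: mult.commute[of "inner x _"] sum.delta' if_distrib cong: if_cong)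
  qed
  then show "b \<in> B \<Longrightarrow> inner (x - P x) b = 0" by (simp add: inner_diff_left)
  have "inner (P x) (P x) = (\<Sum>b\<in>B. inner x b * inner (P x) b)"
    by (subst (2) P_def) (simp add: inner_sum_right)
  also have "\<dots> = (\<Sum>b\<in>B. (inner x b)\<^sup>2)" by (simp add: Pb power2_eq_square)
  finally have 1: "inner (P x) (P x) = (\<Sum>b\<in>B. (inner x b)\<^sup>2)" .
  have "inner x (P x) = (\<Sum>b\<in>B. (inner x b)\<^sup>2)"
    unfolding P_def inner_sum_right by (simp add: power2_eq_square)
  then show "inner (x - P x) (x - P x) = inner x x - (\<Sum>b\<in>B. (inner x b)\<^sup>2)"
    using 1 by (simp add: inner_diff_left inner_diff_right inner_commute[of "P x" x])
qed

lemma Bessel_inequality: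
  assumes "finite B" "orthonormal B"
  shows "(\<Sum>b\<in>B. (inner x b)\<^sup>2) \<le> (norm x)\<^sup>2"
  using orthonormal_expansion(2)[OF assms, of x]
    inner_ge_zero[of "x - (\<Sum>b\<in>B. inner x b *\<^sub>R b)"] by (simp add: power2_norm_eq_inner)

lemma Parseval_span:
  assumes B: "finite B" "orthonormal B" and x: "x \<in> span B"
  shows "(norm x)\<^sup>2 = (\<Sum>b\<in>B. (inner x b)\<^sup>2)"
proof -
  define y where "y = x - (\<Sum>b\<in>B. inner x b *\<^sub>R b)"
  have "y \<in> span B" unfolding y_def using x by (intro span_diff span_sum span_scale) (auto intro: span_base)
  moreover have "orthogonal y b" if "b \<in> B" for b
    using orthonormal_expansion(1)[OF B that, of x] by (simp add: orthogonal_def y_def)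
  ultimately have "orthogonal y y" using orthogonal_to_span by blast
  then show ?thesis
    using orthonormal_expansion(2)[OF B, of x] by (simp add: y_def orthogonal_def power2_norm_eq_inner)
qed

lemma Gram_Schmidt:
  fixes S :: "'a::real_inner set"
  assumes "finite S"
  obtains B where "finite B" "orthonormal B" "S \<subseteq> span B"
proof -
  have "\<exists>B. finite B \<and> orthonormal B \<and> S \<subseteq> span B"
    using assms
  proof (induction S)
    case empty
    show ?case by (intro exI[of _ "{}"]) (simp add: orthonormal_def)
  next
    case (insert v S)
    then obtain B where B: "finite B" "orthonormal B" "S \<subseteq> span B" by blast
    define w where "w = v - (\<Sum>b\<in>B. inner v b *\<^sub>R b)"
    have w: "inner w b = 0" if "b \<in> B" for b
      unfolding w_def by (rule orthonormal_expansion(1)[OF B(1,2) that])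
    have s: "(\<Sum>b\<in>B. inner v b *\<^sub>R b) \<in> span B" by (intro span_sum span_scale span_base)
    show ?case
    proof (cases "w = 0")
      case True
      then have "v \<in> span B" using s by (simp add: w_def)
      then show ?thesis using B by blast
    next
      case False
      define u where "u = (1 / norm w) *\<^sub>R w"
      have u: "inner u u = 1" "\<And>b. b \<in> B \<Longrightarrow> inner u b = 0" "\<And>b. b \<in> B \<Longrightarrow> inner b u = 0"
        using False w by (auto simp: u_def dot_square_norm power2_eq_square inner_commute)
      have "v = norm w *\<^sub>R u + (\<Sum>b\<in>B. inner v b *\<^sub>R b)"
        using False by (simp add: u_def w_def)
      moreover have "(\<Sum>b\<in>B. inner v b *\<^sub>R b) \<in> span (insert u B)"
        using s span_mono[of B "insert u B"] by blast
      ultimately have "v \<in> span (insert u B)"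
        by (metis insertI1 span_add span_base span_scale)
      moreover have "S \<subseteq> span (insert u B)" using B(3) span_mono[of B "insert u B"] by blast
      moreover have "orthonormal (insert u B)"
        using B(2) u unfolding orthonormal_def by (metis insert_iff zero_neq_one)
      ultimately show ?thesis using B(1) by (intro exI[of _ "insert u B"]) auto
    qed
  qed
  then show thesis using that by blast
qed

text \<open>Each summand is a tent in y with peak 1 at j and support [j - 1, j + 1]. The sum
  telescopes and is 1 for 0 \<le> y \<le> J.\<close>

lemma tent_sum:
  fixes y :: real
  defines "\<tau> \<equiv> \<lambda>z::real. max 0 (min 1 z)"
  shows "(\<Sum>j\<le>J. \<tau> (y - real j + 1) - \<tau> (y - real j)) = \<tau> (y + 1) - \<tau> (y - real J)"
proof (induction J)
  case (Suc J)
  have "y - real (Suc J) + 1 = y - real J" by simp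
  then have "\<tau> (y - real (Suc J) + 1) = \<tau> (y - real J)" by (rule arg_cong)
  then show ?case using Suc by simp
qed simp

context form_op
begin

text \<open>Rests on the equality of the Hilbert-Schmidt norms of an operator and its adjoint: M R
  X_j is exchanged for X_j R M, the X_j are removed by \<open>X_le\<close>, and R M is exchanged for
  M R. Gram-Schmidt bases \<open>B\<close> and \<open>B'\<close> of just the vectors that occur keep
  every sum finite; the only loss is Bessel's inequality, which goes in the right direction.\<close>

lemma double_sum_swap_bound:
  fixes M R :: "'a \<Rightarrow> 'a" and X :: "nat \<Rightarrow> 'a \<Rightarrow> 'a"
  assumes M: "\<And>x y. inner (M x) y = inner x (M y)"
    and R: "\<And>x y. inner (R x) y = inner x (R y)"
    and X: "\<And>j x y. inner (X j x) y = inner x (X j y)"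
    and X_le: "\<And>x. (\<Sum>j\<le>J. (norm (X j x))\<^sup>2) \<le> (norm x)\<^sup>2"
    and HS: "\<And>F. finite F \<Longrightarrow> orthonormal F \<Longrightarrow> (\<Sum>b\<in>F. (norm (M (R b)))\<^sup>2) \<le> Z"
    and F: "finite F" "orthonormal F"
  shows "(\<Sum>j\<le>J. \<Sum>e\<in>F. (norm (M (R (X j e))))\<^sup>2) \<le> Z"
proof -
  obtain B where B: "finite B" "orthonormal B" "(\<lambda>(j, e). M (R (X j e))) ` ({..J} \<times> F) \<subseteq> span B"
    using Gram_Schmidt[of "(\<lambda>(j, e). M (R (X j e))) ` ({..J} \<times> F)"] F by auto
  obtain B' where B': "finite B'" "orthonormal B'" "(\<lambda>b. R (M b)) ` B \<subseteq> span B'"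
    using Gram_Schmidt[of "(\<lambda>b. R (M b)) ` B"] B by auto
  have "(\<Sum>j\<le>J. \<Sum>e\<in>F. (norm (M (R (X j e))))\<^sup>2) = (\<Sum>j\<le>J. \<Sum>e\<in>F. \<Sum>b\<in>B. (inner (M (R (X j e))) b)\<^sup>2)"
    using B(3) by (intro sum.cong refl Parseval_span[OF B(1,2)]) auto
  also have "\<dots> = (\<Sum>j\<le>J. \<Sum>e\<in>F. \<Sum>b\<in>B. (inner (X j (R (M b))) e)\<^sup>2)"
  proof (intro sum.cong refl)
    fix j e b
    have "inner (M (R (X j e))) b = inner e (X j (R (M b)))" by (simp only: M R X)
    then show "(inner (M (R (X j e))) b)\<^sup>2 = (inner (X j (R (M b))) e)\<^sup>2" by (simp only: inner_commute)
  qed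
  also have "\<dots> = (\<Sum>b\<in>B. \<Sum>j\<le>J. \<Sum>e\<in>F. (inner (X j (R (M b))) e)\<^sup>2)"
  proof -
    define h where "h j e b = (inner (X j (R (M b))) e)\<^sup>2" for j e b
    have "(\<Sum>j\<le>J. \<Sum>e\<in>F. \<Sum>b\<in>B. h j e b) = (\<Sum>j\<le>J. \<Sum>b\<in>B. \<Sum>e\<in>F. h j e b)"
      by (intro sum.cong refl sum.swap)
    also have "\<dots> = (\<Sum>b\<in>B. \<Sum>j\<le>J. \<Sum>e\<in>F. h j e b)"
      by (rule sum.swap)
    finally show ?thesis unfolding h_def .
  qed
  also have "\<dots> \<le> (\<Sum>b\<in>B. \<Sum>j\<le>J. (norm (X j (R (M b))))\<^sup>2)"
    by (intro sum_mono Bessel_inequality F)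
  also have "\<dots> \<le> (\<Sum>b\<in>B. (norm (R (M b)))\<^sup>2)"
    by (intro sum_mono X_le)
  also have "\<dots> = (\<Sum>b\<in>B. \<Sum>b'\<in>B'. (inner (R (M b)) b')\<^sup>2)"
    using B'(3) by (intro sum.cong refl Parseval_span[OF B'(1,2)]) auto
  also have "\<dots> = (\<Sum>b'\<in>B'. \<Sum>b\<in>B. (inner (M (R b')) b)\<^sup>2)"
  proof (subst sum.swap, intro sum.cong refl)
    fix b b'
    have "inner (R (M b)) b' = inner b (M (R b'))" by (simp only: M R)
    then show "(inner (R (M b)) b')\<^sup>2 = (inner (M (R b')) b)\<^sup>2" by (simp only: inner_commute)
  qed
  also have "\<dots> \<le> (\<Sum>b'\<in>B'. (norm (M (R b')))\<^sup>2)"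
    by (intro sum_mono Bessel_inequality B)
  also have "\<dots> \<le> Z" by (rule HS[OF B'(1,2)])
  finally show ?thesis .
qed

text \<open>\<open>X j\<close> cuts out the layer of the spectrum of \<open>(t/2) H\<close> within distance \<open>d\<close> of \<open>j d\<close>. There the tangent at
  \<open>l = j d\<close> loses only the factor \<open>exp d / (1 - d)\<close>; the part above \<open>J d\<close> gives the error term.\<close>
lemma trace_bound_step:
  fixes M :: "'a \<Rightarrow> 'a" and t d :: real and J :: nat
  assumes t: "0 < t" and d: "0 < d" "d < 1"
    and M: "\<And>x y. inner (M x) y = inner x (M y)"
    and HS: "\<And>F. finite F \<Longrightarrow> orthonormal F \<Longrightarrow> (\<Sum>b\<in>F. (norm (M (U (t/4) b)))\<^sup>2) \<le> Z"
    and tangent: "\<And>k l. 0 \<le> l \<Longrightarrow>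
      exp (- l) * ((1 + l) * (norm (G k))\<^sup>2 - (t/2) * inner (k - G k) (G k)) \<le> (norm (M (G k)))\<^sup>2"
    and F: "finite F" "orthonormal F"
  shows "(\<Sum>e\<in>F. inner (U t e) e) \<le> exp d / (1 - d) * Z + exp (- 2 * (real J * d)) * card F"
proof -
  \<comment> \<open>The value of (t/2) \<lambda> at x = 1 / (1 + \<lambda>). For x > 0 it follows
    that \<open>ft t x = exp (- 2 * \<alpha> x)\<close> and
    \<open>ft (t/4) x = exp (- \<alpha> x / 2)\<close>.\<close>
  define \<alpha> where "\<alpha> x = (t/2) * (1 / x - 1)" for x :: real
  define \<tau> where "\<tau> z = max 0 (min 1 z)" for z :: real
  define \<psi> where "\<psi> j x = \<tau> (\<alpha> x / d - real j + 1) - \<tau> (\<alpha> x / d - real j)" for j x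
  \<comment> \<open>Square roots of the tents, so that the squares of the operators
    \<open>X j\<close> add up to at most 1. A tent has bounded support in
    \<open>\<alpha> x / d\<close>, hence vanishes for small positive x, which gives continuity at
    0.\<close>
  define \<eta> where "\<eta> j x = (if x \<le> 0 then 0 else sqrt (\<psi> j x))" for j x
  have \<psi>0: "0 \<le> \<psi> j x" for j x unfolding \<psi>_def \<tau>_def by (auto simp: max_def min_def)
  have cont_\<eta>: "continuous_on {0..1} (\<eta> j)" for j
    unfolding \<eta>_def[abs_def]
  proof (rule continuous_on_if_nonpos)
    show "continuous_on {0<..} (\<lambda>x. sqrt (\<psi> j x))"
      unfolding \<psi>_def \<tau>_def \<alpha>_def using d by (auto intro!: continuous_intros)
    have "filterlim (\<lambda>x. \<alpha> x / d) at_top (at_right 0)"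
      unfolding \<alpha>_def using t d by real_asymp
    then have "\<forall>\<^sub>F x in at_right 0. real j + 1 \<le> \<alpha> x / d" by (simp add: filterlim_at_top)
    then have "\<forall>\<^sub>F x in at_right 0. sqrt (\<psi> j x) = 0"
      by eventually_elim (simp add: \<psi>_def \<tau>_def)
    then show "((\<lambda>x. sqrt (\<psi> j x)) \<longlongrightarrow> 0) (at_right 0)" by (rule tendsto_eventually)
  qed
  have sum_\<psi>: "(\<Sum>j\<le>J. \<psi> j x) = \<tau> (\<alpha> x / d + 1) - \<tau> (\<alpha> x / d - real J)" for x
    unfolding \<psi>_def \<tau>_def by (rule tent_sum)
  have sum_\<psi>_le: "(\<Sum>j\<le>J. \<psi> j x) \<le> 1" for x
    unfolding sum_\<psi> by (auto simp: \<tau>_def max_def min_def)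
  define X where "X j = calc (\<eta> j)" for j
  define R where "R = U (t/4)"
  have X_le: "(\<Sum>j\<le>J. (norm (X j x))\<^sup>2) \<le> (norm x)\<^sup>2" for x
  proof -
    have "(\<Sum>j\<le>J. (norm (X j x))\<^sup>2) = (\<Sum>j\<le>J. inner (calc (\<lambda>t. \<eta> j t * \<eta> j t) x) x)"
      unfolding X_def power2_norm_eq_inner by (simp add: calc_inner_mult cont_\<eta>)
    also have "\<dots> = inner (calc (\<lambda>t. \<Sum>j\<le>J. \<eta> j t * \<eta> j t) x) x"
      by (subst calc_sum) (auto intro!: continuous_on_mult cont_\<eta> simp: inner_sum_left)
    also have "\<dots> \<le> inner (calc (\<lambda>t. 1) x) x"
    proof (rule calc_mono)
      fix s :: real assume "0 \<le> s" "s \<le> 1"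
      show "(\<Sum>j\<le>J. \<eta> j s * \<eta> j s) \<le> 1"
        using sum_\<psi>_le[of s] by (cases "s \<le> 0") (auto simp: \<eta>_def \<psi>0)
    qed (auto intro!: continuous_intros cont_\<eta>)
    finally show ?thesis by (simp add: calc_one power2_norm_eq_inner)
  qed
  have swap: "(\<Sum>j\<le>J. \<Sum>e\<in>F. (norm (M (R (X j e))))\<^sup>2) \<le> Z"
  proof (rule double_sum_swap_bound[OF M _ _ X_le _ F])
    show "inner (R x) y = inner x (R y)" for x y unfolding R_def using t by (simp add: U_sym)
    show "inner (X j x) y = inner x (X j y)" for j x y unfolding X_def by (simp add: calc_sym cont_\<eta>)
  qed (auto simp: R_def HS)
  define f g where "f j x = ft (t/4) x * \<eta> j x" and "g j x = gt (t/4) x * \<eta> j x" for j x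
  have cf: "continuous_on {0..1} (f j)" and cg: "continuous_on {0..1} (g j)" for j
    unfolding f_def g_def using t by (auto intro!: continuous_on_mult cont_ft cont_gt cont_\<eta>)
  \<comment> \<open>The symbol of the left side of \<open>tangent\<close> at l = j d for the vector
    \<open>R (X j e)\<close>; the product of \<open>g j - f j\<close> with \<open>f j\<close> stands
    for \<lambda> times the square of \<open>f j\<close>.\<close>
  define \<Theta> where "\<Theta> j x = exp (- (real j * d)) * ((1 + real j * d) * (f j x * f j x) - (t/2) * ((g j x - f j x) * f j x))" for j x
  have c\<Theta>: "continuous_on {0..1} (\<Theta> j)" for j
    unfolding \<Theta>_def[abs_def] by (intro continuous_intros cf cg)
  have lower: "inner (calc (\<Theta> j) e) e \<le> (norm (M (R (X j e))))\<^sup>2" for j e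
  proof -
    define k where "k = calc (g j) e"
    have RX: "R (X j e) = calc (f j) e"
      unfolding R_def X_def U_def f_def[abs_def] using t by (intro calc_mult[symmetric] cont_ft cont_\<eta>) auto
    have "calc (f j) e = calc (\<lambda>x. x * g j x) e"
      by (intro calc_cong cf) (auto simp: f_def g_def ft_def gt_def)
    then have Gk: "calc (f j) e = G k"
      unfolding k_def by (simp add: calc_mult[OF continuous_on_id cg] calc_id)
    have kG: "k - G k = calc (\<lambda>x. g j x - f j x) e"
      unfolding k_def Gk[symmetric, unfolded k_def] by (simp add: calc_diff cf cg)
    have "inner (calc (\<Theta> j) e) e = exp (- (real j * d)) * ((1 + real j * d) * inner (calc (\<lambda>x. f j x * f j x) e) e
        - (t/2) * inner (calc (\<lambda>x. (g j x - f j x) * f j x) e) e)"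
      unfolding \<Theta>_def[abs_def]
      by (simp add: calc_cmult calc_diff cf cg continuous_on_mult continuous_on_diff continuous_on_mult_left inner_diff_left del: times_divide_eq_left)
    also have "inner (calc (\<lambda>x. f j x * f j x) e) e = (norm (G k))\<^sup>2"
      unfolding Gk[symmetric] power2_norm_eq_inner by (simp add: calc_inner_mult cf)
    also have "inner (calc (\<lambda>x. (g j x - f j x) * f j x) e) e = inner (k - G k) (G k)"
      unfolding kG unfolding Gk[symmetric] by (subst calc_inner_mult) (auto intro!: continuous_on_diff cf cg)
    finally show ?thesis
      using tangent[of "real j * d" k] d unfolding RX Gk by simp
  qed
  \<comment> \<open>Comparison of symbols. The last summand takes care of the spectrum above J d,
    where the tents no longer add up to 1.\<close>
  have point: "ft t x \<le> exp d / (1 - d) * (\<Sum>j\<le>J. \<Theta> j x) + exp (- 2 * (real J * d))" if x: "0 \<le> x" "x \<le> 1" for x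
  proof (cases "x = 0")
    case True
    then show ?thesis by (simp add: ft_def \<Theta>_def f_def g_def gt_def)
  next
    case False
    then have x0: "0 < x" using x by simp
    define a where "a = \<alpha> x"
    have a0: "0 \<le> a" unfolding a_def \<alpha>_def using t x x0 by (simp add: field_simps)
    have ft: "ft t x = exp (- 2 * a)" "ft (t/4) x = exp (- a / 2)" "gt (t/4) x = (1 / x) * exp (- a / 2)"
      using x0 by (auto simp: ft_def gt_def a_def \<alpha>_def)
    have \<Theta>: "\<Theta> j x = \<psi> j x * (exp (- (real j * d)) * (1 + real j * d - a) * exp (- a))" for j
    proof -
      have chi: "\<eta> j x * \<eta> j x = \<psi> j x" using x0 \<psi>0[of j x] by (simp add: \<eta>_def)
      have e: "exp (- a / 2) * exp (- a / 2) = exp (- a)" by (simp flip: exp_add)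
      have 1: "f j x * f j x = \<psi> j x * exp (- a)"
      proof -
        have "f j x * f j x = (\<eta> j x * \<eta> j x) * (exp (- a / 2) * exp (- a / 2))" by (simp only: f_def ft ac_simps)
        then show ?thesis by (simp only: chi e)
      qed
      have "(g j x - f j x) * f j x = (1 / x - 1) * (f j x * f j x)"
        by (simp add: g_def f_def ft algebra_simps)
      then have 2: "(t/2) * ((g j x - f j x) * f j x) = a * (\<psi> j x * exp (- a))"
        unfolding 1 a_def \<alpha>_def by (simp only: mult.assoc)
      show ?thesis unfolding \<Theta>_def 2 unfolding 1 by (simp add: algebra_simps)
    qed
    have \<Theta>_ge: "\<psi> j x * ((1 - d) * exp (- d) * exp (- 2 * a)) \<le> \<Theta> j x" for j
    proof (cases "\<psi> j x = 0")
      case False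
      have near: "real j - 1 \<le> a / d" "a / d \<le> real j + 1"
        using False by (auto simp: \<psi>_def \<tau>_def a_def max_def min_def split: if_splits)
      then have near: "real j * d - d \<le> a" "a \<le> real j * d + d"
        using d by (simp_all add: field_simps)
      \<comment> \<open>On the layer |a - j d| \<le> d one has exp (- j d) \<ge> exp (- a - d) and 1
        + j d - a \<ge> 1 - d.\<close>
      have "(1 - d) * exp (- d) * exp (- 2 * a) = exp (- a - d) * (1 - d) * exp (- a)"
        by (simp add: mult_exp_exp)
      also have "\<dots> \<le> exp (- (real j * d)) * (1 + real j * d - a) * exp (- a)"
        using near d by (intro mult_right_mono mult_mono) auto
      finally show ?thesis unfolding \<Theta> using \<psi>0[of j x] by (rule mult_left_mono)
    qed (simp add: \<Theta>)
    have pos: "0 \<le> (1 - d) * exp (- d) * exp (- 2 * a)" using d by simp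
    have cancel: "exp d / (1 - d) * ((1 - d) * exp (- d) * exp (- 2 * a)) = exp (- 2 * a)"
      using d by (simp add: mult_exp_exp)
    have S: "(\<Sum>j\<le>J. \<psi> j x) * ((1 - d) * exp (- d) * exp (- 2 * a)) \<le> (\<Sum>j\<le>J. \<Theta> j x)"
      unfolding sum_distrib_right by (intro sum_mono \<Theta>_ge)
    have S0: "0 \<le> (\<Sum>j\<le>J. \<Theta> j x)"
      by (rule order_trans[OF _ S]) (intro mult_nonneg_nonneg sum_nonneg \<psi>0 pos)
    show ?thesis
    proof (cases "a / d \<le> real J")
      case True
      have "0 \<le> a / d" using a0 d by simp
      then have "(\<Sum>j\<le>J. \<psi> j x) = 1" using True unfolding sum_\<psi> \<tau>_def a_def by simp
      then have "exp d / (1 - d) * ((1 - d) * exp (- d) * exp (- 2 * a)) \<le> exp d / (1 - d) * (\<Sum>j\<le>J. \<Theta> j x)"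
        using S d by (intro mult_left_mono) auto
      then show ?thesis unfolding cancel ft by (simp add: add_increasing2)
    next
      case False
      then have "real J * d \<le> a" using d by (simp add: field_simps)
      then have "exp (- 2 * a) \<le> exp (- 2 * (real J * d))" by simp
      moreover have "0 \<le> exp d / (1 - d) * (\<Sum>j\<le>J. \<Theta> j x)" using S0 d by simp
      ultimately show ?thesis unfolding ft by linarith
    qed
  qed
  have each: "inner (U t e) e \<le> exp d / (1 - d) * (\<Sum>j\<le>J. (norm (M (R (X j e))))\<^sup>2) + exp (- 2 * (real J * d))"
    if "e \<in> F" for e
  proof -
    have "inner (U t e) e \<le> inner (calc (\<lambda>x. exp d / (1 - d) * (\<Sum>j\<le>J. \<Theta> j x) + exp (- 2 * (real J * d)) * 1) e) e"
      unfolding U_def using point t by (intro calc_mono cont_ft continuous_intros c\<Theta>) auto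
    also have "\<dots> = exp d / (1 - d) * (\<Sum>j\<le>J. inner (calc (\<Theta> j) e) e) + exp (- 2 * (real J * d)) * inner e e"
      by (subst calc_add, (intro continuous_intros c\<Theta>)+, subst calc_cmult, intro continuous_intros c\<Theta>,
          subst calc_cmult, intro continuous_intros, subst calc_sum, rule c\<Theta>)
        (simp add: calc_one inner_add_left inner_sum_left)
    also have "inner e e = 1" using F that by (simp add: orthonormal_def)
    also have "exp d / (1 - d) * (\<Sum>j\<le>J. inner (calc (\<Theta> j) e) e) \<le> exp d / (1 - d) * (\<Sum>j\<le>J. (norm (M (R (X j e))))\<^sup>2)"
      using d by (intro mult_left_mono sum_mono lower) auto
    finally show ?thesis by simp
  qed
  have "(\<Sum>e\<in>F. inner (U t e) e) \<le> (\<Sum>e\<in>F. exp d / (1 - d) * (\<Sum>j\<le>J. (norm (M (R (X j e))))\<^sup>2) + exp (- 2 * (real J * d)))"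
    by (intro sum_mono each)
  also have "\<dots> = exp d / (1 - d) * (\<Sum>j\<le>J. \<Sum>e\<in>F. (norm (M (R (X j e))))\<^sup>2) + exp (- 2 * (real J * d)) * card F"
  proof -
    have "(\<Sum>j\<le>J. \<Sum>e\<in>F. (norm (M (R (X j e))))\<^sup>2) = (\<Sum>e\<in>F. \<Sum>j\<le>J. (norm (M (R (X j e))))\<^sup>2)"
      by (rule sum.swap)
    then show ?thesis by (simp add: sum.distrib sum_distrib_left mult.commute)
  qed
  also have "\<dots> \<le> exp d / (1 - d) * Z + exp (- 2 * (real J * d)) * card F"
    using swap d by (intro add_right_mono mult_left_mono) auto
  finally show ?thesis .
qed

text \<open>First J tends to infinity with d fixed, which removes the tail because \<open>F\<close>
  is finite; then d tends to 0.\<close>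

lemma trace_bound:
  fixes M :: "'a \<Rightarrow> 'a" and t :: real
  assumes t: "0 < t"
    and M: "\<And>x y. inner (M x) y = inner x (M y)"
    and HS: "\<And>F. finite F \<Longrightarrow> orthonormal F \<Longrightarrow> (\<Sum>b\<in>F. (norm (M (U (t/4) b)))\<^sup>2) \<le> Z"
    and tangent: "\<And>k l. 0 \<le> l \<Longrightarrow>
      exp (- l) * ((1 + l) * (norm (G k))\<^sup>2 - (t/2) * inner (k - G k) (G k)) \<le> (norm (M (G k)))\<^sup>2"
    and F: "finite F" "orthonormal F"
  shows "(\<Sum>e\<in>F. inner (U t e) e) \<le> Z"
proof -
  have 1: "(\<Sum>e\<in>F. inner (U t e) e) \<le> exp d / (1 - d) * Z" if d: "0 < d" "d < 1" for d
  proof (rule LIMSEQ_le_const)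
    have "(\<lambda>J. exp (- 2 * (real J * d))) \<longlonglongrightarrow> 0" using d by real_asymp
    from tendsto_add[OF tendsto_const tendsto_mult[OF this tendsto_const], of "exp d / (1 - d) * Z" "real (card F)"]
    show "(\<lambda>J. exp d / (1 - d) * Z + exp (- 2 * (real J * d)) * card F) \<longlonglongrightarrow> exp d / (1 - d) * Z" by simp
    show "\<exists>N. \<forall>J\<ge>N. (\<Sum>e\<in>F. inner (U t e) e) \<le> exp d / (1 - d) * Z + exp (- 2 * (real J * d)) * card F"
      using trace_bound_step[OF t d M HS tangent F] by blast
  qed
  have "((\<lambda>d. exp d / (1 - d) * Z) \<longlongrightarrow> exp 0 / (1 - 0) * Z) (at_right 0)"
    by (intro tendsto_intros) auto
  moreover have "\<forall>\<^sub>F d in at_right (0::real). d \<in> {0<..<1}" by (rule eventually_at_right_real) simp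
  then have "\<forall>\<^sub>F d in at_right 0. (\<Sum>e\<in>F. inner (U t e) e) \<le> exp d / (1 - d) * Z"
    by eventually_elim (use 1 in auto)
  ultimately have "(\<Sum>e\<in>F. inner (U t e) e) \<le> exp 0 / (1 - 0) * Z"
    by (rule tendsto_lowerbound) simp
  then show ?thesis by simp
qed

end

subsection \<open>The space of square integrable functions\<close>

text \<open>Square integrability over the whole space; functions on a domain enter later through
  extension by zero.\<close>

definition sqint :: "('a::euclidean_space \<Rightarrow> real) \<Rightarrow> bool" where
  "sqint f \<longleftrightarrow> f \<in> borel_measurable lborel \<and> integrable lborel (\<lambda>x. (f x)\<^sup>2)"

lemma sqint_measurable: "sqint f \<Longrightarrow> f \<in> borel_measurable lborel"
  and sqint_square: "sqint f \<Longrightarrow> integrable lborel (\<lambda>x. (f x)\<^sup>2)"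
  by (auto simp: sqint_def)

lemma sqint_bound:
  assumes "f \<in> borel_measurable lborel" "integrable lborel g" "AE x in lborel. (f x)\<^sup>2 \<le> g x"
  shows "sqint f"
  unfolding sqint_def
proof (intro conjI)
  have [measurable]: "f \<in> borel_measurable lborel" by fact
  show "integrable lborel (\<lambda>x. (f x)\<^sup>2)"
    by (rule Bochner_Integration.integrable_bound[OF assms(2)]) (use assms(3) in auto)
qed fact

lemma sqint_mult:
  assumes "sqint f" "sqint g"
  shows "integrable lborel (\<lambda>x. f x * g x)"
proof (rule Bochner_Integration.integrable_bound)
  note [measurable] = assms[THEN sqint_measurable]
  show "integrable lborel (\<lambda>x. (f x)\<^sup>2 + (g x)\<^sup>2)"
    using assms by (intro Bochner_Integration.integrable_add sqint_square)
  show "(\<lambda>x. f x * g x) \<in> borel_measurable lborel" by measurable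
  have "\<bar>a * b\<bar> \<le> a\<^sup>2 + b\<^sup>2" for a b :: real
    using sum_squares_bound[of "\<bar>a\<bar>" "\<bar>b\<bar>"] mult_nonneg_nonneg[of "\<bar>a\<bar>" "\<bar>b\<bar>"]
    unfolding abs_mult power2_abs by linarith
  then show "AE x in lborel. norm (f x * g x) \<le> norm ((f x)\<^sup>2 + (g x)\<^sup>2)" by simp
qed

lemma sqint_0: "sqint (\<lambda>x. 0)"
  by (simp add: sqint_def)

lemma sqint_cmult: "sqint f \<Longrightarrow> sqint (\<lambda>x. c * f x)"
  by (auto simp: sqint_def power_mult_distrib)

lemma sqint_add:
  assumes "sqint f" "sqint g"
  shows "sqint (\<lambda>x. f x + g x)"
proof (rule sqint_bound)
  note [measurable] = assms[THEN sqint_measurable]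
  show "(\<lambda>x. f x + g x) \<in> borel_measurable lborel" by measurable
  show "integrable lborel (\<lambda>x. 2 * (f x)\<^sup>2 + 2 * (g x)\<^sup>2)"
    using assms by (intro Bochner_Integration.integrable_add integrable_mult_right sqint_square)
  have "(a + b)\<^sup>2 \<le> 2 * a\<^sup>2 + 2 * b\<^sup>2" for a b :: real
    using sum_squares_bound[of a b] by (simp add: power2_sum)
  then show "AE x in lborel. (f x + g x)\<^sup>2 \<le> 2 * (f x)\<^sup>2 + 2 * (g x)\<^sup>2" by simp
qed

lemma sqint_minus: "sqint f \<Longrightarrow> sqint (\<lambda>x. - f x)"
  by (simp add: sqint_def)

lemma sqint_diff: "sqint f \<Longrightarrow> sqint g \<Longrightarrow> sqint (\<lambda>x. f x - g x)"
  using sqint_add[of f "\<lambda>x. - g x"] sqint_minus[of g] by simp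

lemma sqint_mult_bounded:
  assumes "sqint f" "g \<in> borel_measurable lborel" "\<And>x. \<bar>g x\<bar> \<le> B"
  shows "sqint (\<lambda>x. g x * f x)"
proof (rule sqint_bound)
  note [measurable] = assms(1)[THEN sqint_measurable] assms(2)
  show "(\<lambda>x. g x * f x) \<in> borel_measurable lborel" by measurable
  show "integrable lborel (\<lambda>x. B\<^sup>2 * (f x)\<^sup>2)" using assms(1) by (auto intro: sqint_square)
  show "AE x in lborel. (g x * f x)\<^sup>2 \<le> B\<^sup>2 * (f x)\<^sup>2"
    unfolding power_mult_distrib
  proof (intro AE_I2 mult_right_mono)
    fix x show "(g x)\<^sup>2 \<le> B\<^sup>2" using power_mono[OF assms(3)[of x] abs_ge_zero, of 2] by simp
  qed simp
qed

definition l2rel :: "('a::euclidean_space \<Rightarrow> real) \<Rightarrow> ('a \<Rightarrow> real) \<Rightarrow> bool" where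
  "l2rel f g \<longleftrightarrow> sqint f \<and> sqint g \<and> (AE x in lborel. f x = g x)"

lemma part_equivp_l2rel: "part_equivp l2rel"
proof (rule part_equivpI)
  show "\<exists>f. l2rel f f" by (intro exI[of _ "\<lambda>_. 0"]) (simp add: l2rel_def sqint_0)
  show "symp l2rel" by (auto intro!: sympI simp: l2rel_def)
  show "transp l2rel" by (auto intro!: transpI simp: l2rel_def)
qed

\<comment> \<open>The partial relation selects the square integrable functions and identifies those
  equal almost everywhere in one step. A type of its own admits the class instances
  \<open>real_inner\<close> and \<open>complete_space\<close> on which the abstract locales
  rest.\<close>
quotient_type (overloaded) 'a l2 = "'a::euclidean_space \<Rightarrow> real" / partial: l2rel
  morphisms rep_l2 abs_l2
  by (rule part_equivp_l2rel)

lemma l2rel_refl: "l2rel f f \<longleftrightarrow> sqint f"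
  by (simp add: l2rel_def)

lemma sqint_rep: "sqint (rep_l2 x)"
  using Quotient3_rep_reflp[OF Quotient3_l2, of x] by (simp add: l2rel_refl)

lemma abs_rep_l2 [simp]: "abs_l2 (rep_l2 x) = x"
  by (rule Quotient3_abs_rep[OF Quotient3_l2])

lemma abs_l2_eqI: "sqint f \<Longrightarrow> sqint g \<Longrightarrow> AE x in lborel. f x = g x \<Longrightarrow> abs_l2 f = abs_l2 g"
  by (rule Quotient3_rel_abs[OF Quotient3_l2]) (simp add: l2rel_def)

lemma rep_abs_l2: "sqint f \<Longrightarrow> AE x in lborel. rep_l2 (abs_l2 f) x = f x"
  using rep_abs_rsp_left[OF Quotient3_l2, of f f] by (simp add: l2rel_def)

lemma abs_l2_eq_iff: "sqint f \<Longrightarrow> sqint g \<Longrightarrow> abs_l2 f = abs_l2 g \<longleftrightarrow> (AE x in lborel. f x = g x)"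
  using rep_abs_l2[of f] rep_abs_l2[of g] by (auto intro: abs_l2_eqI)

instantiation l2 :: (euclidean_space) real_inner
begin

definition "0 = abs_l2 (\<lambda>_. 0)"
definition "x + y = abs_l2 (\<lambda>t. rep_l2 x t + rep_l2 y t)"
definition "- x = abs_l2 (\<lambda>t. - rep_l2 x t)"
definition "x - y = abs_l2 (\<lambda>t. rep_l2 x t - rep_l2 y t)"
definition "a *\<^sub>R x = abs_l2 (\<lambda>t. a * rep_l2 x t)"
definition "inner x y = (\<integral>t. rep_l2 x t * rep_l2 y t \<partial>lborel)"
definition "norm (x::'a l2) = sqrt (inner x x)"
definition "dist x y = norm (x - y :: 'a l2)"
definition "sgn x = inverse (norm x) *\<^sub>R (x :: 'a l2)"
definition "(uniformity :: ('a l2 \<times> 'a l2) filter) = (INF e\<in>{0<..}. principal {(x, y). dist x y < e})"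
definition "open (S :: 'a l2 set) \<longleftrightarrow> (\<forall>x\<in>S. \<forall>\<^sub>F (x', y) in uniformity. x' = x \<longrightarrow> y \<in> S)"

lemma
  shows rep_l2_zero: "AE t in lborel. rep_l2 0 t = 0"
    and rep_l2_add: "AE t in lborel. rep_l2 (x + y) t = rep_l2 x t + rep_l2 y t"
    and rep_l2_minus: "AE t in lborel. rep_l2 (- x) t = - rep_l2 x t"
    and rep_l2_diff: "AE t in lborel. rep_l2 (x - y) t = rep_l2 x t - rep_l2 y t"
    and rep_l2_scaleR: "AE t in lborel. rep_l2 (a *\<^sub>R x) t = a * rep_l2 x t"
  unfolding zero_l2_def plus_l2_def uminus_l2_def minus_l2_def scaleR_l2_def
  by (intro rep_abs_l2 sqint_0 sqint_add sqint_diff sqint_minus sqint_cmult sqint_rep)+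

lemma l2_eqI: "AE t in lborel. rep_l2 x t = rep_l2 y t \<Longrightarrow> x = y"
  using abs_l2_eqI[OF sqint_rep[of x] sqint_rep[of y]] by simp

instance
proof
  fix x y z :: "'a l2" and a b :: real
  show "x + y + z = x + (y + z)"
    by (rule l2_eqI) (use rep_l2_add[of "x + y" z] rep_l2_add[of x y] rep_l2_add[of x "y + z"] rep_l2_add[of y z] in eventually_elim, simp)
  show "x + y = y + x"
    by (rule l2_eqI) (use rep_l2_add[of x y] rep_l2_add[of y x] in eventually_elim, simp)
  show "0 + x = x"
    by (rule l2_eqI) (use rep_l2_add[of 0 x] rep_l2_zero in eventually_elim, simp)
  show "- x + x = 0"
    by (rule l2_eqI) (use rep_l2_add[of "- x" x] rep_l2_zero rep_l2_minus[of x] in eventually_elim, simp)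
  show "x - y = x + - y"
    by (rule l2_eqI) (use rep_l2_add[of x "- y"] rep_l2_diff[of x y] rep_l2_minus[of y] in eventually_elim, simp)
  show "a *\<^sub>R (x + y) = a *\<^sub>R x + a *\<^sub>R y"
    by (rule l2_eqI) (use rep_l2_add[of x y] rep_l2_add[of "a *\<^sub>R x" "a *\<^sub>R y"] rep_l2_scaleR[of a x] rep_l2_scaleR[of a y] rep_l2_scaleR[of a "x + y"]
      in eventually_elim, simp add: algebra_simps)
  show "(a + b) *\<^sub>R x = a *\<^sub>R x + b *\<^sub>R x"
    by (rule l2_eqI) (use rep_l2_add[of "a *\<^sub>R x" "b *\<^sub>R x"] rep_l2_scaleR[of a x] rep_l2_scaleR[of b x] rep_l2_scaleR[of "a + b" x]
      in eventually_elim, simp add: algebra_simps)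
  show "a *\<^sub>R b *\<^sub>R x = (a * b) *\<^sub>R x"
    by (rule l2_eqI) (use rep_l2_scaleR[of a "b *\<^sub>R x"] rep_l2_scaleR[of b x] rep_l2_scaleR[of "a * b" x]
      in eventually_elim, simp add: algebra_simps)
  show "1 *\<^sub>R x = x"
    by (rule l2_eqI) (use rep_l2_scaleR[of 1 x] in eventually_elim, simp)
  note int = sqint_mult[OF sqint_rep sqint_rep]
  have meas [measurable]: "rep_l2 u \<in> borel_measurable lborel" for u :: "'a l2"
    by (rule sqint_measurable[OF sqint_rep])
  show "inner x y = inner y x" by (simp add: inner_l2_def mult.commute)
  show "inner (x + y) z = inner x z + inner y z"
  proof -
    have "inner (x + y) z = (\<integral>t. rep_l2 x t * rep_l2 z t + rep_l2 y t * rep_l2 z t \<partial>lborel)"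
      unfolding inner_l2_def
      by (rule integral_cong_AE; measurable?; use rep_l2_add[of x y] in eventually_elim, simp add: algebra_simps)
    then show ?thesis by (simp add: inner_l2_def int)
  qed
  show "inner (a *\<^sub>R x) y = a * inner x y"
  proof -
    have "inner (a *\<^sub>R x) y = (\<integral>t. a * (rep_l2 x t * rep_l2 y t) \<partial>lborel)"
      unfolding inner_l2_def
      by (rule integral_cong_AE; measurable?; use rep_l2_scaleR[of a x] in eventually_elim, simp add: algebra_simps)
    then show ?thesis by (simp add: inner_l2_def)
  qed
  show "0 \<le> inner x x" by (simp add: inner_l2_def)
  show "(inner x x = 0) = (x = 0)"
  proof
    assume "inner x x = 0"
    then have "AE t in lborel. rep_l2 x t * rep_l2 x t = 0"
      unfolding inner_l2_def by (subst (asm) integral_nonneg_eq_0_iff_AE) (auto intro: int)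
    then have "AE t in lborel. rep_l2 x t = rep_l2 0 t"
      using rep_l2_zero by eventually_elim simp
    then show "x = 0" by (rule l2_eqI)
  next
    assume "x = 0"
    have "inner (0::'a l2) 0 = (\<integral>t. 0 \<partial>(lborel::'a measure))"
      unfolding inner_l2_def
      by (rule integral_cong_AE; measurable?; use rep_l2_zero in eventually_elim, simp)
    with \<open>x = 0\<close> show "inner x x = 0" by simp
  qed
qed (simp_all add: norm_l2_def dist_l2_def sgn_l2_def uniformity_l2_def open_l2_def)

end

lemma measurable_rep_l2 [measurable]: "rep_l2 u \<in> borel_measurable lborel"
  by (rule sqint_measurable[OF sqint_rep])

lemma inner_abs_l2:
  assumes "sqint f" "sqint g"
  shows "inner (abs_l2 f) (abs_l2 g) = (\<integral>t. f t * g t \<partial>lborel)"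
proof -
  note [measurable] = assms[THEN sqint_measurable]
  have "AE t in lborel. rep_l2 (abs_l2 f) t * rep_l2 (abs_l2 g) t = f t * g t"
    using rep_abs_l2[OF assms(1)] rep_abs_l2[OF assms(2)] by eventually_elim simp
  then show ?thesis unfolding inner_l2_def by (intro integral_cong_AE) auto
qed

lemma abs_l2_add: "sqint f \<Longrightarrow> sqint g \<Longrightarrow> abs_l2 (\<lambda>x. f x + g x) = abs_l2 f + abs_l2 g"
  unfolding plus_l2_def using rep_abs_l2[of f] rep_abs_l2[of g]
  by (intro abs_l2_eqI sqint_add sqint_rep) auto

lemma abs_l2_diff: "sqint f \<Longrightarrow> sqint g \<Longrightarrow> abs_l2 (\<lambda>x. f x - g x) = abs_l2 f - abs_l2 g"
  unfolding minus_l2_def using rep_abs_l2[of f] rep_abs_l2[of g]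
  by (intro abs_l2_eqI sqint_diff sqint_rep) auto

lemma abs_l2_scaleR: "sqint f \<Longrightarrow> abs_l2 (\<lambda>x. a * f x) = a *\<^sub>R abs_l2 f"
  unfolding scaleR_l2_def
proof (intro abs_l2_eqI sqint_cmult sqint_rep)
  assume "sqint f"
  from rep_abs_l2[OF this] show "AE x in lborel. a * f x = a * rep_l2 (abs_l2 f) x"
    by eventually_elim simp
qed

lemma norm_abs_l2_sq: "sqint f \<Longrightarrow> (norm (abs_l2 f))\<^sup>2 = (\<integral>t. (f t)\<^sup>2 \<partial>lborel)"
  unfolding power2_norm_eq_inner by (simp add: inner_abs_l2 power2_eq_square)

text \<open>Riesz-Fischer: along a fast Cauchy subsequence the series of 2^k-weighted squares
  converges a.e., and a \<le> 2^{-k} + 2^k a^2 then yields pointwise convergence.\<close>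
lemma l2_fast_Cauchy_limit:
  fixes Y :: "nat \<Rightarrow> 'a::euclidean_space l2"
  assumes Y: "\<And>k. norm (Y (Suc k) - Y k) \<le> (1/2) ^ k"
  obtains f where "f \<in> borel_measurable lborel" "AE x in lborel. (\<lambda>k. rep_l2 (Y k) x) \<longlonglongrightarrow> f x"
proof -
  define d where "d k x = rep_l2 (Y (Suc k)) x - rep_l2 (Y k) x" for k x
  have d_meas [measurable]: "d k \<in> borel_measurable lborel" for k unfolding d_def by measurable
  have d_sq: "sqint (d k)" for k unfolding d_def by (intro sqint_diff sqint_rep)
  have "abs_l2 (d k) = Y (Suc k) - Y k" for k
    unfolding d_def by (subst abs_l2_diff) (simp_all add: sqint_rep)
  have d_int: "(\<integral>x. (d k x)\<^sup>2 \<partial>lborel) \<le> (1/4) ^ k" for k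
  proof -
    have "((1/2::real) ^ k)\<^sup>2 = (1/4) ^ k" by (simp add: power2_eq_square flip: power_mult_distrib)
    then show ?thesis
      using norm_abs_l2_sq[OF d_sq[of k]] power_mono[OF Y[of k] norm_ge_zero, of 2] \<open>\<And>k. abs_l2 (d k) = _\<close> by simp
  qed
  have "(\<integral>\<^sup>+x. (\<Sum>k. ennreal (2 ^ k * (d k x)\<^sup>2)) \<partial>lborel) = (\<Sum>k. \<integral>\<^sup>+x. ennreal (2 ^ k * (d k x)\<^sup>2) \<partial>lborel)"
    by (rule nn_integral_suminf) measurable
  also have "\<dots> \<le> (\<Sum>k. ennreal ((1/2) ^ k))"
  proof (intro suminf_le allI)
    fix k
    have "(\<integral>\<^sup>+x. ennreal (2 ^ k * (d k x)\<^sup>2) \<partial>lborel) = ennreal (\<integral>x. 2 ^ k * (d k x)\<^sup>2 \<partial>lborel)"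
      using sqint_square[OF d_sq[of k]] by (intro nn_integral_eq_integral) auto
    also have "(\<integral>x. 2 ^ k * (d k x)\<^sup>2 \<partial>lborel) = 2 ^ k * (\<integral>x. (d k x)\<^sup>2 \<partial>lborel)" by simp
    also have "\<dots> \<le> 2 ^ k * (1/4) ^ k" using d_int[of k] by (intro mult_left_mono) auto
    also have "\<dots> = (1/2::real) ^ k" by (simp flip: power_mult_distrib)
    finally show "(\<integral>\<^sup>+x. ennreal (2 ^ k * (d k x)\<^sup>2) \<partial>lborel) \<le> ennreal ((1/2) ^ k)"
      by (simp add: ennreal_leI)
  qed auto
  also have "\<dots> = ennreal (\<Sum>k. (1/2) ^ k)"
    by (intro suminf_ennreal2) (auto intro: summable_geometric)
  finally have "(\<integral>\<^sup>+x. (\<Sum>k. ennreal (2 ^ k * (d k x)\<^sup>2)) \<partial>lborel) \<noteq> \<infinity>"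
    by (auto simp: top_unique)
  then have "AE x in lborel. (\<Sum>k. ennreal (2 ^ k * (d k x)\<^sup>2)) \<noteq> \<infinity>"
    by (intro nn_integral_noteq_infinite) measurable
  then have ae: "AE x in lborel. convergent (\<lambda>k. rep_l2 (Y k) x)"
  proof eventually_elim
    case (elim x)
    have s: "summable (\<lambda>k. 2 ^ k * (d k x)\<^sup>2)"
      by (rule summable_suminf_not_top) (use elim in auto)
    have "summable (\<lambda>k. (1/2) ^ k + 2 ^ k * (d k x)\<^sup>2)"
      by (intro summable_add s summable_geometric) simp
    then have "summable (\<lambda>k. d k x)"
    proof (rule summable_comparison_test')
      fix k :: nat
      have "\<bar>a\<bar> \<le> (1/2) ^ k + 2 ^ k * a\<^sup>2" for a :: real
      proof -
        have "0 \<le> (1 - 2 ^ k * \<bar>a\<bar>)\<^sup>2 * (1/2) ^ k" by simp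
        also have "\<dots> = (1/2) ^ k + 2 ^ k * a\<^sup>2 - 2 * \<bar>a\<bar>"
        proof -
          have "(2::real) ^ k * (1/2) ^ k = 1" by (simp flip: power_mult_distrib)
          moreover have "(1 - 2 ^ k * \<bar>a\<bar>)\<^sup>2 * (1/2) ^ k
             = (1/2) ^ k - 2 * \<bar>a\<bar> * (2 ^ k * (1/2) ^ k) + 2 ^ k * a\<^sup>2 * (2 ^ k * (1/2) ^ k)"
            by (simp add: power2_eq_square algebra_simps)
          ultimately show ?thesis by simp
        qed
        finally show ?thesis by simp
      qed
      then show "norm (d k x) \<le> (1/2) ^ k + 2 ^ k * (d k x)\<^sup>2" by simp
    qed
    then have "convergent (\<lambda>n. \<Sum>k<n. d k x)" by (simp add: summable_iff_convergent)
    then have "convergent (\<lambda>n. (\<Sum>k<n. d k x) + rep_l2 (Y 0) x)"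
      by (intro convergent_add convergent_const)
    moreover have "(\<Sum>k<n. d k x) + rep_l2 (Y 0) x = rep_l2 (Y n) x" for n
      unfolding d_def by (subst sum_lessThan_telescope) simp
    ultimately show ?case by simp
  qed
  show thesis
  proof
    show "(\<lambda>x. lim (\<lambda>k. rep_l2 (Y k) x)) \<in> borel_measurable lborel" by measurable
    show "AE x in lborel. (\<lambda>k. rep_l2 (Y k) x) \<longlonglongrightarrow> lim (\<lambda>k. rep_l2 (Y k) x)"
      using ae by eventually_elim (simp add: convergent_LIMSEQ_iff)
  qed
qed

text \<open>Fatou's lemma applied to the squared distance to a fixed \<open>z\<close> yields
  membership and a norm bound at once. With \<open>z\<close> a term of a Cauchy sequence this
  becomes convergence in norm.\<close>

lemma l2_Fatou:
  fixes Y :: "nat \<Rightarrow> 'a::euclidean_space l2"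
  assumes [measurable]: "f \<in> borel_measurable lborel"
    and lim: "AE x in lborel. (\<lambda>k. rep_l2 (Y k) x) \<longlonglongrightarrow> f x"
    and bnd: "\<And>k. M \<le> k \<Longrightarrow> norm (Y k - z) \<le> B"
  shows "sqint f" "norm (abs_l2 f - z) \<le> B"
proof -
  have B: "0 \<le> B" using bnd[of M] norm_ge_zero by (meson order_refl order_trans)
  let ?g = "\<lambda>x. f x - rep_l2 z x"
  have nn: "(\<integral>\<^sup>+x. ennreal ((?g x)\<^sup>2) \<partial>lborel) \<le> ennreal (B\<^sup>2)"
  proof -
    have "(\<integral>\<^sup>+x. ennreal ((?g x)\<^sup>2) \<partial>lborel) = (\<integral>\<^sup>+x. liminf (\<lambda>k. ennreal ((rep_l2 (Y k) x - rep_l2 z x)\<^sup>2)) \<partial>lborel)"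
    proof (rule nn_integral_cong_AE)
      show "AE x in lborel. ennreal ((?g x)\<^sup>2) = liminf (\<lambda>k. ennreal ((rep_l2 (Y k) x - rep_l2 z x)\<^sup>2))"
        using lim
      proof eventually_elim
        case (elim x)
        have "(\<lambda>k. ennreal ((rep_l2 (Y k) x - rep_l2 z x)\<^sup>2)) \<longlonglongrightarrow> ennreal ((?g x)\<^sup>2)"
          by (intro tendsto_ennrealI tendsto_power tendsto_diff tendsto_const elim)
        from lim_imp_Liminf[OF _ this] show ?case by simp
      qed
    qed
    also have "\<dots> \<le> liminf (\<lambda>k. \<integral>\<^sup>+x. ennreal ((rep_l2 (Y k) x - rep_l2 z x)\<^sup>2) \<partial>lborel)"
      by (rule nn_integral_liminf) measurable
    also have "\<dots> \<le> ennreal (B\<^sup>2)"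
    proof (rule order_trans[OF Liminf_le_Limsup Limsup_bounded])
        show "\<forall>\<^sub>F k in sequentially. (\<integral>\<^sup>+x. ennreal ((rep_l2 (Y k) x - rep_l2 z x)\<^sup>2) \<partial>lborel) \<le> ennreal (B\<^sup>2)"
          using eventually_ge_at_top[of M]
        proof eventually_elim
          case (elim k)
          have sq: "sqint (\<lambda>x. rep_l2 (Y k) x - rep_l2 z x)" by (intro sqint_diff sqint_rep)
          have "abs_l2 (\<lambda>x. rep_l2 (Y k) x - rep_l2 z x) = Y k - z"
            by (subst abs_l2_diff) (simp_all add: sqint_rep)
          then have "(\<integral>x. (rep_l2 (Y k) x - rep_l2 z x)\<^sup>2 \<partial>lborel) \<le> B\<^sup>2"
            using norm_abs_l2_sq[OF sq] power_mono[OF bnd[OF elim] norm_ge_zero, of 2] by simp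
          then show ?case using sqint_square[OF sq] by (subst nn_integral_eq_integral) (auto intro: ennreal_leI)
        qed
    qed simp
    finally show ?thesis .
  qed
  have "integrable lborel (\<lambda>x. (?g x)\<^sup>2)"
    by (rule integrableI_nonneg) (use nn in \<open>auto simp: top_unique less_top[symmetric]\<close>)
  then have g: "sqint ?g" by (simp add: sqint_def)
  from sqint_add[OF this sqint_rep[of z]] show f: "sqint f" by simp
  have "ennreal (\<integral>x. (?g x)\<^sup>2 \<partial>lborel) \<le> ennreal (B\<^sup>2)"
    using nn sqint_square[OF g] by (subst (asm) nn_integral_eq_integral) auto
  then have "(norm (abs_l2 ?g))\<^sup>2 \<le> B\<^sup>2"
    using norm_abs_l2_sq[OF g] by (simp add: ennreal_le_iff)
  then have "norm (abs_l2 ?g) \<le> B" using B by (simp add: power2_le_iff_abs_le)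
  then show "norm (abs_l2 f - z) \<le> B" using abs_l2_diff[OF f sqint_rep[of z]] by simp
qed

instance l2 :: (euclidean_space) complete_space
proof
  fix X :: "nat \<Rightarrow> 'a l2"
  assume C: "Cauchy X"
  have "\<exists>N. \<forall>m\<ge>N. \<forall>n\<ge>N. norm (X m - X n) < (1/2) ^ k" for k :: nat
    using C[unfolded Cauchy_iff, rule_format, of "(1/2) ^ k"] by simp
  then obtain N where N: "\<And>k m n. N k \<le> m \<Longrightarrow> N k \<le> n \<Longrightarrow> norm (X m - X n) < (1/2) ^ k" by metis
  \<comment> \<open>Partial sums dominate every earlier \<open>N i\<close>, which spares arranging
    that \<open>N\<close> is monotone.\<close>
  define M where "M k = (\<Sum>i\<le>k. N i)" for k
  have MN: "N i \<le> M k" if "i \<le> k" for i k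
    unfolding M_def using that by (intro member_le_sum) auto
  define Y where "Y k = X (M k)" for k
  have Y: "norm (Y (Suc k) - Y k) \<le> (1/2) ^ k" for k
    unfolding Y_def using N[of k "M (Suc k)" "M k"] MN[of k k] MN[of k "Suc k"] by (simp add: less_imp_le)
  obtain f where f: "f \<in> borel_measurable lborel" "AE x in lborel. (\<lambda>k. rep_l2 (Y k) x) \<longlonglongrightarrow> f x"
    by (rule l2_fast_Cauchy_limit[of Y, OF Y])
  have "X \<longlonglongrightarrow> abs_l2 f"
  proof (rule LIMSEQ_I)
    fix e :: real assume e: "0 < e"
    have "(\<lambda>k. (1/2::real) ^ k) \<longlonglongrightarrow> 0" by (intro LIMSEQ_power_zero) simp
    then have "\<forall>\<^sub>F k in sequentially. (1/2::real) ^ k < e" using e by (rule order_tendstoD)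
    then obtain j where j: "(1/2) ^ j < e" by (auto simp: eventually_sequentially)
    have "norm (X n - abs_l2 f) < e" if n: "N j \<le> n" for n
    proof -
      have "norm (Y k - X n) \<le> (1/2) ^ j" if "j \<le> k" for k
        unfolding Y_def using N[of j "M k" n] MN[OF that] n by (simp add: less_imp_le)
      then have "norm (abs_l2 f - X n) \<le> (1/2) ^ j" by (rule l2_Fatou(2)[OF f])
      then show ?thesis using j by (simp add: norm_minus_commute)
    qed
    then show "\<exists>no. \<forall>n\<ge>no. norm (X n - abs_l2 f) < e" by blast
  qed
  then show "convergent X" by (auto simp: convergent_def)
qed

section \<open>Calculus of functions with continuous iterated partial derivatives\<close>

lemma Ck_cont: "Ck k f \<Longrightarrow> continuous_on UNIV f"
  by (cases k) auto

lemma Ck_Suc_D: "Ck (Suc k) f \<Longrightarrow> Ck k f"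
  by (induction k arbitrary: f) auto

lemma Ck_partial: "Ck (Suc k) f \<Longrightarrow> Ck k (partial i f)"
  by simp

lemma Ck_has_partial:
  assumes "Ck (Suc k) f"
  shows "((\<lambda>s. f (x + s *\<^sub>R axis i 1)) has_real_derivative partial i f (x + s *\<^sub>R axis i 1)) (at s)"
proof -
  let ?y = "x + s *\<^sub>R axis i 1"
  have "(\<lambda>u. f (?y + u *\<^sub>R axis i 1)) differentiable (at 0)" using assms by simp
  then have "((\<lambda>u. f (?y + u *\<^sub>R axis i 1)) has_real_derivative partial i f ?y) (at 0)"
    unfolding partial_def by (simp add: DERIV_deriv_iff_real_differentiable)
  then have "((\<lambda>u. f (?y + (u - s) *\<^sub>R axis i 1)) has_real_derivative partial i f ?y) (at s)"
    using DERIV_shift[of "\<lambda>u. f (?y + (u - s) *\<^sub>R axis i 1)" "partial i f ?y" 0 s] by simp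
  then show ?thesis by (simp add: algebra_simps)
qed

lemma partialI:
  assumes "((\<lambda>s. f (x + s *\<^sub>R axis i 1)) has_real_derivative D) (at 0)"
  shows "partial i f x = D"
  unfolding partial_def by (rule DERIV_imp_deriv[OF assms])

lemma partial_cmult: "Ck (Suc k) f \<Longrightarrow> partial i (\<lambda>x. c * f x) = (\<lambda>x. c * partial i f x)"
proof
  fix x assume f: "Ck (Suc k) f"
  show "partial i (\<lambda>x. c * f x) x = c * partial i f x"
    by (rule partialI) (use DERIV_cmult[OF Ck_has_partial[OF f, of x i 0], of c] in simp)
qed

lemma partial_add: "Ck (Suc k) f \<Longrightarrow> Ck (Suc k) g \<Longrightarrow> partial i (\<lambda>x. f x + g x) = (\<lambda>x. partial i f x + partial i g x)"
proof
  fix x assume f: "Ck (Suc k) f" and g: "Ck (Suc k) g"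
  show "partial i (\<lambda>x. f x + g x) x = partial i f x + partial i g x"
    by (rule partialI) (use DERIV_add[OF Ck_has_partial[OF f, of x i 0] Ck_has_partial[OF g, of x i 0]] in simp)
qed

lemma partial_mult: "Ck (Suc k) f \<Longrightarrow> Ck (Suc k) g \<Longrightarrow>
    partial i (\<lambda>x. f x * g x) = (\<lambda>x. partial i f x * g x + f x * partial i g x)"
proof
  fix x assume f: "Ck (Suc k) f" and g: "Ck (Suc k) g"
  show "partial i (\<lambda>x. f x * g x) x = partial i f x * g x + f x * partial i g x"
    by (rule partialI) (use DERIV_mult[OF Ck_has_partial[OF f, of x i 0] Ck_has_partial[OF g, of x i 0]] in \<open>simp add: algebra_simps\<close>)
qed

lemma Ck_SucI:
  assumes "continuous_on UNIV f"
    and "\<And>i x. ((\<lambda>s. f (x + s *\<^sub>R axis i 1)) has_real_derivative D i x) (at 0)"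
    and "\<And>i. Ck k (D i)"
  shows "Ck (Suc k) f"
proof -
  have "partial i f = D i" for i using partialI[OF assms(2)] by auto
  then show ?thesis using assms by (auto intro: differentiableI simp: real_differentiable_def)
qed

lemma Ck_const: "Ck k (\<lambda>x. c)"
proof (induction k arbitrary: c)
  case (Suc k)
  show ?case by (rule Ck_SucI[where D = "\<lambda>i x. 0"]) (auto intro: Suc)
qed auto

lemma Ck_cmult: "Ck k f \<Longrightarrow> Ck k (\<lambda>x. c * f x)"
proof (induction k arbitrary: f)
  case (Suc k)
  show ?case
  proof (rule Ck_SucI[where D = "\<lambda>i x. c * partial i f x"])
    show "continuous_on UNIV (\<lambda>x. c * f x)" using Ck_cont[OF Suc.prems] by (intro continuous_intros)
    show "((\<lambda>s. c * f (x + s *\<^sub>R axis i 1)) has_real_derivative c * partial i f x) (at 0)" for i x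
      using DERIV_cmult[OF Ck_has_partial[OF Suc.prems, of x i 0], of c] by simp
    show "Ck k (\<lambda>x. c * partial i f x)" for i by (intro Suc.IH Ck_partial Suc.prems)
  qed
qed (auto intro!: continuous_intros)

lemma Ck_add: "Ck k f \<Longrightarrow> Ck k g \<Longrightarrow> Ck k (\<lambda>x. f x + g x)"
proof (induction k arbitrary: f g)
  case (Suc k)
  show ?case
  proof (rule Ck_SucI[where D = "\<lambda>i x. partial i f x + partial i g x"])
    show "continuous_on UNIV (\<lambda>x. f x + g x)"
      using Ck_cont[OF Suc.prems(1)] Ck_cont[OF Suc.prems(2)] by (intro continuous_intros)
    show "((\<lambda>s. f (x + s *\<^sub>R axis i 1) + g (x + s *\<^sub>R axis i 1)) has_real_derivative partial i f x + partial i g x) (at 0)" for i x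
      using DERIV_add[OF Ck_has_partial[OF Suc.prems(1), of x i 0] Ck_has_partial[OF Suc.prems(2), of x i 0]] by simp
    show "Ck k (\<lambda>x. partial i f x + partial i g x)" for i by (intro Suc.IH Ck_partial Suc.prems)
  qed
qed (auto intro!: continuous_intros)

lemma Ck_mult: "Ck k f \<Longrightarrow> Ck k g \<Longrightarrow> Ck k (\<lambda>x. f x * g x)"
proof (induction k arbitrary: f g)
  case (Suc k)
  show ?case
  proof (rule Ck_SucI[where D = "\<lambda>i x. partial i f x * g x + f x * partial i g x"])
    show "continuous_on UNIV (\<lambda>x. f x * g x)"
      using Ck_cont[OF Suc.prems(1)] Ck_cont[OF Suc.prems(2)] by (intro continuous_intros)
    show "((\<lambda>s. f (x + s *\<^sub>R axis i 1) * g (x + s *\<^sub>R axis i 1)) has_real_derivative partial i f x * g x + f x * partial i g x) (at 0)" for i x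
      using DERIV_mult[OF Ck_has_partial[OF Suc.prems(1), of x i 0] Ck_has_partial[OF Suc.prems(2), of x i 0]]
      by (simp add: algebra_simps)
    show "Ck k (\<lambda>x. partial i f x * g x + f x * partial i g x)" for i
      by (intro Ck_add Suc.IH Ck_partial Suc.prems Ck_Suc_D[OF Suc.prems(1)] Ck_Suc_D[OF Suc.prems(2)])
  qed
qed (auto intro!: continuous_intros)

lemma Ck_sum: "(\<And>i. i \<in> S \<Longrightarrow> Ck k (f i)) \<Longrightarrow> Ck k (\<lambda>x. \<Sum>i\<in>S. f i x)"
  by (induction S rule: infinite_finite_induct) (auto intro: Ck_const Ck_add)

lemma Ck_prod: "(\<And>i. i \<in> S \<Longrightarrow> Ck k (f i)) \<Longrightarrow> Ck k (\<lambda>x. \<Prod>i\<in>S. f i x)"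
  by (induction S rule: infinite_finite_induct) (auto intro: Ck_const Ck_mult)

lemma partial_zero: "partial i (\<lambda>x. 0) x = 0"
  by (rule partialI) simp

lemma partial_sum:
  "(\<And>j. j \<in> S \<Longrightarrow> Ck (Suc k) (f j)) \<Longrightarrow> partial i (\<lambda>x. \<Sum>j\<in>S. f j x) = (\<lambda>x. \<Sum>j\<in>S. partial i (f j) x)"
proof (induction S rule: infinite_finite_induct)
  case (insert j S)
  then show ?case by (subst sum.insert, simp, simp) (simp add: partial_add[of k "f j" "\<lambda>x. \<Sum>j\<in>S. f j x"] Ck_sum del: Ck.simps)
qed (simp_all add: partial_zero fun_eq_iff)

lemma real_MVT_from_0:
  fixes g g' :: "real \<Rightarrow> real"
  assumes "\<And>s. (g has_real_derivative g' s) (at s)"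
  obtains \<theta> where "\<bar>\<theta>\<bar> \<le> \<bar>a\<bar>" "g a - g 0 = a * g' \<theta>"
proof (cases a "0::real" rule: linorder_cases)
  case greater
  then obtain z where "0 < z" "z < a" "g a - g 0 = (a - 0) * g' z"
    using MVT2[of 0 a g g'] assms by auto
  then show thesis by (intro that[of z]) auto
next
  case less
  then obtain z where "a < z" "z < 0" "g 0 - g a = (0 - a) * g' z"
    using MVT2[of a 0 g g'] assms by auto
  then show thesis by (intro that[of z]) auto
next
  case equal
  then show thesis by (intro that[of 0]) auto
qed

text \<open>The increment is built up one coordinate at a time, with the mean value theorem in each
  step; continuity of the partial derivatives compares their intermediate values with those at
  x.\<close>

lemma Ck_has_derivative:
  fixes f :: "real^'n \<Rightarrow> real"
  assumes f: "Ck (Suc k) f"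
  shows "(f has_derivative (\<lambda>v. \<Sum>i\<in>UNIV. v $ i * partial i f x)) (at x)"
  unfolding has_derivative_at_alt
proof (intro conjI allI impI)
  show "bounded_linear (\<lambda>v. \<Sum>i\<in>UNIV. v $ i * partial i f x)"
    by (intro bounded_linear_sum bounded_linear_compose[OF bounded_linear_mult_left bounded_linear_vec_nth])
  fix e :: real assume e: "0 < e"
  define e' where "e' = e / real CARD('n)"
  have e': "0 < e'" using e by (simp add: e'_def)
  have "\<exists>d>0. \<forall>y. dist y x < d \<longrightarrow> dist (partial i f y) (partial i f x) < e'" for i
  proof -
    have "continuous_on UNIV (partial i f)" using Ck_cont[OF Ck_partial[OF f]] .
    then show ?thesis using e' by (simp add: continuous_on_iff)
  qed
  then obtain d where d: "\<And>i. 0 < d i" "\<And>i y. dist y x < d i \<Longrightarrow> dist (partial i f y) (partial i f x) < e'"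
    by metis
  define r where "r = Min (range d)"
  have r: "0 < r" "\<And>i. r \<le> d i" unfolding r_def using d(1) by auto
  have "norm (f y - f x - (\<Sum>i\<in>UNIV. (y - x) $ i * partial i f x)) \<le> e * norm (y - x)" if "norm (y - x) < r" for y
  proof -
    define v where "v = y - x"
    define V where "V I = (\<Sum>i\<in>I. v $ i *\<^sub>R axis i (1::real))" for I
    have V_nth: "V I $ j = (if j \<in> I then v $ j else 0)" for I j
      unfolding V_def by (simp add: axis_def if_distrib cong: if_cong)
    have claim: "\<bar>f (x + V I) - f x - (\<Sum>i\<in>I. v $ i * partial i f x)\<bar> \<le> real (card I) * (e' * norm v)" for I
    proof (induction I rule: infinite_finite_induct)
      case (insert j I)
      have g: "((\<lambda>s. f ((x + V I) + s *\<^sub>R axis j 1)) has_real_derivative partial j f ((x + V I) + s *\<^sub>R axis j 1)) (at s)" for s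
        by (rule Ck_has_partial[OF f])
      obtain \<theta> where \<theta>: "\<bar>\<theta>\<bar> \<le> \<bar>v $ j\<bar>"
        "f ((x + V I) + v $ j *\<^sub>R axis j 1) - f ((x + V I) + 0 *\<^sub>R axis j 1) = v $ j * partial j f ((x + V I) + \<theta> *\<^sub>R axis j 1)"
        using real_MVT_from_0[OF g, of "v $ j"] by metis
      have "norm (V I + \<theta> *\<^sub>R axis j 1) \<le> norm v"
        by (rule norm_le_componentwise_cart) (use insert \<theta>(1) in \<open>auto simp: V_nth axis_def\<close>)
      then have "dist (x + V I + \<theta> *\<^sub>R axis j 1) x < d j"
        using that r(2)[of j] unfolding v_def dist_norm by (simp add: algebra_simps)
      then have "\<bar>partial j f (x + V I + \<theta> *\<^sub>R axis j 1) - partial j f x\<bar> < e'"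
        using d(2) by (simp add: dist_real_def)
      then have "\<bar>v $ j * (partial j f (x + V I + \<theta> *\<^sub>R axis j 1) - partial j f x)\<bar> \<le> norm v * e'"
        unfolding abs_mult by (intro mult_mono component_le_norm_cart) auto
      moreover have "x + V (insert j I) = (x + V I) + v $ j *\<^sub>R axis j 1" using insert by (simp add: V_def)
      moreover have "f ((x + V I) + v $ j *\<^sub>R axis j 1) - f x - (\<Sum>i\<in>insert j I. v $ i * partial i f x)
         = (f (x + V I) - f x - (\<Sum>i\<in>I. v $ i * partial i f x)) + v $ j * (partial j f (x + V I + \<theta> *\<^sub>R axis j 1) - partial j f x)"
        using \<theta>(2) insert by (simp add: algebra_simps)
      ultimately have "\<bar>f (x + V (insert j I)) - f x - (\<Sum>i\<in>insert j I. v $ i * partial i f x)\<bar> \<le> real (card I) * (e' * norm v) + norm v * e'"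
        using insert.IH by (simp only: abs_le_iff) linarith
      then show ?case using insert by (simp add: algebra_simps)
    qed (auto simp: V_def)
    have "x + V UNIV = y"
      unfolding v_def[symmetric] by (simp add: vec_eq_iff V_nth) (simp add: v_def)
    with claim[of UNIV] show ?thesis by (simp add: v_def e'_def)
  qed
  then show "\<exists>d>0. \<forall>y. norm (y - x) < d \<longrightarrow> norm (f y - f x - (\<Sum>i\<in>UNIV. (y - x) $ i * partial i f x)) \<le> e * norm (y - x)"
    using r(1) by blast
qed

definition dirD :: "real^'n \<Rightarrow> (real^'n \<Rightarrow> real) \<Rightarrow> real^'n \<Rightarrow> real" where
  "dirD w f x = (\<Sum>i\<in>UNIV. w $ i * partial i f x)"

lemma dirD_has_derivative:
  assumes "Ck (Suc k) f"
  shows "((\<lambda>s. f (x + s *\<^sub>R w)) has_real_derivative dirD w f (x + s *\<^sub>R w)) (at s)"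
proof -
  have "((\<lambda>s. x + s *\<^sub>R w) has_derivative (\<lambda>h. h *\<^sub>R w)) (at s)"
    by (auto intro!: derivative_eq_intros)
  from diff_chain_at[OF this Ck_has_derivative[OF assms]]
  have "((\<lambda>s. f (x + s *\<^sub>R w)) has_derivative (\<lambda>h. \<Sum>i\<in>UNIV. (h *\<^sub>R w) $ i * partial i f (x + s *\<^sub>R w))) (at s)"
    by (simp add: o_def)
  then show ?thesis
    by (rule has_derivative_imp_has_field_derivative) (simp add: dirD_def sum_distrib_left algebra_simps)
qed

text \<open>The mean value theorem in direction i, then in direction j. As the second difference is
  symmetric in i and j, it is also given by the other mixed derivative, and shrinking s yields
  \<open>partial_commute\<close>.\<close>

lemma second_difference:
  fixes f :: "real^'n \<Rightarrow> real"
  assumes "Ck (Suc (Suc k)) f"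
  obtains \<sigma> \<tau> where "\<bar>\<sigma>\<bar> \<le> \<bar>s\<bar>" "\<bar>\<tau>\<bar> \<le> \<bar>s\<bar>"
    "f (x + s *\<^sub>R axis i 1 + s *\<^sub>R axis j 1) - f (x + s *\<^sub>R axis i 1) - f (x + s *\<^sub>R axis j 1) + f x
     = s * s * partial j (partial i f) (x + \<sigma> *\<^sub>R axis i 1 + \<tau> *\<^sub>R axis j 1)"
proof -
  let ?i = "axis i (1::real)" and ?j = "axis j (1::real)"
  define g where "g u = f (x + s *\<^sub>R ?j + u *\<^sub>R ?i) - f (x + u *\<^sub>R ?i)" for u
  have g: "(g has_real_derivative (partial i f (x + s *\<^sub>R ?j + u *\<^sub>R ?i) - partial i f (x + u *\<^sub>R ?i))) (at u)" for u
    unfolding g_def by (intro DERIV_diff Ck_has_partial[OF assms])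
  obtain \<sigma> where \<sigma>: "\<bar>\<sigma>\<bar> \<le> \<bar>s\<bar>"
      "g s - g 0 = s * (partial i f (x + s *\<^sub>R ?j + \<sigma> *\<^sub>R ?i) - partial i f (x + \<sigma> *\<^sub>R ?i))"
    by (rule real_MVT_from_0[OF g, of s])
  have h: "((\<lambda>u. partial i f ((x + \<sigma> *\<^sub>R ?i) + u *\<^sub>R ?j)) has_real_derivative partial j (partial i f) ((x + \<sigma> *\<^sub>R ?i) + u *\<^sub>R ?j)) (at u)" for u
    by (rule Ck_has_partial[OF Ck_partial[OF assms]])
  obtain \<tau> where \<tau>: "\<bar>\<tau>\<bar> \<le> \<bar>s\<bar>"
      "partial i f ((x + \<sigma> *\<^sub>R ?i) + s *\<^sub>R ?j) - partial i f ((x + \<sigma> *\<^sub>R ?i) + 0 *\<^sub>R ?j)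
       = s * partial j (partial i f) ((x + \<sigma> *\<^sub>R ?i) + \<tau> *\<^sub>R ?j)"
    by (rule real_MVT_from_0[OF h, of s])
  have swap: "x + s *\<^sub>R ?j + u *\<^sub>R ?i = x + u *\<^sub>R ?i + s *\<^sub>R ?j" for u by simp
  show thesis
  proof (rule that[OF \<sigma>(1) \<tau>(1)])
    show "f (x + s *\<^sub>R ?i + s *\<^sub>R ?j) - f (x + s *\<^sub>R ?i) - f (x + s *\<^sub>R ?j) + f x
     = s * s * partial j (partial i f) (x + \<sigma> *\<^sub>R ?i + \<tau> *\<^sub>R ?j)"
      using \<sigma>(2) \<tau>(2) unfolding g_def swap by simp
  qed
qed

lemma partial_commute:
  fixes f :: "real^'n \<Rightarrow> real"
  assumes f: "Ck (Suc (Suc k)) f"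
  shows "partial i (partial j f) = partial j (partial i f)"
proof
  fix x :: "real^'n"
  define s where "s n = 1 / real (Suc n)" for n
  have s: "s \<longlonglongrightarrow> 0" "\<And>n. s n \<noteq> 0" unfolding s_def by (rule LIMSEQ_Suc[OF lim_1_over_n], simp)
  let ?D = "\<lambda>n. f (x + s n *\<^sub>R axis i 1 + s n *\<^sub>R axis j 1) - f (x + s n *\<^sub>R axis i 1) - f (x + s n *\<^sub>R axis j 1) + f x"
  have "\<exists>\<sigma> \<tau>. \<bar>\<sigma>\<bar> \<le> \<bar>s n\<bar> \<and> \<bar>\<tau>\<bar> \<le> \<bar>s n\<bar> \<and> ?D n = s n * s n * partial j (partial i f) (x + \<sigma> *\<^sub>R axis i 1 + \<tau> *\<^sub>R axis j 1)" for n
    using second_difference[OF f, of "s n" x i j] by metis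
  then obtain \<sigma> \<tau> where 1: "\<And>n. \<bar>\<sigma> n\<bar> \<le> \<bar>s n\<bar>" "\<And>n. \<bar>\<tau> n\<bar> \<le> \<bar>s n\<bar>"
     "\<And>n. ?D n = s n * s n * partial j (partial i f) (x + \<sigma> n *\<^sub>R axis i 1 + \<tau> n *\<^sub>R axis j 1)" by metis
  have sw: "?D n = f (x + s n *\<^sub>R axis j 1 + s n *\<^sub>R axis i 1) - f (x + s n *\<^sub>R axis j 1) - f (x + s n *\<^sub>R axis i 1) + f x" for n
    by (simp add: add.commute add.left_commute)
  have "\<exists>\<sigma> \<tau>. \<bar>\<sigma>\<bar> \<le> \<bar>s n\<bar> \<and> \<bar>\<tau>\<bar> \<le> \<bar>s n\<bar> \<and> ?D n = s n * s n * partial i (partial j f) (x + \<sigma> *\<^sub>R axis j 1 + \<tau> *\<^sub>R axis i 1)" for n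
    unfolding sw using second_difference[OF f, of "s n" x j i] by metis
  then obtain \<sigma>' \<tau>' where 2: "\<And>n. \<bar>\<sigma>' n\<bar> \<le> \<bar>s n\<bar>" "\<And>n. \<bar>\<tau>' n\<bar> \<le> \<bar>s n\<bar>"
     "\<And>n. ?D n = s n * s n * partial i (partial j f) (x + \<sigma>' n *\<^sub>R axis j 1 + \<tau>' n *\<^sub>R axis i 1)" by metis
  have eq: "partial j (partial i f) (x + \<sigma> n *\<^sub>R axis i 1 + \<tau> n *\<^sub>R axis j 1) = partial i (partial j f) (x + \<sigma>' n *\<^sub>R axis j 1 + \<tau>' n *\<^sub>R axis i 1)" for n
    using 1(3)[of n] 2(3)[of n] s(2)[of n] by simp
  have to0: "r \<longlonglongrightarrow> 0" if "\<And>n. \<bar>r n\<bar> \<le> \<bar>s n\<bar>" for r :: "nat \<Rightarrow> real"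
    by (rule Lim_null_comparison[OF _ tendsto_rabs_zero[OF s(1)]]) (use that in auto)
  have lim: "(\<lambda>n. g (x + a n *\<^sub>R axis i 1 + b n *\<^sub>R axis j 1)) \<longlonglongrightarrow> g x"
    if "continuous_on UNIV g" "a \<longlonglongrightarrow> 0" "b \<longlonglongrightarrow> 0" for g :: "real^'n \<Rightarrow> real" and a b i j
  proof -
    have "(\<lambda>n. x + a n *\<^sub>R axis i 1 + b n *\<^sub>R axis j 1) \<longlonglongrightarrow> x + 0 *\<^sub>R axis i 1 + 0 *\<^sub>R axis j 1"
      by (intro tendsto_intros that)
    then show ?thesis using continuous_on_tendsto_compose[OF that(1), of _ x] by simp
  qed
  have c: "continuous_on UNIV (partial j (partial i f))" "continuous_on UNIV (partial i (partial j f))"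
    using Ck_cont[OF Ck_partial[OF Ck_partial[OF f]]] by auto
  show "partial i (partial j f) x = partial j (partial i f) x"
    using LIMSEQ_unique[OF lim[OF c(1) to0[OF 1(1)] to0[OF 1(2)], of i j, unfolded eq] lim[OF c(2) to0[OF 2(1)] to0[OF 2(2)]]] ..
qed

subsection \<open>Test functions and integration by parts\<close>

lemma closure_supp_mono: "(\<And>x. f x = 0 \<Longrightarrow> g x = 0) \<Longrightarrow> closure {x. g x \<noteq> 0} \<subseteq> closure {x. f x \<noteq> (0::real)}"
  by (intro closure_mono) auto

lemma supp_partial: "closure {x. partial i f x \<noteq> 0} \<subseteq> closure {x. f x \<noteq> 0}"
proof (rule closure_minimal)
  show "{x. partial i f x \<noteq> 0} \<subseteq> closure {x. f x \<noteq> 0}"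
  proof (intro subsetI, rule ccontr)
    fix x assume x: "x \<in> {x. partial i f x \<noteq> 0}" "x \<notin> closure {x. f x \<noteq> 0}"
    define O' where "O' = - closure {x. f x \<noteq> 0}"
    have O': "open O'" "x \<in> O'" "\<And>y. y \<in> O' \<Longrightarrow> f y = 0"
      using x(2) closure_subset[of "{x. f x \<noteq> 0}"] by (auto simp: O'_def)
    have "isCont (\<lambda>s. x + s *\<^sub>R axis i 1) 0" by (intro continuous_intros)
    then have "((\<lambda>s. x + s *\<^sub>R axis i 1) \<longlongrightarrow> x + 0 *\<^sub>R axis i 1) (nhds 0)"
      using tendsto_at_iff_tendsto_nhds[of "\<lambda>s. x + s *\<^sub>R axis i 1" 0] by (simp only: isCont_def)
    then have "\<forall>\<^sub>F s in nhds 0. x + s *\<^sub>R axis i 1 \<in> O'" by (rule topological_tendstoD) (use O' in auto)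
    then have "\<forall>\<^sub>F s in nhds 0. f (x + s *\<^sub>R axis i 1) = 0" by eventually_elim (rule O')
    then have "((\<lambda>s. f (x + s *\<^sub>R axis i 1)) has_real_derivative 0) (at 0)"
      by (subst DERIV_cong_ev[where g = "\<lambda>_. 0" and y = 0 and v = 0]) auto
    then show False using x(1) partialI by blast
  qed
qed simp

lemma compact_closed_subset: "compact K \<Longrightarrow> closed S \<Longrightarrow> S \<subseteq> K \<Longrightarrow> compact (S :: 'a::t2_space set)"
  by (metis compact_Int_closed inf.absorb_iff2)

lemma compact_supp_bounded:
  fixes f :: "'a::euclidean_space \<Rightarrow> real"
  assumes "continuous_on UNIV f" "compact (closure {x. f x \<noteq> 0})"
  obtains B where "\<And>x. \<bar>f x\<bar> \<le> B" "0 \<le> B"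
proof -
  have "bounded (f ` closure {x. f x \<noteq> 0})"
    using assms by (intro compact_imp_bounded compact_continuous_image) (auto intro: continuous_on_subset)
  then obtain B where B: "\<And>x. x \<in> closure {x. f x \<noteq> 0} \<Longrightarrow> \<bar>f x\<bar> \<le> B"
    unfolding bounded_iff by (metis imageI real_norm_def)
  have "\<bar>f x\<bar> \<le> max B 0" for x
  proof (cases "f x = 0")
    case False
    then show ?thesis using B[of x] closure_subset[of "{x. f x \<noteq> 0}"] by auto
  qed simp
  then show thesis using that[of "max B 0"] by simp
qed

lemma compact_supp_integrable:
  fixes f :: "'a::euclidean_space \<Rightarrow> real"
  assumes "continuous_on UNIV f" "compact (closure {x. f x \<noteq> 0})"
  shows "integrable lborel f"
proof -
  let ?K = "closure {x. f x \<noteq> 0}"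
  have "integrable lborel (\<lambda>x. indicator ?K x *\<^sub>R f x)"
    using assms by (intro borel_integrable_compact) (auto intro: continuous_on_subset)
  moreover have "(\<lambda>x. indicator ?K x *\<^sub>R f x) = f"
    using closure_subset[of "{x. f x \<noteq> 0}"] by (auto simp: indicator_def fun_eq_iff)
  ultimately show ?thesis by (simp only:)
qed

lemma integral_translate:
  fixes f :: "'a::euclidean_space \<Rightarrow> real"
  assumes "f \<in> borel_measurable lborel"
  shows "(\<integral>x. f (x + a) \<partial>lborel) = (\<integral>x. f x \<partial>lborel)"
proof -
  have "(\<integral>x. f x \<partial>lborel) = (\<integral>x. f x \<partial>distr lborel borel ((+) a))" by (simp add: lborel_distr_plus)
  also have "\<dots> = (\<integral>x. f (a + x) \<partial>lborel)" using assms by (intro integral_distr) auto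
  finally show ?thesis by (simp add: add.commute)
qed

text \<open>Translation invariance makes the integral of every difference quotient 0, and dominated
  convergence passes to the derivative. No iterated integration is involved.\<close>

lemma integral_partial_zero:
  fixes f :: "real^'n \<Rightarrow> real"
  assumes f: "Ck (Suc k) f" and c: "compact (closure {x. f x \<noteq> 0})"
  shows "(\<integral>x. partial i f x \<partial>lborel) = 0"
proof -
  let ?e = "axis i (1::real) :: real^'n"
  have cont: "continuous_on UNIV f" by (rule Ck_cont[OF f])
  have cont': "continuous_on UNIV (partial i f)" by (rule Ck_cont[OF Ck_partial[OF f]])
  have c': "compact (closure {x. partial i f x \<noteq> 0})"
    by (rule compact_closed_subset[OF c closed_closure supp_partial])
  obtain B where B: "\<And>x. \<bar>partial i f x\<bar> \<le> B" "0 \<le> B" using compact_supp_bounded[OF cont' c'] by metis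
  obtain R where R: "closure {x. f x \<noteq> 0} \<subseteq> cball 0 R"
    using compact_imp_bounded[OF c] unfolding bounded_iff by (auto simp: subset_eq)
  have zero: "f x = 0" if "R < norm x" for x
    using R closure_subset[of "{x. f x \<noteq> 0}"] that by force
  define s where "s n = 1 / real (Suc n)" for n
  have s: "s \<longlonglongrightarrow> 0" "\<And>n. s n \<noteq> 0" "\<And>n. 0 < s n" "\<And>n. s n \<le> 1"
    unfolding s_def by (rule LIMSEQ_Suc[OF lim_1_over_n], simp_all)
  define Dq where "Dq n x = (f (x + s n *\<^sub>R ?e) - f x) / s n" for n x
  have [measurable]: "f \<in> borel_measurable borel" using cont by (rule borel_measurable_continuous_onI)
  have [measurable]: "partial i f \<in> borel_measurable borel" using cont' by (rule borel_measurable_continuous_onI)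
  have "(\<lambda>n. \<integral>x. Dq n x \<partial>lborel) \<longlonglongrightarrow> (\<integral>x. partial i f x \<partial>lborel)"
  proof (rule integral_dominated_convergence)
    \<comment> \<open>The steps \<open>s n\<close> are at most 1, so all difference quotients vanish
      outside the ball of radius R + 1.\<close>
    show "integrable lborel (\<lambda>x::real^'n. B * indicator (cball 0 (R + 1)) x)"
      using emeasure_bounded_finite[OF bounded_cball[of "0 :: real^'n" "R + 1"]]
      by (intro integrable_mult_right integrable_real_indicator) auto
    show "AE x in lborel. (\<lambda>n. Dq n x) \<longlonglongrightarrow> partial i f x"
    proof (intro AE_I2)
      fix x :: "real^'n"
      have "((\<lambda>h. (f (x + h *\<^sub>R ?e) - f x) / h) \<longlongrightarrow> partial i f x) (at 0)"
        using Ck_has_partial[OF f, of x i 0] by (simp add: DERIV_def)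
      moreover have "filterlim s (at 0) sequentially" using s by (intro filterlim_atI) auto
      ultimately show "(\<lambda>n. Dq n x) \<longlonglongrightarrow> partial i f x"
        unfolding Dq_def by (rule filterlim_compose)
    qed
    fix n
    show "AE x in lborel. norm (Dq n x) \<le> B * indicator (cball 0 (R + 1)) x"
    proof (intro AE_I2)
      fix x :: "real^'n"
      obtain \<theta> where "f (x + s n *\<^sub>R ?e) - f (x + 0 *\<^sub>R ?e) = s n * partial i f (x + \<theta> *\<^sub>R ?e)"
        using real_MVT_from_0[OF Ck_has_partial[OF f, of x i], of "s n"] by metis
      then have "Dq n x = partial i f (x + \<theta> *\<^sub>R ?e)" unfolding Dq_def using s(2)[of n] by simp
      then have 1: "\<bar>Dq n x\<bar> \<le> B" using B by simp
      have 2: "Dq n x = 0" if "R + 1 < norm x"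
      proof -
        have "norm x \<le> norm (x + s n *\<^sub>R ?e) + norm (s n *\<^sub>R ?e)"
          using norm_triangle_ineq4[of "x + s n *\<^sub>R ?e" "s n *\<^sub>R ?e"] by simp
        also have "norm (s n *\<^sub>R ?e) \<le> 1" using s(3,4)[of n] by simp
        finally have "R < norm (x + s n *\<^sub>R ?e)" using that by simp
        then show ?thesis using zero that by (simp add: Dq_def)
      qed
      show "norm (Dq n x) \<le> B * indicator (cball 0 (R + 1)) x"
        using 1 2 by (cases "R + 1 < norm x") (auto simp: indicator_def)
    qed
  qed (auto simp: Dq_def)
  moreover have "(\<integral>x. Dq n x \<partial>lborel) = 0" for n
  proof -
    have i: "integrable lborel f" by (rule compact_supp_integrable[OF cont c])
    have "integrable lborel (\<lambda>x. f (s n *\<^sub>R ?e + x))"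
      using i by (subst integrable_distr_eq[symmetric, where N = borel and g = "(+) (s n *\<^sub>R ?e)"]) (auto simp: lborel_distr_plus)
    then have "integrable lborel (\<lambda>x. f (x + s n *\<^sub>R ?e))" by (simp add: add.commute)
    then show ?thesis unfolding Dq_def using i integral_translate[of f "s n *\<^sub>R ?e"] by simp
  qed
  ultimately show ?thesis by (simp add: LIMSEQ_const_iff)
qed

lemma integral_by_parts:
  fixes f g :: "real^'n \<Rightarrow> real"
  assumes f: "Ck (Suc k) f" and c: "compact (closure {x. f x \<noteq> 0})" and g: "Ck (Suc k) g"
  shows "(\<integral>x. partial i f x * g x \<partial>lborel) = - (\<integral>x. f x * partial i g x \<partial>lborel)"
proof -
  have cs: "compact (closure {x. h x \<noteq> 0})" if "\<And>x. f x = 0 \<Longrightarrow> h x = 0" for h :: "real^'n \<Rightarrow> real"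
    by (rule compact_closed_subset[OF c closed_closure closure_supp_mono]) (rule that)
  have c1: "compact (closure {x. f x * g x \<noteq> 0})" by (rule cs) simp
  have c2: "compact (closure {x. f x * partial i g x \<noteq> 0})" by (rule cs) simp
  have c3: "compact (closure {x. partial i f x * g x \<noteq> 0})"
    by (rule compact_closed_subset[OF c closed_closure order_trans[OF closure_supp_mono supp_partial[of i f]]]) simp
  have i2: "integrable lborel (\<lambda>x. f x * partial i g x)"
    by (intro compact_supp_integrable c2 continuous_on_mult Ck_cont[OF f] Ck_cont[OF Ck_partial[OF g]])
  have i3: "integrable lborel (\<lambda>x. partial i f x * g x)"
    by (intro compact_supp_integrable c3 continuous_on_mult Ck_cont[OF g] Ck_cont[OF Ck_partial[OF f]])
  have "(\<integral>x. partial i (\<lambda>x. f x * g x) x \<partial>lborel) = 0"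
    by (rule integral_partial_zero[OF Ck_mult[OF f g] c1])
  then show ?thesis unfolding partial_mult[OF f g] using i2 i3 by simp
qed

lemma test_fun_Ck: "test_fun \<Omega> f \<Longrightarrow> Ck k f"
  and test_fun_compact: "test_fun \<Omega> f \<Longrightarrow> compact (closure {x. f x \<noteq> 0})"
  and test_fun_subset: "test_fun \<Omega> f \<Longrightarrow> closure {x. f x \<noteq> 0} \<subseteq> \<Omega>"
  by (auto simp: test_fun_def)

lemma test_fun_outside: "test_fun \<Omega> f \<Longrightarrow> x \<notin> \<Omega> \<Longrightarrow> f x = 0"
  using test_fun_subset[of \<Omega> f] closure_subset[of "{x. f x \<noteq> 0}"] by blast

lemma test_fun_cont: "test_fun \<Omega> f \<Longrightarrow> continuous_on UNIV f"
  using Ck_cont[OF test_fun_Ck] .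

lemma test_funI:
  assumes f: "test_fun \<Omega> f" and g: "\<And>k. Ck k g" and s: "closure {x. g x \<noteq> 0} \<subseteq> closure {x. f x \<noteq> 0}"
  shows "test_fun \<Omega> g"
  unfolding test_fun_def
proof (intro conjI allI g)
  show "compact (closure {x. g x \<noteq> 0})"
    by (rule compact_closed_subset[OF test_fun_compact[OF f] _ s]) simp
  show "closure {x. g x \<noteq> 0} \<subseteq> \<Omega>" using s test_fun_subset[OF f] by blast
qed

lemma test_fun_0: "test_fun \<Omega> (\<lambda>x. 0)"
  by (simp add: test_fun_def Ck_const)

lemma test_fun_partial: "test_fun \<Omega> f \<Longrightarrow> test_fun \<Omega> (partial i f)"
  by (rule test_funI[OF _ Ck_partial[OF test_fun_Ck] supp_partial])

lemma test_fun_cmult: "test_fun \<Omega> f \<Longrightarrow> test_fun \<Omega> (\<lambda>x. c * f x)"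
  by (rule test_funI[OF _ Ck_cmult[OF test_fun_Ck] closure_supp_mono]) auto

lemma test_fun_add:
  assumes "test_fun \<Omega> f" "test_fun \<Omega> g"
  shows "test_fun \<Omega> (\<lambda>x. f x + g x)"
proof -
  have s: "closure {x. f x + g x \<noteq> 0} \<subseteq> closure {x. f x \<noteq> 0} \<union> closure {x. g x \<noteq> 0}"
    unfolding closure_Un[symmetric] by (intro closure_mono) auto
  have "compact (closure {x. f x + g x \<noteq> 0})"
    by (rule compact_closed_subset[OF compact_Un[OF test_fun_compact[OF assms(1)] test_fun_compact[OF assms(2)]] _ s]) simp
  moreover have "closure {x. f x + g x \<noteq> 0} \<subseteq> \<Omega>"
    using s test_fun_subset[OF assms(1)] test_fun_subset[OF assms(2)] by blast
  ultimately show ?thesis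
    unfolding test_fun_def using Ck_add[OF test_fun_Ck[OF assms(1)] test_fun_Ck[OF assms(2)]] by blast
qed

lemma test_fun_sum: "(\<And>i. i \<in> S \<Longrightarrow> test_fun \<Omega> (f i)) \<Longrightarrow> test_fun \<Omega> (\<lambda>x. \<Sum>i\<in>S. f i x)"
  by (induction S rule: infinite_finite_induct) (auto intro: test_fun_0 test_fun_add)

lemma test_fun_diff: "test_fun \<Omega> f \<Longrightarrow> test_fun \<Omega> g \<Longrightarrow> test_fun \<Omega> (\<lambda>x. f x - g x)"
  using test_fun_add[of \<Omega> f "\<lambda>x. -1 * g x"] test_fun_cmult[of \<Omega> g "-1"] by simp

lemma test_fun_laplacian: "test_fun \<Omega> f \<Longrightarrow> test_fun \<Omega> (laplacian f)"
  unfolding laplacian_def[abs_def] by (intro test_fun_sum test_fun_partial)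

lemma test_fun_laplacian_pow: "test_fun \<Omega> f \<Longrightarrow> test_fun \<Omega> ((laplacian ^^ m) f)"
  by (induction m) (auto intro: test_fun_laplacian)

lemma test_fun_dirD: "test_fun \<Omega> f \<Longrightarrow> test_fun \<Omega> (dirD w f)"
  unfolding dirD_def[abs_def] by (intro test_fun_sum test_fun_cmult test_fun_partial)

lemma test_fun_dirD_pow: "test_fun \<Omega> f \<Longrightarrow> test_fun \<Omega> ((dirD w ^^ m) f)"
  by (induction m) (auto intro: test_fun_dirD)

lemma test_fun_integrable_mult:
  assumes "test_fun \<Omega> f" "continuous_on UNIV g"
  shows "integrable lborel (\<lambda>x. f x * g x)"
proof (rule compact_supp_integrable)
  show "continuous_on UNIV (\<lambda>x. f x * g x)" using assms test_fun_cont by (intro continuous_on_mult)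
  show "compact (closure {x. f x * g x \<noteq> 0})"
    by (rule compact_closed_subset[OF test_fun_compact[OF assms(1)] _ closure_supp_mono]) auto
qed

lemma test_fun_parts:
  assumes "test_fun \<Omega> f" "test_fun \<Omega> g"
  shows "(\<integral>x. partial i f x * g x \<partial>lborel) = - (\<integral>x. f x * partial i g x \<partial>lborel)"
  by (rule integral_by_parts[OF test_fun_Ck[OF assms(1)] test_fun_compact[OF assms(1)] test_fun_Ck[OF assms(2), of "Suc 0"]])

lemma laplacian_parts:
  assumes f: "test_fun \<Omega> f" and g: "test_fun \<Omega> g"
  shows "(\<integral>x. laplacian f x * g x \<partial>lborel) = - (\<Sum>i\<in>UNIV. \<integral>x. partial i f x * partial i g x \<partial>lborel)"
proof -
  have "(\<integral>x. laplacian f x * g x \<partial>lborel) = (\<Sum>i\<in>UNIV. \<integral>x. partial i (partial i f) x * g x \<partial>lborel)"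
    unfolding laplacian_def sum_distrib_right
    by (intro Bochner_Integration.integral_sum test_fun_integrable_mult[of \<Omega>] test_fun_partial f test_fun_cont[OF g])
  then show ?thesis
    by (simp add: test_fun_parts[OF test_fun_partial[OF f] g] sum_negf)
qed

lemma laplacian_sym:
  assumes f: "test_fun \<Omega> f" and g: "test_fun \<Omega> g"
  shows "(\<integral>x. laplacian f x * g x \<partial>lborel) = (\<integral>x. f x * laplacian g x \<partial>lborel)"
  using laplacian_parts[OF f g] laplacian_parts[OF g f] by (simp add: mult.commute)

lemma laplacian_pow_sym:
  assumes f: "test_fun \<Omega> f" and g: "test_fun \<Omega> g"
  shows "(\<integral>x. (laplacian ^^ m) f x * g x \<partial>lborel) = (\<integral>x. f x * (laplacian ^^ m) g x \<partial>lborel)"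
  using g
proof (induction m arbitrary: g)
  case (Suc m)
  have "(\<integral>x. (laplacian ^^ Suc m) f x * g x \<partial>lborel) = (\<integral>x. (laplacian ^^ m) f x * laplacian g x \<partial>lborel)"
    using laplacian_sym[OF test_fun_laplacian_pow[OF f] Suc.prems, of m] by simp
  also have "\<dots> = (\<integral>x. f x * (laplacian ^^ m) (laplacian g) x \<partial>lborel)"
    by (rule Suc.IH[OF test_fun_laplacian[OF Suc.prems]])
  finally show ?case by (simp add: funpow_swap1)
qed simp

text \<open>Half of the Laplacians are moved across. What remains is the integral of (\<Delta>^k
  f)^2 for m = 2k, and of the squared gradient of \<Delta>^k f for m = 2k + 1.\<close>

lemma laplacian_pow_pos:
  assumes f: "test_fun \<Omega> f"
  shows "0 \<le> (\<integral>x. ((-1) ^ m * (laplacian ^^ m) f x) * f x \<partial>lborel)"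
proof (cases "even m")
  case True
  then obtain k where m: "m = k + k" by (metis evenE mult_2)
  have "(\<integral>x. (laplacian ^^ (k + k)) f x * f x \<partial>lborel) = (\<integral>x. (laplacian ^^ k) f x * (laplacian ^^ k) f x \<partial>lborel)"
    unfolding funpow_add o_def by (rule laplacian_pow_sym[OF test_fun_laplacian_pow[OF f] f])
  also have "\<dots> \<ge> 0" by (intro integral_nonneg_AE) auto
  finally show ?thesis using True by (simp add: m)
next
  case False
  then obtain k where m: "m = Suc (k + k)" by (metis oddE mult_2 Suc_eq_plus1)
  let ?g = "(laplacian ^^ k) f"
  have g: "test_fun \<Omega> ?g" by (rule test_fun_laplacian_pow[OF f])
  have "(laplacian ^^ m) f = (laplacian ^^ k) (laplacian ?g)"
    unfolding m funpow_swap1[symmetric] by (simp add: funpow_add funpow_swap1)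
  then have "(\<integral>x. (laplacian ^^ m) f x * f x \<partial>lborel) = (\<integral>x. laplacian ?g x * ?g x \<partial>lborel)"
    using laplacian_pow_sym[OF test_fun_laplacian[OF g] f, of k] by simp
  also have "\<dots> = - (\<Sum>i\<in>UNIV. \<integral>x. partial i ?g x * partial i ?g x \<partial>lborel)"
    by (rule laplacian_parts[OF g g])
  also have "\<dots> \<le> 0" by (auto intro!: sum_nonneg integral_nonneg_AE)
  finally show ?thesis using False by simp
qed

lemma l2_inner_test:
  assumes "test_fun \<Omega> g"
  shows "l2_inner \<Omega> f g = (\<integral>x. f x * g x \<partial>lborel)"
  unfolding l2_inner_def set_lebesgue_integral_def
  by (intro Bochner_Integration.integral_cong) (use test_fun_outside[OF assms] in \<open>auto simp: indicator_def\<close>)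

lemma dirD_parts:
  assumes f: "test_fun \<Omega> f" and g: "test_fun \<Omega> g"
  shows "(\<integral>x. dirD w f x * g x \<partial>lborel) = - (\<integral>x. f x * dirD w g x \<partial>lborel)"
proof -
  have 1: "(\<integral>x. dirD w f x * g x \<partial>lborel) = (\<Sum>i\<in>UNIV. w $ i * (\<integral>x. partial i f x * g x \<partial>lborel))"
    unfolding dirD_def sum_distrib_right mult.assoc
    by (subst Bochner_Integration.integral_sum)
      (auto intro!: integrable_mult_right test_fun_integrable_mult[of \<Omega>] test_fun_partial f test_fun_cont[OF g])
  have "(\<integral>x. f x * dirD w g x \<partial>lborel) = (\<integral>x. dirD w g x * f x \<partial>lborel)" by (simp add: mult.commute)
  also have "\<dots> = (\<Sum>i\<in>UNIV. w $ i * (\<integral>x. partial i g x * f x \<partial>lborel))"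
    unfolding dirD_def sum_distrib_right mult.assoc
    by (subst Bochner_Integration.integral_sum)
      (auto intro!: integrable_mult_right test_fun_integrable_mult[of \<Omega>] test_fun_partial g test_fun_cont[OF f])
  finally have 2: "(\<integral>x. f x * dirD w g x \<partial>lborel) = (\<Sum>i\<in>UNIV. w $ i * (\<integral>x. partial i g x * f x \<partial>lborel))" .
  show ?thesis unfolding 1 2 test_fun_parts[OF f g] by (simp add: sum_negf mult.commute)
qed

lemma dirD_pow_parts:
  assumes f: "test_fun \<Omega> f" and g: "test_fun \<Omega> g"
  shows "(\<integral>x. (dirD w ^^ m) f x * g x \<partial>lborel) = (-1) ^ m * (\<integral>x. f x * (dirD w ^^ m) g x \<partial>lborel)"
  using g
proof (induction m arbitrary: g)
  case (Suc m)
  have "(\<integral>x. (dirD w ^^ Suc m) f x * g x \<partial>lborel) = - (\<integral>x. (dirD w ^^ m) f x * dirD w g x \<partial>lborel)"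
    using dirD_parts[OF test_fun_dirD_pow[OF f] Suc.prems, of w m] by simp
  also have "\<dots> = - ((-1) ^ m * (\<integral>x. f x * (dirD w ^^ m) (dirD w g) x \<partial>lborel))"
    by (subst Suc.IH[OF test_fun_dirD[OF Suc.prems]]) simp
  finally show ?case by (simp add: funpow_swap1)
qed simp

lemma dirD_pow_square:
  assumes f: "test_fun \<Omega> f"
  shows "(\<integral>x. ((dirD w ^^ m) f x)\<^sup>2 \<partial>lborel) = (-1) ^ m * (\<integral>x. f x * (dirD w ^^ (2 * m)) f x \<partial>lborel)"
  using dirD_pow_parts[OF f test_fun_dirD_pow[OF f, where w = w and m = m], where w = w and m = m]
  by (simp add: power2_eq_square mult_2 funpow_add)

subsection \<open>Powers of a directional derivative as a polynomial in the direction\<close>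

text \<open>Words of indices in place of multi-indices: powers of a directional derivative then
  expand without multinomial coefficients.\<close>

definition mpartial :: "'n list \<Rightarrow> (real^'n \<Rightarrow> real) \<Rightarrow> real^'n \<Rightarrow> real" where
  "mpartial l f = foldr partial l f"

lemma mpartial_simps [simp]: "mpartial [] f = f" "mpartial (i # l) f = partial i (mpartial l f)"
  by (simp_all add: mpartial_def)

lemma smooth_mpartial: "(\<And>k. Ck k f) \<Longrightarrow> Ck k (mpartial l f)"
  by (induction l arbitrary: k) (auto simp del: Ck.simps intro!: Ck_partial)

lemma sum_lists_Suc:
  fixes h :: "'n::finite list \<Rightarrow> real"
  shows "(\<Sum>l | length l = Suc k. h l) = (\<Sum>i\<in>UNIV. \<Sum>l | length l = k. h (i # l))"
proof -
  have "(\<Sum>i\<in>UNIV. \<Sum>l | length l = k. h (i # l)) = (\<Sum>(i, l)\<in>UNIV \<times> {l. length l = k}. h (i # l))"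
    by (simp add: sum.cartesian_product)
  also have "\<dots> = (\<Sum>l | length l = Suc k. h l)"
    by (rule sum.reindex_bij_witness[of _ "\<lambda>l. (hd l, tl l)" "\<lambda>(i, l). i # l"]) (auto simp: length_Suc_conv)
  finally show ?thesis ..
qed

lemma dirD_pow_eq:
  fixes f :: "real^'n \<Rightarrow> real"
  assumes f: "\<And>k. Ck k f"
  shows "(dirD w ^^ k) f = (\<lambda>x. \<Sum>l | length l = k. (\<Prod>i\<leftarrow>l. w $ i) * mpartial l f x)"
proof (induction k)
  case (Suc k)
  have "dirD w ((dirD w ^^ k) f) x = (\<Sum>i\<in>UNIV. w $ i * (\<Sum>l | length l = k. (\<Prod>i\<leftarrow>l. w $ i) * partial i (mpartial l f) x))" for x
    unfolding Suc dirD_def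
    by (subst partial_sum[where k = 0])
      (auto intro!: Ck_cmult smooth_mpartial f simp: partial_cmult[OF smooth_mpartial[OF f, of "Suc 0"]] simp del: Ck.simps)
  then show ?case by (auto simp: sum_lists_Suc sum_distrib_left mult.assoc)
qed (auto simp: fun_eq_iff)

section \<open>The one-dimensional Hardy inequality of order m\<close>

text \<open>Integrate (h' r^k - \<kappa> h r^(k+1))^2 \<ge> 0 with r = 1 / (s - a). Up to a multiple
  of h^2 r^(2k+2) the cross term is the derivative of \<open>F\<close>, whose boundary values have
  the right sign. The choice \<kappa> = (2k+1) / 2 maximises the resulting constant \<kappa> (2k+1)
  - \<kappa>^2.\<close>

lemma Hardy_step:
  fixes h h' :: "real \<Rightarrow> real"
  assumes ab: "a < \<alpha>" "\<alpha> \<le> b"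
    and d: "\<And>s. (h has_real_derivative h' s) (at s)" and c: "continuous_on UNIV h'" and z: "h \<alpha> = 0"
  shows "((2 * real k + 1) / 2)\<^sup>2 * integral {\<alpha>..b} (\<lambda>s. (h s)\<^sup>2 * inverse (s - a) ^ (2 * Suc k))
     \<le> integral {\<alpha>..b} (\<lambda>s. (h' s)\<^sup>2 * inverse (s - a) ^ (2 * k))"
proof -
  define \<kappa> where "\<kappa> = (2 * real k + 1) / 2"
  define r where "r s = inverse (s - a)" for s
  have ch: "continuous_on A h" for A
    using d by (meson DERIV_isCont continuous_at_imp_continuous_on)
  have ch': "continuous_on A h'" for A using c continuous_on_subset by blast
  have cr: "continuous_on {\<alpha>..b} r" unfolding r_def using ab by (intro continuous_intros) auto
  have dr: "(r has_real_derivative - (r s)\<^sup>2) (at s within {\<alpha>..b})" if "s \<in> {\<alpha>..b}" for s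
    unfolding r_def using that ab by (auto intro!: derivative_eq_intros simp: power2_eq_square)
  define F where "F s = \<kappa> * (h s)\<^sup>2 * r s ^ (2 * k + 1)" for s
  define F' where "F' s = 2 * \<kappa> * h s * h' s * r s ^ (2 * k + 1) - \<kappa> * (2 * real k + 1) * (h s)\<^sup>2 * r s ^ (2 * Suc k)" for s
  have "(F has_real_derivative F' s) (at s within {\<alpha>..b})" if s: "s \<in> {\<alpha>..b}" for s
    unfolding F_def F'_def
    by (rule derivative_eq_intros dr[OF s] has_field_derivative_at_within[OF d] refl)+
      (simp add: power2_eq_square algebra_simps)
  then have "(F' has_integral (F b - F \<alpha>)) {\<alpha>..b}"
    using ab by (intro fundamental_theorem_of_calculus) (simp_all add: has_real_derivative_iff_has_vector_derivative)
  then have F': "F' integrable_on {\<alpha>..b}" "integral {\<alpha>..b} F' = F b - F \<alpha>" by (auto simp: has_integral_iff)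
  have "0 \<le> F b - F \<alpha>" unfolding F_def \<kappa>_def r_def using z ab by (simp add: zero_le_mult_iff)
  have i1: "(\<lambda>s. (h' s)\<^sup>2 * r s ^ (2 * k)) integrable_on {\<alpha>..b}"
    by (intro integrable_continuous_interval continuous_intros cr ch')
  have i2: "(\<lambda>s. (h s)\<^sup>2 * r s ^ (2 * Suc k)) integrable_on {\<alpha>..b}"
    by (intro integrable_continuous_interval continuous_intros cr ch)
  have "integral {\<alpha>..b} (\<lambda>s. \<kappa>\<^sup>2 * ((h s)\<^sup>2 * r s ^ (2 * Suc k)) + F' s) \<le> integral {\<alpha>..b} (\<lambda>s. (h' s)\<^sup>2 * r s ^ (2 * k))"
  proof (rule integral_le)
    fix s
    have "(h' s)\<^sup>2 * r s ^ (2 * k) - (\<kappa>\<^sup>2 * ((h s)\<^sup>2 * r s ^ (2 * Suc k)) + F' s)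
      = (h' s * r s ^ k - \<kappa> * h s * r s ^ Suc k)\<^sup>2"
      unfolding F'_def \<kappa>_def by (simp add: power2_eq_square power_mult power_add field_simps)
    also have "\<dots> \<ge> 0" by simp
    finally show "\<kappa>\<^sup>2 * ((h s)\<^sup>2 * r s ^ (2 * Suc k)) + F' s \<le> (h' s)\<^sup>2 * r s ^ (2 * k)" by simp
  qed (use i1 i2 F' in \<open>auto intro!: integrable_add integrable_on_mult_right\<close>)
  also have "integral {\<alpha>..b} (\<lambda>s. \<kappa>\<^sup>2 * ((h s)\<^sup>2 * r s ^ (2 * Suc k)) + F' s)
     = \<kappa>\<^sup>2 * integral {\<alpha>..b} (\<lambda>s. (h s)\<^sup>2 * r s ^ (2 * Suc k)) + (F b - F \<alpha>)"
    using i2 F' by (subst integral_add) (auto intro: integrable_on_mult_right)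
  finally show ?thesis using \<open>0 \<le> F b - F \<alpha>\<close> unfolding \<kappa>_def r_def by simp
qed

definition hardy_const :: "nat \<Rightarrow> real" where
  "hardy_const m = (\<Prod>k<m. ((2 * real k + 1) / 2)\<^sup>2)"

lemma hardy_const_nonneg: "0 \<le> hardy_const m"
  unfolding hardy_const_def by (intro prod_nonneg) auto

text \<open>Each use of \<open>Hardy_step\<close> trades two powers of the singular weight for one
  derivative.\<close>

lemma Hardy_halfline:
  fixes h :: "nat \<Rightarrow> real \<Rightarrow> real"
  assumes ab: "a < \<alpha>" "\<alpha> \<le> b"
    and d: "\<And>j s. (h j has_real_derivative h (Suc j) s) (at s)" and z: "\<And>j. h j \<alpha> = 0"
  shows "hardy_const i * integral {\<alpha>..b} (\<lambda>s. (h n s)\<^sup>2 * inverse (s - a) ^ (2 * i)) \<le> integral {\<alpha>..b} (\<lambda>s. (h (n + i) s)\<^sup>2)"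
proof (induction i arbitrary: n)
  case (Suc i)
  have c: "continuous_on UNIV (h (Suc n))" using d by (meson DERIV_isCont continuous_at_imp_continuous_on)
  have "hardy_const (Suc i) * integral {\<alpha>..b} (\<lambda>s. (h n s)\<^sup>2 * inverse (s - a) ^ (2 * Suc i))
    = hardy_const i * (((2 * real i + 1) / 2)\<^sup>2 * integral {\<alpha>..b} (\<lambda>s. (h n s)\<^sup>2 * inverse (s - a) ^ (2 * Suc i)))"
    by (simp add: hardy_const_def)
  also have "\<dots> \<le> hardy_const i * integral {\<alpha>..b} (\<lambda>s. (h (Suc n) s)\<^sup>2 * inverse (s - a) ^ (2 * i))"
    by (intro mult_left_mono Hardy_step[OF ab d c z] hardy_const_nonneg)
  also have "\<dots> \<le> integral {\<alpha>..b} (\<lambda>s. (h (Suc n + i) s)\<^sup>2)" by (rule Suc.IH)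
  finally show ?case by simp
qed (simp add: hardy_const_def)

lemma nn_integral_Icc_eq_integral:
  fixes f :: "real \<Rightarrow> real"
  assumes f: "continuous_on {\<alpha>..b} f" and nn: "\<And>s. s \<in> {\<alpha>..b} \<Longrightarrow> 0 \<le> f s"
  shows "(\<integral>\<^sup>+s. ennreal (f s) * indicator {\<alpha>..b} s \<partial>lborel) = ennreal (integral {\<alpha>..b} f)"
proof -
  have si: "set_integrable lborel {\<alpha>..b} f"
    by (rule borel_integrable_atLeastAtMost') (rule f)
  have "(\<integral>\<^sup>+s. ennreal (f s) * indicator {\<alpha>..b} s \<partial>lborel) = (\<integral>\<^sup>+s. ennreal (indicator {\<alpha>..b} s *\<^sub>R f s) \<partial>lborel)"
    by (intro nn_integral_cong) (auto simp: indicator_def)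
  also have "\<dots> = ennreal (\<integral>s. indicator {\<alpha>..b} s *\<^sub>R f s \<partial>lborel)"
    using si nn unfolding set_integrable_def by (intro nn_integral_eq_integral) (auto simp: indicator_def)
  also have "(\<integral>s. indicator {\<alpha>..b} s *\<^sub>R f s \<partial>lborel) = integral {\<alpha>..b} f"
    using set_borel_integral_eq_integral(2)[OF si] by (simp add: set_lebesgue_integral_def)
  finally show ?thesis .
qed

text \<open>\<open>S\<close> models the points whose nearest boundary point is \<open>a\<close>, to
  their left: an interval starting at \<open>a\<close> whose other end may be missing or infinite.
  Since all functions vanish near \<open>a\<close> and beyond \<open>M\<close>, integrals over
  \<open>S\<close> agree with integrals over a compact interval.\<close>

lemma Hardy_cell:
  fixes h :: "nat \<Rightarrow> real \<Rightarrow> real" and S :: "real set"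
  assumes S: "S \<subseteq> {a<..}" "\<And>s s'. s \<in> S \<Longrightarrow> a < s' \<Longrightarrow> s' \<le> s \<Longrightarrow> s' \<in> S"
    and d: "\<And>j s. (h j has_real_derivative h (Suc j) s) (at s)"
    and \<alpha>: "a < \<alpha>" "\<And>j s. a \<le> s \<Longrightarrow> s \<le> \<alpha> \<Longrightarrow> h j s = 0" and M: "\<And>j s. M < s \<Longrightarrow> h j s = 0"
  shows "(\<integral>\<^sup>+s. ennreal (hardy_const m * ((h 0 s)\<^sup>2 * inverse (s - a) ^ (2 * m))) * indicator S s \<partial>lborel)
     \<le> (\<integral>\<^sup>+s. ennreal ((h m s)\<^sup>2) * indicator S s \<partial>lborel)"
proof -
  define P where "P g \<longleftrightarrow> (\<forall>s. a \<le> s \<longrightarrow> s \<le> \<alpha> \<longrightarrow> g s = 0) \<and> (\<forall>s>M. g s = 0)" for g :: "real \<Rightarrow> ennreal"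
  \<comment> \<open>The right end is \<alpha> if \<open>S\<close> does not reach beyond \<alpha>,
    \<open>Sup S\<close> if \<open>S\<close> is bounded, and \<open>max \<alpha> M\<close> if
    \<open>S\<close> is the whole half-line. In the second case \<open>Sup S\<close> itself may or
    may not belong to \<open>S\<close>, hence the exceptional null set.\<close>
  have ex: "\<exists>b\<ge>\<alpha>. \<forall>g. P g \<longrightarrow> (AE s in lborel. g s * indicator S s = g s * indicator {\<alpha>..b} s)"
  proof (cases "\<exists>s\<in>S. \<alpha> < s")
    case False
    show ?thesis
    proof (intro exI[of _ \<alpha>] conjI allI impI AE_I2 order_refl)
      fix g :: "real \<Rightarrow> ennreal" and s assume "P g"
      then show "g s * indicator S s = g s * indicator {\<alpha>..\<alpha>} s"
        using False S(1) \<alpha>(1) by (force simp: P_def indicator_def not_less)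
    qed
  next
    case True
    then obtain s0 where s0: "s0 \<in> S" "\<alpha> < s0" by blast
    show ?thesis
    proof (cases "bdd_above S")
      case True
      have s0': "s0 \<le> Sup S" using True s0 by (intro cSup_upper)
      show ?thesis
      proof (intro exI[of _ "Sup S"] conjI allI impI)
        show "\<alpha> \<le> Sup S" using s0 s0' by simp
        fix g :: "real \<Rightarrow> ennreal" assume g: "P g"
        have "AE s in lborel. s \<noteq> Sup S" by (rule AE_lborel_singleton)
        then show "AE s in lborel. g s * indicator S s = g s * indicator {\<alpha>..Sup S} s"
        proof eventually_elim
          case (elim s)
          show ?case
          proof (cases "s \<in> S")
            case True
            then have "s \<le> Sup S" "a < s" using \<open>bdd_above S\<close> S(1) by (auto intro: cSup_upper)
            then show ?thesis using g True by (cases "s \<le> \<alpha>") (auto simp: P_def indicator_def)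
          next
            case False
            have "\<not> (\<alpha> \<le> s \<and> s \<le> Sup S)"
            proof
              assume "\<alpha> \<le> s \<and> s \<le> Sup S"
              then have "s < Sup S" "a < s" using elim \<alpha> by auto
              then obtain s' where "s' \<in> S" "s < s'" using less_cSup_iff[OF _ \<open>bdd_above S\<close>] s0 by blast
              then show False using S(2)[of s' s] \<open>a < s\<close> False by auto
            qed
            then show ?thesis using False by (auto simp: indicator_def)
          qed
        qed
      qed
    next
      case False
      have all: "s \<in> S" if "a < s" for s
      proof -
        obtain s' where "s' \<in> S" "s < s'" using False unfolding bdd_above_def by (meson not_le)
        then show ?thesis using S(2)[of s' s] that by auto
      qed
      show ?thesis
      proof (intro exI[of _ "max \<alpha> M"] conjI allI impI AE_I2)
        fix g :: "real \<Rightarrow> ennreal" and s assume g: "P g"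
        show "g s * indicator S s = g s * indicator {\<alpha>..max \<alpha> M} s"
          using g all[of s] S(1) \<alpha>(1) by (cases "s \<le> \<alpha>"; cases "M < s") (auto simp: P_def indicator_def)
      qed simp
    qed
  qed
  then obtain b where b: "\<alpha> \<le> b" "\<And>g. P g \<Longrightarrow> AE s in lborel. g s * indicator S s = g s * indicator {\<alpha>..b} s"
    by blast
  have ch: "continuous_on A (h j)" for A j
    using d by (meson DERIV_isCont continuous_at_imp_continuous_on)
  have e1: "(\<integral>\<^sup>+s. ennreal (hardy_const m * ((h 0 s)\<^sup>2 * inverse (s - a) ^ (2 * m))) * indicator S s \<partial>lborel)
     = (\<integral>\<^sup>+s. ennreal (hardy_const m * ((h 0 s)\<^sup>2 * inverse (s - a) ^ (2 * m))) * indicator {\<alpha>..b} s \<partial>lborel)"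
    by (intro nn_integral_cong_AE b(2)) (use \<alpha>(2) M in \<open>auto simp: P_def\<close>)
  have e2: "(\<integral>\<^sup>+s. ennreal ((h m s)\<^sup>2) * indicator S s \<partial>lborel) = (\<integral>\<^sup>+s. ennreal ((h m s)\<^sup>2) * indicator {\<alpha>..b} s \<partial>lborel)"
    by (intro nn_integral_cong_AE b(2)) (use \<alpha>(2) M in \<open>auto simp: P_def\<close>)
  have "(\<integral>\<^sup>+s. ennreal (hardy_const m * ((h 0 s)\<^sup>2 * inverse (s - a) ^ (2 * m))) * indicator {\<alpha>..b} s \<partial>lborel)
    = ennreal (integral {\<alpha>..b} (\<lambda>s. hardy_const m * ((h 0 s)\<^sup>2 * inverse (s - a) ^ (2 * m))))"
    using \<alpha>(1) by (intro nn_integral_Icc_eq_integral continuous_intros ch mult_nonneg_nonneg hardy_const_nonneg) auto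
  moreover have "(\<integral>\<^sup>+s. ennreal ((h m s)\<^sup>2) * indicator {\<alpha>..b} s \<partial>lborel) = ennreal (integral {\<alpha>..b} (\<lambda>s. (h m s)\<^sup>2))"
    by (intro nn_integral_Icc_eq_integral continuous_intros ch) auto
  moreover have "integral {\<alpha>..b} (\<lambda>s. hardy_const m * ((h 0 s)\<^sup>2 * inverse (s - a) ^ (2 * m))) \<le> integral {\<alpha>..b} (\<lambda>s. (h m s)\<^sup>2)"
    using Hardy_halfline[of a \<alpha> b h, OF \<alpha>(1) b(1) d \<alpha>(2), of m 0] \<alpha>(1) by simp
  ultimately show ?thesis unfolding e1 e2 by (simp add: ennreal_leI)
qed

text \<open>Reflection s \<mapsto> - s; the sign \<open>(-1) ^ j\<close> keeps each function the
  derivative of its predecessor.\<close>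

lemma Hardy_cell_right:
  fixes h :: "nat \<Rightarrow> real \<Rightarrow> real" and S :: "real set"
  assumes S: "S \<subseteq> {..<a}" "\<And>s s'. s \<in> S \<Longrightarrow> s' < a \<Longrightarrow> s \<le> s' \<Longrightarrow> s' \<in> S" "S \<in> sets borel"
    and d: "\<And>j s. (h j has_real_derivative h (Suc j) s) (at s)"
    and \<alpha>: "\<alpha> < a" "\<And>j s. \<alpha> \<le> s \<Longrightarrow> s \<le> a \<Longrightarrow> h j s = 0" and M: "\<And>j s. s < M \<Longrightarrow> h j s = 0"
  shows "(\<integral>\<^sup>+s. ennreal (hardy_const m * ((h 0 s)\<^sup>2 * inverse (a - s) ^ (2 * m))) * indicator S s \<partial>lborel)
     \<le> (\<integral>\<^sup>+s. ennreal ((h m s)\<^sup>2) * indicator S s \<partial>lborel)"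
proof -
  define h' where "h' j s = (-1) ^ j * h j (- s)" for j s
  have [measurable]: "S \<in> sets borel" by fact
  have "continuous_on UNIV (h j)" for j
    using d by (meson DERIV_isCont continuous_at_imp_continuous_on)
  then have [measurable]: "h j \<in> borel_measurable borel" for j
    by (rule borel_measurable_continuous_onI)
  have d': "(h' j has_real_derivative h' (Suc j) s) (at s)" for j s
  proof -
    have "((\<lambda>s. h j (- s)) has_real_derivative (h (Suc j) (- s) * - 1)) (at s)"
      by (rule DERIV_chain2[OF d]) (auto intro!: derivative_eq_intros)
    from DERIV_cmult[OF this, of "(-1) ^ j"] show ?thesis by (simp add: h'_def[abs_def])
  qed
  have "(\<integral>\<^sup>+s. ennreal (hardy_const m * ((h' 0 s)\<^sup>2 * inverse (s - (-a)) ^ (2 * m))) * indicator (uminus ` S) s \<partial>lborel)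
     \<le> (\<integral>\<^sup>+s. ennreal ((h' m s)\<^sup>2) * indicator (uminus ` S) s \<partial>lborel)"
  proof (rule Hardy_cell[where \<alpha> = "- \<alpha>" and M = "- M"])
    show "s' \<in> uminus ` S" if "s \<in> uminus ` S" "- a < s'" "s' \<le> s" for s s'
      using that S(2)[of "- s" "- s'"] by (force intro: image_eqI[of _ _ "- s'"])
    show "(h' j has_real_derivative h' (Suc j) s) (at s)" for j s by (rule d')
  qed (use S \<alpha> M in \<open>auto simp: h'_def\<close>)
  moreover have ind: "indicator (uminus ` S) (- s) = (indicator S s :: ennreal)" for s by (auto simp: indicator_def)
  have "(\<integral>\<^sup>+s. g s * indicator (uminus ` S) s \<partial>lborel) = (\<integral>\<^sup>+s. g (- s) * indicator S s \<partial>lborel)"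
    if [measurable]: "g \<in> borel_measurable borel" for g
  proof -
    have "uminus ` S = uminus -` S" by force
    also have "\<dots> \<in> sets borel" using measurable_sets_borel[of uminus borel S] by simp
    finally have [measurable]: "uminus ` S \<in> sets borel" .
    show ?thesis by (subst nn_integral_real_affine[where c = "-1" and t = 0]) (auto simp: ind)
  qed
  moreover have "((-1::real) ^ m)\<^sup>2 = 1" by (cases "even m") auto
  ultimately show ?thesis by (simp add: h'_def power_mult_distrib)
qed

lemma infdist_attained:
  fixes A :: "'a::heine_borel set"
  assumes "closed A" "A \<noteq> {}"
  obtains y where "y \<in> A" "infdist x A = dist x y"
  using infdist_attains_inf[OF assms, of x] by blast

text \<open>\<open>U\<close> is cut into cells according to the nearest point of the complement and
  the side on which it lies. On a cell the weight is a pure power of the distance to one fixed end,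
  so the half-line inequality applies; the cells are disjoint and countable in number, and their
  inequalities add up.\<close>

lemma Hardy_line:
  fixes h :: "nat \<Rightarrow> real \<Rightarrow> real" and U K :: "real set"
  assumes U: "open U" "- U \<noteq> {}" and K: "compact K" "K \<subseteq> U"
    and d: "\<And>j s. (h j has_real_derivative h (Suc j) s) (at s)"
    and z: "\<And>j s. s \<notin> K \<Longrightarrow> h j s = 0"
  shows "(\<integral>\<^sup>+s. ennreal (hardy_const m * ((h 0 s)\<^sup>2 * inverse (infdist s (- U) ^ (2 * m)))) \<partial>lborel)
     \<le> (\<integral>\<^sup>+s. ennreal ((h m s)\<^sup>2) \<partial>lborel)"
proof -
  define \<delta> where "\<delta> s = infdist s (- U)" for s
  have cl: "closed (- U)" using U by auto
  have c\<delta>: "continuous_on UNIV \<delta>" unfolding \<delta>_def by (intro continuous_intros)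
  then have m\<delta> [measurable]: "\<delta> \<in> borel_measurable borel" by (rule borel_measurable_continuous_onI)
  have \<delta>_le: "\<delta> s \<le> \<bar>s - y\<bar>" if "y \<notin> U" for s y
    unfolding \<delta>_def using that infdist_le[of y "- U" s] by (simp add: dist_real_def)
  have att: "s - \<delta> s \<notin> U \<or> s + \<delta> s \<notin> U" for s
  proof -
    obtain y where "y \<in> - U" "\<delta> s = dist s y" unfolding \<delta>_def using infdist_attained[OF cl U(2)] by metis
    then show ?thesis by (auto simp: dist_real_def abs_if split: if_splits)
  qed
  have \<delta>_nonneg: "0 \<le> \<delta> s" for s by (simp add: \<delta>_def infdist_nonneg)
  have \<delta>_pos: "0 < \<delta> s" if "s \<in> U" for s
    using that infdist_pos_not_in_closed[OF cl U(2), of s] by (simp add: \<delta>_def)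
  have inU: "y \<in> U" if "\<bar>s - y\<bar> < \<delta> s" for s y using \<delta>_le[of y s] that by force
  obtain M where M: "\<And>s. s \<in> K \<Longrightarrow> \<bar>s\<bar> \<le> M" using compact_imp_bounded[OF K(1)] by (auto simp: bounded_iff)
  have "continuous_on UNIV (h j)" for j
    using d by (meson DERIV_isCont continuous_at_imp_continuous_on)
  then have [measurable]: "h j \<in> borel_measurable borel" for j
    by (rule borel_measurable_continuous_onI)
  have [measurable]: "U \<in> sets borel" using U by simp
  define Lc where "Lc a = {s. a < s \<and> \<delta> s = s - a}" for a
  \<comment> \<open>The last condition gives points equidistant from both sides to the left cells
    only, which makes the two families disjoint.\<close>
  define Rc where "Rc a = {s. s < a \<and> \<delta> s = a - s \<and> s - \<delta> s \<in> U}" for a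
  define f1 where "f1 s = ennreal (hardy_const m * ((h 0 s)\<^sup>2 * inverse (\<delta> s ^ (2 * m))))" for s
  define f2 where "f2 s = ennreal ((h m s)\<^sup>2)" for s
  have [measurable]: "f1 \<in> borel_measurable borel" "f2 \<in> borel_measurable borel"
    unfolding f1_def f2_def by measurable
  have mL [measurable]: "Lc a \<in> sets borel" for a unfolding Lc_def by measurable
  have mR [measurable]: "Rc a \<in> sets borel" for a unfolding Rc_def by measurable
  have near: "\<exists>e>0. \<forall>j s. \<bar>s - a\<bar> \<le> e \<longrightarrow> h j s = 0" if "a \<notin> U" for a
  proof -
    have "open (- K)" "a \<in> - K" using K that compact_imp_closed by auto
    then obtain e where "0 < e" "cball a e \<subseteq> - K" using open_contains_cball by blast
    then show ?thesis using z by (intro exI[of _ e]) (auto simp: subset_eq dist_real_def abs_minus_commute)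
  qed
  have cellL: "(\<integral>\<^sup>+s. f1 s * indicator (Lc a) s \<partial>lborel) \<le> (\<integral>\<^sup>+s. f2 s * indicator (Lc a) s \<partial>lborel)" if a: "a \<notin> U" for a
  proof -
    obtain e where e: "0 < e" "\<And>j s. \<bar>s - a\<bar> \<le> e \<Longrightarrow> h j s = 0" using near[OF a] by blast
    have "(\<integral>\<^sup>+s. f1 s * indicator (Lc a) s \<partial>lborel)
      = (\<integral>\<^sup>+s. ennreal (hardy_const m * ((h 0 s)\<^sup>2 * inverse (s - a) ^ (2 * m))) * indicator (Lc a) s \<partial>lborel)"
      by (intro nn_integral_cong) (auto simp: f1_def Lc_def indicator_def power_inverse)
    also have "\<dots> \<le> (\<integral>\<^sup>+s. f2 s * indicator (Lc a) s \<partial>lborel)"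
      unfolding f2_def
    proof (rule Hardy_cell[where \<alpha> = "a + e" and M = M])
      fix s s' assume s: "s \<in> Lc a" "a < s'" "s' \<le> s"
      have "\<delta> s' \<le> s' - a" using \<delta>_le[OF a, of s'] s by simp
      \<comment> \<open>A boundary point nearer to s' than a would also be nearer to s.\<close>
      moreover have "s' - a \<le> \<delta> s'"
      proof -
        obtain y where y: "y \<notin> U" "\<bar>s' - y\<bar> = \<delta> s'"
          using att[of s'] \<delta>_nonneg[of s'] by (metis abs_of_nonneg add_diff_cancel_left' diff_diff_eq2 abs_minus_commute diff_add_cancel)
        then have "\<delta> s \<le> \<bar>s - y\<bar>" by (intro \<delta>_le)
        then have "s - a \<le> \<bar>s - y\<bar>" using s by (simp add: Lc_def)
        then show ?thesis using y(2) s(2,3) by linarith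
      qed
      ultimately show "s' \<in> Lc a" using s by (simp add: Lc_def)
    qed (use e z M d in \<open>auto simp: Lc_def\<close>, fastforce)
    finally show ?thesis .
  qed
  have cellR: "(\<integral>\<^sup>+s. f1 s * indicator (Rc a) s \<partial>lborel) \<le> (\<integral>\<^sup>+s. f2 s * indicator (Rc a) s \<partial>lborel)" if a: "a \<notin> U" for a
  proof -
    obtain e where e: "0 < e" "\<And>j s. \<bar>s - a\<bar> \<le> e \<Longrightarrow> h j s = 0" using near[OF a] by blast
    have "(\<integral>\<^sup>+s. f1 s * indicator (Rc a) s \<partial>lborel)
      = (\<integral>\<^sup>+s. ennreal (hardy_const m * ((h 0 s)\<^sup>2 * inverse (a - s) ^ (2 * m))) * indicator (Rc a) s \<partial>lborel)"
      by (intro nn_integral_cong) (auto simp: f1_def Rc_def indicator_def power_inverse)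
    also have "\<dots> \<le> (\<integral>\<^sup>+s. f2 s * indicator (Rc a) s \<partial>lborel)"
      unfolding f2_def
    proof (rule Hardy_cell_right[where \<alpha> = "a - e" and M = "- M"])
      fix s s' assume s: "s \<in> Rc a" "s' < a" "s \<le> s'"
      have "\<delta> s' \<le> a - s'" using \<delta>_le[OF a, of s'] s by simp
      moreover have "a - s' \<le> \<delta> s'"
      proof -
        obtain y where y: "y \<notin> U" "\<bar>s' - y\<bar> = \<delta> s'"
          using att[of s'] \<delta>_nonneg[of s'] by (metis abs_of_nonneg add_diff_cancel_left' diff_diff_eq2 abs_minus_commute diff_add_cancel)
        then have "\<delta> s \<le> \<bar>s - y\<bar>" by (intro \<delta>_le)
        then have "a - s \<le> \<bar>s - y\<bar>" using s by (simp add: Rc_def)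
        then show ?thesis using y(2) s(2,3) by linarith
      qed
      ultimately have \<delta>': "\<delta> s' = a - s'" by simp
      have "s' - \<delta> s' \<in> U"
      proof (cases "s' = s")
        case False
        then show ?thesis using s \<delta>' by (intro inU[of s]) (auto simp: Rc_def)
      qed (use s in \<open>auto simp: Rc_def\<close>)
      then show "s' \<in> Rc a" using s \<delta>' by (simp add: Rc_def)
    qed (use e z M d in \<open>auto simp: Rc_def\<close>, fastforce)
    finally show ?thesis .
  qed
  define AL where "AL = {a. a \<notin> U \<and> Lc a \<noteq> {}}"
  define AR where "AR = {a. a \<notin> U \<and> Rc a \<noteq> {}}"
  have disjL: "disjoint_family_on Lc AL" unfolding disjoint_family_on_def Lc_def by auto
  have disjR: "disjoint_family_on Rc AR" unfolding disjoint_family_on_def Rc_def by auto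
  \<comment> \<open>A nonempty cell contains, with s, all points between s and a, hence a rational
    number.\<close>
  have countable_cells: "countable A"
    if C: "disjoint_family_on C A" "\<And>a. a \<in> A \<Longrightarrow> \<exists>q\<in>\<rat>. q \<in> C a" for A and C :: "real \<Rightarrow> real set"
  proof -
    obtain q where q: "\<And>a. a \<in> A \<Longrightarrow> q a \<in> \<rat> \<and> q a \<in> C a" using C(2) by metis
    then have "inj_on q A" using C(1) unfolding inj_on_def disjoint_family_on_def by (metis IntI empty_iff)
    moreover have "countable (q ` A)" using q by (intro countable_subset[OF _ countable_rat]) auto
    ultimately show ?thesis using countable_image_inj_on by blast
  qed
  have ctL: "countable AL"
  proof (rule countable_cells[OF disjL])
    fix a assume "a \<in> AL"
    then obtain s where s: "a \<notin> U" "a < s" "\<delta> s = s - a" by (auto simp: AL_def Lc_def)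
    obtain q where q: "q \<in> \<rat>" "a < q" "q < s" using Rats_dense_in_real[OF s(2)] by blast
    have "\<delta> q = q - a"
    proof (rule antisym)
      show "\<delta> q \<le> q - a" using \<delta>_le[OF s(1), of q] q by simp
      have "q - \<delta> q \<notin> U \<or> q + \<delta> q \<notin> U" by (rule att)
      then show "q - a \<le> \<delta> q" using \<delta>_le[of "q - \<delta> q" s] \<delta>_le[of "q + \<delta> q" s] s q \<delta>_nonneg[of q] by linarith
    qed
    then show "\<exists>q\<in>\<rat>. q \<in> Lc a" using q by (auto simp: Lc_def)
  qed
  have ctR: "countable AR"
  proof (rule countable_cells[OF disjR])
    fix a assume "a \<in> AR"
    then obtain s where s: "a \<notin> U" "s < a" "\<delta> s = a - s" by (auto simp: AR_def Rc_def)
    obtain q where q: "q \<in> \<rat>" "s < q" "q < a" using Rats_dense_in_real[OF s(2)] by blast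
    have "\<delta> q = a - q"
    proof (rule antisym)
      show "\<delta> q \<le> a - q" using \<delta>_le[OF s(1), of q] q by simp
      have "q - \<delta> q \<notin> U \<or> q + \<delta> q \<notin> U" by (rule att)
      then show "a - q \<le> \<delta> q" using \<delta>_le[of "q - \<delta> q" s] \<delta>_le[of "q + \<delta> q" s] s q \<delta>_nonneg[of q] by linarith
    qed
    then have "q \<in> Rc a" using q s by (auto simp: Rc_def intro!: inU[of s])
    then show "\<exists>q\<in>\<rat>. q \<in> Rc a" using q by auto
  qed
  define SL SR where "SL = \<Union>(Lc ` AL)" and "SR = \<Union>(Rc ` AR)"
  have [measurable]: "SL \<in> sets borel" "SR \<in> sets borel"
    unfolding SL_def SR_def using ctL ctR mL mR by (auto intro!: sets.countable_UN')
  have disj: "SL \<inter> SR = {}"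
  proof -
    have "False" if "s \<in> Lc a" "a \<notin> U" "s \<in> Rc b" for s a b
    proof -
      have "a = s - \<delta> s" using that by (simp add: Lc_def)
      then show False using that by (simp add: Rc_def)
    qed
    then show ?thesis unfolding SL_def SR_def AL_def AR_def by blast
  qed
  have cover: "U \<subseteq> SL \<union> SR"
  proof
    fix s assume s: "s \<in> U"
    show "s \<in> SL \<union> SR"
    proof (cases "s - \<delta> s \<in> U")
      case True
      then have "s + \<delta> s \<notin> U" using att by blast
      moreover have "s \<in> Rc (s + \<delta> s)" using True \<delta>_pos[OF s] by (simp add: Rc_def)
      ultimately show ?thesis unfolding SR_def AR_def by blast
    next
      case False
      moreover have "s \<in> Lc (s - \<delta> s)" using \<delta>_pos[OF s] by (simp add: Lc_def)
      ultimately show ?thesis unfolding SL_def AL_def by blast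
    qed
  qed
  have split: "(\<integral>\<^sup>+s. f s * indicator (\<Union>(C ` A)) s \<partial>lborel) = (\<integral>\<^sup>+a. (\<integral>\<^sup>+s. f s * indicator (C a) s \<partial>lborel) \<partial>count_space A)"
    if [measurable]: "f \<in> borel_measurable borel" "\<And>a. C a \<in> sets borel" and "countable A" "disjoint_family_on C A"
    for f :: "real \<Rightarrow> ennreal" and C and A :: "real set"
  proof -
    have "\<Union>(C ` A) \<in> sets borel" using that by (auto intro!: sets.countable_UN')
    then have "(\<integral>\<^sup>+s. f s * indicator (\<Union>(C ` A)) s \<partial>lborel) = emeasure (density lborel f) (\<Union>(C ` A))"
      by (simp add: emeasure_density)
    also have "\<dots> = (\<integral>\<^sup>+a. emeasure (density lborel f) (C a) \<partial>count_space A)"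
      using that by (intro emeasure_UN_countable) auto
    also have "\<dots> = (\<integral>\<^sup>+a. (\<integral>\<^sup>+s. f s * indicator (C a) s \<partial>lborel) \<partial>count_space A)"
      by (intro nn_integral_cong) (simp add: emeasure_density)
    finally show ?thesis .
  qed
  have leL: "(\<integral>\<^sup>+s. f1 s * indicator SL s \<partial>lborel) \<le> (\<integral>\<^sup>+s. f2 s * indicator SL s \<partial>lborel)"
  proof -
    have "(\<integral>\<^sup>+a. (\<integral>\<^sup>+s. f1 s * indicator (Lc a) s \<partial>lborel) \<partial>count_space AL)
        \<le> (\<integral>\<^sup>+a. (\<integral>\<^sup>+s. f2 s * indicator (Lc a) s \<partial>lborel) \<partial>count_space AL)"
      by (rule nn_integral_mono) (simp add: AL_def cellL)
    then show ?thesis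
      unfolding SL_def using ctL disjL by (simp add: split[OF _ mL])
  qed
  have leR: "(\<integral>\<^sup>+s. f1 s * indicator SR s \<partial>lborel) \<le> (\<integral>\<^sup>+s. f2 s * indicator SR s \<partial>lborel)"
  proof -
    have "(\<integral>\<^sup>+a. (\<integral>\<^sup>+s. f1 s * indicator (Rc a) s \<partial>lborel) \<partial>count_space AR)
        \<le> (\<integral>\<^sup>+a. (\<integral>\<^sup>+s. f2 s * indicator (Rc a) s \<partial>lborel) \<partial>count_space AR)"
      by (rule nn_integral_mono) (simp add: AR_def cellR)
    then show ?thesis
      unfolding SR_def using ctR disjR by (simp add: split[OF _ mR])
  qed
  have sum: "(\<integral>\<^sup>+s. f s * indicator SL s \<partial>lborel) + (\<integral>\<^sup>+s. f s * indicator SR s \<partial>lborel) = (\<integral>\<^sup>+s. f s * indicator (SL \<union> SR) s \<partial>lborel)"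
    if [measurable]: "f \<in> borel_measurable borel" for f
    by (subst nn_integral_add[symmetric], simp, simp, intro nn_integral_cong)
      (use disj in \<open>auto simp: indicator_def\<close>)
  have "(\<integral>\<^sup>+s. f1 s \<partial>lborel) = (\<integral>\<^sup>+s. f1 s * indicator (SL \<union> SR) s \<partial>lborel)"
  proof (rule nn_integral_cong)
    fix s show "f1 s = f1 s * indicator (SL \<union> SR) s"
      using cover K(2) z[of s 0] by (cases "s \<in> K") (auto simp: f1_def indicator_def)
  qed
  also have "\<dots> \<le> (\<integral>\<^sup>+s. f2 s * indicator (SL \<union> SR) s \<partial>lborel)"
    using add_mono[OF leL leR] by (simp add: sum)
  also have "\<dots> \<le> (\<integral>\<^sup>+s. f2 s \<partial>lborel)"
    by (intro nn_integral_mono) (auto simp: indicator_def)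
  finally show ?thesis by (simp add: f1_def f2_def \<delta>_def)
qed

subsection \<open>Averaging directional derivatives over the sphere\<close>

lemma Ck_nth: "Ck k (\<lambda>y::real^'n. y $ i)"
proof (cases k)
  case (Suc k')
  show ?thesis unfolding Suc
  proof (rule Ck_SucI[where D = "\<lambda>j y. if j = i then 1 else 0"])
    show "((\<lambda>s. (x + s *\<^sub>R axis j 1) $ i) has_real_derivative (if j = i then 1 else 0)) (at 0)" for x :: "real^'n" and j
      by (auto simp: axis_def intro!: derivative_eq_intros)
  qed (auto intro!: continuous_intros Ck_const)
qed (auto intro!: continuous_intros)

lemma partial_nth: "partial j (\<lambda>y::real^'n. y $ i) x = (if j = i then 1 else 0)"
  by (rule partialI) (auto simp: axis_def intro!: derivative_eq_intros)

lemma Ck_prod_list: "Ck k (\<lambda>y::real^'n. \<Prod>i\<leftarrow>l. y $ i)"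
  by (induction l) (auto intro!: Ck_const Ck_mult Ck_nth simp del: Ck.simps)

text \<open>The polynomial \<open>y \<mapsto> (y \<cdot> \<nabla>)\<^sup>k f (x)\<close>.\<close>
definition hp :: "nat \<Rightarrow> (real^'n \<Rightarrow> real) \<Rightarrow> real^'n \<Rightarrow> real^'n \<Rightarrow> real" where
  "hp k f x y = (\<Sum>l | length l = k. (\<Prod>i\<leftarrow>l. y $ i) * mpartial l f x)"

lemma Ck_hp: "Ck j (hp k f x)"
  unfolding hp_def[abs_def] mult.commute[of "prod_list _"]
  by (intro Ck_sum Ck_cmult Ck_prod_list)

lemma hp_0: "hp 0 f x y = f x"
  by (simp add: hp_def)

lemma mpartial_commute: "(\<And>k. Ck k f) \<Longrightarrow> partial i (mpartial l f) = mpartial l (partial i f)"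
proof (induction l)
  case (Cons j l)
  have "partial i (partial j (mpartial l f)) = partial j (partial i (mpartial l f))"
    by (rule partial_commute[where k = 0, OF smooth_mpartial[OF Cons.prems]])
  then show ?case using Cons by simp
qed simp

lemma hp_Suc:
  assumes "\<And>k. Ck k f"
  shows "hp (Suc k) f x y = (\<Sum>i\<in>UNIV. y $ i * hp k (partial i f) x y)"
  unfolding hp_def by (simp add: sum_lists_Suc mpartial_commute[OF assms] sum_distrib_left mult.assoc)

text \<open>Constant-coefficient derivatives commute, so y \<mapsto> (y \<cdot> \<nabla>)^(k+1)
  differentiates by the ordinary power rule.\<close>

lemma partial_hp:
  fixes f :: "real^'n \<Rightarrow> real"
  assumes f: "\<And>k. Ck k f"
  shows "partial j (hp (Suc k) f x) y = real (Suc k) * hp k (partial j f) x y"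
  using f
proof (induction k arbitrary: f)
  case 0
  have e: "hp (Suc 0) f x = (\<lambda>y. \<Sum>i\<in>UNIV. partial i f x * y $ i)"
    by (simp add: fun_eq_iff hp_Suc[OF 0] hp_0 mult.commute)
  have "partial j (hp (Suc 0) f x) y = (\<Sum>i\<in>UNIV. partial i f x * (if j = i then 1 else 0))"
    unfolding e by (subst partial_sum[where k = 0])
      (auto intro!: Ck_cmult Ck_nth simp: partial_cmult[OF Ck_nth[of "Suc 0"]] partial_nth simp del: Ck.simps)
  then show ?case by (simp add: hp_0 if_distrib cong: if_cong)
next
  case (Suc k)
  have e: "hp (Suc (Suc k)) f x = (\<lambda>y. \<Sum>i\<in>UNIV. y $ i * hp (Suc k) (partial i f) x y)"
    by (simp add: fun_eq_iff hp_Suc[OF Suc.prems])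
  have "partial j (hp (Suc (Suc k)) f x) y
     = (\<Sum>i\<in>UNIV. partial j (\<lambda>y. y $ i * hp (Suc k) (partial i f) x y) y)"
    unfolding e by (subst partial_sum[where k = 0]) (auto intro!: Ck_mult Ck_nth Ck_hp simp del: Ck.simps)
  also have "\<dots> = (\<Sum>i\<in>UNIV. (if j = i then 1 else 0) * hp (Suc k) (partial i f) x y
       + y $ i * (real (Suc k) * hp k (partial j (partial i f)) x y))"
    by (intro sum.cong refl, subst partial_mult[OF Ck_nth[of "Suc 0"] Ck_hp])
      (simp add: partial_nth Suc.IH[OF Ck_partial[OF Suc.prems]])
  also have "\<dots> = (\<Sum>i\<in>UNIV. if j = i then hp (Suc k) (partial i f) x y else 0)
      + (\<Sum>i\<in>UNIV. real (Suc k) * (y $ i * hp k (partial i (partial j f)) x y))"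
    unfolding sum.distrib[symmetric] partial_commute[OF Suc.prems[of "Suc (Suc 0)"], of j]
    by (intro sum.cong refl) (simp only: mult.left_commute if_True if_False mult_1 mult_zero_left split: if_splits, simp)
  also have "\<dots> = hp (Suc k) (partial j f) x y + real (Suc k) * (\<Sum>i\<in>UNIV. y $ i * hp k (partial i (partial j f)) x y)"
    by (simp only: sum_distrib_left sum.delta' finite UNIV_I if_True)
  also have "(\<Sum>i\<in>UNIV. y $ i * hp k (partial i (partial j f)) x y) = hp (Suc k) (partial j f) x y"
    by (rule hp_Suc[symmetric, OF Ck_partial[OF Suc.prems]])
  finally show ?case by (simp add: algebra_simps)
qed

lemma mpartial_sum:
  "(\<And>i k. i \<in> S \<Longrightarrow> Ck k (f i)) \<Longrightarrow> mpartial l (\<lambda>x. \<Sum>i\<in>S. f i x) = (\<lambda>x. \<Sum>i\<in>S. mpartial l (f i) x)"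
proof (induction l)
  case (Cons j l)
  then show ?case by (simp add: partial_sum[where k = 0, OF smooth_mpartial])
qed simp

lemma hp_laplacian:
  assumes f: "\<And>k. Ck k f"
  shows "(\<Sum>i\<in>UNIV. hp k (partial i (partial i f)) x y) = hp k (laplacian f) x y"
proof -
  have "mpartial l (laplacian f) x = (\<Sum>i\<in>UNIV. mpartial l (partial i (partial i f)) x)" for l
    unfolding laplacian_def[abs_def] by (subst mpartial_sum) (intro Ck_partial f, simp)
  then show ?thesis unfolding hp_def by (subst sum.swap) (simp add: sum_distrib_left)
qed

lemma hp_scale: "hp k f x (c *\<^sub>R y) = c ^ k * hp k f x y"
proof -
  have "(\<Prod>i\<leftarrow>l. (c *\<^sub>R y) $ i) = c ^ length l * (\<Prod>i\<leftarrow>l. y $ i)" for l by (induction l) auto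
  then show ?thesis unfolding hp_def sum_distrib_left by (intro sum.cong refl) (simp only: mem_Collect_eq mult.assoc)
qed

lemma hp_normalize: "hp k f x y = norm y ^ k * hp k f x (y /\<^sub>R norm y)"
  unfolding hp_scale[symmetric] by (cases "y = 0") auto

lemma max0_sq_deriv: "((\<lambda>u::real. (max 0 u)\<^sup>2) has_real_derivative 2 * max 0 u) (at u)"
proof (cases u "0::real" rule: linorder_cases)
  case less
  have "\<forall>\<^sub>F v in nhds u. v \<in> {..<0}" using less by (intro eventually_nhds_in_open) auto
  then have "\<forall>\<^sub>F v in nhds u. (max 0 v)\<^sup>2 = 0" by eventually_elim auto
  then have "((\<lambda>u::real. (max 0 u)\<^sup>2) has_real_derivative 0) (at u)"
    using less by (subst DERIV_cong_ev[where g = "\<lambda>_. 0" and y = u and v = 0]) auto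
  then show ?thesis using less by simp
next
  case greater
  have "\<forall>\<^sub>F v in nhds u. v \<in> {0<..}" using greater by (intro eventually_nhds_in_open) auto
  then have "\<forall>\<^sub>F v in nhds u. (max 0 v)\<^sup>2 = v\<^sup>2" by eventually_elim auto
  then show ?thesis
    using greater by (subst DERIV_cong_ev[where g = "\<lambda>v. v\<^sup>2" and y = u and v = "2 * u"]) (auto intro!: derivative_eq_intros)
next
  case equal
  have "((\<lambda>h::real. (max 0 h)\<^sup>2 / h) \<longlongrightarrow> 0) (at 0)"
  proof (rule Lim_null_comparison)
    show "\<forall>\<^sub>F h in at 0. norm ((max 0 h)\<^sup>2 / h :: real) \<le> \<bar>h\<bar>"
      by (intro always_eventually) (auto simp: max_def power2_eq_square)
    show "((\<lambda>h::real. \<bar>h\<bar>) \<longlongrightarrow> 0) (at 0)" by (intro tendsto_rabs_zero tendsto_ident_at)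
  qed
  then show ?thesis using equal by (simp add: DERIV_def)
qed

text \<open>A radial weight whose gradient is again a radial multiple of \<open>y\<close>: integration by parts against it relates two
  weighted integrals over the ball, both of which reduce to spherical averages by homogeneity.\<close>
definition bumpW :: "real^'n \<Rightarrow> real" where "bumpW y = (max 0 (1 - (norm y)\<^sup>2))\<^sup>2"
definition bumpW' :: "real^'n \<Rightarrow> real" where "bumpW' y = 4 * max 0 (1 - (norm y)\<^sup>2)"

lemma bumpW_deriv:
  fixes y :: "real^'n"
  shows
  "((\<lambda>s. bumpW (y + s *\<^sub>R axis i 1)) has_real_derivative - (y $ i * bumpW' y)) (at 0)"
proof -
  have n: "(norm (y + s *\<^sub>R axis i 1))\<^sup>2 = (norm y)\<^sup>2 + 2 * s * y $ i + s\<^sup>2" for s :: real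
  proof -
    have "(axis i (1::real) :: real^'n) $ i = 1" by (simp add: axis_def)
    then show ?thesis
      unfolding power2_norm_eq_inner
      by (simp add: inner_add_left inner_add_right inner_axis inner_axis' power2_eq_square algebra_simps)
  qed
  have "((\<lambda>s. (max 0 (1 - ((norm y)\<^sup>2 + 2 * s * y $ i + s\<^sup>2)))\<^sup>2) has_real_derivative
      2 * max 0 (1 - ((norm y)\<^sup>2 + 2 * 0 * y $ i + 0\<^sup>2)) * (- 2 * y $ i)) (at 0)"
    by (rule DERIV_chain2[OF max0_sq_deriv]) (auto intro!: derivative_eq_intros)
  then show ?thesis unfolding bumpW_def bumpW'_def n by (simp add: algebra_simps)
qed

lemma bumpW'_cont: "continuous_on UNIV bumpW'"
  unfolding bumpW'_def[abs_def] by (intro continuous_intros)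

lemma Ck_bumpW: "Ck (Suc 0) bumpW"
  by (rule Ck_SucI[OF _ bumpW_deriv])
    (auto simp: bumpW_def[abs_def] bumpW'_def[abs_def] intro!: continuous_intros)

lemma partial_bumpW: "partial i bumpW y = - (y $ i * bumpW' y)"
  by (rule partialI[OF bumpW_deriv])

lemma bumpW_outside: "1 \<le> norm y \<Longrightarrow> bumpW y = 0" "1 \<le> norm y \<Longrightarrow> bumpW' y = 0"
proof -
  assume "1 \<le> norm y"
  then have "1 \<le> (norm y)\<^sup>2" by simp
  then show "bumpW y = 0" "bumpW' y = 0" by (simp_all add: bumpW_def bumpW'_def)
qed

lemma compact_supp_ball:
  fixes g :: "real^'n \<Rightarrow> real"
  assumes "\<And>y. 1 \<le> norm y \<Longrightarrow> g y = 0"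
  shows "compact (closure {y. g y \<noteq> 0})"
proof (rule compact_closed_subset[OF compact_cball[of 0 1]])
  show "closure {y. g y \<noteq> 0} \<subseteq> cball 0 1"
    by (rule closure_minimal) (use assms in \<open>auto simp: not_le intro: less_imp_le leI\<close>, meson linorder_le_cases)
qed simp

lemma bumpW_parts:
  fixes F :: "real^'n \<Rightarrow> real"
  assumes F: "Ck (Suc 0) F"
  shows "(\<integral>y. y $ i * bumpW' y * F y \<partial>lborel) = (\<integral>y. bumpW y * partial i F y \<partial>lborel)"
  using integral_by_parts[OF Ck_bumpW compact_supp_ball F, of i]
  by (simp add: bumpW_outside partial_bumpW)

lemma bumpW_integrable:
  assumes "continuous_on UNIV F"
  shows "integrable lborel (\<lambda>y. bumpW y * F y)" "integrable lborel (\<lambda>y. bumpW' y * F y)"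
  by (intro compact_supp_integrable compact_supp_ball continuous_on_mult assms bumpW'_cont Ck_cont[OF Ck_bumpW]; simp add: bumpW_outside)+

lemma hp_cont: "continuous_on UNIV (hp k f x)"
  by (rule Ck_cont[OF Ck_hp])

text \<open>\<open>y $ i * bumpW' y\<close> is minus the i-th derivative of \<open>bumpW\<close>.
  After (y \<cdot> \<nabla>)^(k+2) f is split as the sum of y_i (y \<cdot> \<nabla>)^(k+1)
  \<partial>_i f, integration by parts differentiates the polynomial once more in the same index i,
  and the Laplacian appears.\<close>

lemma hp_recursion:
  fixes f :: "real^'n \<Rightarrow> real"
  assumes f: "\<And>k. Ck k f"
  shows "(\<integral>y. bumpW' y * hp (Suc (Suc k)) f x y \<partial>lborel) = real (Suc k) * (\<integral>y. bumpW y * hp k (laplacian f) x y \<partial>lborel)"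
proof -
  have "(\<integral>y. bumpW' y * hp (Suc (Suc k)) f x y \<partial>lborel) = (\<integral>y. (\<Sum>i\<in>UNIV. y $ i * bumpW' y * hp (Suc k) (partial i f) x y) \<partial>lborel)"
    by (simp add: hp_Suc[OF f, of "Suc k"] sum_distrib_left algebra_simps)
  also have "\<dots> = (\<Sum>i\<in>UNIV. \<integral>y. y $ i * bumpW' y * hp (Suc k) (partial i f) x y \<partial>lborel)"
  proof (rule Bochner_Integration.integral_sum)
    fix i
    have "integrable lborel (\<lambda>y. bumpW' y * (y $ i * hp (Suc k) (partial i f) x y))"
      by (intro bumpW_integrable continuous_intros hp_cont)
    then show "integrable lborel (\<lambda>y. y $ i * bumpW' y * hp (Suc k) (partial i f) x y)"
      by (simp add: algebra_simps)
  qed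
  also have "\<dots> = (\<Sum>i\<in>UNIV. \<integral>y. real (Suc k) * (bumpW y * hp k (partial i (partial i f)) x y) \<partial>lborel)"
    unfolding bumpW_parts[OF Ck_hp] by (simp only: partial_hp[OF Ck_partial[OF f]] mult.left_commute)
  also have "\<dots> = real (Suc k) * (\<Sum>i\<in>UNIV. \<integral>y. bumpW y * hp k (partial i (partial i f)) x y \<partial>lborel)"
    by (simp only: sum_distrib_left integral_mult_right_zero)
  also have "(\<Sum>i\<in>UNIV. \<integral>y. bumpW y * hp k (partial i (partial i f)) x y \<partial>lborel)
     = (\<integral>y. bumpW y * hp k (laplacian f) x y \<partial>lborel)"
    by (subst Bochner_Integration.integral_sum[symmetric], intro bumpW_integrable hp_cont)
      (simp add: hp_laplacian[OF f, symmetric] sum_distrib_left)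
  finally show ?thesis .
qed

text \<open>The same integration by parts for the vector field with components y_i |y|^(2k), whose
  divergence is (N + 2k) |y|^(2k).\<close>

lemma radial_recursion:
  "(\<integral>y. bumpW' (y::real^'n) * norm y ^ (2 * Suc k) \<partial>lborel)
    = (real CARD('n) + 2 * real k) * (\<integral>y. bumpW (y::real^'n) * norm y ^ (2 * k) \<partial>lborel)"
proof -
  define n2 where "n2 y = (\<Sum>i\<in>UNIV. y $ i * y $ i)" for y :: "real^'n"
  have n2: "norm y ^ (2 * k) = n2 y ^ k" for y and k
    unfolding power_mult n2_def power2_norm_eq_inner by (simp add: inner_vec_def)
  have Ckn2: "Ck j n2" for j unfolding n2_def[abs_def] by (intro Ck_sum Ck_mult Ck_nth)
  have Ckn2p: "Ck j (\<lambda>y. n2 y ^ k)" for j k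
  proof -
    have "Ck j (\<lambda>y. \<Prod>i\<in>{..<k}. n2 y)" by (intro Ck_prod Ckn2)
    then show ?thesis by simp
  qed
  have dn2: "((\<lambda>s. n2 (y + s *\<^sub>R axis i 1)) has_real_derivative 2 * y $ i) (at 0)" for y i
  proof -
    have e: "n2 (y + s *\<^sub>R axis i 1) = n2 y + 2 * s * y $ i + s\<^sup>2" for s
    proof -
      have "n2 (y + s *\<^sub>R axis i 1) = (\<Sum>j\<in>UNIV. y $ j * y $ j + (if j = i then 2 * s * y $ i + s\<^sup>2 else 0))"
        unfolding n2_def by (intro sum.cong) (auto simp: axis_def power2_eq_square algebra_simps)
      then show ?thesis by (simp add: sum.distrib n2_def)
    qed
    show ?thesis unfolding e by (auto intro!: derivative_eq_intros)
  qed
  define F where "F i y = y $ i * n2 y ^ k" for i and y :: "real^'n"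
  have CkF: "Ck j (F i)" for i j unfolding F_def[abs_def] by (intro Ck_mult Ck_nth Ckn2p)
  have pF: "partial i (F i) y = n2 y ^ k + 2 * real k * (y $ i * y $ i) * n2 y ^ (k - 1)" for i y
  proof (rule partialI)
    have "((\<lambda>s. (y + s *\<^sub>R axis i 1) $ i * n2 (y + s *\<^sub>R axis i 1) ^ k) has_real_derivative
      1 * n2 (y + 0 *\<^sub>R axis i 1) ^ k + real k * (2 * y $ i * n2 (y + 0 *\<^sub>R axis i 1) ^ (k - 1)) * (y + 0 *\<^sub>R axis i 1) $ i) (at 0)"
    proof (rule DERIV_mult)
      show "((\<lambda>s. (y + s *\<^sub>R axis i 1) $ i) has_real_derivative 1) (at 0)"
        by (auto simp: axis_def intro!: derivative_eq_intros)
      show "((\<lambda>s. n2 (y + s *\<^sub>R axis i 1) ^ k) has_real_derivative real k * (2 * y $ i * n2 (y + 0 *\<^sub>R axis i 1) ^ (k - 1))) (at 0)"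
        using DERIV_power[OF dn2[of y i], of k] by simp
    qed
    then show "((\<lambda>s. F i (y + s *\<^sub>R axis i 1)) has_real_derivative n2 y ^ k + 2 * real k * (y $ i * y $ i) * n2 y ^ (k - 1)) (at 0)"
      by (simp add: F_def algebra_simps)
  qed
  have "(\<integral>y. bumpW' (y::real^'n) * norm y ^ (2 * Suc k) \<partial>lborel) = (\<integral>y. (\<Sum>i\<in>UNIV. y $ i * bumpW' y * F i y) \<partial>lborel)"
    unfolding n2 by (intro Bochner_Integration.integral_cong refl) (simp add: F_def sum_distrib_left sum_distrib_right n2_def[of _] algebra_simps)
  also have "\<dots> = (\<Sum>i\<in>UNIV. \<integral>y. y $ i * bumpW' y * F i y \<partial>lborel)"
  proof (rule Bochner_Integration.integral_sum)
    fix i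
    have "integrable lborel (\<lambda>y. bumpW' y * (y $ i * F i y))"
      by (intro bumpW_integrable continuous_intros Ck_cont[OF CkF])
    then show "integrable lborel (\<lambda>y. y $ i * bumpW' y * F i y)"
      by (simp add: algebra_simps)
  qed
  also have "\<dots> = (\<Sum>i\<in>UNIV. \<integral>y. bumpW y * partial i (F i) y \<partial>lborel)"
    by (simp add: bumpW_parts[OF CkF])
  also have "\<dots> = (\<integral>y. (\<Sum>i\<in>UNIV. bumpW y * partial i (F i) y) \<partial>lborel)"
    by (intro Bochner_Integration.integral_sum[symmetric] bumpW_integrable Ck_cont[OF Ck_partial[OF CkF]])
  also have "\<dots> = (\<integral>y. (real CARD('n) + 2 * real k) * (bumpW y * n2 y ^ k) \<partial>lborel)"
  proof (intro Bochner_Integration.integral_cong refl)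
    fix y
    have "(\<Sum>i\<in>UNIV. partial i (F i) y) = real CARD('n) * n2 y ^ k + 2 * real k * (n2 y * n2 y ^ (k - 1))"
      unfolding pF by (simp add: sum.distrib n2_def sum_distrib_left sum_distrib_right mult.assoc)
    moreover have "real k * (n2 y * n2 y ^ (k - 1)) = real k * n2 y ^ k" by (cases k) auto
    ultimately have "(\<Sum>i\<in>UNIV. partial i (F i) y) = (real CARD('n) + 2 * real k) * n2 y ^ k"
      by (simp only: mult.assoc distrib_right)
    then show "(\<Sum>i\<in>UNIV. bumpW y * partial i (F i) y) = (real CARD('n) + 2 * real k) * (bumpW y * n2 y ^ k)"
      by (simp add: sum_distrib_left[symmetric])
  qed
  finally show ?thesis unfolding n2 by simp
qed

lemma radial_positive: "0 < (\<integral>y. bumpW (y::real^'n) * norm y ^ (2 * k) \<partial>lborel)"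
proof -
  have int: "integrable lborel (\<lambda>y::real^'n. bumpW y * norm y ^ (2 * k))"
    by (intro bumpW_integrable continuous_intros)
  have nn: "0 \<le> bumpW y * norm y ^ (2 * k)" for y :: "real^'n" by (simp add: bumpW_def)
  have "(\<integral>y. bumpW (y::real^'n) * norm y ^ (2 * k) \<partial>lborel) \<noteq> 0"
  proof
    assume "(\<integral>y. bumpW (y::real^'n) * norm y ^ (2 * k) \<partial>lborel) = 0"
    then have "AE y in lborel. bumpW (y::real^'n) * norm y ^ (2 * k) = 0"
      using integral_nonneg_eq_0_iff_AE[OF int] nn by auto
    moreover have "AE y in lborel. y \<noteq> (0::real^'n)" by (rule AE_lborel_singleton)
    ultimately have "AE y in lborel. y \<notin> ball (0::real^'n) 1"
    proof eventually_elim
      case (elim y)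
      show ?case
      proof
        assume "y \<in> ball 0 1"
        then have "(norm y)\<^sup>2 < 1" by (simp add: power_less_one_iff abs_square_less_1)
        then show False using elim by (simp add: bumpW_def)
      qed
    qed
    then have "emeasure lborel (ball (0::real^'n) 1) = 0" by (subst (asm) AE_iff_measurable[where N = "ball 0 1"]) auto
    moreover have "0 < emeasure lborel (ball (0::real^'n) 1)" by (simp add: emeasure_ball unit_ball_vol_pos)
    ultimately show False by simp
  qed
  moreover have "0 \<le> (\<integral>y. bumpW (y::real^'n) * norm y ^ (2 * k) \<partial>lborel)" using nn by simp
  ultimately show ?thesis by linarith
qed

lemma nn_integral_scale:
  fixes f :: "'a::euclidean_space \<Rightarrow> ennreal"
  assumes [measurable]: "f \<in> borel_measurable borel" and r: "0 < r"
  shows "(\<integral>\<^sup>+y. f y \<partial>lborel) = ennreal (r ^ DIM('a)) * (\<integral>\<^sup>+y. f (r *\<^sub>R y) \<partial>lborel)"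
proof -
  have "(\<integral>\<^sup>+y. f y \<partial>lborel) = (\<integral>\<^sup>+y. f y \<partial>density (distr lborel borel (\<lambda>x. 0 + r *\<^sub>R x)) (\<lambda>_. \<bar>r\<bar> ^ DIM('a)))"
    using lborel_affine[of r "0::'a"] r by simp
  also have "\<dots> = ennreal (r ^ DIM('a)) * (\<integral>\<^sup>+y. f (r *\<^sub>R y) \<partial>lborel)"
    using r by (simp add: nn_integral_density nn_integral_distr nn_integral_cmult)
  finally show ?thesis .
qed

lemma AE_norm_neq: "AE y in lborel. norm (y::'a::euclidean_space) \<noteq> r"
proof -
  have "sphere (0::'a) r \<in> null_sets lborel"
    using negligible_sphere[of "0::'a" r] by (auto simp: null_sets_completion_iff negligible_iff_null_sets)
  then show ?thesis by (rule AE_I') auto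
qed

text \<open>Polar coordinates without a surface measure. A density that is homogeneous of degree 0
  gives the ball of radius x the mass x^N times that of the unit ball, so the distributions of |y|
  under two such densities are proportional and are identified by their tails. Each is multiplied by
  the total mass of the other, which avoids division in \<open>ennreal\<close>.\<close>

lemma polar_nn:
  fixes G :: "real^'n \<Rightarrow> real" and \<rho> :: "real \<Rightarrow> real"
  assumes G [measurable]: "G \<in> borel_measurable borel" and G0: "\<And>y. 0 \<le> G y" and GB: "\<And>y. norm y \<le> 1 \<Longrightarrow> G y \<le> B"
    and \<rho> [measurable]: "\<rho> \<in> borel_measurable borel"
  shows "emeasure lborel (ball (0::real^'n) 1) * (\<integral>\<^sup>+y. ennreal (\<rho> (norm y)) * ennreal (G (y /\<^sub>R norm y)) * indicator (ball 0 1) y \<partial>lborel)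
    = (\<integral>\<^sup>+y. ennreal (G (y /\<^sub>R norm y)) * indicator (ball 0 1) y \<partial>lborel) * (\<integral>\<^sup>+y. ennreal (\<rho> (norm (y::real^'n))) * indicator (ball 0 1) y \<partial>lborel)"
proof -
  define G0 where "G0 y = G (y /\<^sub>R norm y)" for y
  have mball [measurable]: "ball (0::real^'n) r \<in> sets borel" for r by simp
  have mG0 [measurable]: "G0 \<in> borel_measurable borel" unfolding G0_def[abs_def] by measurable
  have G0B: "G0 y \<le> B" for y unfolding G0_def by (rule GB) (cases "y = 0", auto)
  have G0nn: "0 \<le> G0 y" for y by (simp add: G0_def assms(2))
  define \<mu> where "\<mu> F = distr (density lborel (\<lambda>y. ennreal (F y) * indicator (ball 0 1) y)) borel norm" for F :: "real^'n \<Rightarrow> real"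
  define I where "I F = (\<integral>\<^sup>+y. ennreal (F y) * indicator (ball 0 1) y \<partial>lborel)" for F :: "real^'n \<Rightarrow> real"
  have tail: "emeasure (\<mu> F) {x<..} = I F * ennreal (1 - (if x < 0 then 0 else if x < 1 then x ^ CARD('n) else 1))" and fin: "I F < \<infinity>"
    if F [measurable]: "F \<in> borel_measurable borel" and F0: "\<And>y. 0 \<le> F y" "\<And>y. F y \<le> C"
      and hom: "\<And>r y. 0 < r \<Longrightarrow> F (r *\<^sub>R y) = F y" for F x C
  proof -
    have "I F \<le> (\<integral>\<^sup>+y. ennreal C * indicator (ball (0::real^'n) 1) y \<partial>lborel)"
      unfolding I_def using F0 by (intro nn_integral_mono mult_right_mono ennreal_leI) auto
    also have "\<dots> < \<infinity>"
      using emeasure_bounded_finite[OF bounded_ball[of "0 :: real^'n" 1]] by (simp add: nn_integral_cmult_indicator ennreal_mult_less_top)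
    finally show fin: "I F < \<infinity>" .
    have em: "emeasure (\<mu> F) A = (\<integral>\<^sup>+y. ennreal (F y) * indicator (ball 0 1) y * indicator A (norm y) \<partial>lborel)"
      if [measurable]: "A \<in> sets borel" for A
    proof -
      have "emeasure (\<mu> F) A = emeasure (density lborel (\<lambda>y. ennreal (F y) * indicator (ball 0 1) y)) (norm -` A \<inter> space lborel)"
        unfolding \<mu>_def by (subst emeasure_distr) auto
      also have "\<dots> = (\<integral>\<^sup>+y. ennreal (F y) * indicator (ball 0 1) y * indicator (norm -` A \<inter> space lborel) y \<partial>lborel)"
      proof (rule emeasure_density)
        show "(\<lambda>y. ennreal (F y) * indicator (ball 0 1) y) \<in> borel_measurable lborel" by measurable
        show "norm -` A \<inter> space lborel \<in> sets (lborel :: (real^'n) measure)"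
          using measurable_sets[of "norm :: real^'n \<Rightarrow> real" lborel borel A] by simp
      qed
      finally show ?thesis by (simp add: indicator_def)
    qed
    show "emeasure (\<mu> F) {x<..} = I F * ennreal (1 - (if x < 0 then 0 else if x < 1 then x ^ CARD('n) else 1))"
    proof (cases "x \<le> 0 \<or> 1 \<le> x")
      case True
      then consider "x < 0" | "x = 0" | "1 \<le> x" by linarith
      then show ?thesis
      proof cases
        case 1
        have "emeasure (\<mu> F) {x<..} = I F"
          unfolding em[OF borel_open[OF open_greaterThan]] I_def
          by (intro nn_integral_cong) (use 1 in \<open>auto simp: indicator_def intro: less_le_trans[OF _ norm_ge_zero]\<close>)
        then show ?thesis using 1 by simp
      next
        case 2
        have "AE y in lborel. y \<noteq> (0::real^'n)" by (rule AE_lborel_singleton)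
        then have "AE y in lborel. ennreal (F y) * indicator (ball 0 1) y * indicator {x<..} (norm y) = ennreal (F y) * indicator (ball 0 1) y"
          by eventually_elim (simp add: 2 indicator_def)
        then have "emeasure (\<mu> F) {x<..} = I F"
          unfolding em[OF borel_open[OF open_greaterThan]] I_def by (rule nn_integral_cong_AE)
        then show ?thesis using 2 by (simp add: power_0_left)
      next
        case 3
        have "emeasure (\<mu> F) {x<..} = (\<integral>\<^sup>+(y::real^'n). 0 \<partial>lborel)"
          unfolding em[OF borel_open[OF open_greaterThan]]
          by (intro nn_integral_cong) (use 3 in \<open>auto simp: indicator_def\<close>)
        then show ?thesis using 3 by simp
      qed
    next
      case False
      then have x: "0 < x" "x < 1" by auto
      have sc: "(\<integral>\<^sup>+y. ennreal (F y) * indicator (ball 0 x) y \<partial>lborel) = ennreal (x ^ CARD('n)) * I F"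
      proof -
        have "indicator (ball 0 x) (x *\<^sub>R y) = (indicator (ball 0 1) y :: ennreal)" for y :: "real^'n"
          using x by (auto simp: indicator_def)
        then show ?thesis
          unfolding I_def using x by (subst nn_integral_scale[of _ x]) (auto simp: hom)
      qed
      have "I F = (\<integral>\<^sup>+y. ennreal (F y) * indicator (ball 0 1) y * indicator {x<..} (norm y) + ennreal (F y) * indicator (ball 0 x) y \<partial>lborel)"
        unfolding I_def
      proof (rule nn_integral_cong_AE)
        show "AE y in lborel. ennreal (F y) * indicator (ball 0 1) y = ennreal (F y) * indicator (ball 0 1) y * indicator {x<..} (norm y) + ennreal (F y) * indicator (ball 0 x) y"
          using AE_norm_neq[of x] by eventually_elim (use x in \<open>auto simp: indicator_def\<close>)
      qed
      also have "\<dots> = emeasure (\<mu> F) {x<..} + ennreal (x ^ CARD('n)) * I F"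
        by (subst nn_integral_add) (auto simp: em sc)
      finally have e: "I F = emeasure (\<mu> F) {x<..} + ennreal (x ^ CARD('n)) * I F" .
      obtain g where g: "I F = ennreal g" "0 \<le> g" using fin by (cases "I F") auto
      have "emeasure (\<mu> F) {x<..} = ennreal g - ennreal (x ^ CARD('n)) * ennreal g"
        using e g by (metis ennreal_add_diff_cancel_right ennreal_mult_eq_top_iff ennreal_neq_top)
      also have "\<dots> = ennreal (g * (1 - x ^ CARD('n)))"
        using g x by (simp add: ennreal_mult'[symmetric] ennreal_minus algebra_simps)
      also have "\<dots> = I F * ennreal (1 - x ^ CARD('n))"
        using g x by (simp add: ennreal_mult' power_le_one)
      finally show ?thesis using x by simp
    qed
  qed
  let ?one = "\<lambda>y::real^'n. 1::real"
  have hG: "G0 (r *\<^sub>R y) = G0 y" if "0 < r" for r y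
  proof -
    have "inverse (norm (r *\<^sub>R y)) * r = inverse (norm y)" using that by (cases "y = 0") (auto simp: field_simps)
    then show ?thesis unfolding G0_def by (metis scaleR_scaleR)
  qed
  note tG = tail[OF mG0 G0nn G0B hG] and fG = fin[OF mG0 G0nn G0B hG]
  have t1: "emeasure (\<mu> ?one) {x<..} = I ?one * ennreal (1 - (if x < 0 then 0 else if x < 1 then x ^ CARD('n) else 1))" for x
    by (rule tail[where C = 1]) auto
  have f1: "I ?one < \<infinity>" by (rule fin[where C = 1]) auto
  have [simp]: "sets (\<mu> F) = sets borel" for F by (simp add: \<mu>_def)
  have eq: "scale_measure (I ?one) (\<mu> G0) = scale_measure (I G0) (\<mu> ?one)"
  proof (rule measure_eqI_lessThan)
    fix x
    show "emeasure (scale_measure (I ?one) (\<mu> G0)) {x<..} < \<infinity>"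
      using fG f1 by (simp add: tG ennreal_mult_less_top)
    show "emeasure (scale_measure (I ?one) (\<mu> G0)) {x<..} = emeasure (scale_measure (I G0) (\<mu> ?one)) {x<..}"
      by (simp add: tG t1 mult_ac)
  qed auto
  have int: "(\<integral>\<^sup>+u. ennreal (\<rho> u) \<partial>\<mu> F) = (\<integral>\<^sup>+y. ennreal (\<rho> (norm y)) * ennreal (F y) * indicator (ball 0 1) y \<partial>lborel)"
    if [measurable]: "F \<in> borel_measurable borel" for F
    unfolding \<mu>_def by (subst nn_integral_distr) (auto simp: nn_integral_density mult_ac)
  have "I ?one * (\<integral>\<^sup>+u. ennreal (\<rho> u) \<partial>\<mu> G0) = (\<integral>\<^sup>+u. ennreal (\<rho> u) \<partial>scale_measure (I ?one) (\<mu> G0))"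
    by (subst nn_integral_scale_measure) (auto simp: \<mu>_def)
  also have "\<dots> = I G0 * (\<integral>\<^sup>+u. ennreal (\<rho> u) \<partial>\<mu> ?one)"
    unfolding eq by (subst nn_integral_scale_measure) (auto simp: \<mu>_def)
  finally have "I ?one * (\<integral>\<^sup>+u. ennreal (\<rho> u) \<partial>\<mu> G0) = I G0 * (\<integral>\<^sup>+u. ennreal (\<rho> u) \<partial>\<mu> ?one)" .
  moreover have "I ?one = emeasure lborel (ball (0::real^'n) 1)" by (simp add: I_def)
  ultimately show ?thesis by (simp add: int I_def G0_def[symmetric] \<open>\<And>F. _ \<Longrightarrow> (\<integral>\<^sup>+u. ennreal (\<rho> u) \<partial>\<mu> F) = _\<close>)
qed

lemma ball_bounded_integrable:
  fixes f :: "real^'n \<Rightarrow> real"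
  assumes [measurable]: "f \<in> borel_measurable borel" and "\<And>y. norm y \<le> 1 \<Longrightarrow> \<bar>f y\<bar> \<le> B"
  shows "integrable lborel (\<lambda>y. indicator (ball 0 1) y * f y)"
proof (rule Bochner_Integration.integrable_bound)
  show "integrable lborel (\<lambda>y::real^'n. B * indicator (ball 0 1) y)"
    using emeasure_bounded_finite[OF bounded_ball[of "0 :: real^'n" 1]]
    by (intro integrable_mult_right integrable_real_indicator) auto
  have "0 \<le> B" using assms(2)[of 0] by simp
  then show "AE y in lborel. norm (indicator (ball 0 1) y * f y) \<le> norm (B * indicator (ball 0 1) y)"
    using assms(2) by (intro AE_I2) (auto simp: indicator_def)
  have [measurable]: "ball (0::real^'n) 1 \<in> sets borel" by simp
  show "(\<lambda>y. indicator (ball 0 1) y * f y) \<in> borel_measurable lborel" by measurable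
qed

lemma sphere_avg_eq:
  fixes g :: "real^'n \<Rightarrow> real"
  shows
  "sphere_avg g = (\<integral>y. indicator (ball 0 1) y * g (y /\<^sub>R norm y) \<partial>lborel) / measure lborel (ball (0::real^'n) 1)"
  by (simp add: sphere_avg_def set_lebesgue_integral_def)

lemma measure_ball_pos: "0 < measure lborel (ball (0::real^'n) 1)"
  using content_ball_pos[of 1 "0::real^'n"] by simp

text \<open>The signed case, by applying \<open>polar_nn\<close> to positive and negative parts; the
  bounds on \<open>G\<close> and \<rho> make all integrals finite.\<close>

lemma polar_avg:
  fixes G :: "real^'n \<Rightarrow> real" and \<rho> :: "real \<Rightarrow> real"
  assumes G [measurable]: "G \<in> borel_measurable borel" and GB: "\<And>y. norm y \<le> 1 \<Longrightarrow> \<bar>G y\<bar> \<le> B"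
    and \<rho> [measurable]: "\<rho> \<in> borel_measurable borel" and \<rho>0: "\<And>u. 0 \<le> \<rho> u" and \<rho>C: "\<And>u. 0 \<le> u \<Longrightarrow> u \<le> 1 \<Longrightarrow> \<rho> u \<le> C"
  shows "(\<integral>y. indicator (ball 0 1) y * (\<rho> (norm y) * G (y /\<^sub>R norm y)) \<partial>lborel)
    = sphere_avg G * (\<integral>y. indicator (ball 0 1) y * \<rho> (norm (y::real^'n)) \<partial>lborel)"
proof -
  have nB: "\<bar>G (y /\<^sub>R norm y)\<bar> \<le> B" for y by (rule GB) (cases "y = 0", auto)
  have B: "0 \<le> B" using nB[of 0] by linarith
  have \<rho>C': "\<bar>\<rho> (norm y)\<bar> \<le> C" if "norm y \<le> 1" for y :: "real^'n" using \<rho>0[of "norm y"] \<rho>C[of "norm y"] that by auto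
  have C: "0 \<le> C" using \<rho>C'[of 0] by simp
  have intF: "integrable lborel (\<lambda>y. indicator (ball 0 1) y * F (y /\<^sub>R norm y))"
      "integrable lborel (\<lambda>y. indicator (ball 0 1) y * (\<rho> (norm y) * F (y /\<^sub>R norm y)))"
    if [measurable]: "F \<in> borel_measurable borel" and FB: "\<And>y. \<bar>F (y /\<^sub>R norm y)\<bar> \<le> D" for F :: "real^'n \<Rightarrow> real" and D
  proof -
    show "integrable lborel (\<lambda>y. indicator (ball 0 1) y * F (y /\<^sub>R norm y))"
      by (rule ball_bounded_integrable[where B = D]) (measurable, rule FB)
    show "integrable lborel (\<lambda>y. indicator (ball 0 1) y * (\<rho> (norm y) * F (y /\<^sub>R norm y)))"
      by (rule ball_bounded_integrable[where B = "C * D"], measurable)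
        (unfold abs_mult, intro mult_mono \<rho>C' FB C, auto)
  qed
  have int\<rho>: "integrable lborel (\<lambda>y::real^'n. indicator (ball 0 1) y * \<rho> (norm y))"
    by (rule ball_bounded_integrable[where B = C]) (measurable, rule \<rho>C')
  have main: "(\<integral>y. indicator (ball 0 1) y * (\<rho> (norm y) * F (y /\<^sub>R norm y)) \<partial>lborel)
    = sphere_avg F * (\<integral>y. indicator (ball 0 1) y * \<rho> (norm (y::real^'n)) \<partial>lborel)"
    if [measurable]: "F \<in> borel_measurable borel" and F0: "\<And>y. 0 \<le> F y" and FB: "\<And>y. norm y \<le> 1 \<Longrightarrow> F y \<le> D" for F :: "real^'n \<Rightarrow> real" and D
  proof -
    have FB': "\<bar>F (y /\<^sub>R norm y)\<bar> \<le> D" for y using F0 FB[of "y /\<^sub>R norm y"] by (cases "y = 0") auto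
    let ?v = "measure lborel (ball (0::real^'n) 1)"
    have v: "emeasure lborel (ball (0::real^'n) 1) = ennreal ?v"
      using emeasure_bounded_finite[OF bounded_ball[of "0 :: real^'n" 1]] by (intro emeasure_eq_ennreal_measure) auto
    have c: "(\<integral>\<^sup>+y. ennreal (h y) * indicator (ball 0 1) y \<partial>lborel) = ennreal (\<integral>y. indicator (ball 0 1) y * h y \<partial>lborel)"
      if "integrable lborel (\<lambda>y. indicator (ball 0 1) y * h y)" "\<And>y. 0 \<le> h y" for h :: "real^'n \<Rightarrow> real"
    proof -
      have "(\<integral>\<^sup>+y. ennreal (h y) * indicator (ball 0 1) y \<partial>lborel) = (\<integral>\<^sup>+y. ennreal (indicator (ball 0 1) y * h y) \<partial>lborel)"
        by (intro nn_integral_cong) (auto simp: indicator_def)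
      also have "\<dots> = ennreal (\<integral>y. indicator (ball 0 1) y * h y \<partial>lborel)"
        using that by (intro nn_integral_eq_integral) auto
      finally show ?thesis .
    qed
    have "ennreal ?v * ennreal (\<integral>y. indicator (ball 0 1) y * (\<rho> (norm y) * F (y /\<^sub>R norm y)) \<partial>lborel)
      = ennreal (\<integral>y. indicator (ball 0 1) y * F (y /\<^sub>R norm y) \<partial>lborel) * ennreal (\<integral>y. indicator (ball 0 1) y * \<rho> (norm (y::real^'n)) \<partial>lborel)"
      using polar_nn[OF that(1) F0 FB \<rho>] F0 \<rho>0
      by (simp add: v c[symmetric] intF[OF that(1) FB'] int\<rho> ennreal_mult')
    then have "?v * (\<integral>y. indicator (ball 0 1) y * (\<rho> (norm y) * F (y /\<^sub>R norm y)) \<partial>lborel)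
      = (\<integral>y. indicator (ball 0 1) y * F (y /\<^sub>R norm y) \<partial>lborel) * (\<integral>y. indicator (ball 0 1) y * \<rho> (norm (y::real^'n)) \<partial>lborel)"
      using F0 \<rho>0 by (subst (asm) (1 2) ennreal_mult'[symmetric]) (auto intro!: integral_nonneg_AE simp: ennreal_inj)
    then show ?thesis using measure_ball_pos[where 'n = 'n] unfolding sphere_avg_eq by (simp add: field_simps)
  qed
  have m1: "(\<integral>y. indicator (ball 0 1) y * (\<rho> (norm y) * (max 0 (G (y /\<^sub>R norm y)))) \<partial>lborel)
    = sphere_avg (\<lambda>y. max 0 (G y)) * (\<integral>y. indicator (ball 0 1) y * \<rho> (norm (y::real^'n)) \<partial>lborel)"
    using main[of "\<lambda>y. max 0 (G y)" B] GB B by (auto simp: abs_le_iff)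
  have m2: "(\<integral>y. indicator (ball 0 1) y * (\<rho> (norm y) * (max 0 (- G (y /\<^sub>R norm y)))) \<partial>lborel)
    = sphere_avg (\<lambda>y. max 0 (- G y)) * (\<integral>y. indicator (ball 0 1) y * \<rho> (norm (y::real^'n)) \<partial>lborel)"
    using main[of "\<lambda>y. max 0 (- G y)" B] GB B by (auto simp: abs_le_iff)
  have dec: "G y = max 0 (G y) - max 0 (- G y)" for y by auto
  have B1: "\<bar>max 0 (G (y /\<^sub>R norm y))\<bar> \<le> B" "\<bar>max 0 (- G (y /\<^sub>R norm y))\<bar> \<le> B" for y using nB[of y] B by auto
  have i1: "integrable lborel (\<lambda>y. indicator (ball 0 1) y * max 0 (G (y /\<^sub>R norm y)))"
    "integrable lborel (\<lambda>y. indicator (ball 0 1) y * (\<rho> (norm y) * max 0 (G (y /\<^sub>R norm y))))"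
    using intF[of "\<lambda>y. max 0 (G y)", OF _ B1(1)] by auto
  have i2: "integrable lborel (\<lambda>y. indicator (ball 0 1) y * max 0 (- G (y /\<^sub>R norm y)))"
    "integrable lborel (\<lambda>y. indicator (ball 0 1) y * (\<rho> (norm y) * max 0 (- G (y /\<^sub>R norm y))))"
    using intF[of "\<lambda>y. max 0 (- G y)", OF _ B1(2)] by auto
  have s: "sphere_avg G = sphere_avg (\<lambda>y. max 0 (G y)) - sphere_avg (\<lambda>y. max 0 (- G y))"
    unfolding sphere_avg_eq diff_divide_distrib[symmetric] Bochner_Integration.integral_diff[OF i1(1) i2(1), symmetric]
    by (subst (1) dec) (simp only: right_diff_distrib)
  have "(\<integral>y. indicator (ball 0 1) y * (\<rho> (norm y) * G (y /\<^sub>R norm y)) \<partial>lborel)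
     = (\<integral>y. indicator (ball 0 1) y * (\<rho> (norm y) * max 0 (G (y /\<^sub>R norm y))) \<partial>lborel)
      - (\<integral>y. indicator (ball 0 1) y * (\<rho> (norm y) * max 0 (- G (y /\<^sub>R norm y))) \<partial>lborel)"
    unfolding Bochner_Integration.integral_diff[OF i1(2) i2(2), symmetric]
    by (subst (1) dec) (simp only: right_diff_distrib)
  then show ?thesis unfolding m1 m2 s by (simp add: left_diff_distrib)
qed

lemma hp_bounded: "\<exists>B. \<forall>y. norm y \<le> 1 \<longrightarrow> \<bar>hp k f x y\<bar> \<le> B"
proof -
  have "bounded (hp k f x ` cball 0 1)"
    by (intro compact_imp_bounded compact_continuous_image continuous_on_subset[OF hp_cont]) auto
  then obtain B where "\<forall>z\<in>hp k f x ` cball 0 1. norm z \<le> B" unfolding bounded_iff by blast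
  then show ?thesis by (intro exI[of _ B]) simp
qed

text \<open>By homogeneity the factor |y|^(2k) can be pulled out of the polynomial into the radial
  weight, leaving a function of the direction alone.\<close>

lemma hp_polar:
  fixes f :: "real^'n \<Rightarrow> real" and \<rho> :: "real \<Rightarrow> real"
  assumes c: "continuous_on UNIV \<rho>" and \<rho>: "\<And>u. 0 \<le> \<rho> u" and z: "\<And>u. 1 \<le> u \<Longrightarrow> \<rho> u = 0"
  shows "(\<integral>y. \<rho> (norm y) * hp (2 * k) f x y \<partial>lborel) = sphere_avg (hp (2 * k) f x) * (\<integral>y. \<rho> (norm (y::real^'n)) * norm y ^ (2 * k) \<partial>lborel)"
proof -
  obtain B where B: "\<And>y. norm y \<le> 1 \<Longrightarrow> \<bar>hp (2 * k) f x y\<bar> \<le> B" using hp_bounded by blast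
  define \<rho>' where "\<rho>' u = \<rho> u * u ^ (2 * k)" for u
  have c': "continuous_on UNIV \<rho>'" unfolding \<rho>'_def by (intro continuous_intros c)
  then have "bounded (\<rho>' ` {0..1})"
    by (intro compact_imp_bounded compact_continuous_image continuous_on_subset[OF c']) auto
  then obtain C where C: "\<And>u. 0 \<le> u \<Longrightarrow> u \<le> 1 \<Longrightarrow> \<rho>' u \<le> C" unfolding bounded_iff by (force simp: abs_le_iff)
  have "(\<integral>y. \<rho> (norm y) * hp (2 * k) f x y \<partial>lborel) = (\<integral>y. indicator (ball 0 1) y * (\<rho>' (norm y) * hp (2 * k) f x (y /\<^sub>R norm y)) \<partial>lborel)"
    unfolding \<rho>'_def by (subst hp_normalize) (auto intro!: Bochner_Integration.integral_cong simp: indicator_def z)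
  also have "\<dots> = sphere_avg (hp (2 * k) f x) * (\<integral>y. indicator (ball 0 1) y * \<rho>' (norm (y::real^'n)) \<partial>lborel)"
    by (rule polar_avg[OF borel_measurable_continuous_onI[OF hp_cont] B borel_measurable_continuous_onI[OF c'] _ C])
      (simp_all add: \<rho>'_def \<rho> power_mult)
  also have "(\<integral>y. indicator (ball 0 1) y * \<rho>' (norm (y::real^'n)) \<partial>lborel) = (\<integral>y. \<rho> (norm (y::real^'n)) * norm y ^ (2 * k) \<partial>lborel)"
    unfolding \<rho>'_def by (auto intro!: Bochner_Integration.integral_cong simp: indicator_def z)
  finally show ?thesis .
qed

text \<open>Both recursions lead to the same positive radial integral \<open>P\<close>. It cancels,
  and the quotient of the two recursion constants remains.\<close>

lemma sphere_avg_step: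
  fixes f :: "real^'n \<Rightarrow> real"
  assumes f: "\<And>k. Ck k f"
  shows "sphere_avg (hp (2 * Suc k) f x) = (2 * real k + 1) / (real CARD('n) + 2 * real k) * sphere_avg (hp (2 * k) (laplacian f) x)"
proof -
  define P where "P = (\<integral>y. bumpW (y::real^'n) * norm y ^ (2 * k) \<partial>lborel)"
  have P: "0 < P" unfolding P_def by (rule radial_positive)
  have z: "1 \<le> u \<Longrightarrow> max 0 (1 - u\<^sup>2) = 0" for u :: real by (simp add: abs_square_le_1 power2_nonneg_ge_1_iff)
  have 1: "(\<integral>y. bumpW' y * hp (2 * Suc k) f x y \<partial>lborel) = sphere_avg (hp (2 * Suc k) f x) * (\<integral>y. bumpW' (y::real^'n) * norm y ^ (2 * Suc k) \<partial>lborel)"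
    unfolding bumpW'_def by (rule hp_polar[where \<rho> = "\<lambda>u. 4 * max 0 (1 - u\<^sup>2)"]) (auto intro!: continuous_intros simp: z)
  have 2: "(\<integral>y. bumpW y * hp (2 * k) (laplacian f) x y \<partial>lborel) = sphere_avg (hp (2 * k) (laplacian f) x) * P"
    unfolding P_def bumpW_def by (rule hp_polar[where \<rho> = "\<lambda>u. (max 0 (1 - u\<^sup>2))\<^sup>2"]) (auto intro!: continuous_intros simp: z)
  have "sphere_avg (hp (2 * Suc k) f x) * ((real CARD('n) + 2 * real k) * P) = real (Suc (2 * k)) * (sphere_avg (hp (2 * k) (laplacian f) x) * P)"
    using hp_recursion[OF f, of "2 * k" x] unfolding P_def radial_recursion[symmetric] 1[symmetric]
    unfolding P_def[symmetric] 2 by simp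
  then have "sphere_avg (hp (2 * Suc k) f x) * (real CARD('n) + 2 * real k) = real (Suc (2 * k)) * sphere_avg (hp (2 * k) (laplacian f) x)"
    using P by (simp add: mult.assoc[symmetric] del: of_nat_Suc)
  moreover have "0 < real CARD('n) + 2 * real k" by (simp add: add_pos_nonneg)
  ultimately show ?thesis by (simp add: field_simps)
qed

lemma smooth_laplacian: "(\<And>k. Ck k f) \<Longrightarrow> Ck k (laplacian f)"
  unfolding laplacian_def[abs_def] by (intro Ck_sum Ck_partial)

text \<open>The average over the unit sphere of the 2m-th power of one coordinate.\<close>

definition kappa :: "nat \<Rightarrow> nat \<Rightarrow> real" where
  "kappa m N = (\<Prod>k<m. (2 * real k + 1) / (real N + 2 * real k))"

lemma sphere_avg_hp:
  fixes f :: "real^'n \<Rightarrow> real"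
  assumes f: "\<And>k. Ck k f"
  shows "sphere_avg (hp (2 * m) f x) = kappa m CARD('n) * (laplacian ^^ m) f x"
  using f
proof (induction m arbitrary: f)
  case 0
  have "sphere_avg (\<lambda>y::real^'n. f x) = f x"
    using measure_ball_pos[where 'n = 'n] unfolding sphere_avg_eq by simp
  then show ?case by (simp add: hp_0[abs_def] kappa_def)
next
  case (Suc m)
  have "sphere_avg (hp (2 * Suc m) f x) = (2 * real m + 1) / (real CARD('n) + 2 * real m) * (kappa m CARD('n) * (laplacian ^^ m) (laplacian f) x)"
    unfolding sphere_avg_step[OF Suc.prems] by (subst Suc.IH) (rule smooth_laplacian[OF Suc.prems], simp)
  then show ?case by (simp add: kappa_def funpow_swap1)
qed

subsection \<open>The Hardy inequality in a fixed direction\<close>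

lemma dist_inv_pow_alt:
  "dist_inv_pow \<Omega> m w x = (if {s. x + s *\<^sub>R w \<notin> \<Omega>} = {} then 0
     else inverse (infdist 0 {s. x + s *\<^sub>R w \<notin> \<Omega>} ^ (2 * m)))"
proof -
  have "{\<bar>s\<bar> | s::real. x + s *\<^sub>R w \<notin> \<Omega>} = dist 0 ` {s. x + s *\<^sub>R w \<notin> \<Omega>}" by auto
  then show ?thesis unfolding dist_inv_pow_def by (auto simp: infdist_def)
qed

lemma dist_inv_pow_nonneg: "0 \<le> dist_inv_pow \<Omega> m w x"
  unfolding dist_inv_pow_alt by (simp add: infdist_nonneg)

lemma closed_line_complement:
  fixes w x :: "'a::real_normed_vector"
  assumes "open \<Omega>" shows "closed {s::real. x + s *\<^sub>R w \<notin> \<Omega>}"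
proof -
  have "closed ((\<lambda>s. x + s *\<^sub>R w) -` (- \<Omega>))"
    using assms by (intro closed_vimage continuous_intros) auto
  then show ?thesis by (simp add: vimage_def)
qed

text \<open>A distance of at most r along the line means that the complement is hit for some
  parameter in [-r, r]; the infimum is attained because the complement is closed. The set of such
  pairs is the projection of a closed set along a compact interval, hence closed. Joint
  measurability is needed for Tonelli's theorem in \<open>Hardy_inequality\<close>.\<close>

lemma dist_inv_pow_measurable [measurable]:
  fixes \<Omega> :: "(real^'n) set"
  assumes \<Omega>: "open \<Omega>"
  shows "(\<lambda>(w, x). dist_inv_pow \<Omega> m w x) \<in> borel_measurable (borel \<Otimes>\<^sub>M borel)"
proof -
  define T where "T w x = {s. x + s *\<^sub>R w \<notin> \<Omega>}" for w x
  define B where "B r = {p :: (real^'n) \<times> (real^'n). \<exists>s. s \<in> {-r..r} \<and> (s, p) \<in> {(s, p). snd p + s *\<^sub>R fst p \<notin> \<Omega>}}" for r :: real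
  have "closed ((\<lambda>q::real \<times> (real^'n) \<times> (real^'n). snd (snd q) + fst q *\<^sub>R fst (snd q)) -` (- \<Omega>))"
    using \<Omega> by (intro closed_vimage continuous_intros) auto
  then have "closed {(s::real, p :: (real^'n) \<times> (real^'n)). snd p + s *\<^sub>R fst p \<notin> \<Omega>}"
    by (simp add: vimage_def case_prod_unfold)
  then have "closed (B r)" for r unfolding B_def by (intro closed_compact_projection) auto
  then have mB [measurable]: "B r \<in> sets borel" for r by simp
  have B: "(w, x) \<in> B r \<longleftrightarrow> (\<exists>s\<in>T w x. \<bar>s\<bar> \<le> r)" for w x r
    unfolding B_def T_def by (simp add: abs_le_iff Bex_def) (metis minus_le_iff)
  define E where "E = (\<Union>n::nat. B (real n))"
  have mE [measurable]: "E \<in> sets borel" unfolding E_def by measurable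
  have E: "(w, x) \<in> E \<longleftrightarrow> T w x \<noteq> {}" for w x
    unfolding E_def by (auto simp: B) (meson real_arch_simple)
  define g where "g p = (if p \<in> E then infdist 0 (T (fst p) (snd p)) else 0)" for p
  have "g \<in> borel_measurable borel"
  proof (rule borel_measurableI_le)
    fix r
    have "{p \<in> space borel. g p \<le> r} = (if r < 0 then {} else (- E) \<union> B r)"
    proof (cases "r < 0")
      case True
      then show ?thesis unfolding g_def using infdist_nonneg[of "0::real"] by (auto simp: not_le intro: less_le_trans)
    next
      case False
      have "infdist 0 (T w x) \<le> r \<longleftrightarrow> (w, x) \<in> B r" if "(w, x) \<in> E" for w x
      proof -
        have "closed (T w x)" "T w x \<noteq> {}" using that E closed_line_complement[OF \<Omega>] by (auto simp: T_def)
        then obtain s where "s \<in> T w x" "infdist 0 (T w x) = dist 0 s" using infdist_attained by metis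
        then show ?thesis unfolding B using infdist_le[of _ "T w x" 0] by force
      qed
      moreover have "B r \<subseteq> E" using B E by force
      ultimately show ?thesis using False unfolding g_def by force
    qed
    then show "{p \<in> space borel. g p \<le> r} \<in> sets borel" by auto
  qed
  then have [measurable]: "g \<in> borel_measurable borel" .
  have "(\<lambda>(w, x). dist_inv_pow \<Omega> m w x) = (\<lambda>p. if p \<in> E then inverse (g p ^ (2 * m)) else 0)"
    by (auto simp: fun_eq_iff dist_inv_pow_alt g_def E T_def)
  also have "\<dots> \<in> borel_measurable borel" by measurable
  finally show ?thesis unfolding borel_prod .
qed

text \<open>Inserting the factor \<open>1\<close> as the length of the slab on each line, and translating along \<open>w\<close>, avoids a rotation of
  coordinates.\<close>
lemma nn_integral_slice:
  fixes F :: "real^'n \<Rightarrow> ennreal" and w :: "real^'n"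
  assumes F [measurable]: "F \<in> borel_measurable borel" and w: "norm w = 1"
  shows "(\<integral>\<^sup>+x. F x \<partial>lborel) = (\<integral>\<^sup>+x. indicator {x. 0 \<le> x \<bullet> w \<and> x \<bullet> w < 1} x * (\<integral>\<^sup>+s. F (x + s *\<^sub>R w) \<partial>lborel) \<partial>lborel)"
proof -
  define Z where "Z = {x :: real^'n. 0 \<le> x \<bullet> w \<and> x \<bullet> w < 1}"
  have ww: "w \<bullet> w = 1" using w by (simp add: dot_square_norm)
  have [measurable]: "Z \<in> sets borel" unfolding Z_def by measurable
  have one: "(\<integral>\<^sup>+s. indicator Z (x + s *\<^sub>R w) \<partial>lborel) = (1::ennreal)" for x
  proof -
    have "(\<integral>\<^sup>+s. indicator Z (x + s *\<^sub>R w) \<partial>lborel) = (\<integral>\<^sup>+s. indicator {- (x \<bullet> w)..<1 - x \<bullet> w} s \<partial>lborel)"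
      by (intro nn_integral_cong) (auto simp: indicator_def Z_def inner_add_left ww)
    then show ?thesis by simp
  qed
  have "(\<integral>\<^sup>+x. F x \<partial>lborel) = (\<integral>\<^sup>+x. (\<integral>\<^sup>+s. F x * indicator Z (x + s *\<^sub>R w) \<partial>lborel) \<partial>lborel)"
    by (simp add: nn_integral_cmult one)
  also have "\<dots> = (\<integral>\<^sup>+s. (\<integral>\<^sup>+x. F x * indicator Z (x + s *\<^sub>R w) \<partial>lborel) \<partial>lborel)"
    by (rule lborel_pair.Fubini') measurable
  also have "\<dots> = (\<integral>\<^sup>+s. (\<integral>\<^sup>+x. F (x + (- s) *\<^sub>R w) * indicator Z x \<partial>lborel) \<partial>lborel)"
  proof (rule nn_integral_cong)
    fix s
    have "(\<integral>\<^sup>+x. F x * indicator Z (x + s *\<^sub>R w) \<partial>lborel)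
      = (\<integral>\<^sup>+x. F x * indicator Z (x + s *\<^sub>R w) \<partial>distr lborel borel ((+) (- s *\<^sub>R w)))"
      by (simp add: lborel_distr_plus)
    also have "\<dots> = (\<integral>\<^sup>+x. F (- s *\<^sub>R w + x) * indicator Z (- s *\<^sub>R w + x + s *\<^sub>R w) \<partial>lborel)"
      by (subst nn_integral_distr) auto
    finally show "(\<integral>\<^sup>+x. F x * indicator Z (x + s *\<^sub>R w) \<partial>lborel) = (\<integral>\<^sup>+x. F (x + (- s) *\<^sub>R w) * indicator Z x \<partial>lborel)"
      by (simp add: add.commute)
  qed
  also have "\<dots> = (\<integral>\<^sup>+s. (\<integral>\<^sup>+x. F (x + s *\<^sub>R w) * indicator Z x \<partial>lborel) \<partial>lborel)"
    by (subst nn_integral_real_affine[where c = "-1" and t = 0]) auto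
  also have "\<dots> = (\<integral>\<^sup>+x. (\<integral>\<^sup>+s. F (x + s *\<^sub>R w) * indicator Z x \<partial>lborel) \<partial>lborel)"
    by (rule lborel_pair.Fubini') measurable
  also have "\<dots> = (\<integral>\<^sup>+x. indicator Z x * (\<integral>\<^sup>+s. F (x + s *\<^sub>R w) \<partial>lborel) \<partial>lborel)"
  proof (rule nn_integral_cong)
    fix x
    have [measurable]: "(\<lambda>s. F (x + s *\<^sub>R w)) \<in> borel_measurable lborel" by measurable
    show "(\<integral>\<^sup>+s. F (x + s *\<^sub>R w) * indicator Z x \<partial>lborel) = indicator Z x * (\<integral>\<^sup>+s. F (x + s *\<^sub>R w) \<partial>lborel)"
      by (subst nn_integral_multc) (auto simp: mult.commute)
  qed
  finally show ?thesis unfolding Z_def .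
qed

lemma test_fun_measurable [measurable (raw)]: "test_fun \<Omega> f \<Longrightarrow> f \<in> borel_measurable borel"
  by (intro borel_measurable_continuous_onI test_fun_cont)

text \<open>Along a line x + s w the weight is the inverse power of \<open>infdist s (- U)\<close>
  with one parameter set \<open>U\<close> for the whole line, so \<open>Hardy_line\<close> applies;
  a line that never leaves \<Omega> has weight 0. \<open>nn_integral_slice\<close> reassembles the
  lines.\<close>

lemma Hardy_direction:
  fixes \<phi> :: "real^'n \<Rightarrow> real"
  assumes \<Omega>: "open \<Omega>" and \<phi>: "test_fun \<Omega> \<phi>" and w: "norm w = 1"
  shows "(\<integral>\<^sup>+x. ennreal (hardy_const m * ((\<phi> x)\<^sup>2 * dist_inv_pow \<Omega> m w x)) \<partial>lborel)
     \<le> (\<integral>\<^sup>+x. ennreal (((dirD w ^^ m) \<phi> x)\<^sup>2) \<partial>lborel)"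
proof -
  have [measurable]: "\<phi> \<in> borel_measurable borel" "(dirD w ^^ m) \<phi> \<in> borel_measurable borel"
    using test_fun_measurable[OF \<phi>] test_fun_measurable[OF test_fun_dirD_pow[OF \<phi>]] by auto
  have [measurable]: "(\<lambda>x. dist_inv_pow \<Omega> m w x) \<in> borel_measurable borel"
    using measurable_compose[OF measurable_Pair1'[of w borel borel] dist_inv_pow_measurable[OF \<Omega>, of m]] by simp
  have line: "(\<integral>\<^sup>+s. ennreal (hardy_const m * ((\<phi> (x + s *\<^sub>R w))\<^sup>2 * dist_inv_pow \<Omega> m w (x + s *\<^sub>R w))) \<partial>lborel)
      \<le> (\<integral>\<^sup>+s. ennreal (((dirD w ^^ m) \<phi> (x + s *\<^sub>R w))\<^sup>2) \<partial>lborel)" for x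
  proof -
    define h where "h j s = (dirD w ^^ j) \<phi> (x + s *\<^sub>R w)" for j s
    define U where "U = {s. x + s *\<^sub>R w \<in> \<Omega>}"
    define K where "K = {s. x + s *\<^sub>R w \<in> closure {x. \<phi> x \<noteq> 0}}"
    have clU: "closed (- U)" using closed_line_complement[OF \<Omega>, of x w] by (simp add: U_def Compl_eq)
    have T: "{\<sigma>. (x + s *\<^sub>R w) + \<sigma> *\<^sub>R w \<notin> \<Omega>} = {\<sigma>. s + \<sigma> \<in> - U}" for s
      by (simp add: U_def algebra_simps)
    show ?thesis
    proof (cases "- U = {}")
      case True
      then have "dist_inv_pow \<Omega> m w (x + s *\<^sub>R w) = 0" for s unfolding dist_inv_pow_alt T by simp
      then show ?thesis by simp
    next
      case False
      have inf: "infdist 0 {\<sigma>. s + \<sigma> \<in> - U} = infdist s (- U)" for s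
      proof -
        have "dist 0 ` {\<sigma>. s + \<sigma> \<in> - U} = dist s ` (- U)"
        proof (intro equalityI subsetI)
          fix d assume "d \<in> dist s ` (- U)"
          then obtain y where "y \<in> - U" "d = dist s y" by blast
          then show "d \<in> dist 0 ` {\<sigma>. s + \<sigma> \<in> - U}"
            by (intro image_eqI[of _ _ "y - s"]) (auto simp: dist_real_def abs_minus_commute)
        qed (force simp: dist_real_def)
        moreover have "{\<sigma>. s + \<sigma> \<in> - U} \<noteq> {}"
        proof -
          obtain y where "y \<in> - U" using False by blast
          then have "y - s \<in> {\<sigma>. s + \<sigma> \<in> - U}" by simp
          then show ?thesis by blast
        qed
        ultimately show ?thesis using False by (auto simp: infdist_def)
      qed
      have ne: "{\<sigma>. s + \<sigma> \<in> - U} \<noteq> {}" for s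
      proof -
        obtain y where "y \<in> - U" using False by blast
        then have "y - s \<in> {\<sigma>. s + \<sigma> \<in> - U}" by simp
        then show ?thesis by blast
      qed
      have dip: "dist_inv_pow \<Omega> m w (x + s *\<^sub>R w) = inverse (infdist s (- U) ^ (2 * m))" for s
        unfolding dist_inv_pow_alt T inf using ne[of s] by (simp only: if_False)
      have "(\<integral>\<^sup>+s. ennreal (hardy_const m * ((h 0 s)\<^sup>2 * inverse (infdist s (- U) ^ (2 * m)))) \<partial>lborel)
         \<le> (\<integral>\<^sup>+s. ennreal ((h m s)\<^sup>2) \<partial>lborel)"
      proof (rule Hardy_line)
        show "open U" using clU by (simp add: closed_def)
        show "compact K"
        proof -
          have "closed ((\<lambda>s. x + s *\<^sub>R w) -` closure {x. \<phi> x \<noteq> 0})"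
            by (intro closed_vimage continuous_intros) auto
          then have "closed K" by (simp add: K_def vimage_def)
          moreover have "bounded K"
          proof -
            obtain R where R: "\<And>y. y \<in> closure {x. \<phi> x \<noteq> 0} \<Longrightarrow> norm y \<le> R"
              using compact_imp_bounded[OF test_fun_compact[OF \<phi>]] unfolding bounded_iff by blast
            have "norm s \<le> R + norm x" if "s \<in> K" for s
              using R[of "x + s *\<^sub>R w"] that norm_triangle_ineq4[of "x + s *\<^sub>R w" x] w by (simp add: K_def)
            then show ?thesis unfolding bounded_iff by blast
          qed
          ultimately show ?thesis by (simp add: compact_eq_bounded_closed)
        qed
        show "K \<subseteq> U" using test_fun_subset[OF \<phi>] by (auto simp: K_def U_def)
        show "(h j has_real_derivative h (Suc j) s) (at s)" for j s
          unfolding h_def[abs_def] using dirD_has_derivative[OF test_fun_Ck[OF test_fun_dirD_pow[OF \<phi>, where w = w and m = j], of "Suc 0"], where x = x and w = w and s = s]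
          by simp
        show "h j s = 0" if "s \<notin> K" for j s
        proof -
          have "closure {x. (dirD w ^^ j) \<phi> x \<noteq> 0} \<subseteq> closure {x. \<phi> x \<noteq> 0}"
          proof (induction j)
            case (Suc j)
            have "closure {x. dirD w ((dirD w ^^ j) \<phi>) x \<noteq> 0} \<subseteq> closure {x. (dirD w ^^ j) \<phi> x \<noteq> 0}"
            proof (rule closure_minimal)
              show "{x. dirD w ((dirD w ^^ j) \<phi>) x \<noteq> 0} \<subseteq> closure {x. (dirD w ^^ j) \<phi> x \<noteq> 0}"
              proof
                fix y assume "y \<in> {x. dirD w ((dirD w ^^ j) \<phi>) x \<noteq> 0}"
                then obtain i where "partial i ((dirD w ^^ j) \<phi>) y \<noteq> 0"
                  unfolding dirD_def by (auto elim!: sum.not_neutral_contains_not_neutral)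
                then show "y \<in> closure {x. (dirD w ^^ j) \<phi> x \<noteq> 0}"
                  using supp_partial[of i "(dirD w ^^ j) \<phi>"] closure_subset[of "{x. partial i ((dirD w ^^ j) \<phi>) x \<noteq> 0}"] by auto
              qed
            qed simp
            then show ?case using Suc by simp
          qed simp
          then show ?thesis using that closure_subset[of "{x. (dirD w ^^ j) \<phi> x \<noteq> 0}"] unfolding h_def K_def by auto
        qed
      qed (use False in simp)
      then show ?thesis by (simp add: h_def dip)
    qed
  qed
  show ?thesis
    by (subst (1 2) nn_integral_slice[OF _ w]) (auto intro!: nn_integral_mono mult_left_mono line)
qed

subsection \<open>The multidimensional Hardy inequality\<close>

lemma norm_normalized_le: "norm (y /\<^sub>R norm y) \<le> 1" for y :: "'a::real_normed_vector"
  by (cases "y = 0") auto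

text \<open>The integral over x is a polynomial in the direction, with the finitely many
  coefficients \<open>c l\<close>. Averaging over directions can thus be exchanged with the integral
  over x term by term, and \<open>sphere_avg_hp\<close> evaluates the average inside.\<close>

lemma dirD_average:
  fixes \<phi> :: "real^'n \<Rightarrow> real"
  assumes \<phi>: "test_fun \<Omega> \<phi>"
  shows "integrable lborel (\<lambda>y. indicator (ball 0 1) y * (\<integral>x. ((dirD (y /\<^sub>R norm y) ^^ m) \<phi> x)\<^sup>2 \<partial>lborel))"
    and "(\<integral>y. indicator (ball 0 1) y * (\<integral>x. ((dirD (y /\<^sub>R norm y) ^^ m) \<phi> x)\<^sup>2 \<partial>lborel) \<partial>lborel)
      = measure lborel (ball (0::real^'n) 1) * (kappa m CARD('n) * Qm \<Omega> m \<phi>)"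
proof -
  let ?L = "{l :: 'n list. length l = 2 * m}"
  let ?v = "measure lborel (ball (0::real^'n) 1)"
  define c where "c l = (\<integral>x. \<phi> x * mpartial l \<phi> x \<partial>lborel)" for l
  have sm: "Ck k \<phi>" for k by (rule test_fun_Ck[OF \<phi>])
  have intl: "integrable lborel (\<lambda>x. \<phi> x * mpartial l \<phi> x)" for l
    by (rule test_fun_integrable_mult[OF \<phi> Ck_cont[OF smooth_mpartial[OF sm]]])
  have sq: "(\<integral>x. ((dirD w ^^ m) \<phi> x)\<^sup>2 \<partial>lborel) = (-1) ^ m * (\<Sum>l\<in>?L. (\<Prod>i\<leftarrow>l. w $ i) * c l)" for w
  proof -
    have "(\<integral>x. \<phi> x * (dirD w ^^ (2 * m)) \<phi> x \<partial>lborel) = (\<integral>x. (\<Sum>l\<in>?L. (\<Prod>i\<leftarrow>l. w $ i) * (\<phi> x * mpartial l \<phi> x)) \<partial>lborel)"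
      unfolding dirD_pow_eq[OF sm] by (simp add: sum_distrib_left algebra_simps)
    also have "\<dots> = (\<Sum>l\<in>?L. (\<Prod>i\<leftarrow>l. w $ i) * c l)"
      unfolding c_def by (subst Bochner_Integration.integral_sum) (auto intro!: integrable_mult_right intl)
    finally show ?thesis unfolding dirD_pow_square[OF \<phi>] by simp
  qed
  have cont_l: "continuous_on UNIV (\<lambda>w::real^'n. \<Prod>i\<leftarrow>l. w $ i)" for l by (rule Ck_cont[OF Ck_prod_list])
  have bnd_l: "\<exists>B. \<forall>w::real^'n. norm w \<le> 1 \<longrightarrow> \<bar>\<Prod>i\<leftarrow>l. w $ i\<bar> \<le> B" for l
  proof -
    have "bounded ((\<lambda>w::real^'n. \<Prod>i\<leftarrow>l. w $ i) ` cball 0 1)"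
      by (intro compact_imp_bounded compact_continuous_image continuous_on_subset[OF cont_l]) auto
    then obtain B where "\<forall>z\<in>(\<lambda>w::real^'n. \<Prod>i\<leftarrow>l. w $ i) ` cball 0 1. norm z \<le> B" unfolding bounded_iff by blast
    then show ?thesis by (intro exI[of _ B]) simp
  qed
  have int_l: "integrable lborel (\<lambda>y::real^'n. indicator (ball 0 1) y * (\<Prod>i\<leftarrow>l. (y /\<^sub>R norm y) $ i))" for l
  proof -
    obtain B where B: "\<And>w::real^'n. norm w \<le> 1 \<Longrightarrow> \<bar>\<Prod>i\<leftarrow>l. w $ i\<bar> \<le> B" using bnd_l by blast
    have [measurable]: "(\<lambda>w::real^'n. \<Prod>i\<leftarrow>l. w $ i) \<in> borel_measurable borel"
      by (rule borel_measurable_continuous_onI[OF cont_l])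
    have "(\<lambda>y::real^'n. y /\<^sub>R norm y) \<in> borel_measurable borel" by measurable
    from measurable_compose[OF this, of "\<lambda>w. \<Prod>i\<leftarrow>l. w $ i" borel]
    have m: "(\<lambda>y::real^'n. \<Prod>i\<leftarrow>l. (y /\<^sub>R norm y) $ i) \<in> borel_measurable borel" by simp
    show ?thesis
      by (rule ball_bounded_integrable[OF m], rule B, rule norm_normalized_le)
  qed
  have e: "indicator (ball 0 1) y * (\<integral>x. ((dirD (y /\<^sub>R norm y) ^^ m) \<phi> x)\<^sup>2 \<partial>lborel)
    = (\<Sum>l\<in>?L. (-1) ^ m * c l * (indicator (ball 0 1) y * (\<Prod>i\<leftarrow>l. (y /\<^sub>R norm y) $ i)))" for y
    unfolding sq by (simp only: sum_distrib_left ac_simps)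
  show "integrable lborel (\<lambda>y. indicator (ball 0 1) y * (\<integral>x. ((dirD (y /\<^sub>R norm y) ^^ m) \<phi> x)\<^sup>2 \<partial>lborel))"
    unfolding e by (intro Bochner_Integration.integrable_sum integrable_mult_right int_l)
  define a where "a l = (\<integral>(y::real^'n). indicator (ball 0 1) y * (\<Prod>i\<leftarrow>l. (y /\<^sub>R norm y) $ i) \<partial>lborel)" for l
  have "(\<integral>y. indicator (ball 0 1) y * (\<integral>x. ((dirD (y /\<^sub>R norm y) ^^ m) \<phi> x)\<^sup>2 \<partial>lborel) \<partial>lborel)
     = (\<Sum>l\<in>?L. (-1) ^ m * c l * a l)"
    unfolding e a_def by (subst Bochner_Integration.integral_sum) (auto intro!: integrable_mult_right int_l)
  also have "\<dots> = (\<integral>x. (\<Sum>l\<in>?L. ((-1) ^ m * a l) * (\<phi> x * mpartial l \<phi> x)) \<partial>lborel)"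
    unfolding c_def by (subst Bochner_Integration.integral_sum, intro integrable_mult_right intl)
      (simp only: integral_mult_right_zero, simp only: ac_simps)
  also have "\<dots> = (\<integral>x. ?v * kappa m CARD('n) * (((-1) ^ m * (laplacian ^^ m) \<phi> x) * \<phi> x) \<partial>lborel)"
  proof (intro Bochner_Integration.integral_cong refl)
    fix x
    have "sphere_avg (hp (2 * m) \<phi> x) = (\<Sum>l\<in>?L. a l * mpartial l \<phi> x) / ?v"
    proof -
      have "(\<integral>y. indicator (ball 0 1) y * hp (2 * m) \<phi> x (y /\<^sub>R norm y) \<partial>lborel)
        = (\<integral>y. (\<Sum>l\<in>?L. mpartial l \<phi> x * (indicator (ball 0 1) y * (\<Prod>i\<leftarrow>l. (y /\<^sub>R norm y) $ i))) \<partial>lborel)"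
        unfolding hp_def by (simp only: sum_distrib_left ac_simps)
      also have "\<dots> = (\<Sum>l\<in>?L. a l * mpartial l \<phi> x)"
        unfolding a_def by (subst Bochner_Integration.integral_sum) (auto intro!: integrable_mult_right int_l simp: mult.commute)
      finally show ?thesis unfolding sphere_avg_eq by simp
    qed
    then have "(\<Sum>l\<in>?L. a l * mpartial l \<phi> x) = ?v * (kappa m CARD('n) * (laplacian ^^ m) \<phi> x)"
      using measure_ball_pos[where 'n = 'n] unfolding sphere_avg_hp[OF sm] by (simp add: field_simps)
    moreover have "(\<Sum>l\<in>?L. ((-1) ^ m * a l) * (\<phi> x * mpartial l \<phi> x)) = (-1) ^ m * \<phi> x * (\<Sum>l\<in>?L. a l * mpartial l \<phi> x)"
      by (simp only: sum_distrib_left ac_simps)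
    ultimately show "(\<Sum>l\<in>?L. ((-1) ^ m * a l) * (\<phi> x * mpartial l \<phi> x)) = ?v * kappa m CARD('n) * (((-1) ^ m * (laplacian ^^ m) \<phi> x) * \<phi> x)"
      by (simp add: algebra_simps)
  qed
  also have "\<dots> = ?v * (kappa m CARD('n) * Qm \<Omega> m \<phi>)"
    unfolding Qm_def l2_inner_test[OF \<phi>] by simp
  finally show "(\<integral>y. indicator (ball 0 1) y * (\<integral>x. ((dirD (y /\<^sub>R norm y) ^^ m) \<phi> x)\<^sup>2 \<partial>lborel) \<partial>lborel)
      = ?v * (kappa m CARD('n) * Qm \<Omega> m \<phi>)" .
qed

text \<open>Origin of the constant: for each k the Hardy inequality contributes ((2k+1) / 2)^2 and
  the spherical average (2k+1) / (N+2k), with quotient (2k+1) (N+2k) / 4. The factor 2 is what the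
  time t/2 in the trace estimate compensates.\<close>

lemma c'_const_eq: "2 * c'_const m N * kappa m N = hardy_const m" if "0 < N"
proof -
  have "(2::real) powr (- real (2 * m) - 1) = inverse (4 ^ m) / 2"
    by (simp add: powr_diff powr_minus powr_realpow power_mult flip: of_nat_mult)
  then have "2 * c'_const m N = inverse (4 ^ m) * (\<Prod>k<m. real (N + 2 * k)) * (\<Prod>k<m. real (2 * k + 1))"
    by (simp add: c'_const_def)
  moreover have "inverse (4 ^ m) = (\<Prod>k<m. 1 / 4 :: real)" by (simp add: power_one_over inverse_eq_divide)
  ultimately have "2 * c'_const m N * kappa m N
     = (\<Prod>k<m. (1 / 4) * real (N + 2 * k) * real (2 * k + 1) * ((2 * real k + 1) / (real N + 2 * real k)))"
    by (simp only: kappa_def prod.distrib)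
  also have "\<dots> = hardy_const m"
    unfolding hardy_const_def
  proof (intro prod.cong refl)
    fix k
    have "real N + 2 * real k > 0" using that by simp
    then show "1 / 4 * real (N + 2 * k) * real (2 * k + 1) * ((2 * real k + 1) / (real N + 2 * real k)) = ((2 * real k + 1) / 2)\<^sup>2"
      unfolding of_nat_add of_nat_mult of_nat_1 of_nat_numeral by (simp add: power2_eq_square field_simps)
  qed
  finally show ?thesis .
qed

lemma am_inv_pow_nonneg: "0 \<le> am_inv_pow \<Omega> m x"
  unfolding am_inv_pow_def sphere_avg_eq
  by (intro divide_nonneg_nonneg integral_nonneg_AE) (auto simp: dist_inv_pow_nonneg)

lemma am_inv_pow_measurable:
  fixes \<Omega> :: "(real^'n) set"
  assumes \<Omega>: "open \<Omega>"
  shows "am_inv_pow \<Omega> m \<in> borel_measurable borel"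
proof -
  have [measurable]: "ball (0::real^'n) 1 \<in> sets borel" by simp
  have [measurable]: "(\<lambda>p. dist_inv_pow \<Omega> m (snd p /\<^sub>R norm (snd p)) (fst p)) \<in> borel_measurable (borel \<Otimes>\<^sub>M borel)"
    using measurable_compose[OF _ dist_inv_pow_measurable[OF \<Omega>, of m], of "\<lambda>p. (snd p /\<^sub>R norm (snd p), fst p)" "borel \<Otimes>\<^sub>M borel"] by simp
  have "(\<lambda>x. \<integral>y. indicator (ball 0 1) y * dist_inv_pow \<Omega> m (y /\<^sub>R norm y) x \<partial>lborel) \<in> borel_measurable borel"
    by (rule sigma_finite_measure.borel_measurable_lebesgue_integral[OF sigma_finite_lborel]) (simp add: case_prod_unfold)
  then show ?thesis unfolding am_inv_pow_def[abs_def] sphere_avg_eq by simp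
qed

theorem Hardy_inequality:
  fixes \<phi> :: "real^'n \<Rightarrow> real"
  assumes \<Omega>: "open \<Omega>" and \<phi>: "test_fun \<Omega> \<phi>"
  shows "(\<integral>\<^sup>+x. ennreal (2 * c'_const m CARD('n) * am_inv_pow \<Omega> m x * (\<phi> x)\<^sup>2) \<partial>lborel) \<le> ennreal (Qm \<Omega> m \<phi>)"
proof -
  let ?N = "CARD('n)"
  let ?v = "measure lborel (ball (0::real^'n) 1)"
  define D where "D y x = dist_inv_pow \<Omega> m (y /\<^sub>R norm y) x" for y x
  have D0: "0 \<le> D y x" for y x by (simp add: D_def dist_inv_pow_nonneg)
  have v: "0 < ?v" by (rule measure_ball_pos)
  have kpos: "0 < kappa m ?N" unfolding kappa_def
    by (intro prod_pos divide_pos_pos) (simp_all add: add_nonneg_pos add_pos_nonneg)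
  have hpos: "0 < hardy_const m" unfolding hardy_const_def
  proof (intro prod_pos)
    fix k
    have "0 < 2 * real k + 1" by (simp add: add_nonneg_pos)
    then show "0 < ((2 * real k + 1) / 2)\<^sup>2" by simp
  qed
  have [measurable]: "ball (0::real^'n) 1 \<in> sets borel" by simp
  have [measurable]: "(\<lambda>p. D (snd p) (fst p)) \<in> borel_measurable (borel \<Otimes>\<^sub>M borel)"
    using measurable_compose[OF _ dist_inv_pow_measurable[OF \<Omega>, of m], of "\<lambda>p. (snd p /\<^sub>R norm (snd p), fst p)" "borel \<Otimes>\<^sub>M borel"]
    unfolding D_def by simp
  have [measurable]: "(\<lambda>p. D (fst p) (snd p)) \<in> borel_measurable (borel \<Otimes>\<^sub>M borel)"
    using measurable_compose[OF _ dist_inv_pow_measurable[OF \<Omega>, of m], of "\<lambda>p. (fst p /\<^sub>R norm (fst p), snd p)" "borel \<Otimes>\<^sub>M borel"]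
    unfolding D_def by simp
  have [measurable]: "D y \<in> borel_measurable borel" for y
    using measurable_compose[OF measurable_Pair1'[of "y /\<^sub>R norm y" borel borel] dist_inv_pow_measurable[OF \<Omega>, of m]] unfolding D_def by simp
  have [measurable]: "(\<lambda>y. D y x) \<in> borel_measurable borel" for x
    using measurable_compose[OF _ dist_inv_pow_measurable[OF \<Omega>, of m], of "\<lambda>y. (y /\<^sub>R norm y, x)" borel] unfolding D_def by simp
  have [measurable]: "\<phi> \<in> borel_measurable borel" by (rule test_fun_measurable[OF \<phi>])
  \<comment> \<open>Only an inequality: where the weight is not integrable over directions, the
    Bochner integral in \<open>am_inv_pow\<close> has the value 0, while the right side is
    infinite.\<close>
  have V_le: "ennreal (?v * am_inv_pow \<Omega> m x) \<le> (\<integral>\<^sup>+y. indicator (ball 0 1) y * ennreal (D y x) \<partial>lborel)" for x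
  proof -
    have e: "?v * am_inv_pow \<Omega> m x = (\<integral>y. indicator (ball 0 1) y * D y x \<partial>lborel)"
      unfolding am_inv_pow_def sphere_avg_eq D_def using v by simp
    have e2: "(\<integral>\<^sup>+y. indicator (ball 0 1) y * ennreal (D y x) \<partial>lborel) = (\<integral>\<^sup>+y. ennreal (indicator (ball 0 1) y * D y x) \<partial>lborel)"
      by (intro nn_integral_cong) (auto simp: indicator_def)
    show ?thesis
    proof (cases "integrable lborel (\<lambda>y. indicator (ball 0 1) y * D y x)")
      case True
      then show ?thesis unfolding e e2 by (subst nn_integral_eq_integral) (auto simp: D0)
    qed (simp add: e not_integrable_integral_eq)
  qed
  have "ennreal ?v * (\<integral>\<^sup>+x. ennreal (2 * c'_const m ?N * am_inv_pow \<Omega> m x * (\<phi> x)\<^sup>2) \<partial>lborel)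
     = (\<integral>\<^sup>+x. ennreal (2 * c'_const m ?N * (\<phi> x)\<^sup>2) * ennreal (?v * am_inv_pow \<Omega> m x) \<partial>lborel)"
  proof -
    have c0: "0 \<le> 2 * c'_const m ?N" unfolding c'_const_def by (intro mult_nonneg_nonneg prod_nonneg) auto
    note am_inv_pow_measurable[OF \<Omega>, of m, measurable]
    have "ennreal ?v * ennreal (2 * c'_const m ?N * am_inv_pow \<Omega> m x * (\<phi> x)\<^sup>2)
       = ennreal (2 * c'_const m ?N * (\<phi> x)\<^sup>2) * ennreal (?v * am_inv_pow \<Omega> m x)" for x
      using c0 v am_inv_pow_nonneg[of \<Omega> m x] by (simp add: ennreal_mult'[symmetric] ac_simps)
    then show ?thesis by (subst nn_integral_cmult[symmetric]) auto
  qed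
  also have "\<dots> \<le> (\<integral>\<^sup>+x. ennreal (2 * c'_const m ?N * (\<phi> x)\<^sup>2) * (\<integral>\<^sup>+y. indicator (ball 0 1) y * ennreal (D y x) \<partial>lborel) \<partial>lborel)"
    by (intro nn_integral_mono mult_left_mono V_le) auto
  also have "\<dots> = (\<integral>\<^sup>+x. (\<integral>\<^sup>+y. ennreal (2 * c'_const m ?N * (\<phi> x)\<^sup>2) * (indicator (ball 0 1) y * ennreal (D y x)) \<partial>lborel) \<partial>lborel)"
    by (intro nn_integral_cong) (simp add: nn_integral_cmult)
  also have "\<dots> = (\<integral>\<^sup>+y. (\<integral>\<^sup>+x. ennreal (2 * c'_const m ?N * (\<phi> x)\<^sup>2) * (indicator (ball 0 1) y * ennreal (D y x)) \<partial>lborel) \<partial>lborel)"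
    by (rule lborel_pair.Fubini') measurable
  also have "\<dots> = (\<integral>\<^sup>+y. indicator (ball 0 1) y * (ennreal (inverse (kappa m ?N)) * (\<integral>\<^sup>+x. ennreal (hardy_const m * ((\<phi> x)\<^sup>2 * D y x)) \<partial>lborel)) \<partial>lborel)"
  proof (rule nn_integral_cong)
    fix y
    have k: "2 * c'_const m ?N = inverse (kappa m ?N) * hardy_const m"
      using c'_const_eq[of ?N m] kpos by (simp add: field_simps)
    have "ennreal (2 * c'_const m ?N * (\<phi> x)\<^sup>2) * (indicator (ball 0 1) y * ennreal (D y x))
      = (indicator (ball 0 1) y * ennreal (inverse (kappa m ?N))) * ennreal (hardy_const m * ((\<phi> x)\<^sup>2 * D y x))" for x
      unfolding k using kpos hpos D0[of y x] by (simp add: ennreal_mult' ac_simps)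
    then show "(\<integral>\<^sup>+x. ennreal (2 * c'_const m ?N * (\<phi> x)\<^sup>2) * (indicator (ball 0 1) y * ennreal (D y x)) \<partial>lborel)
      = indicator (ball 0 1) y * (ennreal (inverse (kappa m ?N)) * (\<integral>\<^sup>+x. ennreal (hardy_const m * ((\<phi> x)\<^sup>2 * D y x)) \<partial>lborel))"
      by (simp add: nn_integral_cmult mult.assoc)
  qed
  also have "\<dots> \<le> (\<integral>\<^sup>+y. indicator (ball 0 1) y * (ennreal (inverse (kappa m ?N)) * ennreal (\<integral>x. ((dirD (y /\<^sub>R norm y) ^^ m) \<phi> x)\<^sup>2 \<partial>lborel)) \<partial>lborel)"
  proof (rule nn_integral_mono_AE)
    \<comment> \<open>At y = 0 the normalised vector is 0 and not a unit vector, so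
      \<open>Hardy_direction\<close> does not apply there.\<close>
    have "AE y in lborel. y \<noteq> (0::real^'n)" by (rule AE_lborel_singleton)
    then show "AE y in lborel. indicator (ball 0 1) y * (ennreal (inverse (kappa m ?N)) * (\<integral>\<^sup>+x. ennreal (hardy_const m * ((\<phi> x)\<^sup>2 * D y x)) \<partial>lborel))
      \<le> indicator (ball 0 1) y * (ennreal (inverse (kappa m ?N)) * ennreal (\<integral>x. ((dirD (y /\<^sub>R norm y) ^^ m) \<phi> x)\<^sup>2 \<partial>lborel))"
    proof eventually_elim
      case (elim y)
      have t: "test_fun \<Omega> ((dirD (y /\<^sub>R norm y) ^^ m) \<phi>)" by (rule test_fun_dirD_pow[OF \<phi>])
      have "norm (y /\<^sub>R norm y) = 1" using elim by simp
      from Hardy_direction[OF \<Omega> \<phi> this, of m]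
      have "(\<integral>\<^sup>+x. ennreal (hardy_const m * ((\<phi> x)\<^sup>2 * D y x)) \<partial>lborel) \<le> (\<integral>\<^sup>+x. ennreal (((dirD (y /\<^sub>R norm y) ^^ m) \<phi> x)\<^sup>2) \<partial>lborel)"
        unfolding D_def .
      also have "\<dots> = ennreal (\<integral>x. ((dirD (y /\<^sub>R norm y) ^^ m) \<phi> x)\<^sup>2 \<partial>lborel)"
        using test_fun_integrable_mult[OF t test_fun_cont[OF t]]
        by (intro nn_integral_eq_integral) (auto simp: power2_eq_square)
      finally show ?case by (intro mult_left_mono) auto
    qed
  qed
  also have "\<dots> = (\<integral>\<^sup>+y. ennreal (inverse (kappa m ?N) * (indicator (ball 0 1) y * (\<integral>x. ((dirD (y /\<^sub>R norm y) ^^ m) \<phi> x)\<^sup>2 \<partial>lborel))) \<partial>lborel)"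
    using kpos by (intro nn_integral_cong) (auto simp: indicator_def ennreal_mult')
  also have "\<dots> = ennreal (inverse (kappa m ?N) * (?v * (kappa m ?N * Qm \<Omega> m \<phi>)))"
  proof (subst nn_integral_eq_integral)
    show "integrable lborel (\<lambda>y. inverse (kappa m ?N) * (indicator (ball 0 1) y * (\<integral>x. ((dirD (y /\<^sub>R norm y) ^^ m) \<phi> x)\<^sup>2 \<partial>lborel)))"
      by (intro integrable_mult_right dirD_average(1)[OF \<phi>])
    show "AE y in lborel. 0 \<le> inverse (kappa m ?N) * (indicator (ball 0 1) y * (\<integral>x. ((dirD (y /\<^sub>R norm y) ^^ m) \<phi> x)\<^sup>2 \<partial>lborel))"
      using kpos by (intro AE_I2 mult_nonneg_nonneg integral_nonneg_AE) auto
  qed (simp only: integral_mult_right_zero dirD_average(2)[OF \<phi>])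
  also have "\<dots> = ennreal ?v * ennreal (Qm \<Omega> m \<phi>)"
  proof -
    have "inverse (kappa m ?N) * (?v * (kappa m ?N * Qm \<Omega> m \<phi>)) = ?v * Qm \<Omega> m \<phi>" using kpos by simp
    then show ?thesis by (simp only: ennreal_mult'[OF less_imp_le[OF v]])
  qed
  finally have le: "ennreal ?v * (\<integral>\<^sup>+x. ennreal (2 * c'_const m ?N * am_inv_pow \<Omega> m x * (\<phi> x)\<^sup>2) \<partial>lborel) \<le> ennreal ?v * ennreal (Qm \<Omega> m \<phi>)" .
  have "ennreal ?v \<noteq> 0" "ennreal ?v \<noteq> top" using v by auto
  from iffD1[OF ennreal_mult_le_mult_iff[OF this] le] show ?thesis .
qed

subsection \<open>Dominated convergence in the space of square integrable functions\<close>

lemma abs_l2_tendsto: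
  assumes f [measurable]: "\<And>n. f n \<in> borel_measurable lborel" "F \<in> borel_measurable lborel"
    and g: "sqint g" and le: "\<And>n. AE x in lborel. \<bar>f n x\<bar> \<le> \<bar>g x\<bar>"
    and lim: "AE x in lborel. (\<lambda>n. f n x) \<longlonglongrightarrow> F x"
  shows "sqint (f n)" "sqint F" "(\<lambda>n. abs_l2 (f n)) \<longlonglongrightarrow> abs_l2 F"
proof -
  note [measurable] = sqint_measurable[OF g]
  have sq: "sqint (f n)" for n
  proof (rule sqint_bound[OF f(1) sqint_square[OF g]])
    show "AE x in lborel. (f n x)\<^sup>2 \<le> (g x)\<^sup>2" using le[of n] by eventually_elim (simp add: abs_le_square_iff)
  qed
  then show "sqint (f n)" .
  have le_all: "AE x in lborel. \<forall>n. \<bar>f n x\<bar> \<le> \<bar>g x\<bar>" using le by (simp add: AE_all_countable)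
  have leF: "AE x in lborel. \<bar>F x\<bar> \<le> \<bar>g x\<bar>"
    using le_all lim
  proof eventually_elim
    case (elim x)
    have "(\<lambda>n. \<bar>f n x\<bar>) \<longlonglongrightarrow> \<bar>F x\<bar>" by (intro tendsto_rabs elim)
    then show ?case using elim(1) by (intro LIMSEQ_le_const2) auto
  qed
  show sF: "sqint F"
  proof (rule sqint_bound[OF f(2) sqint_square[OF g]])
    show "AE x in lborel. (F x)\<^sup>2 \<le> (g x)\<^sup>2" using leF by eventually_elim (simp add: abs_le_square_iff)
  qed
  have "(\<lambda>n. \<integral>x. (f n x - F x)\<^sup>2 \<partial>lborel) \<longlonglongrightarrow> (\<integral>x. 0 \<partial>(lborel :: 'a measure))"
  proof (rule integral_dominated_convergence[where w = "\<lambda>x. 4 * (g x)\<^sup>2"])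
    show "integrable lborel (\<lambda>x. 4 * (g x)\<^sup>2)" by (intro integrable_mult_right sqint_square g)
    show "AE x in lborel. (\<lambda>n. (f n x - F x)\<^sup>2) \<longlonglongrightarrow> 0"
      using lim
    proof eventually_elim
      case (elim x)
      have "(\<lambda>n. (f n x - F x)\<^sup>2) \<longlonglongrightarrow> (F x - F x)\<^sup>2" by (intro tendsto_intros elim)
      then show ?case by simp
    qed
    fix n
    show "AE x in lborel. norm ((f n x - F x)\<^sup>2) \<le> 4 * (g x)\<^sup>2"
      using le[of n] leF
    proof eventually_elim
      case (elim x)
      have "\<bar>f n x - F x\<bar> \<le> 2 * \<bar>g x\<bar>" using elim by linarith
      then have "\<bar>f n x - F x\<bar>\<^sup>2 \<le> (2 * \<bar>g x\<bar>)\<^sup>2" by (intro power_mono) auto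
      then show ?case by (simp add: power_mult_distrib)
    qed
  qed auto
  then have "(\<lambda>n. (norm (abs_l2 (f n) - abs_l2 F))\<^sup>2) \<longlonglongrightarrow> 0"
    by (simp add: abs_l2_diff[symmetric] sq sF norm_abs_l2_sq sqint_diff)
  from tendsto_real_sqrt[OF this] have "(\<lambda>n. norm (abs_l2 (f n) - abs_l2 F)) \<longlonglongrightarrow> 0" by simp
  then show "(\<lambda>n. abs_l2 (f n)) \<longlonglongrightarrow> abs_l2 F"
    by (simp add: LIM_zero_iff tendsto_norm_zero_iff)
qed

subsection \<open>Smooth cut-off functions\<close>

text \<open>With p = 1 this is the classical flat function. Differentiation maps the family to
  itself, taking p to X^2 (p - p'), so smoothness follows by induction.\<close>

definition EP :: "real poly \<Rightarrow> real \<Rightarrow> real" where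
  "EP p x = (if x \<le> 0 then 0 else poly p (inverse x) * exp (- inverse x))"

lemma poly_times_exp_tendsto_0: "((\<lambda>u. poly r u * exp (- u)) \<longlongrightarrow> 0) at_top" for r :: "real poly"
proof -
  have "((\<lambda>u. \<Sum>i\<le>degree r. coeff r i * (u ^ i / exp u)) \<longlongrightarrow> (\<Sum>i\<le>degree r. coeff r i * 0)) at_top"
    by (intro tendsto_sum tendsto_mult tendsto_const tendsto_power_div_exp_0)
  then show ?thesis
    by (simp add: poly_altdef sum_distrib_right exp_minus divide_inverse mult.assoc)
qed

lemma EP_deriv: "(EP p has_real_derivative EP ([:0,0,1:] * (p - pderiv p)) x) (at x)"
proof (cases x "0::real" rule: linorder_cases)
  case less
  have "\<forall>\<^sub>F v in nhds x. v \<in> {..<0}" using less by (intro eventually_nhds_in_open) auto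
  then have "\<forall>\<^sub>F v in nhds x. EP p v = 0" by eventually_elim (auto simp: EP_def)
  then show ?thesis
    using less by (subst DERIV_cong_ev[where g = "\<lambda>_. 0" and y = x and v = 0]) (auto simp: EP_def)
next
  case greater
  have "\<forall>\<^sub>F v in nhds x. v \<in> {0<..}" using greater by (intro eventually_nhds_in_open) auto
  then have "\<forall>\<^sub>F v in nhds x. EP p v = poly p (inverse v) * exp (- inverse v)"
    by eventually_elim (auto simp: EP_def)
  moreover have "((\<lambda>v. poly p (inverse v) * exp (- inverse v)) has_real_derivative EP ([:0,0,1:] * (p - pderiv p)) x) (at x)"
  proof -
    have i: "((\<lambda>v::real. inverse v) has_real_derivative - (inverse x * inverse x)) (at x)"
      using greater by (auto intro!: derivative_eq_intros)
    have 1: "((\<lambda>v. poly p (inverse v)) has_real_derivative poly (pderiv p) (inverse x) * - (inverse x * inverse x)) (at x)"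
      by (rule DERIV_chain2[OF poly_DERIV i])
    have 2: "((\<lambda>v. exp (- inverse v)) has_real_derivative exp (- inverse x) * - (- (inverse x * inverse x))) (at x)"
      by (rule DERIV_chain2[OF DERIV_exp DERIV_minus[OF i]])
    show ?thesis
      by (rule DERIV_cong[OF DERIV_mult[OF 1 2]]) (use greater in \<open>simp add: EP_def algebra_simps\<close>)
  qed
  ultimately show ?thesis by (subst DERIV_cong_ev) auto
next
  case equal
  have r: "((\<lambda>h. EP p h / h) \<longlongrightarrow> 0) (at_right 0)"
  proof -
    have "((\<lambda>h. poly (pCons 0 p) (inverse h) * exp (- inverse h)) \<longlongrightarrow> 0) (at_right 0)"
      by (rule filterlim_compose[OF poly_times_exp_tendsto_0 filterlim_inverse_at_top_right])
    then show ?thesis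
      by (rule Lim_transform_eventually) (auto simp: eventually_at_filter EP_def divide_inverse)
  qed
  have l: "((\<lambda>h. EP p h / h) \<longlongrightarrow> 0) (at_left 0)"
    by (rule tendsto_eventually) (auto simp: eventually_at_filter EP_def)
  show ?thesis unfolding equal DERIV_def using l r by (simp add: EP_def filterlim_split_at)
qed

lemma EP_cont: "continuous_on A (EP p)"
  by (meson EP_deriv DERIV_isCont continuous_at_imp_continuous_on)

lemma Ck_EP: "Ck k (\<lambda>x::real^'n. EP p (c * x $ i + d))"
proof (induction k arbitrary: p)
  case (Suc k)
  show ?case
  proof (rule Ck_SucI[where D = "\<lambda>j x. (if j = i then c else 0) * EP ([:0,0,1:] * (p - pderiv p)) (c * x $ i + d)"])
    show "continuous_on UNIV (\<lambda>x::real^'n. EP p (c * x $ i + d))"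
      by (rule continuous_on_compose2[OF EP_cont[of UNIV]]) (auto intro!: continuous_intros)
    show "Ck k (\<lambda>x. (if j = i then c else 0) * EP ([:0, 0, 1:] * (p - pderiv p)) (c * x $ i + d))" for j
      by (intro Ck_cmult Suc.IH)
    fix j and x :: "real^'n"
    have a: "((\<lambda>s. c * (x + s *\<^sub>R axis j 1) $ i + d) has_real_derivative (if j = i then c else 0)) (at 0)"
      by (auto simp: axis_def intro!: derivative_eq_intros)
    show "((\<lambda>s. EP p (c * (x + s *\<^sub>R axis j 1) $ i + d)) has_real_derivative (if j = i then c else 0) * EP ([:0, 0, 1:] * (p - pderiv p)) (c * x $ i + d)) (at 0)"
      using DERIV_chain2[OF EP_deriv a] by (simp add: mult.commute)
  qed
qed (auto intro!: continuous_on_compose2[OF EP_cont[of UNIV]] continuous_intros)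

text \<open>Every coordinate carries a factor that is flat at the two faces of the box. Stretching
  by \<open>Suc n\<close> drives the product to the indicator of the open box while it keeps
  vanishing outside.\<close>

definition boxbump :: "real^'n \<Rightarrow> real^'n \<Rightarrow> nat \<Rightarrow> real^'n \<Rightarrow> real" where
  "boxbump a b n x = (\<Prod>i\<in>UNIV. EP 1 (real (Suc n) * x $ i + - real (Suc n) * a $ i) * EP 1 (- real (Suc n) * x $ i + real (Suc n) * b $ i))"

lemma EP1_bounds: "0 \<le> EP 1 u" "EP 1 u \<le> 1"
  by (auto simp: EP_def)

lemma boxbump_bounds: "0 \<le> boxbump a b n x" "boxbump a b n x \<le> 1"
  unfolding boxbump_def by (intro prod_nonneg prod_le_1 mult_nonneg_nonneg mult_le_one conjI ballI EP1_bounds)+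

lemma boxbump_outside: "x \<notin> box a b \<Longrightarrow> boxbump a b n x = 0"
proof -
  assume "x \<notin> box a b"
  then obtain i where "x $ i \<le> a $ i \<or> b $ i \<le> x $ i" by (auto simp: mem_box_cart not_less)
  then have "EP 1 (real (Suc n) * x $ i + - real (Suc n) * a $ i) * EP 1 (- real (Suc n) * x $ i + real (Suc n) * b $ i) = 0"
  proof
    assume "x $ i \<le> a $ i"
    then have "real (Suc n) * x $ i \<le> real (Suc n) * a $ i" by (intro mult_left_mono) auto
    then show ?thesis by (simp add: EP_def del: of_nat_Suc)
  next
    assume "b $ i \<le> x $ i"
    then have "real (Suc n) * b $ i \<le> real (Suc n) * x $ i" by (intro mult_left_mono) auto
    then show ?thesis by (simp add: EP_def del: of_nat_Suc)
  qed
  then show ?thesis unfolding boxbump_def by (intro prod_zero) auto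
qed

lemma boxbump_test_fun:
  assumes "cbox a b \<subseteq> \<Omega>"
  shows "test_fun \<Omega> (boxbump a b n)"
proof -
  have s: "closure {x. boxbump a b n x \<noteq> 0} \<subseteq> cbox a b"
    using boxbump_outside[of _ a b n] box_subset_cbox[of a b] by (intro closure_minimal) auto
  show ?thesis
    unfolding test_fun_def
  proof (intro conjI allI)
    show "Ck k (boxbump a b n)" for k
      unfolding boxbump_def[abs_def] by (intro Ck_prod Ck_mult Ck_EP)
    show "compact (closure {x. boxbump a b n x \<noteq> 0})"
      by (rule compact_closed_subset[OF compact_cbox closed_closure s])
    show "closure {x. boxbump a b n x \<noteq> 0} \<subseteq> \<Omega>" using s assms by blast
  qed
qed

lemma EP1_scaled_tendsto:
  assumes "0 < y" shows "(\<lambda>n. EP 1 (real (Suc n) * y)) \<longlonglongrightarrow> 1"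
proof -
  have "(\<lambda>n. exp (- (inverse (real (Suc n)) * inverse y))) \<longlonglongrightarrow> exp (- (0 * inverse y))"
    by (intro tendsto_intros LIMSEQ_inverse_real_of_nat)
  moreover have "exp (- (inverse (real (Suc n)) * inverse y)) = EP 1 (real (Suc n) * y)" for n
  proof -
    have "0 < real (Suc n) * y" using assms by (intro mult_pos_pos) auto
    then show ?thesis by (simp add: EP_def not_le del: of_nat_Suc)
  qed
  ultimately show ?thesis by simp
qed

lemma boxbump_tendsto: "(\<lambda>n. boxbump a b n x) \<longlonglongrightarrow> indicator (box a b) x"
proof (cases "x \<in> box a b")
  case True
  then have i: "0 < x $ i - a $ i" "0 < b $ i - x $ i" for i by (auto simp: mem_box_cart)
  have "(\<lambda>n. \<Prod>i\<in>UNIV. EP 1 (real (Suc n) * (x $ i - a $ i)) * EP 1 (real (Suc n) * (b $ i - x $ i))) \<longlonglongrightarrow> (\<Prod>i\<in>(UNIV::'a set). 1 * 1)"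
    by (intro tendsto_prod tendsto_mult EP1_scaled_tendsto i)
  then show ?thesis using True by (simp add: boxbump_def algebra_simps)
qed (simp add: boxbump_outside)

subsection \<open>Density of the test functions\<close>

lemma test_fun_sqint: "test_fun \<Omega> f \<Longrightarrow> sqint f"
  unfolding sqint_def using test_fun_integrable_mult[of \<Omega> f f] test_fun_cont[of \<Omega> f]
  by (auto simp: power2_eq_square intro: borel_measurable_continuous_onI)

definition test_l2 :: "(real^'n) set \<Rightarrow> (real^'n) l2 set" where
  "test_l2 \<Omega> = abs_l2 ` {f. test_fun \<Omega> f}"

lemma subspace_test_l2: "subspace (test_l2 \<Omega>)"
  unfolding subspace_def test_l2_def
proof (intro conjI ballI allI)
  show "0 \<in> abs_l2 ` {f. test_fun \<Omega> f}" unfolding zero_l2_def using test_fun_0 by blast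
  fix x y assume "x \<in> abs_l2 ` {f. test_fun \<Omega> f}" "y \<in> abs_l2 ` {f. test_fun \<Omega> f}"
  then obtain f g where "test_fun \<Omega> f" "test_fun \<Omega> g" "x = abs_l2 f" "y = abs_l2 g" by blast
  then show "x + y \<in> abs_l2 ` {f. test_fun \<Omega> f}"
    using test_fun_add[of \<Omega> f g] by (auto simp: abs_l2_add[symmetric] test_fun_sqint)
next
  fix c x assume "x \<in> abs_l2 ` {f. test_fun \<Omega> f}"
  then obtain f where "test_fun \<Omega> f" "x = abs_l2 f" by blast
  then show "c *\<^sub>R x \<in> abs_l2 ` {f. test_fun \<Omega> f}"
    using test_fun_cmult[of \<Omega> f c] by (auto simp: abs_l2_scaleR[symmetric] test_fun_sqint)
qed

lemma sqint_indicator_box: "sqint (\<lambda>x::'a::euclidean_space. indicator (A \<inter> box a b) x :: real)" if "A \<in> sets borel"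
proof -
  have [measurable]: "A \<in> sets borel" by fact
  have "emeasure lborel (A \<inter> box a b) \<le> emeasure lborel (box a b)" by (intro emeasure_mono) auto
  also have "\<dots> < \<infinity>" using emeasure_bounded_finite[OF bounded_box] .
  finally have "integrable lborel (indicator (A \<inter> box a b) :: 'a \<Rightarrow> real)" by (intro integrable_real_indicator) auto
  moreover have "(indicator (A \<inter> box a b) x :: real)\<^sup>2 = indicator (A \<inter> box a b) x" for x by (simp add: indicator_def)
  ultimately show ?thesis by (simp add: sqint_def)
qed

context
  fixes \<Omega> :: "(real^'n) set" and Cl
  defines "Cl \<equiv> closure (test_l2 \<Omega>)"
begin

lemma Cl_subspace: "subspace Cl"
  unfolding subspace_def
proof (intro conjI ballI allI)
  note S = subspace_test_l2[of \<Omega>]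
  show "0 \<in> Cl" unfolding Cl_def using subspace_0[OF S] closure_subset by blast
  fix x y assume "x \<in> Cl" "y \<in> Cl"
  then obtain u v where "\<And>n. u n \<in> test_l2 \<Omega>" "u \<longlonglongrightarrow> x" "\<And>n. v n \<in> test_l2 \<Omega>" "v \<longlonglongrightarrow> y"
    unfolding Cl_def closure_sequential by blast
  then show "x + y \<in> Cl"
    unfolding Cl_def closure_sequential
    by (intro exI[of _ "\<lambda>n. u n + v n"] conjI allI subspace_add[OF S] tendsto_add)
next
  note S = subspace_test_l2[of \<Omega>]
  fix c x assume "x \<in> Cl"
  then obtain u where "\<And>n. u n \<in> test_l2 \<Omega>" "u \<longlonglongrightarrow> x"
    unfolding Cl_def closure_sequential by blast
  then show "c *\<^sub>R x \<in> Cl"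
    unfolding Cl_def closure_sequential
    by (intro exI[of _ "\<lambda>n. c *\<^sub>R u n"] conjI allI subspace_scale[OF S] tendsto_scaleR tendsto_const)
qed

lemma Cl_lim: "(\<And>n. f n \<in> Cl) \<Longrightarrow> f \<longlonglongrightarrow> x \<Longrightarrow> x \<in> Cl"
  unfolding Cl_def by (metis closed_closure closed_sequentially)

lemma Cl_box: "cbox a b \<subseteq> \<Omega> \<Longrightarrow> abs_l2 (\<lambda>x. indicator (box a b) x) \<in> Cl"
proof -
  assume ab: "cbox a b \<subseteq> \<Omega>"
  have "(\<lambda>n. abs_l2 (boxbump a b n)) \<longlonglongrightarrow> abs_l2 (\<lambda>x. indicator (box a b) x)"
  proof (rule abs_l2_tendsto)
    show "sqint (\<lambda>x. indicator (UNIV \<inter> box a b) x :: real)" by (rule sqint_indicator_box) simp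
    show "AE x in lborel. \<bar>boxbump a b n x\<bar> \<le> \<bar>indicator (UNIV \<inter> box a b) x\<bar>" for n
      using boxbump_bounds[of a b n] boxbump_outside[of _ a b n] by (intro AE_I2) (auto simp: indicator_def)
    show "boxbump a b n \<in> borel_measurable lborel" for n
      by (rule sqint_measurable[OF test_fun_sqint[OF boxbump_test_fun[OF ab]]])
  qed (auto intro!: boxbump_tendsto)
  moreover have "abs_l2 (boxbump a b n) \<in> Cl" for n
    unfolding Cl_def test_l2_def using boxbump_test_fun[OF ab] by (intro closure_subset[THEN subsetD]) blast
  ultimately show ?thesis by (rule Cl_lim[rotated])
qed

lemma Cl_zero: "abs_l2 (\<lambda>x. 0) \<in> Cl"
  using subspace_0[OF Cl_subspace] by (simp add: zero_l2_def)

lemma sigma_sets_induct_disjoint_box: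
  assumes "A \<in> sigma_sets UNIV G" "Int_stable G" "G \<subseteq> Pow UNIV"
    and "\<And>A. A \<in> G \<Longrightarrow> P A" "P {}" "\<And>A. A \<in> sigma_sets UNIV G \<Longrightarrow> P A \<Longrightarrow> P (UNIV - A)"
    and "\<And>A. disjoint_family A \<Longrightarrow> range A \<subseteq> sigma_sets UNIV G \<Longrightarrow> (\<And>i. P (A i)) \<Longrightarrow> P (\<Union>i::nat. A i)"
  shows "P A"
  using sigma_sets_induct_disjoint[OF assms(2,3,1), of P] assms(4-) by blast

text \<open>Dynkin's argument inside a fixed box: boxes are stable under intersection and generate
  the Borel sets, complements become differences of classes, and disjoint unions become limits. The
  fixed box keeps all indicators square integrable.\<close>

lemma Cl_borel_box:
  assumes ab: "cbox a b \<subseteq> \<Omega>" and A: "A \<in> sets borel"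
  shows "abs_l2 (\<lambda>x. indicator (A \<inter> box a b) x) \<in> Cl"
proof -
  have gen: "sets borel = sigma_sets UNIV (range (\<lambda>(c::real^'n, d). box c d))"
    by (subst borel_eq_box) simp
  have "A \<in> sigma_sets UNIV (range (\<lambda>(c::real^'n, d). box c d))" using A gen by simp
  moreover have "Int_stable (range (\<lambda>(c::real^'n, d). box c d))"
    by (auto simp: Int_stable_def box_Int_box)
  moreover have "range (\<lambda>(c::real^'n, d). box c d) \<subseteq> Pow UNIV" by simp
  ultimately show ?thesis
  proof (induction rule: sigma_sets_induct_disjoint_box[consumes 3, case_names basic empty compl union])
    case (basic A)
    then obtain c d where A: "A = box c d" by auto
    define e f where "e = (\<Sum>i\<in>Basis. max (c\<bullet>i) (a\<bullet>i) *\<^sub>R i)" and "f = (\<Sum>i\<in>Basis. min (d\<bullet>i) (b\<bullet>i) *\<^sub>R i)"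
    have "box c d \<inter> box a b = box e f" unfolding e_def f_def by (rule box_Int_box)
    moreover have "cbox c d \<inter> cbox a b = cbox e f" unfolding e_def f_def by (rule Int_interval)
    then have "cbox e f \<subseteq> \<Omega>" using ab by blast
    ultimately show ?case unfolding A using Cl_box by simp
  next
    case empty
    show ?case using Cl_zero by simp
  next
    case (compl A)
    then have mA: "A \<in> sets borel" using gen by simp
    have e: "(\<lambda>x. indicator ((UNIV - A) \<inter> box a b) x :: real) = (\<lambda>x. indicator (UNIV \<inter> box a b) x - indicator (A \<inter> box a b) x)"
      by (auto simp: indicator_def fun_eq_iff)
    have "abs_l2 (\<lambda>x. indicator ((UNIV - A) \<inter> box a b) x) = abs_l2 (\<lambda>x. indicator (UNIV \<inter> box a b) x) - abs_l2 (\<lambda>x. indicator (A \<inter> box a b) x)"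
      unfolding e by (rule abs_l2_diff[OF sqint_indicator_box sqint_indicator_box[OF mA]]) simp
    then show ?case using compl Cl_box[OF ab] subspace_diff[OF Cl_subspace] by simp
  next
    case (union A)
    then have mA: "A i \<in> sets borel" for i using gen by auto
    have "(\<lambda>n. abs_l2 (\<lambda>x. \<Sum>i<n. indicator (A i \<inter> box a b) x)) \<longlonglongrightarrow> abs_l2 (\<lambda>x. indicator (\<Union> (range A) \<inter> box a b) x)"
    proof (rule abs_l2_tendsto)
      note [measurable] = mA
      have U: "\<Union> (range A) \<in> sets borel" using mA by blast
      have sum: "(\<Sum>i<n. indicator (A i \<inter> box a b) x :: real) = indicator ((\<Union>i<n. A i) \<inter> box a b) x" for n x
        using union(1) by (subst indicator_UN_disjoint[symmetric])
          (auto simp: disjoint_family_on_def indicator_def)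
      show "sqint (\<lambda>x. indicator (UNIV \<inter> box a b) x :: real)" by (rule sqint_indicator_box) simp
      show "AE x in lborel. \<bar>\<Sum>i<n. indicator (A i \<inter> box a b) x :: real\<bar> \<le> \<bar>indicator (UNIV \<inter> box a b) x\<bar>" for n
        unfolding sum by (intro AE_I2) (auto simp: indicator_def)
      show "AE x in lborel. (\<lambda>n. \<Sum>i<n. indicator (A i \<inter> box a b) x :: real) \<longlonglongrightarrow> indicator (\<Union> (range A) \<inter> box a b) x"
      proof (intro AE_I2, cases)
        fix x assume "x \<in> \<Union> (range A) \<inter> box a b"
        then obtain i where i: "x \<in> A i" "x \<in> box a b" by blast
        have "\<forall>\<^sub>F n in sequentially. (\<Sum>i<n. indicator (A i \<inter> box a b) x :: real) = indicator (\<Union> (range A) \<inter> box a b) x"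
          unfolding sum by (rule eventually_mono[OF eventually_gt_at_top[of i]]) (use i in \<open>auto simp: indicator_def\<close>)
        then show "(\<lambda>n. \<Sum>i<n. indicator (A i \<inter> box a b) x :: real) \<longlonglongrightarrow> indicator (\<Union> (range A) \<inter> box a b) x" by (rule tendsto_eventually)
      next
        fix x assume "x \<notin> \<Union> (range A) \<inter> box a b"
        then show "(\<lambda>n. \<Sum>i<n. indicator (A i \<inter> box a b) x :: real) \<longlonglongrightarrow> indicator (\<Union> (range A) \<inter> box a b) x"
          unfolding sum by (auto simp: indicator_def)
      qed
      show "(\<lambda>x. indicator (\<Union> (range A) \<inter> box a b) x :: real) \<in> borel_measurable lborel" using U by measurable
      show "(\<lambda>x. \<Sum>i<n. indicator (A i \<inter> box a b) x :: real) \<in> borel_measurable lborel" for n by measurable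
    qed
    moreover have "sqint (\<lambda>x. \<Sum>i<n. indicator (A i \<inter> box a b) x :: real) \<and> abs_l2 (\<lambda>x. \<Sum>i<n. indicator (A i \<inter> box a b) x) \<in> Cl" for n
    proof (induction n)
      case (Suc n)
      then show ?case
        using union(3)[of n] sqint_indicator_box[OF mA[of n]] by (auto simp: abs_l2_add intro!: sqint_add subspace_add[OF Cl_subspace])
    qed (simp add: sqint_0 Cl_zero)
    ultimately show ?case using Cl_lim[of "\<lambda>n. abs_l2 (\<lambda>x. \<Sum>i<n. indicator (A i \<inter> box a b) x)"] by blast
  qed
qed

text \<open>Square integrability is part of the inductive claim, because in the induction it is
  passed down from a sum or limit to the smaller functions that build it.\<close>

lemma Cl_nonneg_box:
  fixes u :: "real^'n \<Rightarrow> real"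
  assumes ab: "cbox a b \<subseteq> \<Omega>" and u: "u \<in> borel_measurable borel" "\<And>x. 0 \<le> u x"
  shows "sqint (\<lambda>x. indicator (box a b) x * u x) \<Longrightarrow> abs_l2 (\<lambda>x. indicator (box a b) x * u x) \<in> Cl"
  using u
proof (induction u rule: borel_measurable_induct_real)
  case (set A)
  have "(\<lambda>x. indicator (box a b) x * indicator A x :: real) = (\<lambda>x. indicator (A \<inter> box a b) x)"
    by (auto simp: indicator_def fun_eq_iff)
  then show ?case using Cl_borel_box[OF ab] set by simp
next
  case (mult u c)
  show ?case
  proof (cases "c = 0")
    case False
    have e: "(\<lambda>x. indicator (box a b) x * (c * u x)) = (\<lambda>x. c * (indicator (box a b) x * u x))" by (simp add: fun_eq_iff)
    have "sqint (\<lambda>x. inverse c * (indicator (box a b) x * (c * u x)))" using mult.prems by (rule sqint_cmult)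
    then have s: "sqint (\<lambda>x. indicator (box a b) x * u x)" using False by (simp add: field_simps)
    then show ?thesis unfolding e abs_l2_scaleR[OF s] using mult.IH by (intro subspace_scale[OF Cl_subspace])
  qed (simp add: Cl_zero)
next
  case (add u v)
  note [measurable] = \<open>u \<in> borel_measurable borel\<close> \<open>v \<in> borel_measurable borel\<close>
  have su: "sqint (\<lambda>x. indicator (box a b) x * u x)" "sqint (\<lambda>x. indicator (box a b) x * v x)"
    by (rule sqint_bound[OF _ sqint_square[OF add.prems]]; measurable?;
        use add in \<open>auto intro!: AE_I2 power_mono mult_left_mono\<close>)+
  have e: "(\<lambda>x. indicator (box a b) x * (v x + u x)) = (\<lambda>x. indicator (box a b) x * v x + indicator (box a b) x * u x)"
    "(\<lambda>x. indicator (box a b) x * (u x + v x)) = (\<lambda>x. indicator (box a b) x * u x + indicator (box a b) x * v x)"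
    by (simp_all add: fun_eq_iff distrib_left)
  show ?case unfolding e abs_l2_add[OF su] abs_l2_add[OF su(2,1)] using add.IH su by (auto intro!: subspace_add[OF Cl_subspace])
next
  case (seq U)
  note [measurable] = \<open>\<And>i. U i \<in> borel_measurable borel\<close> \<open>u \<in> borel_measurable borel\<close>
  have conv: "(\<lambda>i. U i x) \<longlonglongrightarrow> u x" for x
    using seq.hyps(4)[of x] by simp
  have le: "U i x \<le> u x" for i x
    using seq.hyps incseq_le[of "\<lambda>i. U i x" "u x" i] by (auto simp: incseq_def le_fun_def)
  have m: "(\<lambda>x. indicator (box a b) x * U i x) \<in> borel_measurable lborel" "(\<lambda>x. indicator (box a b) x * u x) \<in> borel_measurable lborel" for i
    by measurable
  have ae1: "AE x in lborel. \<bar>indicator (box a b) x * U i x\<bar> \<le> \<bar>indicator (box a b) x * u x\<bar>" for i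
  proof (intro AE_I2)
    fix x show "\<bar>indicator (box a b) x * U i x\<bar> \<le> \<bar>indicator (box a b) x * u x\<bar>"
      using le[of i x] seq.hyps(2)[of i x] by (simp add: indicator_def)
  qed
  have ae2: "AE x in lborel. (\<lambda>i. indicator (box a b) x * U i x) \<longlonglongrightarrow> indicator (box a b) x * u x"
    by (intro AE_I2 tendsto_mult tendsto_const conv)
  note lim = abs_l2_tendsto(3)[OF m seq.prems ae1 ae2] and sq = abs_l2_tendsto(1)[OF m seq.prems ae1 ae2]
  show ?case using Cl_lim[OF seq.IH[OF sq] lim] .
qed

lemma sqint_box_in_closure:
  fixes f :: "real^'n \<Rightarrow> real"
  assumes ab: "cbox a b \<subseteq> \<Omega>" and f: "sqint f"
  shows "abs_l2 (\<lambda>x. indicator (box a b) x * f x) \<in> Cl"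
proof -
  have [measurable]: "f \<in> borel_measurable borel" using sqint_measurable[OF f] by simp
  have s: "sqint (\<lambda>x. indicator (box a b) x * max 0 (f x))" "sqint (\<lambda>x. indicator (box a b) x * max 0 (- f x))"
    by (rule sqint_bound[OF _ sqint_square[OF f]]; measurable?; auto intro!: AE_I2 simp: indicator_def max_def)+
  have e: "(\<lambda>x. indicator (box a b) x * f x) = (\<lambda>x. indicator (box a b) x * max 0 (f x) - indicator (box a b) x * max 0 (- f x))"
    by (auto simp: fun_eq_iff max_def)
  show ?thesis unfolding e abs_l2_diff[OF s]
    by (intro subspace_diff[OF Cl_subspace] Cl_nonneg_box[OF ab] s) auto
qed

text \<open>\<Omega> is exhausted by countably many closed boxes made disjoint. Each piece is
  handled by \<open>sqint_box_in_closure\<close>, and the partial sums converge because they are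
  dominated by f.\<close>

lemma sqint_in_closure:
  fixes f :: "real^'n \<Rightarrow> real"
  assumes \<Omega>: "open \<Omega>" and f: "sqint f" and z: "\<And>x. x \<notin> \<Omega> \<Longrightarrow> f x = 0"
  shows "abs_l2 f \<in> Cl"
proof -
  have [measurable]: "f \<in> borel_measurable borel" using sqint_measurable[OF f] by simp
  obtain \<D> where D: "countable \<D>" "\<D> \<subseteq> Pow \<Omega>" "\<And>X. X \<in> \<D> \<Longrightarrow> \<exists>a b. X = cbox a b" "\<Union>\<D> = \<Omega>"
    using open_countable_Union_open_cbox[OF \<Omega>] by metis
  \<comment> \<open>\<open>from_nat_into\<close> enumerates only nonempty sets; the inserted empty
    box covers the case of an empty \<Omega>.\<close>
  define C where "C n = (from_nat_into (insert {} \<D>) n)" for n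
  have rC: "range C = insert {} \<D>" unfolding C_def using D(1) by (intro range_from_nat_into) auto
  have C: "C n \<subseteq> \<Omega>" "\<exists>a b. C n = cbox a b" for n
  proof -
    have "C n \<in> insert {} \<D>" using rC by blast
    moreover have "\<exists>a b. {} = cbox a (b::real^'n)" using empty_as_interval by blast
    ultimately show "\<exists>a b. C n = cbox a b" using D(3)[of "C n"] by (cases "C n = {}") (metis, blast)
    show "C n \<subseteq> \<Omega>" using \<open>C n \<in> insert {} \<D>\<close> D(2) by auto
  qed
  have UC: "(\<Union>n. C n) = \<Omega>" using rC D(4) by auto
  have mC [measurable]: "C n \<in> sets borel" for n using C(2)[of n] by auto
  have mD [measurable]: "disjointed C n \<in> sets borel" for n
  proof -
    have "range C \<subseteq> sets borel" using mC by blast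
    then show ?thesis using sets.range_disjointed_sets[of C borel] by blast
  qed
  have piece: "sqint (\<lambda>x. indicator (disjointed C n) x * f x)" "abs_l2 (\<lambda>x. indicator (disjointed C n) x * f x) \<in> Cl" for n
  proof -
    show s: "sqint (\<lambda>x. indicator (disjointed C n) x * f x)"
      by (rule sqint_mult_bounded[OF f, where B = 1]) (auto simp: indicator_def)
    obtain a b where ab: "C n = cbox a b" using C(2) by blast
    have "abs_l2 (\<lambda>x. indicator (box a b) x * (indicator (disjointed C n) x * f x)) \<in> Cl"
      using C(1)[of n] ab s by (intro sqint_box_in_closure) auto
    moreover have "abs_l2 (\<lambda>x. indicator (box a b) x * (indicator (disjointed C n) x * f x)) = abs_l2 (\<lambda>x. indicator (disjointed C n) x * f x)"
    proof (rule abs_l2_eqI[OF _ s])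
      show "sqint (\<lambda>x. indicator (box a b) x * (indicator (disjointed C n) x * f x))"
        by (rule sqint_mult_bounded[OF s, where B = 1]) (auto simp: indicator_def)
      \<comment> \<open>The cover consists of closed boxes, while the bumps reach only indicators of
        open ones; the difference is a null set.\<close>
      have "cbox a b - box a b \<in> null_sets lborel"
        using negligible_frontier_interval[of a b] by (auto simp: null_sets_completion_iff negligible_iff_null_sets)
      from AE_not_in[OF this]
      show "AE x in lborel. indicator (box a b) x * (indicator (disjointed C n) x * f x) = indicator (disjointed C n) x * f x"
      proof eventually_elim
        case (elim x)
        then show ?case using disjointed_subset[of C n] ab by (auto simp: indicator_def)
      qed
    qed
    ultimately show "abs_l2 (\<lambda>x. indicator (disjointed C n) x * f x) \<in> Cl" by simp
  qed
  have "(\<lambda>n. abs_l2 (\<lambda>x. \<Sum>i<n. indicator (disjointed C i) x * f x)) \<longlonglongrightarrow> abs_l2 f"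
  proof (rule abs_l2_tendsto[OF _ _ f])
    have sum: "(\<Sum>i<n. indicator (disjointed C i) x * f x) = indicator (\<Union>i<n. disjointed C i) x * f x" for n x
      using disjoint_family_disjointed[of C]
      by (subst indicator_UN_disjoint) (auto simp: sum_distrib_right disjoint_family_on_def)
    show "AE x in lborel. \<bar>\<Sum>i<n. indicator (disjointed C i) x * f x\<bar> \<le> \<bar>f x\<bar>" for n
      unfolding sum by (intro AE_I2) (auto simp: indicator_def)
    show "AE x in lborel. (\<lambda>n. \<Sum>i<n. indicator (disjointed C i) x * f x) \<longlonglongrightarrow> f x"
    proof (intro AE_I2, cases)
      fix x assume "x \<in> \<Omega>"
      then obtain i where i: "x \<in> disjointed C i" using UN_disjointed_eq[of C] UC by blast
      have "\<forall>\<^sub>F n in sequentially. (\<Sum>i<n. indicator (disjointed C i) x * f x) = f x"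
        unfolding sum by (rule eventually_mono[OF eventually_gt_at_top[of i]]) (use i in \<open>auto simp: indicator_def\<close>)
      then show "(\<lambda>n. \<Sum>i<n. indicator (disjointed C i) x * f x) \<longlonglongrightarrow> f x" by (rule tendsto_eventually)
    qed (simp add: z)
  qed measurable
  moreover have "sqint (\<lambda>x. \<Sum>i<n. indicator (disjointed C i) x * f x) \<and> abs_l2 (\<lambda>x. \<Sum>i<n. indicator (disjointed C i) x * f x) \<in> Cl" for n
  proof (induction n)
    case (Suc n)
    then show ?case using piece[of n] by (auto simp: abs_l2_add intro!: sqint_add subspace_add[OF Cl_subspace])
  qed (simp add: sqint_0 Cl_zero)
  ultimately show ?thesis using Cl_lim[of "\<lambda>n. abs_l2 (\<lambda>x. \<Sum>i<n. indicator (disjointed C i) x * f x)"] by blast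
qed

end

subsection \<open>Classes of functions on a domain\<close>

text \<open>Extension by zero: functions on \<Omega> correspond to the elements of
  \<open>closure (test_l2 \<Omega>)\<close>, by \<open>cls_in_closure\<close> and
  \<open>cls_rep\<close>.\<close>

definition cls :: "(real^'n) set \<Rightarrow> (real^'n \<Rightarrow> real) \<Rightarrow> (real^'n) l2" where
  "cls \<Omega> f = abs_l2 (\<lambda>x. indicator \<Omega> x * f x)"

lemma L2_iff: "L2 \<Omega> f \<longleftrightarrow> sqint (\<lambda>x. indicator \<Omega> x * f x)"
proof -
  have "(indicator \<Omega> x * f x)\<^sup>2 = indicator \<Omega> x *\<^sub>R (f x)\<^sup>2" for x by (simp add: indicator_def)
  then show ?thesis by (simp add: L2_def sqint_def set_borel_measurable_def set_integrable_def)
qed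

lemma l2_inner_cls: "L2 \<Omega> f \<Longrightarrow> L2 \<Omega> g \<Longrightarrow> l2_inner \<Omega> f g = inner (cls \<Omega> f) (cls \<Omega> g)"
  unfolding l2_inner_def set_lebesgue_integral_def cls_def
  by (subst inner_abs_l2) (auto simp: L2_iff indicator_def intro!: Bochner_Integration.integral_cong)

lemma l2_norm_cls: "L2 \<Omega> f \<Longrightarrow> l2_norm \<Omega> f = norm (cls \<Omega> f)"
  unfolding l2_norm_def by (simp add: l2_inner_cls norm_eq_sqrt_inner)

lemma
  assumes "L2 \<Omega> f" "L2 \<Omega> g"
  shows L2_add: "L2 \<Omega> (\<lambda>x. f x + g x)" and cls_add: "cls \<Omega> (\<lambda>x. f x + g x) = cls \<Omega> f + cls \<Omega> g"
    and L2_diff: "L2 \<Omega> (\<lambda>x. f x - g x)" and cls_diff: "cls \<Omega> (\<lambda>x. f x - g x) = cls \<Omega> f - cls \<Omega> g"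
  using sqint_add[of "\<lambda>x. indicator \<Omega> x * f x" "\<lambda>x. indicator \<Omega> x * g x"]
    sqint_diff[of "\<lambda>x. indicator \<Omega> x * f x" "\<lambda>x. indicator \<Omega> x * g x"]
    abs_l2_add[of "\<lambda>x. indicator \<Omega> x * f x" "\<lambda>x. indicator \<Omega> x * g x"]
    abs_l2_diff[of "\<lambda>x. indicator \<Omega> x * f x" "\<lambda>x. indicator \<Omega> x * g x"] assms
  by (simp_all add: L2_iff cls_def distrib_left right_diff_distrib)

lemma
  assumes "L2 \<Omega> f"
  shows L2_cmult: "L2 \<Omega> (\<lambda>x. c * f x)" and cls_cmult: "cls \<Omega> (\<lambda>x. c * f x) = c *\<^sub>R cls \<Omega> f"
  using sqint_cmult[of "\<lambda>x. indicator \<Omega> x * f x" c] abs_l2_scaleR[of "\<lambda>x. indicator \<Omega> x * f x" c] assms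
  by (simp_all add: L2_iff cls_def mult.left_commute)

lemma
  assumes "test_fun \<Omega> \<phi>"
  shows test_fun_L2: "L2 \<Omega> \<phi>" and cls_test: "cls \<Omega> \<phi> = abs_l2 \<phi>"
proof -
  have "(\<lambda>x. indicator \<Omega> x * \<phi> x) = \<phi>"
    using test_fun_outside[OF assms] by (auto simp: fun_eq_iff indicator_def)
  then show "L2 \<Omega> \<phi>" "cls \<Omega> \<phi> = abs_l2 \<phi>" using test_fun_sqint[OF assms] by (simp_all add: L2_iff cls_def)
qed

text \<open>Test functions vanish off \<Omega>, so the part of \<open>x\<close> there has norm at
  most \<open>norm (x - u n)\<close> for every approximating \<open>u n\<close>.\<close>

lemma cls_zero_off:
  assumes "open \<Omega>" "x \<in> closure (test_l2 \<Omega>)"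
  shows "AE t in lborel. t \<notin> \<Omega> \<longrightarrow> rep_l2 x t = 0"
proof -
  have [measurable]: "\<Omega> \<in> sets borel" using assms by simp
  obtain u where u: "\<And>n. u n \<in> test_l2 \<Omega>" "u \<longlonglongrightarrow> x" using assms(2) by (auto simp: closure_sequential)
  let ?i = "\<lambda>t. indicator (- \<Omega>) t :: real"
  have sq: "sqint (\<lambda>t. ?i t * rep_l2 x t)"
    by (rule sqint_mult_bounded[OF sqint_rep, where B = 1]) (auto simp: indicator_def)
  have "norm (abs_l2 (\<lambda>t. ?i t * rep_l2 x t)) \<le> norm (x - u n)" for n
  proof -
    obtain \<phi> where \<phi>: "test_fun \<Omega> \<phi>" "u n = abs_l2 \<phi>" using u(1)[of n] by (auto simp: test_l2_def)
    have ae: "AE t in lborel. (?i t * rep_l2 x t)\<^sup>2 \<le> (rep_l2 (x - u n) t)\<^sup>2"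
      using rep_l2_diff[of x "u n"] rep_abs_l2[OF test_fun_sqint[OF \<phi>(1)]]
    proof eventually_elim
      case (elim t)
      then show ?case using test_fun_outside[OF \<phi>(1), of t] \<phi>(2) by (simp add: indicator_def)
    qed
    have "(norm (abs_l2 (\<lambda>t. ?i t * rep_l2 x t)))\<^sup>2 \<le> (norm (abs_l2 (rep_l2 (x - u n))))\<^sup>2"
      unfolding norm_abs_l2_sq[OF sq] norm_abs_l2_sq[OF sqint_rep]
      by (rule integral_mono_AE[OF sqint_square[OF sq] sqint_square[OF sqint_rep] ae])
    then show ?thesis by simp
  qed
  moreover have "(\<lambda>n. norm (x - u n)) \<longlonglongrightarrow> norm (x - x)" by (intro tendsto_intros u(2))
  ultimately have "norm (abs_l2 (\<lambda>t. ?i t * rep_l2 x t)) \<le> 0" by (intro LIMSEQ_le_const) auto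
  then have "abs_l2 (\<lambda>t. ?i t * rep_l2 x t) = abs_l2 (\<lambda>t. 0)" by (simp add: zero_l2_def[symmetric])
  then have "AE t in lborel. ?i t * rep_l2 x t = 0" using abs_l2_eq_iff[OF sq sqint_0] by simp
  then show ?thesis by eventually_elim (auto simp: indicator_def)
qed

lemma cls_in_closure: "open \<Omega> \<Longrightarrow> L2 \<Omega> f \<Longrightarrow> cls \<Omega> f \<in> closure (test_l2 \<Omega>)"
  unfolding cls_def L2_iff by (rule sqint_in_closure) auto

lemma
  assumes \<Omega>: "open \<Omega>"
  shows L2_rep: "L2 \<Omega> (rep_l2 x)" and cls_rep: "x \<in> closure (test_l2 \<Omega>) \<Longrightarrow> cls \<Omega> (rep_l2 x) = x"
proof -
  have [measurable]: "\<Omega> \<in> sets borel" using \<Omega> by simp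
  have sq: "sqint (\<lambda>t. indicator \<Omega> t * rep_l2 x t)"
    by (rule sqint_mult_bounded[OF sqint_rep, where B = 1]) (auto simp: indicator_def)
  then show "L2 \<Omega> (rep_l2 x)" by (simp add: L2_iff)
  assume x: "x \<in> closure (test_l2 \<Omega>)"
  have "abs_l2 (\<lambda>t. indicator \<Omega> t * rep_l2 x t) = abs_l2 (rep_l2 x)"
    by (rule abs_l2_eqI[OF sq sqint_rep])
      (use cls_zero_off[OF \<Omega> x] in eventually_elim, auto simp: indicator_def)
  then show "cls \<Omega> (rep_l2 x) = x" by (simp add: cls_def)
qed

subsection \<open>The polyharmonic operator\<close>

definition poly_op :: "(real^'n) set \<Rightarrow> nat \<Rightarrow> (real^'n) l2 \<Rightarrow> (real^'n) l2" where
  "poly_op \<Omega> m u = abs_l2 (\<lambda>x. (-1) ^ m * (laplacian ^^ m) (SOME \<phi>. test_fun \<Omega> \<phi> \<and> abs_l2 \<phi> = u) x)"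

lemma test_fun_poly: "test_fun \<Omega> \<phi> \<Longrightarrow> test_fun \<Omega> (\<lambda>x. (-1) ^ m * (laplacian ^^ m) \<phi> x)"
  by (intro test_fun_cmult test_fun_laplacian_pow)

lemma inner_poly:
  assumes "test_fun \<Omega> \<phi>" "test_fun \<Omega> \<psi>"
  shows "inner (abs_l2 (\<lambda>x. (-1) ^ m * (laplacian ^^ m) \<phi> x)) (abs_l2 \<psi>) = inner (abs_l2 \<phi>) (abs_l2 (\<lambda>x. (-1) ^ m * (laplacian ^^ m) \<psi> x))"
proof -
  note sq = test_fun_sqint[OF assms(1)] test_fun_sqint[OF assms(2)]
    test_fun_sqint[OF test_fun_poly[OF assms(1)]] test_fun_sqint[OF test_fun_poly[OF assms(2)]]
  show ?thesis
    using laplacian_pow_sym[OF assms, of m]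
    by (simp add: inner_abs_l2 sq mult.assoc mult.left_commute[of _ "(-1) ^ m"])
qed

text \<open>The chosen representative is immaterial: the images of two representatives differ by a
  test function, and testing this difference against itself and moving the operator across gives
  0.\<close>

lemma poly_op_abs:
  assumes \<phi>: "test_fun \<Omega> \<phi>"
  shows "poly_op \<Omega> m (abs_l2 \<phi>) = abs_l2 (\<lambda>x. (-1) ^ m * (laplacian ^^ m) \<phi> x)"
proof -
  let ?P = "\<lambda>\<phi> x. (-1) ^ m * (laplacian ^^ m) \<phi> x"
  define \<psi> where "\<psi> = (SOME \<psi>. test_fun \<Omega> \<psi> \<and> abs_l2 \<psi> = abs_l2 \<phi>)"
  have "test_fun \<Omega> \<psi> \<and> abs_l2 \<psi> = abs_l2 \<phi>" unfolding \<psi>_def by (rule someI[of _ \<phi>]) (use \<phi> in simp)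
  then have \<psi>: "test_fun \<Omega> \<psi>" "abs_l2 \<psi> = abs_l2 \<phi>" by auto
  have t: "test_fun \<Omega> (\<lambda>x. ?P \<psi> x - ?P \<phi> x)" by (intro test_fun_diff test_fun_poly \<psi> \<phi>)
  have "abs_l2 (\<lambda>x. ?P \<psi> x - ?P \<phi> x) = abs_l2 (?P \<psi>) - abs_l2 (?P \<phi>)"
    by (rule abs_l2_diff) (intro test_fun_sqint[of \<Omega>] test_fun_poly \<psi> \<phi>)+
  then have "inner (abs_l2 (?P \<psi>) - abs_l2 (?P \<phi>)) (abs_l2 (?P \<psi>) - abs_l2 (?P \<phi>)) = inner (abs_l2 (?P \<psi>) - abs_l2 (?P \<phi>)) (abs_l2 (\<lambda>x. ?P \<psi> x - ?P \<phi> x))"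
    by simp
  also have "\<dots> = 0"
    unfolding inner_diff_left inner_poly[OF \<psi>(1) t] inner_poly[OF \<phi> t] \<psi>(2) by simp
  finally have "abs_l2 (?P \<psi>) = abs_l2 (?P \<phi>)" by simp
  then show ?thesis unfolding poly_op_def \<psi>_def[symmetric] .
qed

locale polyharmonic =
  fixes \<Omega> :: "(real^'n) set" and m :: nat
  assumes \<Omega>: "open \<Omega>"
begin

sublocale form_op "test_l2 \<Omega>" "poly_op \<Omega> m"
proof (rule form_op.intro)
  show "subspace (test_l2 \<Omega>)" by (rule subspace_test_l2)
  fix x y :: "(real^'n) l2" and a :: real
  assume x: "x \<in> test_l2 \<Omega>"
  then obtain \<phi> where \<phi>: "test_fun \<Omega> \<phi>" "x = abs_l2 \<phi>" by (auto simp: test_l2_def)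
  show "0 \<le> inner (poly_op \<Omega> m x) x"
    using laplacian_pow_pos[OF \<phi>(1), of m] unfolding \<phi>(2) poly_op_abs[OF \<phi>(1)]
    by (subst inner_abs_l2) (auto intro: test_fun_sqint[OF test_fun_poly[OF \<phi>(1)]] test_fun_sqint[OF \<phi>(1)])
  have lap_c: "(laplacian ^^ m) (\<lambda>x. a * \<phi> x) = (\<lambda>x. a * (laplacian ^^ m) \<phi> x)" for m
  proof (induction m)
    case (Suc m)
    have t: "Ck k ((laplacian ^^ m) \<phi>)" for k by (rule test_fun_Ck[OF test_fun_laplacian_pow[OF \<phi>(1)]])
    have "partial i (partial i (\<lambda>x. a * (laplacian ^^ m) \<phi> x)) = (\<lambda>x. a * partial i (partial i ((laplacian ^^ m) \<phi>)) x)" for i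
      by (simp add: partial_cmult[OF t[of "Suc 0"]] partial_cmult[OF Ck_partial[OF t[of "Suc (Suc 0)"]]])
    then have "laplacian (\<lambda>x. a * (laplacian ^^ m) \<phi> x) = (\<lambda>x. a * laplacian ((laplacian ^^ m) \<phi>) x)"
      unfolding laplacian_def[of "\<lambda>x. a * (laplacian ^^ m) \<phi> x"] laplacian_def[of "(laplacian ^^ m) \<phi>"]
      by (simp add: sum_distrib_left)
    then show ?case by (simp add: Suc)
  qed simp
  show "poly_op \<Omega> m (a *\<^sub>R x) = a *\<^sub>R poly_op \<Omega> m x"
  proof -
    have "a *\<^sub>R x = abs_l2 (\<lambda>x. a * \<phi> x)" unfolding \<phi>(2) by (rule abs_l2_scaleR[symmetric, OF test_fun_sqint[OF \<phi>(1)]])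
    then have "poly_op \<Omega> m (a *\<^sub>R x) = abs_l2 (\<lambda>x. a * ((-1) ^ m * (laplacian ^^ m) \<phi> x))"
      by (simp add: poly_op_abs[OF test_fun_cmult[OF \<phi>(1)]] lap_c mult.left_commute)
    also have "\<dots> = a *\<^sub>R abs_l2 (\<lambda>x. (-1) ^ m * (laplacian ^^ m) \<phi> x)"
      by (rule abs_l2_scaleR[OF test_fun_sqint[OF test_fun_poly[OF \<phi>(1)]]])
    finally show ?thesis unfolding \<phi>(2) poly_op_abs[OF \<phi>(1)] .
  qed
  assume y: "y \<in> test_l2 \<Omega>"
  then obtain \<psi> where \<psi>: "test_fun \<Omega> \<psi>" "y = abs_l2 \<psi>" by (auto simp: test_l2_def)
  show "inner (poly_op \<Omega> m x) y = inner x (poly_op \<Omega> m y)"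
    unfolding \<phi>(2) \<psi>(2) poly_op_abs[OF \<phi>(1)] poly_op_abs[OF \<psi>(1)] by (rule inner_poly[OF \<phi>(1) \<psi>(1)])
  have lap_a: "(laplacian ^^ m) (\<lambda>x. \<phi> x + \<psi> x) = (\<lambda>x. (laplacian ^^ m) \<phi> x + (laplacian ^^ m) \<psi> x)" for m
  proof (induction m)
    case (Suc m)
    have t: "Ck k ((laplacian ^^ m) \<phi>)" "Ck k ((laplacian ^^ m) \<psi>)" for k
      by (rule test_fun_Ck[OF test_fun_laplacian_pow[OF \<phi>(1)]], rule test_fun_Ck[OF test_fun_laplacian_pow[OF \<psi>(1)]])
    have "partial i (partial i (\<lambda>x. (laplacian ^^ m) \<phi> x + (laplacian ^^ m) \<psi> x))
       = (\<lambda>x. partial i (partial i ((laplacian ^^ m) \<phi>)) x + partial i (partial i ((laplacian ^^ m) \<psi>)) x)" for i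
      by (simp add: partial_add[OF t(1)[of "Suc 0"] t(2)] partial_add[OF Ck_partial[OF t(1)[of "Suc (Suc 0)"]] Ck_partial[OF t(2)]])
    then have "laplacian (\<lambda>x. (laplacian ^^ m) \<phi> x + (laplacian ^^ m) \<psi> x) = (\<lambda>x. laplacian ((laplacian ^^ m) \<phi>) x + laplacian ((laplacian ^^ m) \<psi>) x)"
      unfolding laplacian_def[of "\<lambda>x. (laplacian ^^ m) \<phi> x + (laplacian ^^ m) \<psi> x"] laplacian_def[of "(laplacian ^^ m) \<phi>"] laplacian_def[of "(laplacian ^^ m) \<psi>"]
      by (simp add: sum.distrib)
    then show ?case by (simp add: Suc)
  qed simp
  show "poly_op \<Omega> m (x + y) = poly_op \<Omega> m x + poly_op \<Omega> m y"
  proof -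
    have "x + y = abs_l2 (\<lambda>x. \<phi> x + \<psi> x)" unfolding \<phi>(2) \<psi>(2)
      by (rule abs_l2_add[symmetric, OF test_fun_sqint[OF \<phi>(1)] test_fun_sqint[OF \<psi>(1)]])
    then have "poly_op \<Omega> m (x + y) = abs_l2 (\<lambda>x. (-1) ^ m * (laplacian ^^ m) \<phi> x + (-1) ^ m * (laplacian ^^ m) \<psi> x)"
      by (simp add: poly_op_abs[OF test_fun_add[OF \<phi>(1) \<psi>(1)]] lap_a distrib_left)
    also have "\<dots> = abs_l2 (\<lambda>x. (-1) ^ m * (laplacian ^^ m) \<phi> x) + abs_l2 (\<lambda>x. (-1) ^ m * (laplacian ^^ m) \<psi> x)"
      by (rule abs_l2_add[OF test_fun_sqint[OF test_fun_poly[OF \<phi>(1)]] test_fun_sqint[OF test_fun_poly[OF \<psi>(1)]]])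
    finally show ?thesis unfolding \<phi>(2) \<psi>(2) poly_op_abs[OF \<phi>(1)] poly_op_abs[OF \<psi>(1)] .
  qed
qed

lemma q_test: "test_fun \<Omega> \<phi> \<Longrightarrow> q (abs_l2 \<phi>) (abs_l2 \<phi>) = Qm \<Omega> m \<phi>"
  unfolding q_def Qm_def
  by (simp add: poly_op_abs inner_abs_l2 test_fun_sqint[OF test_fun_poly] test_fun_sqint l2_inner_test)

lemma form_approx_iff:
  assumes f: "L2 \<Omega> f"
  shows "form_approx \<Omega> m f \<phi> \<longleftrightarrow> (\<forall>k. test_fun \<Omega> (\<phi> k)) \<and> approx (cls \<Omega> f) (\<lambda>k. abs_l2 (\<phi> k))"
proof (cases "\<forall>k. test_fun \<Omega> (\<phi> k)")
  case True
  then have t: "test_fun \<Omega> (\<phi> k)" for k by blast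
  have 1: "l2_norm \<Omega> (\<lambda>x. \<phi> k x - f x) = norm (abs_l2 (\<phi> k) - cls \<Omega> f)" for k
    using test_fun_L2[OF t] f by (simp add: l2_norm_cls L2_diff cls_diff cls_test[OF t])
  have 2: "Qm \<Omega> m (\<lambda>x. \<phi> j x - \<phi> k x) = q (abs_l2 (\<phi> j) - abs_l2 (\<phi> k)) (abs_l2 (\<phi> j) - abs_l2 (\<phi> k))" for j k
    unfolding q_test[OF test_fun_diff[OF t t], symmetric] abs_l2_diff[OF test_fun_sqint[OF t] test_fun_sqint[OF t]] ..
  have 3: "abs_l2 (\<phi> k) \<in> test_l2 \<Omega>" for k using t by (auto simp: test_l2_def)
  have 4: "(\<lambda>k. norm (abs_l2 (\<phi> k) - cls \<Omega> f)) \<longlonglongrightarrow> 0 \<longleftrightarrow> (\<lambda>k. abs_l2 (\<phi> k)) \<longlonglongrightarrow> cls \<Omega> f"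
    by (simp add: tendsto_norm_zero_iff LIM_zero_iff)
  show ?thesis unfolding form_approx_def approx_def 1 2 4 using t 3 by simp
next
  case False
  then show ?thesis by (auto simp: form_approx_def)
qed

lemma form_dom_iff: "f \<in> form_dom \<Omega> m \<longleftrightarrow> L2 \<Omega> f \<and> cls \<Omega> f \<in> D"
proof -
  have "\<exists>\<phi>. form_approx \<Omega> m f \<phi>" if f: "L2 \<Omega> f" "cls \<Omega> f \<in> D"
  proof -
    obtain u where u: "approx (cls \<Omega> f) u" using f(2) by (auto simp: D_def)
    have "\<forall>k. \<exists>\<phi>. test_fun \<Omega> \<phi> \<and> abs_l2 \<phi> = u k"
    proof
      fix k
      show "\<exists>\<phi>. test_fun \<Omega> \<phi> \<and> abs_l2 \<phi> = u k" using approx_T[OF u, of k] unfolding test_l2_def by force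
    qed
    then obtain \<phi> where \<phi>: "\<And>k. test_fun \<Omega> (\<phi> k)" "\<And>k. abs_l2 (\<phi> k) = u k" by metis
    then show ?thesis using u f(1) by (intro exI[of _ \<phi>]) (simp add: form_approx_iff)
  qed
  then show ?thesis unfolding form_dom_def D_def using form_approx_iff by blast
qed

lemma form_val_eq:
  assumes "f \<in> form_dom \<Omega> m"
  shows "form_val \<Omega> m f = bf (cls \<Omega> f) (cls \<Omega> f)"
proof -
  have f: "L2 \<Omega> f" using assms form_dom_iff by blast
  define \<phi> where "\<phi> = (SOME \<phi>. form_approx \<Omega> m f \<phi>)"
  have "form_approx \<Omega> m f \<phi>" 
    unfolding \<phi>_def using assms someI_ex[of "form_approx \<Omega> m f"] by (simp add: form_dom_def)
  then have \<phi>: "\<And>k. test_fun \<Omega> (\<phi> k)" "approx (cls \<Omega> f) (\<lambda>k. abs_l2 (\<phi> k))" using form_approx_iff[OF f] by auto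
  have "(\<lambda>k. Qm \<Omega> m (\<phi> k)) \<longlonglongrightarrow> bf (cls \<Omega> f) (cls \<Omega> f)"
    using bf_lim[OF \<phi>(2) \<phi>(2)] by (simp add: q_test[OF \<phi>(1)])
  then show ?thesis unfolding form_val_def \<phi>_def by (rule limI)
qed

lemma form_bil_eq:
  assumes "f \<in> form_dom \<Omega> m" "g \<in> form_dom \<Omega> m"
  shows "form_bil \<Omega> m f g = bf (cls \<Omega> f) (cls \<Omega> g)"
proof -
  have f: "L2 \<Omega> f" "cls \<Omega> f \<in> D" and g: "L2 \<Omega> g" "cls \<Omega> g \<in> D" using assms form_dom_iff by auto
  let ?x = "cls \<Omega> f" and ?y = "cls \<Omega> g"
  have D: "?x + ?y \<in> D" "?x - ?y \<in> D" using D_comb[OF f(2) g(2), of 1] D_comb[OF f(2) g(2), of "-1"] by auto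
  have d: "(\<lambda>x. f x + g x) \<in> form_dom \<Omega> m" "(\<lambda>x. f x - g x) \<in> form_dom \<Omega> m"
    using D f(1) g(1) by (auto simp: form_dom_iff L2_add L2_diff cls_add cls_diff)
  have l: "bf (?x + ?y) z = bf ?x z + bf ?y z" "bf (?x - ?y) z = bf ?x z - bf ?y z" if "z \<in> D" for z
    using bf_comb_left[OF f(2) g(2) that, of 1] bf_comb_left[OF f(2) g(2) that, of "-1"] by auto
  have r: "bf z (?x + ?y) = bf z ?x + bf z ?y" "bf z (?x - ?y) = bf z ?x - bf z ?y" if "z \<in> D" for z
    using l[OF that] bf_sym[OF that] D f(2) g(2) by auto
  show ?thesis
    unfolding form_bil_def form_val_eq[OF d(1)] form_val_eq[OF d(2)] cls_add[OF f(1) g(1)] cls_diff[OF f(1) g(1)]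
    by (simp add: l r D f(2) g(2) bf_sym[OF g(2) f(2)])
qed

text \<open>Every element of \<open>D\<close> has a representative on \<Omega> with the same class,
  so quantifying over functions in \<open>form_dom\<close> amounts to quantifying over
  \<open>D\<close>.\<close>

lemma Hm_graph_iff: "Hm_graph \<Omega> m f h \<longleftrightarrow> L2 \<Omega> f \<and> L2 \<Omega> h \<and> hgraph (cls \<Omega> f) (cls \<Omega> h)"
proof
  assume H: "Hm_graph \<Omega> m f h"
  then have f: "f \<in> form_dom \<Omega> m" and h: "L2 \<Omega> h" by (auto simp: Hm_graph_def)
  have "bf (cls \<Omega> f) y = inner (cls \<Omega> h) y" if y: "y \<in> D" for y
  proof -
    have c: "cls \<Omega> (rep_l2 y) = y" by (rule cls_rep[OF \<Omega> D_closure[OF y]])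
    have g: "rep_l2 y \<in> form_dom \<Omega> m" using y by (simp add: form_dom_iff L2_rep[OF \<Omega>] c)
    have "form_bil \<Omega> m f (rep_l2 y) = l2_inner \<Omega> h (rep_l2 y)" using H g by (auto simp: Hm_graph_def)
    then show ?thesis by (simp add: form_bil_eq[OF f g] l2_inner_cls[OF h L2_rep[OF \<Omega>]] c)
  qed
  then show "L2 \<Omega> f \<and> L2 \<Omega> h \<and> hgraph (cls \<Omega> f) (cls \<Omega> h)" using f h by (auto simp: hgraph_def form_dom_iff)
next
  assume H: "L2 \<Omega> f \<and> L2 \<Omega> h \<and> hgraph (cls \<Omega> f) (cls \<Omega> h)"
  then have f: "f \<in> form_dom \<Omega> m" by (simp add: form_dom_iff hgraph_def)
  have "form_bil \<Omega> m f g = l2_inner \<Omega> h g" if g: "g \<in> form_dom \<Omega> m" for g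
    using H g form_bil_eq[OF f g] by (simp add: form_dom_iff hgraph_def l2_inner_cls)
  then show "Hm_graph \<Omega> m f h" using H f by (simp add: Hm_graph_def)
qed

lemma U_in_closure: "0 < t \<Longrightarrow> U t x \<in> closure (test_l2 \<Omega>)"
  using hgraph_U[of t x] by (intro D_closure) (simp add: hgraph_def)

text \<open>The symbol \<lambda> exp (- t \<lambda>) contains the factor exp (- (t/2) \<lambda>), so
  the vector lies in the range of \<open>U (t/2)\<close>. Hence restricting its representative to
  \<Omega> does not change its class.\<close>

lemma calc_ht_closure:
  assumes t: "0 < t"
  shows "calc (ht t) x \<in> closure (test_l2 \<Omega>)"
proof -
  have "calc (ht t) x = calc (\<lambda>y. ft (t/2) y * ht (t/2) y) x"
  proof (rule calc_cong)
    fix y :: real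
    show "ht t y = ft (t/2) y * ht (t/2) y"
      using ft_add[of "t/2" y "t/2"] by (auto simp: ht_def gt_def ft_def algebra_simps simp flip: exp_add)
  qed (rule cont_ht[OF t])
  also have "\<dots> = U (t/2) (calc (ht (t/2)) x)"
    unfolding U_def using t by (intro calc_mult cont_ft cont_ht) auto
  finally show ?thesis using U_in_closure[of "t/2"] t by simp
qed

lemma heat_sol_exists:
  assumes f: "L2 \<Omega> f"
  shows "heat_sol \<Omega> m f (\<lambda>t. rep_l2 (U t (cls \<Omega> f)))"
proof -
  let ?x = "cls \<Omega> f"
  let ?u = "\<lambda>t. rep_l2 (U t ?x)"
  have uL: "L2 \<Omega> (?u t)" for t by (rule L2_rep[OF \<Omega>])
  have uc: "cls \<Omega> (?u t) = U t ?x" if "0 < t" for t by (rule cls_rep[OF \<Omega> U_in_closure[OF that]])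
  have "\<exists>h. Hm_graph \<Omega> m (?u t) h \<and> ((\<lambda>s. l2_norm \<Omega> (\<lambda>x. (?u s x - ?u t x) / (s - t) + h x)) \<longlongrightarrow> 0) (at t)" if t: "0 < t" for t
  proof (intro exI conjI)
    let ?h = "rep_l2 (calc (ht t) ?x)"
    have hL: "L2 \<Omega> ?h" by (rule L2_rep[OF \<Omega>])
    have hc: "cls \<Omega> ?h = calc (ht t) ?x" by (rule cls_rep[OF \<Omega> calc_ht_closure[OF t]])
    show "Hm_graph \<Omega> m (?u t) ?h" unfolding Hm_graph_iff using uL hL uc[OF t] hc hgraph_U[OF t] by simp
    have "\<forall>\<^sub>F s in at t. s \<in> {0<..}" using t by (intro eventually_at_in_open') auto
    then have "\<forall>\<^sub>F s in at t. norm ((1 / (s - t)) *\<^sub>R (U s ?x - U t ?x) + calc (ht t) ?x) = l2_norm \<Omega> (\<lambda>x. (?u s x - ?u t x) / (s - t) + ?h x)"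
    proof eventually_elim
      case (elim s)
      have s: "0 < s" using elim by simp
      have d: "L2 \<Omega> (\<lambda>x. ?u s x - ?u t x)" "cls \<Omega> (\<lambda>x. ?u s x - ?u t x) = U s ?x - U t ?x"
        using L2_diff[OF uL uL] cls_diff[OF uL uL] uc[OF s] uc[OF t] by auto
      have e: "L2 \<Omega> (\<lambda>x. 1 / (s - t) * (?u s x - ?u t x))"
        "cls \<Omega> (\<lambda>x. 1 / (s - t) * (?u s x - ?u t x)) = (1 / (s - t)) *\<^sub>R (U s ?x - U t ?x)"
        by (rule L2_cmult[OF d(1)]) (simp only: cls_cmult[OF d(1)] d(2))
      have "cls \<Omega> (\<lambda>x. 1 / (s - t) * (?u s x - ?u t x) + ?h x) = (1 / (s - t)) *\<^sub>R (U s ?x - U t ?x) + calc (ht t) ?x"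
        by (simp only: cls_add[OF e(1) hL] e(2) hc)
      then show ?case using l2_norm_cls[OF L2_add[OF e(1) hL]] by simp
    qed
    then show "((\<lambda>s. l2_norm \<Omega> (\<lambda>x. (?u s x - ?u t x) / (s - t) + ?h x)) \<longlongrightarrow> 0) (at t)"
      using U_diff_quotient[OF t, of ?x] by (rule Lim_transform_eventually[rotated])
  qed
  moreover have "((\<lambda>s. l2_norm \<Omega> (\<lambda>x. ?u s x - f x)) \<longlongrightarrow> 0) (at_right 0)"
  proof (rule Lim_transform_eventually[OF U_strongly_continuous[OF cls_in_closure[OF \<Omega> f]]])
    have "\<forall>\<^sub>F s in at_right (0::real). 0 < s" by (simp add: eventually_at_right_less)
    then show "\<forall>\<^sub>F s in at_right 0. norm (U s ?x - ?x) = l2_norm \<Omega> (\<lambda>x. ?u s x - f x)"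
      by eventually_elim (simp add: l2_norm_cls[OF L2_diff[OF uL f]] cls_diff[OF uL f] uc)
  qed
  ultimately show ?thesis unfolding heat_sol_def by blast
qed

text \<open>Needed because \<open>heat_sg\<close> selects an arbitrary solution. The difference to
  the constructed one starts from 0, and \<open>hgraph_diff_nonneg\<close> supplies the monotonicity
  that \<open>cauchy_problem_unique\<close> asks for.\<close>

lemma heat_sol_unique:
  assumes f: "L2 \<Omega> f" and u: "heat_sol \<Omega> m f u" and t: "0 < t"
  shows "L2 \<Omega> (u t)" "cls \<Omega> (u t) = U t (cls \<Omega> f)"
proof -
  let ?x = "cls \<Omega> f"
  obtain h where h: "\<And>t. 0 < t \<Longrightarrow> Hm_graph \<Omega> m (u t) (h t)"
    "\<And>t. 0 < t \<Longrightarrow> ((\<lambda>s. l2_norm \<Omega> (\<lambda>x. (u s x - u t x) / (s - t) + h t x)) \<longlongrightarrow> 0) (at t)"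
  proof -
    have "\<forall>t. \<exists>h. 0 < t \<longrightarrow> Hm_graph \<Omega> m (u t) h \<and> ((\<lambda>s. l2_norm \<Omega> (\<lambda>x. (u s x - u t x) / (s - t) + h x)) \<longlongrightarrow> 0) (at t)"
      using u unfolding heat_sol_def by blast
    from choice[OF this] obtain h where
      "\<forall>t. 0 < t \<longrightarrow> Hm_graph \<Omega> m (u t) (h t) \<and> ((\<lambda>s. l2_norm \<Omega> (\<lambda>x. (u s x - u t x) / (s - t) + h t x)) \<longlongrightarrow> 0) (at t)" ..
    then show thesis by (intro that[of h]) blast+
  qed
  have uL: "L2 \<Omega> (u t)" and hL: "L2 \<Omega> (h t)" and g: "hgraph (cls \<Omega> (u t)) (cls \<Omega> (h t))" if "0 < t" for t
    using h(1)[OF that] by (simp_all add: Hm_graph_iff)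
  show "L2 \<Omega> (u t)" by (rule uL[OF t])
  define v where "v t = cls \<Omega> (u t) - U t ?x" for t
  define k where "k t = cls \<Omega> (h t) - calc (ht t) ?x" for t
  have "v t = 0"
  proof (rule cauchy_problem_unique[OF _ _ _ t])
    show "0 \<le> inner (k s) (v s)" if "0 < s" for s
      unfolding k_def v_def by (rule hgraph_diff_nonneg[OF g[OF that] hgraph_U[OF that]])
    show "(v has_vector_derivative - k t) (at t)" if t: "0 < t" for t
    proof -
      have ev: "\<forall>\<^sub>F s in at t. s \<in> {0<..} - {t}"
        using t by (intro eventually_at_in_open) auto
      have 1: "((\<lambda>s. norm ((1 / (s - t)) *\<^sub>R (cls \<Omega> (u s) - cls \<Omega> (u t)) + cls \<Omega> (h t))) \<longlongrightarrow> 0) (at t)"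
      proof (rule Lim_transform_eventually[OF h(2)[OF t]])
        show "\<forall>\<^sub>F s in at t. l2_norm \<Omega> (\<lambda>x. (u s x - u t x) / (s - t) + h t x) = norm ((1 / (s - t)) *\<^sub>R (cls \<Omega> (u s) - cls \<Omega> (u t)) + cls \<Omega> (h t))"
          using ev
        proof eventually_elim
          case (elim s)
          have s: "0 < s" using elim by simp
          note d = L2_diff[OF uL[OF s] uL[OF t]]
          have e: "L2 \<Omega> (\<lambda>x. 1 / (s - t) * (u s x - u t x))"
            "cls \<Omega> (\<lambda>x. 1 / (s - t) * (u s x - u t x)) = (1 / (s - t)) *\<^sub>R (cls \<Omega> (u s) - cls \<Omega> (u t))"
            by (rule L2_cmult[OF d]) (simp only: cls_cmult[OF d] cls_diff[OF uL[OF s] uL[OF t]])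
          show ?case using l2_norm_cls[OF L2_add[OF e(1) hL[OF t]]] cls_add[OF e(1) hL[OF t]] e(2) by simp
        qed
      qed
      have "((\<lambda>s. norm ((1 / (s - t)) *\<^sub>R (v s - v t) + k t)) \<longlongrightarrow> 0) (at t)"
      proof (rule Lim_null_comparison)
        show "((\<lambda>s. norm ((1 / (s - t)) *\<^sub>R (cls \<Omega> (u s) - cls \<Omega> (u t)) + cls \<Omega> (h t)) + norm ((1 / (s - t)) *\<^sub>R (U s ?x - U t ?x) + calc (ht t) ?x)) \<longlongrightarrow> 0) (at t)"
          using tendsto_add[OF 1 U_diff_quotient[OF t, of ?x]] by simp
        have "(1 / (s - t)) *\<^sub>R (v s - v t) + k t = ((1 / (s - t)) *\<^sub>R (cls \<Omega> (u s) - cls \<Omega> (u t)) + cls \<Omega> (h t)) - ((1 / (s - t)) *\<^sub>R (U s ?x - U t ?x) + calc (ht t) ?x)" for s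
          by (simp add: v_def k_def scaleR_diff_right)
        then show "\<forall>\<^sub>F s in at t. norm (norm ((1 / (s - t)) *\<^sub>R (v s - v t) + k t)) \<le> norm ((1 / (s - t)) *\<^sub>R (cls \<Omega> (u s) - cls \<Omega> (u t)) + cls \<Omega> (h t)) + norm ((1 / (s - t)) *\<^sub>R (U s ?x - U t ?x) + calc (ht t) ?x)"
          by (intro always_eventually allI) (simp add: norm_triangle_ineq4)
      qed
      moreover have "\<forall>\<^sub>F s in at t. norm ((1 / (s - t)) *\<^sub>R (v s - v t) + k t) = norm ((v s - v t - (s - t) *\<^sub>R (- k t)) /\<^sub>R norm (s - t))"
        using ev
      proof eventually_elim
        case (elim s)
        have "(1 / (s - t)) *\<^sub>R (v s - v t) + k t = (1 / (s - t)) *\<^sub>R (v s - v t - (s - t) *\<^sub>R (- k t))"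
          using elim by (simp add: scaleR_add_right)
        then show ?case by (simp add: divide_inverse abs_inverse)
      qed
      ultimately have "((\<lambda>s. norm ((v s - v t - (s - t) *\<^sub>R (- k t)) /\<^sub>R norm (s - t))) \<longlongrightarrow> 0) (at t)"
        by (rule Lim_transform_eventually)
      then show ?thesis
        unfolding has_vector_derivative_def has_derivative_at_within
        unfolding tendsto_norm_zero_iff by (auto intro: bounded_linear_scaleR_left simp del: scaleR_minus_right)
    qed
    have "((\<lambda>s. l2_norm \<Omega> (\<lambda>x. u s x - f x) + norm (U s ?x - ?x)) \<longlongrightarrow> 0) (at_right 0)"
      using u by (intro tendsto_add_zero U_strongly_continuous cls_in_closure[OF \<Omega> f]) (simp add: heat_sol_def)
    moreover have "\<forall>\<^sub>F s in at_right (0::real). 0 < s" by (simp add: eventually_at_right_less)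
    then have "\<forall>\<^sub>F s in at_right 0. norm (norm (v s)) \<le> l2_norm \<Omega> (\<lambda>x. u s x - f x) + norm (U s ?x - ?x)"
    proof eventually_elim
      case (elim s)
      have "v s = (cls \<Omega> (u s) - ?x) - (U s ?x - ?x)" by (simp add: v_def)
      then show ?case
        using norm_triangle_ineq4[of "cls \<Omega> (u s) - ?x" "U s ?x - ?x"]
        by (simp add: l2_norm_cls[OF L2_diff[OF uL[OF elim] f]] cls_diff[OF uL[OF elim] f])
    qed
    ultimately show "((\<lambda>s. norm (v s)) \<longlongrightarrow> 0) (at_right 0)" by (rule Lim_null_comparison[rotated])
  qed
  then show "cls \<Omega> (u t) = U t ?x" by (simp add: v_def)
qed

lemma
  assumes f: "L2 \<Omega> f" and t: "0 < t"
  shows heat_sg_L2: "L2 \<Omega> (heat_sg \<Omega> m t f)" and cls_heat_sg: "cls \<Omega> (heat_sg \<Omega> m t f) = U t (cls \<Omega> f)"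
proof -
  have "heat_sol \<Omega> m f (SOME u. heat_sol \<Omega> m f u)" by (rule someI[of "heat_sol \<Omega> m f", OF heat_sol_exists[OF f]])
  from heat_sol_unique[OF f this t] show "L2 \<Omega> (heat_sg \<Omega> m t f)" "cls \<Omega> (heat_sg \<Omega> m t f) = U t (cls \<Omega> f)"
    by (simp_all add: heat_sg_def)
qed

end

subsection \<open>Bounded multipliers\<close>

definition mulop :: "('a::euclidean_space \<Rightarrow> real) \<Rightarrow> 'a l2 \<Rightarrow> 'a l2" where
  "mulop e x = abs_l2 (\<lambda>t. e t * rep_l2 x t)"

context
  fixes e :: "'a::euclidean_space \<Rightarrow> real" and B :: real
  assumes e [measurable]: "e \<in> borel_measurable lborel" and B: "\<And>x. \<bar>e x\<bar> \<le> B"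
begin

lemma sqint_mulop: "sqint (\<lambda>t. e t * rep_l2 x t)"
  by (rule sqint_mult_bounded[OF sqint_rep e B])

lemma mulop_abs: "sqint f \<Longrightarrow> mulop e (abs_l2 f) = abs_l2 (\<lambda>t. e t * f t)"
  unfolding mulop_def
proof (rule abs_l2_eqI[OF sqint_mulop])
  assume f: "sqint f"
  show "sqint (\<lambda>t. e t * f t)" by (rule sqint_mult_bounded[OF f e B])
  show "AE t in lborel. e t * rep_l2 (abs_l2 f) t = e t * f t"
    using rep_abs_l2[OF f] by eventually_elim simp
qed

lemma mulop_sym: "inner (mulop e x) y = inner x (mulop e y)"
proof -
  have "inner (mulop e x) (abs_l2 (rep_l2 y)) = inner (abs_l2 (rep_l2 x)) (mulop e y)"
    unfolding mulop_def inner_abs_l2[OF sqint_mulop sqint_rep] inner_abs_l2[OF sqint_rep sqint_mulop]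
    by (simp add: ac_simps)
  then show ?thesis by simp
qed

lemma mulop_norm: "(norm (mulop e x))\<^sup>2 = (\<integral>t. (e t)\<^sup>2 * (rep_l2 x t)\<^sup>2 \<partial>lborel)"
  unfolding mulop_def norm_abs_l2_sq[OF sqint_mulop] by (simp add: power_mult_distrib)

lemma mulop_integrable: "integrable lborel (\<lambda>t. (e t)\<^sup>2 * (rep_l2 x t)\<^sup>2)"
  using sqint_square[OF sqint_mulop, of x] by (simp add: power_mult_distrib)

lemma mulop_diff: "mulop e x - mulop e y = mulop e (x - y)"
proof -
  have "mulop e x - mulop e y = abs_l2 (\<lambda>t. e t * rep_l2 x t - e t * rep_l2 y t)"
    unfolding mulop_def by (rule abs_l2_diff[OF sqint_mulop sqint_mulop, symmetric])
  also have "\<dots> = mulop e (x - y)"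
    unfolding mulop_def
  proof (rule abs_l2_eqI[OF sqint_diff[OF sqint_mulop sqint_mulop] sqint_mulop])
    show "AE t in lborel. e t * rep_l2 x t - e t * rep_l2 y t = e t * rep_l2 (x - y) t"
      using rep_l2_diff[of x y] by eventually_elim (simp add: right_diff_distrib)
  qed
  finally show ?thesis .
qed

lemma mulop_norm_le: "norm (mulop e x) \<le> B * norm x"
proof -
  have B0: "0 \<le> B" using B[of 0] by linarith
  have "(norm (mulop e x))\<^sup>2 \<le> (\<integral>t. B\<^sup>2 * (rep_l2 x t)\<^sup>2 \<partial>lborel)"
    unfolding mulop_norm
  proof (rule integral_mono[OF mulop_integrable])
    show "integrable lborel (\<lambda>t. B\<^sup>2 * (rep_l2 x t)\<^sup>2)" by (intro integrable_mult_right sqint_square sqint_rep)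
    show "(e t)\<^sup>2 * (rep_l2 x t)\<^sup>2 \<le> B\<^sup>2 * (rep_l2 x t)\<^sup>2" for t
      using power_mono[OF B[of t] abs_ge_zero, of 2] by (intro mult_right_mono) auto
  qed
  also have "\<dots> = B\<^sup>2 * (norm (abs_l2 (rep_l2 x)))\<^sup>2" unfolding norm_abs_l2_sq[OF sqint_rep] by simp
  also have "\<dots> = (B * norm x)\<^sup>2" by (simp add: power_mult_distrib)
  finally show ?thesis by (rule power2_le_imp_le) (simp add: B0)
qed

lemma mulop_tendsto:
  assumes "u \<longlonglongrightarrow> x"
  shows "(\<lambda>n. mulop e (u n)) \<longlonglongrightarrow> mulop e x"
proof -
  have 1: "(\<lambda>n. B * norm (u n - x)) \<longlonglongrightarrow> 0"
    using tendsto_mult_right_zero[OF tendsto_norm_zero[OF LIM_zero[OF assms]]] .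
  have "(\<lambda>n. mulop e (u n) - mulop e x) \<longlonglongrightarrow> 0"
    by (rule Lim_null_comparison[OF _ 1]) (simp add: mulop_diff mulop_norm_le)
  then show ?thesis by (rule LIM_zero_cancel)
qed

end

lemma rep_l2_sum:
  "finite F \<Longrightarrow> AE t in lborel. rep_l2 (\<Sum>b\<in>F. a b *\<^sub>R y b) t = (\<Sum>b\<in>F. a b * rep_l2 (y b) t)"
proof (induction F rule: finite_induct)
  case empty
  then show ?case using rep_l2_zero by simp
next
  case (insert x F)
  show ?case
    using insert.IH rep_l2_add[of "a x *\<^sub>R y x" "\<Sum>b\<in>F. a b *\<^sub>R y b"] rep_l2_scaleR[of "a x" "y x"]
    by eventually_elim (simp add: insert.hyps)
qed

text \<open>A pointwise bound on all linear combinations controls the sum of squares: test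
  rational coefficients (a countable family) and pass to the limit.\<close>
lemma AE_sum_squares_le:
  fixes w :: "'b \<Rightarrow> 'a \<Rightarrow> real"
  assumes F: "finite F" and C: "0 \<le> C"
    and b: "\<And>a. AE x in M. \<bar>\<Sum>b\<in>F. a b * w b x\<bar> \<le> sqrt C * sqrt (\<Sum>b\<in>F. (a b)\<^sup>2)"
  shows "AE x in M. (\<Sum>b\<in>F. (w b x)\<^sup>2) \<le> C"
proof -
  have "countable (PiE F (\<lambda>_. \<rat>::real set))" using F by (intro countable_PiE) (auto simp: countable_rat)
  then have "AE x in M. \<forall>a\<in>PiE F (\<lambda>_. \<rat>). \<bar>\<Sum>b\<in>F. a b * w b x\<bar> \<le> sqrt C * sqrt (\<Sum>b\<in>F. (a b)\<^sup>2)"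
    using b by (subst AE_ball_countable) auto
  then show ?thesis
  proof eventually_elim
    case (elim x)
    have "\<forall>b. \<exists>r. (\<forall>n::nat. r n \<in> \<rat>) \<and> r \<longlonglongrightarrow> w b x"
    proof
      fix b
      have "w b x \<in> closure \<rat>" by (simp add: Rats_closure_real)
      then show "\<exists>r. (\<forall>n::nat. r n \<in> \<rat>) \<and> r \<longlonglongrightarrow> w b x" by (simp add: closure_sequential)
    qed
    from choice[OF this] obtain r where r: "\<And>b n. r b n \<in> \<rat>" "\<And>b. r b \<longlonglongrightarrow> w b x" by blast
    have "\<bar>\<Sum>b\<in>F. r b n * w b x\<bar> \<le> sqrt C * sqrt (\<Sum>b\<in>F. (r b n)\<^sup>2)" for n
    proof -
      have "restrict (\<lambda>b. r b n) F \<in> PiE F (\<lambda>_. \<rat>)" using r(1) by auto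
      from elim[rule_format, OF this] show ?thesis by simp
    qed
    moreover have "(\<lambda>n. \<bar>\<Sum>b\<in>F. r b n * w b x\<bar>) \<longlonglongrightarrow> \<bar>\<Sum>b\<in>F. w b x * w b x\<bar>"
      by (intro tendsto_intros r(2))
    moreover have "(\<lambda>n. sqrt C * sqrt (\<Sum>b\<in>F. (r b n)\<^sup>2)) \<longlonglongrightarrow> sqrt C * sqrt (\<Sum>b\<in>F. (w b x)\<^sup>2)"
      by (intro tendsto_intros r(2))
    ultimately have le: "\<bar>\<Sum>b\<in>F. w b x * w b x\<bar> \<le> sqrt C * sqrt (\<Sum>b\<in>F. (w b x)\<^sup>2)"
      by (intro LIMSEQ_le[of _ "\<bar>\<Sum>b\<in>F. w b x * w b x\<bar>" _ "sqrt C * sqrt (\<Sum>b\<in>F. (w b x)\<^sup>2)"]) auto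
    define S where "S = (\<Sum>b\<in>F. (w b x)\<^sup>2)"
    have S0: "0 \<le> S" unfolding S_def by (intro sum_nonneg) auto
    have "sqrt S * sqrt S \<le> sqrt C * sqrt S" using le S0 unfolding S_def[symmetric] power2_eq_square[symmetric] by simp
    then have "sqrt S \<le> sqrt C" using S0 C by (cases "S = 0") (auto simp only: mult_le_cancel_right real_sqrt_gt_0_iff real_sqrt_ge_0_iff real_sqrt_zero)
    then show ?case by (simp add: S_def)
  qed
qed

subsection \<open>Consequences of the kernel bound\<close>

context polyharmonic
begin

lemma linear_U: "0 < t \<Longrightarrow> linear (U t)"
  unfolding U_def by (rule linear_calc[OF cont_ft])

lemma norm_U_sq: "0 < s \<Longrightarrow> (norm (U s x))\<^sup>2 = inner (U (2 * s) x) x"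
  using U_add[of s s x] U_sym[of s x "U s x"] U_sym[of s "U s x" x] by (simp add: power2_norm_eq_inner)

text \<open>\<open>k\<close> is the kernel at time 2 s, because bounds for \<open>U s\<close> are
  read off its square. In the application s = t/4, and \<open>C\<close> is the kernel bound at time
  t/2.\<close>

context
  fixes s C :: real and k :: "real^'n \<Rightarrow> real^'n \<Rightarrow> real"
  assumes s: "0 < s" and C: "0 \<le> C"
    and kernel: "\<And>f. L2 \<Omega> f \<Longrightarrow> AE x in lborel. x \<in> \<Omega> \<longrightarrow>
           set_integrable lborel \<Omega> (\<lambda>y. k x y * f y) \<and>
           heat_sg \<Omega> m (2 * s) f x = (LINT y:\<Omega>|lborel. k x y * f y)"
    and bound: "\<And>x y. x \<in> \<Omega> \<Longrightarrow> y \<in> \<Omega> \<Longrightarrow> \<bar>k x y\<bar> \<le> C"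
begin

text \<open>The squared norm of \<open>U s h\<close> is the quadratic form of
  \<open>U (2 * s)\<close> at h, hence a double integral against a kernel bounded by
  \<open>C\<close>.\<close>

lemma L1_L2_bound:
  assumes h: "sqint h" "integrable lborel h" "\<And>x. x \<notin> \<Omega> \<Longrightarrow> h x = 0"
  shows "(norm (U s (abs_l2 h)))\<^sup>2 \<le> C * (\<integral>x. \<bar>h x\<bar> \<partial>lborel)\<^sup>2"
proof -
  let ?H = "heat_sg \<Omega> m (2 * s) h" and ?A = "\<integral>x. \<bar>h x\<bar> \<partial>lborel"
  have ih: "(\<lambda>x. indicator \<Omega> x * h x) = h" using h(3) by (auto simp: fun_eq_iff indicator_def)
  have hL: "L2 \<Omega> h" and hc: "cls \<Omega> h = abs_l2 h" using h(1) by (auto simp: L2_iff cls_def ih)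
  have HL: "L2 \<Omega> ?H" by (rule heat_sg_L2[OF hL]) (use s in simp)
  have sH: "sqint (\<lambda>x. indicator \<Omega> x * ?H x)" using HL by (simp add: L2_iff)
  have "(norm (U s (abs_l2 h)))\<^sup>2 = l2_inner \<Omega> ?H h"
    using s by (simp add: l2_inner_cls[OF HL hL] cls_heat_sg[OF hL] hc norm_U_sq)
  also have "\<dots> = (\<integral>x. (indicator \<Omega> x * ?H x) * h x \<partial>lborel)"
    unfolding l2_inner_def set_lebesgue_integral_def by (simp add: mult.assoc)
  also have "\<dots> \<le> (\<integral>x. C * ?A * \<bar>h x\<bar> \<partial>lborel)"
  proof (rule integral_mono_AE)
    show "integrable lborel (\<lambda>x. (indicator \<Omega> x * ?H x) * h x)" by (rule sqint_mult[OF sH h(1)])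
    show "integrable lborel (\<lambda>x. C * ?A * \<bar>h x\<bar>)" by (intro integrable_mult_right integrable_abs h(2))
    show "AE x in lborel. (indicator \<Omega> x * ?H x) * h x \<le> C * ?A * \<bar>h x\<bar>"
      using kernel[OF hL]
    proof eventually_elim
      case (elim x)
      show ?case
      proof (cases "x \<in> \<Omega>")
        case True
        have "\<bar>?H x\<bar> = \<bar>\<integral>y. indicator \<Omega> y *\<^sub>R (k x y * h y) \<partial>lborel\<bar>"
          using elim True by (simp add: set_lebesgue_integral_def)
        also have "\<dots> \<le> (\<integral>y. \<bar>indicator \<Omega> y *\<^sub>R (k x y * h y)\<bar> \<partial>lborel)" by (rule integral_abs_bound)
        also have "\<dots> \<le> (\<integral>y. C * \<bar>h y\<bar> \<partial>lborel)"
        proof (rule integral_mono)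
          show "integrable lborel (\<lambda>y. \<bar>indicator \<Omega> y *\<^sub>R (k x y * h y)\<bar>)"
            using elim True by (intro integrable_abs) (simp add: set_integrable_def)
          show "integrable lborel (\<lambda>y. C * \<bar>h y\<bar>)" by (intro integrable_mult_right integrable_abs h(2))
          show "\<bar>indicator \<Omega> y *\<^sub>R (k x y * h y)\<bar> \<le> C * \<bar>h y\<bar>" for y
            using bound[OF True, of y] C by (auto simp: indicator_def abs_mult intro: mult_right_mono)
        qed
        finally have "\<bar>?H x\<bar> \<le> C * ?A" by simp
        then have "\<bar>?H x\<bar> * \<bar>h x\<bar> \<le> C * ?A * \<bar>h x\<bar>" by (rule mult_right_mono) simp
        then show ?thesis using True abs_ge_self[of "?H x * h x"] by (simp add: abs_mult)
      qed (simp add: h(3))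
    qed
  qed
  also have "\<dots> = C * ?A\<^sup>2" by (simp add: power2_eq_square)
  finally show ?thesis .
qed

text \<open>Dual to \<open>L1_L2_bound\<close>: on the set where the bound fails, cut down to a box
  to have finite measure, \<open>U s g\<close> is tested with its own sign. Symmetry moves
  \<open>U s\<close> to the test function, and the resulting estimate forces the set to be
  null.\<close>

lemma L2_Linf_bound: "AE x in lborel. \<bar>rep_l2 (U s g) x\<bar> \<le> sqrt C * norm g"
proof -
  have [measurable]: "\<Omega> \<in> sets borel" using \<Omega> by simp
  let ?w = "rep_l2 (U s g)" and ?B = "sqrt C * norm g"
  define E where "E n = {x. x \<in> \<Omega> \<and> ?B < \<bar>?w x\<bar>} \<inter> box (- real n *\<^sub>R One) (real n *\<^sub>R One)" for n :: nat
  have "AE x in lborel. x \<notin> E n" for n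
  proof -
    have En [measurable]: "E n \<in> sets lborel" unfolding E_def by measurable
    define h where "h x = sgn (?w x) * indicator (E n) x" for x
    have sqE: "sqint (\<lambda>x. indicator (E n) x :: real)"
    proof -
      have "{x. x \<in> \<Omega> \<and> ?B < \<bar>?w x\<bar>} \<in> sets borel" by measurable
      from sqint_indicator_box[OF this] show ?thesis unfolding E_def .
    qed
    have "(\<lambda>x. (indicator (E n) x :: real)\<^sup>2) = (\<lambda>x. indicator (E n) x)" by (auto simp: indicator_def)
    then have iE: "integrable lborel (\<lambda>x. indicator (E n) x :: real)" using sqint_square[OF sqE] by simp
    have sm: "(\<lambda>x. sgn (?w x)) \<in> borel_measurable lborel" by measurable
    have h1: "sqint h" unfolding h_def
      by (rule sqint_mult_bounded[OF sqE sm, of 1]) (simp add: sgn_if)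
    have hb: "\<bar>h x\<bar> \<le> indicator (E n) x" for x by (simp add: h_def sgn_if indicator_def)
    have h2: "integrable lborel h"
      by (rule Bochner_Integration.integrable_bound[OF iE sqint_measurable[OF h1]]) (use hb in \<open>auto simp: abs_le_iff\<close>)
    have h3: "x \<notin> \<Omega> \<Longrightarrow> h x = 0" for x by (simp add: h_def E_def)
    let ?\<mu> = "\<integral>x. indicator (E n) x \<partial>lborel :: real"
    have hi: "(\<integral>x. \<bar>h x\<bar> \<partial>lborel) \<le> ?\<mu>"
      by (rule integral_mono[OF integrable_abs[OF h2] iE hb])
    have hi0: "0 \<le> (\<integral>x. \<bar>h x\<bar> \<partial>lborel)" by (rule Bochner_Integration.integral_nonneg) simp
    have \<mu>0: "0 \<le> ?\<mu>" by (rule Bochner_Integration.integral_nonneg) simp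
    have "(norm (U s (abs_l2 h)))\<^sup>2 \<le> C * ?\<mu>\<^sup>2"
      using L1_L2_bound[OF h1 h2 h3] mult_left_mono[OF power_mono[OF hi hi0, of 2] C] by linarith
    also have "\<dots> = (sqrt C * ?\<mu>)\<^sup>2" using C by (simp add: power_mult_distrib)
    finally have n: "norm (U s (abs_l2 h)) \<le> sqrt C * ?\<mu>" by (rule power2_le_imp_le) (simp add: C \<mu>0)
    have wh: "?w x * h x = \<bar>?w x\<bar> * indicator (E n) x" for x by (simp add: h_def sgn_if)
    have iw: "integrable lborel (\<lambda>x. \<bar>?w x\<bar> * indicator (E n) x)"
      using sqint_mult[OF sqint_rep h1, of "U s g"] by (simp add: wh)
    have "(\<integral>x. \<bar>?w x\<bar> * indicator (E n) x \<partial>lborel) = inner (abs_l2 ?w) (abs_l2 h)"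
      unfolding inner_abs_l2[OF sqint_rep h1] wh ..
    also have "\<dots> = inner g (U s (abs_l2 h))" by (simp add: U_sym[OF s])
    also have "\<dots> \<le> norm g * (sqrt C * ?\<mu>)"
      using norm_cauchy_schwarz[of g "U s (abs_l2 h)"] mult_left_mono[OF n norm_ge_zero[of g]] by linarith
    finally have le: "(\<integral>x. \<bar>?w x\<bar> * indicator (E n) x \<partial>lborel) \<le> ?B * ?\<mu>" by (simp add: ac_simps)
    let ?d = "\<lambda>x. \<bar>?w x\<bar> * indicator (E n) x - ?B * indicator (E n) x"
    have d: "integrable lborel ?d" by (intro Bochner_Integration.integrable_diff iw integrable_mult_right iE)
    have dp: "0 \<le> ?d x" for x by (auto simp: indicator_def E_def)
    have "integral\<^sup>L lborel ?d = (\<integral>x. \<bar>?w x\<bar> * indicator (E n) x \<partial>lborel) - ?B * ?\<mu>"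
      by (subst Bochner_Integration.integral_diff[OF iw]) (use iE in auto)
    then have "integral\<^sup>L lborel ?d = 0" using le Bochner_Integration.integral_nonneg[of lborel ?d, OF dp] by linarith
    then have "AE x in lborel. ?d x = 0" using integral_nonneg_eq_0_iff_AE[OF d] dp by simp
    then show ?thesis by eventually_elim (auto simp: indicator_def E_def split: if_splits)
  qed
  then have "AE x in lborel. \<forall>n. x \<notin> E n" by (simp add: AE_all_countable)
  then show ?thesis using cls_zero_off[OF \<Omega> U_in_closure[OF s, of g]]
  proof eventually_elim
    case (elim x)
    show ?case
    proof (rule ccontr)
      assume n: "\<not> ?thesis"
      have "0 \<le> ?B" using C by simp
      then have x: "x \<in> \<Omega>" using elim n by (cases "x \<in> \<Omega>") auto
      obtain k :: nat where k: "norm x < real k" using reals_Archimedean2 by blast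
      have "x \<in> box (- real k *\<^sub>R One) (real k *\<^sub>R One)"
      proof (subst mem_box, intro ballI)
        fix i :: "real^'n" assume i: "i \<in> Basis"
        have "\<bar>inner x i\<bar> \<le> norm x" by (rule Basis_le_norm[OF i])
        then show "(- real k *\<^sub>R One) \<bullet> i < x \<bullet> i \<and> x \<bullet> i < (real k *\<^sub>R One) \<bullet> i"
          using k i by (simp add: abs_le_iff)
      qed
      then have "x \<in> E k" using n x by (simp add: E_def)
      then show False using elim by blast
    qed
  qed
qed

text \<open>For each combination of \<open>F\<close>, the value of its image under
  \<open>U s\<close> is almost everywhere at most sqrt C times its norm. This bounds the sum of the
  squared values of the \<open>U s b\<close> by C almost everywhere, whatever the size of
  \<open>F\<close>, and integration against e^2 finishes.\<close>

lemma Hilbert_Schmidt_bound: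
  assumes e [measurable]: "e \<in> borel_measurable lborel" and B: "\<And>x. \<bar>e x\<bar> \<le> B"
    and F: "finite F" "orthonormal F"
  shows "ennreal (\<Sum>b\<in>F. (norm (mulop e (U s b)))\<^sup>2) \<le> ennreal C * (\<integral>\<^sup>+x\<in>\<Omega>. ennreal ((e x)\<^sup>2) \<partial>lborel)"
proof -
  have [measurable]: "\<Omega> \<in> sets borel" using \<Omega> by simp
  let ?w = "\<lambda>b. rep_l2 (U s b)"
  have "AE x in lborel. \<bar>\<Sum>b\<in>F. a b * ?w b x\<bar> \<le> sqrt C * sqrt (\<Sum>b\<in>F. (a b)\<^sup>2)" for a
  proof -
    let ?x = "\<Sum>b\<in>F. a b *\<^sub>R b"
    have "inner ?x b = a b" if "b \<in> F" for b
    proof -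
      have "inner ?x b = (\<Sum>b'\<in>F. a b' * inner b' b)" by (simp add: inner_sum_left)
      also have "\<dots> = (\<Sum>b'\<in>F. if b' = b then a b else 0)"
        using F(2) that by (intro sum.cong) (auto simp: orthonormal_def)
      also have "\<dots> = a b" using F(1) that by simp
      finally show ?thesis .
    qed
    moreover have "?x \<in> span F" by (intro span_sum span_scale span_base)
    ultimately have n: "(norm ?x)\<^sup>2 = (\<Sum>b\<in>F. (a b)\<^sup>2)" using Parseval_span[OF F] by simp
    have nx: "norm ?x = sqrt (\<Sum>b\<in>F. (a b)\<^sup>2)" unfolding n[symmetric] by simp
    interpret U: linear "U s" by (rule linear_U[OF s])
    have u: "U s ?x = (\<Sum>b\<in>F. a b *\<^sub>R U s b)" by (simp add: U.sum U.scale)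
    show ?thesis using L2_Linf_bound[of ?x] rep_l2_sum[OF F(1), of a "U s"]
      unfolding u nx by eventually_elim simp
  qed
  from AE_sum_squares_le[OF F(1) C this]
  have ae: "AE x in lborel. (\<Sum>b\<in>F. (?w b x)\<^sup>2) \<le> C" .
  have z: "AE x in lborel. \<forall>b\<in>F. x \<notin> \<Omega> \<longrightarrow> ?w b x = 0"
    using cls_zero_off[OF \<Omega> U_in_closure[OF s]] F(1) by (subst AE_ball_countable) (auto simp: countable_finite)
  have "ennreal (\<Sum>b\<in>F. (norm (mulop e (U s b)))\<^sup>2) = (\<Sum>b\<in>F. ennreal (\<integral>x. (e x)\<^sup>2 * (?w b x)\<^sup>2 \<partial>lborel))"
    by (subst sum_ennreal) (auto simp: mulop_norm[OF e B])
  also have "\<dots> = (\<Sum>b\<in>F. \<integral>\<^sup>+x. ennreal ((e x)\<^sup>2 * (?w b x)\<^sup>2) \<partial>lborel)"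
    by (intro sum.cong refl nn_integral_eq_integral[symmetric] mulop_integrable[OF e B]) auto
  also have "\<dots> = (\<integral>\<^sup>+x. (\<Sum>b\<in>F. ennreal ((e x)\<^sup>2 * (?w b x)\<^sup>2)) \<partial>lborel)"
    by (subst nn_integral_sum) auto
  also have "\<dots> \<le> (\<integral>\<^sup>+x. ennreal C * (ennreal ((e x)\<^sup>2) * indicator \<Omega> x) \<partial>lborel)"
  proof (rule nn_integral_mono_AE)
    show "AE x in lborel. (\<Sum>b\<in>F. ennreal ((e x)\<^sup>2 * (?w b x)\<^sup>2)) \<le> ennreal C * (ennreal ((e x)\<^sup>2) * indicator \<Omega> x)"
      using ae z
    proof eventually_elim
      case (elim x)
      have "(\<Sum>b\<in>F. ennreal ((e x)\<^sup>2 * (?w b x)\<^sup>2)) = ennreal ((e x)\<^sup>2 * (\<Sum>b\<in>F. (?w b x)\<^sup>2))"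
        by (subst sum_ennreal) (auto simp: sum_distrib_left)
      also have "\<dots> \<le> ennreal (C * ((e x)\<^sup>2 * indicator \<Omega> x))"
      proof (rule ennreal_leI)
        show "(e x)\<^sup>2 * (\<Sum>b\<in>F. (?w b x)\<^sup>2) \<le> C * ((e x)\<^sup>2 * indicator \<Omega> x)"
          using mult_left_mono[OF elim(1), of "(e x)\<^sup>2"] elim(2) by (cases "x \<in> \<Omega>") (auto simp: mult.commute)
      qed
      also have "\<dots> = ennreal C * (ennreal ((e x)\<^sup>2) * indicator \<Omega> x)"
        using C by (simp add: ennreal_mult indicator_def)
      finally show ?case .
    qed
  qed
  also have "\<dots> = ennreal C * (\<integral>\<^sup>+x\<in>\<Omega>. ennreal ((e x)\<^sup>2) \<partial>lborel)"
    by (rule nn_integral_cmult) measurable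
  finally show ?thesis .
qed

end

end

subsection \<open>The exponential weight\<close>

context polyharmonic
begin

lemma test_weight_le:
  fixes e :: "real^'n \<Rightarrow> real" and a :: real
  assumes e [measurable]: "e \<in> borel_measurable lborel" and B: "\<And>x. \<bar>e x\<bar> \<le> B"
    and a: "0 \<le> a" and le: "\<And>x. (e x)\<^sup>2 \<le> a * (2 * c'_const m CARD('n) * am_inv_pow \<Omega> m x)"
    and \<phi>: "test_fun \<Omega> \<phi>"
  shows "(norm (mulop e (abs_l2 \<phi>)))\<^sup>2 \<le> a * q (abs_l2 \<phi>) (abs_l2 \<phi>)"
proof -
  note s = test_fun_sqint[OF \<phi>]
  have [measurable]: "am_inv_pow \<Omega> m \<in> borel_measurable borel" "\<phi> \<in> borel_measurable borel"
    by (rule am_inv_pow_measurable[OF \<Omega>], rule test_fun_measurable[OF \<phi>])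
  have se: "sqint (\<lambda>x. e x * \<phi> x)" by (rule sqint_mult_bounded[OF s e B])
  have Q: "0 \<le> Qm \<Omega> m \<phi>" unfolding q_test[OF \<phi>, symmetric] by (rule q_pos) (use \<phi> in \<open>auto simp: test_l2_def\<close>)
  have "ennreal ((norm (mulop e (abs_l2 \<phi>)))\<^sup>2) = (\<integral>\<^sup>+x. ennreal ((e x * \<phi> x)\<^sup>2) \<partial>lborel)"
    unfolding mulop_abs[OF e B s] norm_abs_l2_sq[OF se]
    by (rule nn_integral_eq_integral[OF sqint_square[OF se], symmetric]) simp
  also have "\<dots> \<le> (\<integral>\<^sup>+x. ennreal a * ennreal (2 * c'_const m CARD('n) * am_inv_pow \<Omega> m x * (\<phi> x)\<^sup>2) \<partial>lborel)"
  proof (rule nn_integral_mono)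
    fix x
    have "(e x * \<phi> x)\<^sup>2 \<le> a * (2 * c'_const m CARD('n) * am_inv_pow \<Omega> m x) * (\<phi> x)\<^sup>2"
      unfolding power_mult_distrib by (rule mult_right_mono[OF le]) simp
    then have "ennreal ((e x * \<phi> x)\<^sup>2) \<le> ennreal (a * (2 * c'_const m CARD('n) * am_inv_pow \<Omega> m x * (\<phi> x)\<^sup>2))"
      by (intro ennreal_leI) (simp add: mult.assoc)
    then show "ennreal ((e x * \<phi> x)\<^sup>2) \<le> ennreal a * ennreal (2 * c'_const m CARD('n) * am_inv_pow \<Omega> m x * (\<phi> x)\<^sup>2)"
      by (simp add: ennreal_mult'[OF a])
  qed
  also have "\<dots> = ennreal a * (\<integral>\<^sup>+x. ennreal (2 * c'_const m CARD('n) * am_inv_pow \<Omega> m x * (\<phi> x)\<^sup>2) \<partial>lborel)"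
    by (rule nn_integral_cmult) measurable
  also have "\<dots> \<le> ennreal a * ennreal (Qm \<Omega> m \<phi>)" by (intro mult_left_mono Hardy_inequality[OF \<Omega> \<phi>]) simp
  also have "\<dots> = ennreal (a * Qm \<Omega> m \<phi>)" by (simp add: ennreal_mult'[OF a])
  finally show ?thesis unfolding q_test[OF \<phi>] using a Q by (simp add: ennreal_le_iff)
qed

text \<open>Boundedness of \<open>e\<close> makes multiplication continuous, so the inequality
  passes from test functions to the form domain. For this reason the weight is truncated in
  \<open>exp_weight_tangent\<close>.\<close>

lemma form_weight_le:
  fixes e :: "real^'n \<Rightarrow> real" and a :: real
  assumes e: "e \<in> borel_measurable lborel" and B: "\<And>x. \<bar>e x\<bar> \<le> B"
    and a: "0 \<le> a" and le: "\<And>x. (e x)\<^sup>2 \<le> a * (2 * c'_const m CARD('n) * am_inv_pow \<Omega> m x)"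
    and x: "x \<in> D"
  shows "(norm (mulop e x))\<^sup>2 \<le> a * bf x x"
proof -
  obtain u where u: "approx x u" using x by (auto simp: D_def)
  have 1: "(\<lambda>n. (norm (mulop e (u n)))\<^sup>2) \<longlonglongrightarrow> (norm (mulop e x))\<^sup>2"
    by (intro tendsto_intros mulop_tendsto[OF e B] approx_lim[OF u])
  have 2: "(\<lambda>n. a * q (u n) (u n)) \<longlonglongrightarrow> a * bf x x" by (intro tendsto_intros bf_lim[OF u u])
  have "(norm (mulop e (u n)))\<^sup>2 \<le> a * q (u n) (u n)" for n
  proof -
    obtain \<phi> where "test_fun \<Omega> \<phi>" "u n = abs_l2 \<phi>" using approx_T[OF u, of n] by (auto simp: test_l2_def)
    then show ?thesis using test_weight_le[OF e B a le] by simp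
  qed
  then show ?thesis by (intro LIMSEQ_le[OF 1 2]) auto
qed

text \<open>The truncation level is harmless: the tangent line to \<open>exp (- w)\<close> at \<open>l\<close> vanishes at \<open>w = 1 + l\<close>.\<close>
lemma exp_weight_tangent:
  fixes W :: "real^'n \<Rightarrow> real"
  assumes W [measurable]: "W \<in> borel_measurable lborel" and W0: "\<And>x. 0 \<le> W x" and t: "0 < t"
    and le: "\<And>x. W x \<le> (t/2) * (2 * c'_const m CARD('n) * am_inv_pow \<Omega> m x)" and l: "0 \<le> l"
  shows "exp (- l) * ((1 + l) * (norm (G k))\<^sup>2 - (t/2) * inner (k - G k) (G k))
    \<le> (norm (mulop (\<lambda>x. exp (- W x / 2)) (G k)))\<^sup>2"
proof -
  \<comment> \<open>\<open>?e\<close> is the square root of the truncated weight, so its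
    multiplication operator measures the form of min W (1 + l).\<close>
  let ?g = "rep_l2 (G k)" and ?e = "\<lambda>x. sqrt (min (W x) (1 + l))" and ?E = "\<lambda>x. exp (- W x / 2)"
  have e: "?e \<in> borel_measurable lborel" "\<And>x. \<bar>?e x\<bar> \<le> sqrt (1 + l)" using W0 l by auto
  have E: "?E \<in> borel_measurable lborel" "\<And>x. \<bar>?E x\<bar> \<le> 1" using W0 by auto
  have ee: "(?e x)\<^sup>2 = min (W x) (1 + l)" for x using W0[of x] l by simp
  have EE: "(?E x)\<^sup>2 = exp (- W x)" for x by (simp flip: exp_of_nat_mult)
  have bf: "bf (G k) (G k) = inner (k - G k) (G k)" using hgraph_G[of k] by (simp add: hgraph_def)
  have 1: "(norm (mulop ?e (G k)))\<^sup>2 \<le> (t/2) * inner (k - G k) (G k)"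
    unfolding bf[symmetric]
    by (rule form_weight_le[OF e _ _ G_D]) (use t le in \<open>auto simp: ee intro: min.coboundedI1\<close>)
  have i: "integrable lborel (\<lambda>x. (?g x)\<^sup>2)" by (rule sqint_square[OF sqint_rep])
  have j: "integrable lborel (\<lambda>x. min (W x) (1 + l) * (?g x)\<^sup>2)" using mulop_integrable[OF e, of "G k"] by (simp only: ee)
  have "exp (- l) * ((1 + l) * (norm (G k))\<^sup>2 - (t/2) * inner (k - G k) (G k))
      \<le> exp (- l) * ((1 + l) * (norm (G k))\<^sup>2 - (norm (mulop ?e (G k)))\<^sup>2)"
    using 1 by simp
  also have "\<dots> = (\<integral>x. exp (- l) * ((1 + l) * (?g x)\<^sup>2 - min (W x) (1 + l) * (?g x)\<^sup>2) \<partial>lborel)"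
  proof -
    have n: "(norm (G k))\<^sup>2 = (\<integral>x. (?g x)\<^sup>2 \<partial>lborel)" using norm_abs_l2_sq[OF sqint_rep, of "G k"] by simp
    show ?thesis unfolding mulop_norm[OF e] n ee
      using i j by (simp add: Bochner_Integration.integral_diff)
  qed
  also have "\<dots> \<le> (\<integral>x. (?E x)\<^sup>2 * (?g x)\<^sup>2 \<partial>lborel)"
  proof (rule integral_mono)
    show "integrable lborel (\<lambda>x. exp (- l) * ((1 + l) * (?g x)\<^sup>2 - min (W x) (1 + l) * (?g x)\<^sup>2))"
      by (intro integrable_mult_right Bochner_Integration.integrable_diff i j)
    show "integrable lborel (\<lambda>x. (?E x)\<^sup>2 * (?g x)\<^sup>2)" by (rule mulop_integrable[OF E])
    fix x
    have "exp (- l) * (1 + l - min (W x) (1 + l)) \<le> exp (- W x)"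
    proof (cases "W x \<le> 1 + l")
      case True
      have "exp (- l) * (1 + (l - W x)) \<le> exp (- l) * exp (l - W x)" by (intro mult_left_mono exp_ge_add_one_self) simp
      then show ?thesis using True by (simp flip: exp_add add: algebra_simps)
    qed simp
    then have "exp (- l) * (1 + l - min (W x) (1 + l)) * (?g x)\<^sup>2 \<le> exp (- W x) * (?g x)\<^sup>2" by (rule mult_right_mono) simp
    then show "exp (- l) * ((1 + l) * (?g x)\<^sup>2 - min (W x) (1 + l) * (?g x)\<^sup>2) \<le> (?E x)\<^sup>2 * (?g x)\<^sup>2"
      unfolding EE by (simp add: algebra_simps)
  qed
  also have "\<dots> = (norm (mulop ?E (G k)))\<^sup>2" unfolding mulop_norm[OF E] ..
  finally show ?thesis .
qed

end

subsection \<open>The trace bound\<close>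

text \<open>\<open>op_trace\<close> picks its basis by choice, so a basis must exist for the choice
  to mean anything. A maximal orthonormal family is one: a nonzero function orthogonal to it could
  be normalised and added.\<close>

lemma onb_exists: "\<exists>B. onb \<Omega> B"
proof -
  let ?P = "\<lambda>B. (\<forall>e\<in>B. L2 \<Omega> e) \<and> (\<forall>e\<in>B. \<forall>e'\<in>B. l2_inner \<Omega> e e' = (if e = e' then 1 else 0))"
  have "\<exists>M\<in>Collect ?P. \<forall>X\<in>Collect ?P. M \<subseteq> X \<longrightarrow> X = M"
  proof (rule subset_Zorn')
    fix \<C> assume c: "subset.chain (Collect ?P) \<C>"
    then have sub: "\<And>B. B \<in> \<C> \<Longrightarrow> ?P B" by (auto simp: subset.chain_def)
    have "l2_inner \<Omega> e e' = (if e = e' then 1 else 0)" if e: "e \<in> \<Union>\<C>" "e' \<in> \<Union>\<C>" for e e'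
    proof -
      obtain A B where AB: "A \<in> \<C>" "e \<in> A" "B \<in> \<C>" "e' \<in> B" using e by blast
      have "A \<subseteq> B \<or> B \<subseteq> A" using c AB(1,3) unfolding subset_chain_def by blast
      then show ?thesis
      proof
        assume "A \<subseteq> B" then show ?thesis using sub[OF AB(3)] AB by blast
      next
        assume "B \<subseteq> A" then show ?thesis using sub[OF AB(1)] AB by blast
      qed
    qed
    then show "\<Union>\<C> \<in> Collect ?P" using sub by auto
  qed
  then obtain B where B0: "B \<in> Collect ?P" "\<forall>X\<in>Collect ?P. B \<subseteq> X \<longrightarrow> X = B" by (elim bexE)
  have B: "?P B" using B0(1) by simp
  have max: "X = B" if "?P X" "B \<subseteq> X" for X using B0(2) that by simp
  have "l2_norm \<Omega> f = 0" if f: "L2 \<Omega> f" "\<forall>e\<in>B. l2_inner \<Omega> f e = 0" for f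
  proof (rule ccontr)
    assume n0: "l2_norm \<Omega> f \<noteq> 0"
    define n where "n = norm (cls \<Omega> f)"
    have n: "n \<noteq> 0" using n0 f(1) by (simp add: n_def l2_norm_cls)
    define h where "h = (\<lambda>x. (1 / n) * f x)"
    have h: "L2 \<Omega> h" "cls \<Omega> h = (1 / n) *\<^sub>R cls \<Omega> f"
      unfolding h_def by (rule L2_cmult[OF f(1)], rule cls_cmult[OF f(1)])
    have hh: "l2_inner \<Omega> h h = 1"
      using n by (simp add: l2_inner_cls h power2_norm_eq_inner[symmetric] power2_eq_square n_def)
    have he: "l2_inner \<Omega> h e = 0 \<and> l2_inner \<Omega> e h = 0" if e: "e \<in> B" for e
    proof -
      have eL: "L2 \<Omega> e" using B e by blast
      have "inner (cls \<Omega> f) (cls \<Omega> e) = 0" using f(2) e l2_inner_cls[OF f(1) eL] by auto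
      then show ?thesis by (simp add: l2_inner_cls[OF h(1) eL] l2_inner_cls[OF eL h(1)] h(2) inner_commute[of "cls \<Omega> e"])
    qed
    have "h \<notin> B" using hh he by force
    moreover have "?P (insert h B)" using B h(1) hh he \<open>h \<notin> B\<close> by auto
    ultimately show False using max[of "insert h B"] by blast
  qed
  then have "onb \<Omega> B" unfolding onb_def using B by blast
  then show ?thesis ..
qed

theorem theorem5p4:
  fixes \<Omega> :: "(real^'n) set" and m :: nat and c :: real
    and K :: "real \<Rightarrow> real^'n \<Rightarrow> real^'n \<Rightarrow> real" and t :: real
  assumes region: "open \<Omega>" "connected \<Omega>" "\<Omega> \<noteq> {}"
    and m: "m \<ge> 1"
    and K_cont: "continuous_on ({0<..} \<times> \<Omega> \<times> \<Omega>) (\<lambda>(s, x, y). K s x y)"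
    and K_kernel: "\<And>f s. L2 \<Omega> f \<Longrightarrow> s > 0 \<Longrightarrow>
         AE x in lborel. x \<in> \<Omega> \<longrightarrow>
           set_integrable lborel \<Omega> (\<lambda>y. K s x y * f y) \<and>
           heat_sg \<Omega> m s f x = (LINT y:\<Omega>|lborel. K s x y * f y)"
    and K_bound: "\<And>s x y. s > 0 \<Longrightarrow> x \<in> \<Omega> \<Longrightarrow> y \<in> \<Omega> \<Longrightarrow>
         \<bar>K s x y\<bar> \<le> c * s powr (- real CARD('n) / real (2*m))"
    and t: "t > 0"
  shows "op_trace \<Omega> (heat_sg \<Omega> m t) \<le>
     ennreal (2 powr (real CARD('n) / real (2*m)) * c * t powr (- real CARD('n) / real (2*m))) *
     (\<integral>\<^sup>+ x\<in>\<Omega>. ennreal (exp (- c'_const m CARD('n) * am_inv_pow \<Omega> m x * t)) \<partial>lborel)"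
proof -
  interpret polyharmonic \<Omega> m by unfold_locales (rule region(1))
  let ?V = "am_inv_pow \<Omega> m" and ?c' = "c'_const m CARD('n)"
  define C where "C = 2 powr (real CARD('n) / real (2*m)) * c * t powr (- real CARD('n) / real (2*m))"
  define W where "W x = ?c' * ?V x * t" for x
  define I where "I = (\<integral>\<^sup>+ x\<in>\<Omega>. ennreal (exp (- W x)) \<partial>lborel)"
  have V [measurable]: "?V \<in> borel_measurable borel" by (rule am_inv_pow_measurable[OF region(1)])
  have c'0: "0 \<le> ?c'" unfolding c'_const_def by (intro mult_nonneg_nonneg prod_nonneg) auto
  have W [measurable]: "W \<in> borel_measurable lborel" unfolding W_def[abs_def] by measurable
  have W0: "0 \<le> W x" for x using c'0 am_inv_pow_nonneg[of \<Omega> m x] t by (simp add: W_def)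
  \<comment> \<open>The kernel is used at time t/2 only, which produces the factor 2 powr (N /
    2m).\<close>
  have Ceq: "c * (t / 2) powr (- real CARD('n) / real (2*m)) = C"
    using t by (simp add: C_def powr_divide powr_minus field_simps)
  have bound: "\<bar>K (t / 2) x y\<bar> \<le> C" if "x \<in> \<Omega>" "y \<in> \<Omega>" for x y
    using K_bound[of "t / 2" x y] that t unfolding Ceq by simp
  \<comment> \<open>The sign of the constant comes from the kernel bound itself at one point of
    \<Omega>.\<close>
  have C0: "0 \<le> C"
  proof -
    obtain x where "x \<in> \<Omega>" using region(3) by blast
    then show ?thesis using bound[of x x] by linarith
  qed
  let ?E = "\<lambda>x. exp (- W x / 2)"
  have E: "?E \<in> borel_measurable lborel" "\<And>x. \<bar>?E x\<bar> \<le> 1" using W0 by auto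
  have EE: "(?E x)\<^sup>2 = exp (- W x)" for x by (simp flip: exp_of_nat_mult)
  have kernel: "AE x in lborel. x \<in> \<Omega> \<longrightarrow> set_integrable lborel \<Omega> (\<lambda>y. K (t / 2) x y * f y) \<and>
      heat_sg \<Omega> m (2 * (t / 4)) f x = (LINT y:\<Omega>|lborel. K (t / 2) x y * f y)" if "L2 \<Omega> f" for f
    using K_kernel[OF that, of "t / 2"] t by simp
  have HS: "ennreal (\<Sum>b\<in>F. (norm (mulop ?E (U (t / 4) b)))\<^sup>2) \<le> ennreal C * I" if "finite F" "orthonormal F" for F
    using Hilbert_Schmidt_bound[OF _ C0 kernel bound E that] t by (simp add: I_def flip: EE)
  have tr: "ennreal (\<Sum>e\<in>F. inner (U t e) e) \<le> ennreal C * I" if F: "finite F" "orthonormal F" for F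
  \<comment> \<open>\<open>trace_bound\<close> compares real numbers, so an infinite right side is
    set apart.\<close>
  proof (cases "ennreal C * I = \<infinity>")
    case False
    define Z where "Z = enn2real (ennreal C * I)"
    have Z: "ennreal C * I = ennreal Z" using False by (simp add: Z_def less_top)
    have Z0: "0 \<le> Z" by (simp add: Z_def)
    have "(\<Sum>e\<in>F. inner (U t e) e) \<le> Z"
    proof (rule trace_bound[OF t mulop_sym[OF E] _ _ F])
      show "(\<Sum>b\<in>F. (norm (mulop ?E (U (t / 4) b)))\<^sup>2) \<le> Z" if "finite F" "orthonormal F" for F
        using HS[OF that] Z0 unfolding Z by (simp add: ennreal_le_iff)
      show "exp (- l) * ((1 + l) * (norm (G k))\<^sup>2 - (t/2) * inner (k - G k) (G k)) \<le> (norm (mulop ?E (G k)))\<^sup>2"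
        if "0 \<le> l" for k l
        by (rule exp_weight_tangent[OF W W0 t _ that]) (simp add: W_def)
    qed
    then show ?thesis unfolding Z by (rule ennreal_leI)
  qed simp
  define B where "B = (SOME B. onb \<Omega> B)"
  have "onb \<Omega> B" unfolding B_def by (rule someI_ex[OF onb_exists])
  then have BL: "\<And>e. e \<in> B \<Longrightarrow> L2 \<Omega> e"
    and Bo: "\<And>e e'. e \<in> B \<Longrightarrow> e' \<in> B \<Longrightarrow> inner (cls \<Omega> e) (cls \<Omega> e') = (if e = e' then 1 else 0)"
    by (auto simp: onb_def l2_inner_cls[symmetric])
  \<comment> \<open>Basis functions have distinct classes, so a sum over functions becomes a sum
    over an orthonormal set in \<open>l2\<close>.\<close>
  have inj: "inj_on (cls \<Omega>) B"
  proof (rule inj_onI)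
    fix e e' assume e: "e \<in> B" "e' \<in> B" "cls \<Omega> e = cls \<Omega> e'"
    show "e = e'" using Bo[OF e(1,2)] Bo[OF e(1,1)] e(3) by (auto split: if_splits)
  qed
  have fin: "(\<Sum>e\<in>F. ennreal (l2_inner \<Omega> (heat_sg \<Omega> m t e) e)) \<le> ennreal C * I" if F: "finite F" "F \<subseteq> B" for F
  proof -
    have "(\<Sum>e\<in>F. ennreal (l2_inner \<Omega> (heat_sg \<Omega> m t e) e)) = (\<Sum>e\<in>F. ennreal (inner (U t (cls \<Omega> e)) (cls \<Omega> e)))"
      using F BL t by (intro sum.cong refl) (simp add: l2_inner_cls heat_sg_L2 cls_heat_sg subset_iff)
    also have "\<dots> = (\<Sum>e\<in>cls \<Omega> ` F. ennreal (inner (U t e) e))"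
      using inj_on_subset[OF inj F(2)] by (simp add: sum.reindex)
    also have "\<dots> = ennreal (\<Sum>e\<in>cls \<Omega> ` F. inner (U t e) e)"
    proof (rule sum_ennreal)
      fix e
      \<comment> \<open>Splitting the time in half makes the diagonal terms squared norms, so
        \<open>ennreal\<close> truncates nothing.\<close>
      have "(norm (U (t / 2) e))\<^sup>2 = inner (U t e) e" using norm_U_sq[of "t / 2" e] t by simp
      then show "0 \<le> inner (U t e) e" by (metis zero_le_power2)
    qed
    also have "\<dots> \<le> ennreal C * I"
      by (rule tr) (use F Bo inj_on_eq_iff[OF inj] in \<open>auto simp: orthonormal_def subset_iff\<close>)
    finally show ?thesis .
  qed
  have "op_trace \<Omega> (heat_sg \<Omega> m t) = (SUP F\<in>{F. finite F \<and> F \<subseteq> B}. \<Sum>e\<in>F. ennreal (l2_inner \<Omega> (heat_sg \<Omega> m t e) e))"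
    unfolding op_trace_def B_def[symmetric] by (rule nonneg_infsum_complete) simp
  also have "\<dots> \<le> ennreal C * I" by (rule SUP_least) (use fin in auto)
  also have "\<dots> = ennreal (2 powr (real CARD('n) / real (2*m)) * c * t powr (- real CARD('n) / real (2*m))) *
     (\<integral>\<^sup>+ x\<in>\<Omega>. ennreal (exp (- c'_const m CARD('n) * am_inv_pow \<Omega> m x * t)) \<partial>lborel)"
    by (simp add: C_def I_def W_def)
  finally show ?thesis .
qed

end
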